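(* Let $x\in\mathbb{R}^p_+$ with $F_X(x)>0$, let $\rho_x>0$, and let $k_n<n$ be a sequence of positive integers. Consider the condition $$\lim_{t\to\infty}\frac{1-F(\varphi(x)-\frac1{tz}\mid x)}{1-F(\varphi(x)-\frac1t\mid x)}=z^{-\rho_x}\quad\text{for all } z>0. \tag{RV}$$ With $k=k_n$ and, for $j=1,2$, $$M_n^{(j)}=\frac1k\sum_{i=0}^{k-1}\Bigl(\log\hat\varphi_{1-\frac{i}{n\hat F_X(x)}}(x)-\log\hat\varphi_{1-\frac{k}{n\hat F_X(x)}}(x)\Bigr)^j,$$ let $$\tilde\rho_x=-\Bigl\{M_n^{(1)}+1-\tfrac12\bigl[1-(M_n^{(1)})^2/M_n^{(2)}\bigr]^{-1}\Bigr\}^{-1}.$$ (i) If (RV) holds, $k_n/n\to0$ and $k_n\to\infty$, then $\tilde\rho_x\to\rho_x$ in probability. (ii) If (RV) holds, $k_n/n\to0$ and $k_n/(\log n)^{\delta}\to\infty$ for some $\delta>0$, then $\tilde\rho_x\to\rho_x$ almost surely. (iii) Let $U(t)=\varphi_{1-\frac1{tF_X(x)}}(x)$ for $t>1/F_X(x)$. If, for one choice of the sign, $\pm t^{1/\rho_x}\{\varphi(x)-U(t)\}\in\Pi(B)$ for some positive function $B$, then $\sqrt{k_n}(\tilde\rho_x-\rho_x)$ has, asymptotically, a normal distribution with mean zero and variance $$\rho_x(2+\rho_x)(1+\rho_x)^2\left\{4-8\frac{2+\rho_x}{3+\rho_x}+\frac{(11+5\rho_x)(2+\rho_x)}{(3+\rho_x)(4+\rho_x)}\right\}$$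 for $k_n\to\infty$ satisfying $k_n=o(n/g^{-1}(n))$, where $g^{-1}$ is the generalized inverse of $g(t)=t^{1+2/\rho_x}\bigl[\{\log\varphi(x)-\log U(t)\}/B(t)\bigr]^2$.
   Context: $(X,Y)$ is a random vector in $\mathbb{R}^p_+\times\mathbb{R}_+$ with joint distribution function $F(x,y)=\mathbb{P}(X\le x,Y\le y)$ (inequalities between vectors are componentwise), and $(X_i,Y_i)$, $i=1,\dots,n$, are i.i.d. copies of $(X,Y)$. Put $F_X(x)=F(x,\infty)$ and, for $F_X(x)>0$, $F(y|x)=F(x,y)/F_X(x)$. The frontier function is $\varphi(x)=\sup\{y\ge0: F(y|x)<1\}$, assumed finite. For $\alpha\in(0,1]$, $\varphi_\alpha(x)=\inf\{y\ge0:F(y|x)\ge\alpha\}$. Empirical versions: $\hat F_n(x,y)=\frac1n\sum_{i=1}^n\mathbf{1}(X_i\le x,Y_i\le y)$, $\hat F_X(x)=\hat F_n(x,\infty)$, $\hat F(y|x)=\hat F_n(x,y)/\hat F_X(x)$, $\hat\varphi_\alpha(x)=\inf\{y\ge0:\hat F(y|x)\ge\alpha\}$. When $k_n/n\to0$ the orders of the empirical quantiles above are positive, with probability one, for $n$ large enough. $f\in\Pi(B)$, for a positive function $B$, means $\lim_{t\to\infty}\{f(tz)-f(t)\}/B(t)=\log z$ for all $z>0$. The generalized inverse of $g$ is $g^{-1}(s)=\inf\{t:g(t)\ge s\}$.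
   Formalization: In (iii) the generalized inverse of g is taken over t ≥ t0 for all sufficiently large t0, not over all t > 1/F_X(x); otherwise g may blow up at the left end (log U(t) → −∞), g^{-1}(n) stays bounded, and the claim fails for k_n = o(n). *)

theory Defs
  imports "HOL-Probability.Probability" "HOL-Library.Landau_Symbols"
begin

definition upper_endpoint :: "(real \<Rightarrow> real) \<Rightarrow> real" where
  "upper_endpoint G = Sup {y. 0 \<le> y \<and> G y < 1}"

definition quantile_of :: "(real \<Rightarrow> real) \<Rightarrow> real \<Rightarrow> real" where
  "quantile_of G \<alpha> = Inf {y. 0 \<le> y \<and> \<alpha> \<le> G y}"

text \<open>Inequalities between vectors are componentwise: this is the library order on
  \<^typ>\<open>real ^ 'p\<close>.\<close>

definition joint_df :: "'a measure \<Rightarrow> ('a \<Rightarrow> real ^ 'p) \<Rightarrow> ('a \<Rightarrow> real) \<Rightarrow> real ^ 'p \<Rightarrow> real \<Rightarrow> real" where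
  "joint_df M X Y x y = measure M {\<omega> \<in> space M. X \<omega> \<le> x \<and> Y \<omega> \<le> y}"

text \<open>This is $F(x,\infty)$.\<close>

definition marginal_df :: "'a measure \<Rightarrow> ('a \<Rightarrow> real ^ 'p) \<Rightarrow> real ^ 'p \<Rightarrow> real" where
  "marginal_df M X x = measure M {\<omega> \<in> space M. X \<omega> \<le> x}"

definition cond_df :: "'a measure \<Rightarrow> ('a \<Rightarrow> real ^ 'p) \<Rightarrow> ('a \<Rightarrow> real) \<Rightarrow> real ^ 'p \<Rightarrow> real \<Rightarrow> real" where
  "cond_df M X Y x y = joint_df M X Y x y / marginal_df M X x"

definition frontier_fun :: "'a measure \<Rightarrow> ('a \<Rightarrow> real ^ 'p) \<Rightarrow> ('a \<Rightarrow> real) \<Rightarrow> real ^ 'p \<Rightarrow> real" where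
  "frontier_fun M X Y x = upper_endpoint (cond_df M X Y x)"

definition tail_quantile :: "'a measure \<Rightarrow> ('a \<Rightarrow> real ^ 'p) \<Rightarrow> ('a \<Rightarrow> real) \<Rightarrow> real ^ 'p \<Rightarrow> real \<Rightarrow> real" where
  "tail_quantile M X Y x t = quantile_of (cond_df M X Y x) (1 - 1 / (t * marginal_df M X x))"

text \<open>The sample of size \<open>n\<close> consists of the observations with indices \<open>0, \<dots>, n - 1\<close>.\<close>

definition emp_joint_df :: "(nat \<Rightarrow> 'a \<Rightarrow> real ^ 'p) \<Rightarrow> (nat \<Rightarrow> 'a \<Rightarrow> real) \<Rightarrow> nat \<Rightarrow> 'a \<Rightarrow> real ^ 'p \<Rightarrow> real \<Rightarrow> real" where
  "emp_joint_df Xs Ys n \<omega> x y = (\<Sum>i<n. of_bool (Xs i \<omega> \<le> x \<and> Ys i \<omega> \<le> y)) / real n"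

definition emp_marginal_df :: "(nat \<Rightarrow> 'a \<Rightarrow> real ^ 'p) \<Rightarrow> nat \<Rightarrow> 'a \<Rightarrow> real ^ 'p \<Rightarrow> real" where
  "emp_marginal_df Xs n \<omega> x = (\<Sum>i<n. of_bool (Xs i \<omega> \<le> x)) / real n"

definition emp_cond_df :: "(nat \<Rightarrow> 'a \<Rightarrow> real ^ 'p) \<Rightarrow> (nat \<Rightarrow> 'a \<Rightarrow> real) \<Rightarrow> nat \<Rightarrow> 'a \<Rightarrow> real ^ 'p \<Rightarrow> real \<Rightarrow> real" where
  "emp_cond_df Xs Ys n \<omega> x y = emp_joint_df Xs Ys n \<omega> x y / emp_marginal_df Xs n \<omega> x"

definition emp_quantile :: "(nat \<Rightarrow> 'a \<Rightarrow> real ^ 'p) \<Rightarrow> (nat \<Rightarrow> 'a \<Rightarrow> real) \<Rightarrow> nat \<Rightarrow> 'a \<Rightarrow> real ^ 'p \<Rightarrow> real \<Rightarrow> real" where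
  "emp_quantile Xs Ys n \<omega> x \<alpha> = quantile_of (emp_cond_df Xs Ys n \<omega> x) \<alpha>"

definition log_moment ::
  "(nat \<Rightarrow> 'a \<Rightarrow> real ^ 'p) \<Rightarrow> (nat \<Rightarrow> 'a \<Rightarrow> real) \<Rightarrow> real ^ 'p \<Rightarrow> nat \<Rightarrow> nat \<Rightarrow> nat \<Rightarrow> 'a \<Rightarrow> real" where
  "log_moment Xs Ys x j k n \<omega> = (1 / real k) *
     (\<Sum>i<k. (ln (emp_quantile Xs Ys n \<omega> x (1 - real i / (real n * emp_marginal_df Xs n \<omega> x)))
            - ln (emp_quantile Xs Ys n \<omega> x (1 - real k / (real n * emp_marginal_df Xs n \<omega> x)))) ^ j)"

definition rho_moment ::
  "(nat \<Rightarrow> 'a \<Rightarrow> real ^ 'p) \<Rightarrow> (nat \<Rightarrow> 'a \<Rightarrow> real) \<Rightarrow> real ^ 'p \<Rightarrow> nat \<Rightarrow> nat \<Rightarrow> 'a \<Rightarrow> real" where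
  "rho_moment Xs Ys x k n \<omega> =
     - inverse (log_moment Xs Ys x 1 k n \<omega> + 1
         - 1 / 2 * inverse (1 - (log_moment Xs Ys x 1 k n \<omega>)\<^sup>2 / log_moment Xs Ys x 2 k n \<omega>))"

definition rv_frontier :: "'a measure \<Rightarrow> ('a \<Rightarrow> real ^ 'p) \<Rightarrow> ('a \<Rightarrow> real) \<Rightarrow> real ^ 'p \<Rightarrow> real \<Rightarrow> bool" where
  "rv_frontier M X Y x \<rho> \<longleftrightarrow> (\<forall>z>0.
     ((\<lambda>t. (1 - cond_df M X Y x (frontier_fun M X Y x - 1 / (t * z)))
         / (1 - cond_df M X Y x (frontier_fun M X Y x - 1 / t))) \<longlongrightarrow> z powr (- \<rho>)) at_top)"

definition Pi_class :: "(real \<Rightarrow> real) \<Rightarrow> (real \<Rightarrow> real) \<Rightarrow> bool" where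
  "Pi_class B f \<longleftrightarrow> (\<forall>z>0. ((\<lambda>t. (f (t * z) - f t) / B t) \<longlongrightarrow> ln z) at_top)"

text \<open>Generalized inverse of \<open>g\<close> as a function on \<open>[t0, \<infinity>)\<close>. The functions inverted below matter
  only near infinity. At the left end of their natural domain they may blow up (a logarithm of
  small quantiles occurs in them), and on bounded sets they may be arbitrary (the auxiliary
  function \<open>B\<close> of the class \<open>\<Pi>(B)\<close> is only determined asymptotically). An infimum over
  the whole domain could therefore stay bounded, and so \<open>t0\<close> is taken large.\<close>

definition gen_inverse_from :: "real \<Rightarrow> (real \<Rightarrow> real) \<Rightarrow> real \<Rightarrow> real" where
  "gen_inverse_from t0 g s = Inf {t. t0 \<le> t \<and> s \<le> g t}"

definition second_order_fun ::
  "'a measure \<Rightarrow> ('a \<Rightarrow> real ^ 'p) \<Rightarrow> ('a \<Rightarrow> real) \<Rightarrow> real ^ 'p \<Rightarrow> real \<Rightarrow> (real \<Rightarrow> real) \<Rightarrow> real \<Rightarrow> real" where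
  "second_order_fun M X Y x \<rho> B t = t powr (1 + 2 / \<rho>) *
     ((ln (frontier_fun M X Y x) - ln (tail_quantile M X Y x t)) / B t)\<^sup>2"

definition asymp_variance :: "real \<Rightarrow> real" where
  "asymp_variance \<rho> = \<rho> * (2 + \<rho>) * (1 + \<rho>)\<^sup>2 *
     (4 - 8 * ((2 + \<rho>) / (3 + \<rho>)) + (11 + 5 * \<rho>) * (2 + \<rho>) / ((3 + \<rho>) * (4 + \<rho>)))"

definition converges_in_prob :: "'a measure \<Rightarrow> (nat \<Rightarrow> 'a \<Rightarrow> real) \<Rightarrow> real \<Rightarrow> bool" where
  "converges_in_prob M Z c \<longleftrightarrow>
     (\<forall>\<epsilon>>0. (\<lambda>n. measure M {\<omega> \<in> space M. \<epsilon> < \<bar>Z n \<omega> - c\<bar>}) \<longlonglongrightarrow> 0)"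

end

theory Submission
  imports Defs "HOL-Real_Asymp.Real_Asymp"
begin

text \<open>Put \<open>Z = Y\<close> on the event \<open>X \<le> x\<close> and \<open>Z = 0\<close> off it. Once the sample contains an observation with
  \<open>X\<^sub>i \<le> x\<close>, the empirical quantile of order \<open>1 - i / (n F)\<close>, where \<open>F\<close> is the empirical marginal distribution
  function at \<open>x\<close>, is the \<open>(i + 1)\<close>-st largest of \<open>Z\<^sub>1, \<dots>, Z\<^sub>n\<close>, so the estimator is a function of the \<open>k + 1\<close>
  largest \<open>Z\<^sub>i\<close> and the problem is univariate.

  Consistency: writing the log-moments as integrals of counts of exceedances, the estimator converges as soon as
  the number of \<open>Z\<^sub>i\<close> above \<open>\<phi> - r d\<^sub>n\<close> divided by \<open>k\<close> tends to \<open>r\<^sup>\<rho>\<close> for every \<open>r > 0\<close>, for some levels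
  \<open>d\<^sub>n \<rightarrow> 0\<close>. Regular variation gives this for the expected counts; Chernoff bounds pass to the counts. For almost
  sure convergence the bounds are used along geometric grids of sample sizes and levels.

  Normality: represent \<open>Z\<close> as a decreasing function of a uniform variable. Divided by the \<open>(k + 1)\<close>-st smallest
  uniform variable, the \<open>k\<close> smaller ones are again independent and uniform. The inequality
  \<open>\<surd>k (\<rho>' - \<rho>) \<le> y\<close> for the estimator \<open>\<rho>'\<close> is polynomial in its two moments, which reduces it, up to small
  errors, to the corresponding inequality for a sum of \<open>k\<close> bounded independent variables. The second-order
  condition bounds the bias by a multiple of \<open>B t / (t powr (1 / \<rho>) * (\<phi> - U t))\<close> at \<open>t = n / k\<close>, and the growth
  condition on \<open>k\<close> makes \<open>\<surd>k\<close> times this quantity vanish.\<close>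

section \<open>Upper order statistics\<close>

text \<open>Almost sure convergence must hold for every \<delta> > 0 in the condition k / (log
  n)^\<delta> -> infinity. For \<delta> < 1 exponential bounds at all n are not summable; along
  sample sizes \<gamma>^m the logarithm is a multiple of m, and exp (- c m^\<delta>) is summable
  even after a union over polynomially many levels. For normality the obstacle is that B is only a
  positive function: neither measurability nor regularity is given. Local uniformity is therefore
  extracted from increments of t^(1/\<rho>) (\<phi> - U t), which is measurable because U is
  monotone, and the same increments control B. Since Z may have atoms, the representation by uniform
  variables is only weakly monotone, so ranks are taken among the uniform variables, which have no
  ties. Clearing denominators replaces the delta method. Both moments then enter through a single
  linear combination, so a one-dimensional central limit theorem suffices; its variance is the
  stated one.\<close>

definition upper_os :: "(nat \<Rightarrow> real) \<Rightarrow> nat \<Rightarrow> nat \<Rightarrow> real" where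
  "upper_os z n i = Inf {y. 0 \<le> y \<and> card {l. l < n \<and> y < z l} \<le> i}"

definition moment_os :: "(nat \<Rightarrow> real) \<Rightarrow> nat \<Rightarrow> nat \<Rightarrow> nat \<Rightarrow> real" where
  "moment_os z n k j = (1 / real k) * (\<Sum>i<k. (ln (upper_os z n i) - ln (upper_os z n k)) ^ j)"

definition rho_os :: "(nat \<Rightarrow> real) \<Rightarrow> nat \<Rightarrow> nat \<Rightarrow> real" where
  "rho_os z n k = - inverse (moment_os z n k 1 + 1
     - 1 / 2 * inverse (1 - (moment_os z n k 1)\<^sup>2 / moment_os z n k 2))"

definition desc_list :: "(nat \<Rightarrow> real) \<Rightarrow> nat \<Rightarrow> real list" where
  "desc_list z n = rev (sort (map z [0..<n]))"

lemma length_desc_list [simp]: "length (desc_list z n) = n"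
  by (simp add: desc_list_def)

lemma mset_desc_list: "mset (desc_list z n) = mset (map z [0..<n])"
  by (simp add: desc_list_def)

lemma desc_list_antimono:
  assumes "i \<le> j" "j < n"
  shows "desc_list z n ! j \<le> desc_list z n ! i"
  using assms sorted_rev_nth_mono[of "desc_list z n" i j]
  by (simp add: desc_list_def)

text \<open>Sorting does not change the number of exceedances, and in a decreasing list the entries
  above \<open>y\<close> form an initial segment.\<close>

lemma card_gt_le_iff:
  assumes "i < n"
  shows "card {l. l < n \<and> y < z l} \<le> i \<longleftrightarrow> desc_list z n ! i \<le> y"
proof -
  have "card {l. l < n \<and> y < z l} = length (filter (\<lambda>v. y < v) (map z [0..<n]))"
    by (subst length_filter_conv_card) (auto intro!: arg_cong[where f=card])
  also have "\<dots> = length (filter (\<lambda>v. y < v) (desc_list z n))"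
    by (metis mset_desc_list mset_filter size_mset)
  also have "\<dots> = card {l. l < n \<and> y < desc_list z n ! l}"
    by (subst length_filter_conv_card) auto
  finally have eq: "card {l. l < n \<and> y < z l} = card {l. l < n \<and> y < desc_list z n ! l}" .
  show ?thesis
  proof
    assume *: "desc_list z n ! i \<le> y"
    have "{l. l < n \<and> y < desc_list z n ! l} \<subseteq> {..<i}"
    proof (rule subsetI, rule ccontr)
      fix l assume "l \<in> {l. l < n \<and> y < desc_list z n ! l}" "l \<notin> {..<i}"
      with desc_list_antimono[of i l n z] * show False by auto
    qed
    from card_mono[OF _ this] show "card {l. l < n \<and> y < z l} \<le> i" unfolding eq by simp
  next
    assume *: "card {l. l < n \<and> y < z l} \<le> i"
    show "desc_list z n ! i \<le> y"
    proof (rule ccontr)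
      assume "\<not> desc_list z n ! i \<le> y"
      then have "{..i} \<subseteq> {l. l < n \<and> y < desc_list z n ! l}"
        using desc_list_antimono[of _ i n z] assms by force
      from card_mono[OF _ this] * show False unfolding eq by simp
    qed
  qed
qed

text \<open>\<open>upper_os\<close> is an infimum over nonnegative levels because
  \<open>quantile_of\<close> is one; the two are identified in \<open>rho_moment_eq\<close>. The
  price is that negative values are read as 0, and that ranks beyond the sample give 0.\<close>

lemma upper_os_eq:
  assumes "i < n"
  shows "upper_os z n i = max 0 (desc_list z n ! i)"
proof -
  have "{y. 0 \<le> y \<and> card {l. l < n \<and> y < z l} \<le> i} = {max 0 (desc_list z n ! i)..}"
    using card_gt_le_iff[OF assms] by auto
  then show ?thesis unfolding upper_os_def by simp
qed

lemma upper_os_ge: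
  assumes "n \<le> i"
  shows "upper_os z n i = 0"
proof -
  have "card {l. l < n \<and> y < z l} \<le> i" for y
    using card_mono[of "{..<n}" "{l. l < n \<and> y < z l}"] assms by fastforce
  then have "{y. 0 \<le> y \<and> card {l. l < n \<and> y < z l} \<le> i} = {0..}"
    by auto
  then show ?thesis unfolding upper_os_def by simp
qed

lemma upper_os_nonneg: "0 \<le> upper_os z n i"
  by (cases "i < n") (simp_all add: upper_os_eq upper_os_ge)

text \<open>This trades order statistics for counts of exceedances, which are sums of independent
  indicators. It holds for every rank \<open>i\<close>, including \<open>n \<le> i\<close>.\<close>

lemma upper_os_le_iff:
  assumes "0 \<le> y"
  shows "upper_os z n i \<le> y \<longleftrightarrow> card {l. l < n \<and> y < z l} \<le> i"
proof (cases "i < n")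
  case True
  then show ?thesis using assms by (auto simp: upper_os_eq card_gt_le_iff)
next
  case False
  then have "card {l. l < n \<and> y < z l} \<le> i"
    using card_mono[of "{..<n}" "{l. l < n \<and> y < z l}"] by fastforce
  then show ?thesis using False assms by (simp add: upper_os_ge)
qed

text \<open>A function vanishing up to the pivot \<open>upper_os z n k\<close> sees only the larger
  values, and values tied with the pivot contribute 0 whatever their rank. So a sum over ranks
  becomes a sum over the whole sample, without sorting. Positivity of the pivot makes the truncation
  at 0 invisible.\<close>

lemma sum_upper_os:
  fixes G :: "real \<Rightarrow> real"
  assumes "k < n" "0 < upper_os z n k" "\<And>y. y \<le> upper_os z n k \<Longrightarrow> G y = 0"
  shows "(\<Sum>i<k. G (upper_os z n i)) = (\<Sum>l<n. G (z l))"
proof -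
  let ?zs = "desc_list z n"
  have os: "upper_os z n k = ?zs ! k" using assms(1,2) by (auto simp: upper_os_eq)
  have "(\<Sum>l<n. G (z l)) = sum_mset (mset (map G (map z [0..<n])))"
    by (simp only: sum_mset_sum_list map_map sum_list_sum_nth)
       (simp add: atLeast0LessThan)
  also have "\<dots> = sum_mset (mset (map G ?zs))"
    by (simp only: mset_map mset_desc_list)
  also have "\<dots> = (\<Sum>i<n. G (?zs ! i))"
    by (simp only: sum_mset_sum_list sum_list_sum_nth) (simp add: atLeast0LessThan)
  also have "\<dots> = (\<Sum>i<k. G (?zs ! i))"
    using assms desc_list_antimono[of k _ n z]
    by (intro sum.mono_neutral_right) (auto simp: os not_less)
  also have "\<dots> = (\<Sum>i<k. G (upper_os z n i))"
  proof (intro sum.cong refl)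
    fix i assume "i \<in> {..<k}"
    then have "?zs ! i \<ge> ?zs ! k" "i < n" using desc_list_antimono[of i k n z] assms(1) by auto
    then show "G (?zs ! i) = G (upper_os z n i)"
      using assms(2) os by (simp add: upper_os_eq)
  qed
  finally show ?thesis by simp
qed

lemma moment_os_eq:
  assumes "k < n" "0 < upper_os z n k" "0 < j"
  shows "moment_os z n k j =
    (1 / real k) * (\<Sum>l<n. if upper_os z n k < z l then (ln (z l / upper_os z n k)) ^ j else 0)"
proof -
  let ?o = "upper_os z n k"
  have "(\<Sum>i<k. (ln (upper_os z n i) - ln ?o) ^ j)
      = (\<Sum>i<k. if ?o < upper_os z n i then (ln (upper_os z n i / ?o)) ^ j else 0)"
  proof (intro sum.cong refl)
    fix i assume i: "i \<in> {..<k}"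
    have "?o \<le> upper_os z n i"
      using i assms(1) desc_list_antimono[of i k n z] by (auto simp: upper_os_eq)
    then show "(ln (upper_os z n i) - ln ?o) ^ j
      = (if ?o < upper_os z n i then (ln (upper_os z n i / ?o)) ^ j else 0)"
      using assms by (auto simp: ln_div)
  qed
  also have "\<dots> = (\<Sum>l<n. if ?o < z l then (ln (z l / ?o)) ^ j else 0)"
    by (rule sum_upper_os) (use assms in auto)
  finally show ?thesis unfolding moment_os_def by simp
qed

section \<open>Measurability of order statistics\<close>

lemma borel_measurable_Inf_nonneg:
  fixes P :: "'a \<Rightarrow> real \<Rightarrow> bool"
  assumes mono: "\<And>\<omega> y y'. \<omega> \<in> space M \<Longrightarrow> P \<omega> y \<Longrightarrow> 0 \<le> y \<Longrightarrow> y \<le> y' \<Longrightarrow> P \<omega> y'"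
    and meas: "\<And>y. 0 \<le> y \<Longrightarrow> {\<omega> \<in> space M. P \<omega> y} \<in> sets M"
  shows "(\<lambda>\<omega>. Inf {y. 0 \<le> y \<and> P \<omega> y}) \<in> borel_measurable M"
proof (subst borel_measurable_iff_less, rule allI)
  fix c :: real
  let ?Q = "{q. q \<in> \<rat> \<and> (0::real) \<le> q}"
  have cQ: "countable ?Q" by (rule countable_subset[OF _ countable_rat]) auto
  have ex: "\<exists>q\<in>?Q. P \<omega> q \<and> (q < c)" if \<omega>: "\<omega> \<in> space M" "P \<omega> y" "0 \<le> y" "y < c" for \<omega> y c
  proof -
    obtain q where "q \<in> \<rat>" "y < q" "q < c" using Rats_dense_in_real[OF \<open>y < c\<close>] by auto
    then show ?thesis using mono[OF \<omega>(1,2,3), of q] \<omega>(3) by force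
  qed
  \<comment> \<open>By monotonicity, rational levels detect whether the infimum is below
    \<open>c\<close>. The second disjunct accounts for the empty set, whose infimum is some fixed
    real number.\<close>
  have "{\<omega> \<in> space M. Inf {y. 0 \<le> y \<and> P \<omega> y} < c}
      = {\<omega> \<in> space M. (\<exists>q\<in>?Q. P \<omega> q \<and> q < c) \<or> (\<not> (\<exists>q\<in>?Q. P \<omega> q) \<and> Inf ({}::real set) < c)}"
    (is "?L = ?R")
  proof (intro set_eqI iffI)
    fix \<omega> assume *: "\<omega> \<in> ?L"
    show "\<omega> \<in> ?R"
    proof (cases "{y. 0 \<le> y \<and> P \<omega> y} = {}")
      case True
      then have "\<not> (\<exists>q\<in>?Q. P \<omega> q)" by auto
      moreover from * have "Inf {y. 0 \<le> y \<and> P \<omega> y} < c" by blast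
      ultimately show ?thesis unfolding True using * by blast
    next
      case False
      have "bdd_below {y. 0 \<le> y \<and> P \<omega> y}" by (rule bdd_belowI[of _ 0]) auto
      with False * obtain y where "0 \<le> y" "P \<omega> y" "y < c"
        using cInf_less_iff[of "{y. 0 \<le> y \<and> P \<omega> y}" c] by auto
      then show ?thesis using ex * by blast
    qed
  next
    fix \<omega> assume *: "\<omega> \<in> ?R"
    then have \<omega>: "\<omega> \<in> space M" by auto
    show "\<omega> \<in> ?L"
    proof (cases "\<exists>q\<in>?Q. P \<omega> q \<and> q < c")
      case True
      then obtain q where q: "0 \<le> q" "P \<omega> q" "q < c" by auto
      have "bdd_below {y. 0 \<le> y \<and> P \<omega> y}" by (rule bdd_belowI[of _ 0]) auto
      then have "Inf {y. 0 \<le> y \<and> P \<omega> y} \<le> q" using q by (intro cInf_lower) auto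
      then show ?thesis using q \<omega> by auto
    next
      case False
      with * have n: "\<not> (\<exists>q\<in>?Q. P \<omega> q)" and c: "Inf ({}::real set) < c" by auto
      have "{y. 0 \<le> y \<and> P \<omega> y} = {}"
      proof (rule ccontr)
        assume "{y. 0 \<le> y \<and> P \<omega> y} \<noteq> {}"
        then obtain y where "0 \<le> y" "P \<omega> y" by auto
        from ex[OF \<omega> this(2,1), of "y + 1"] n show False by auto
      qed
      then have "Inf {y. 0 \<le> y \<and> P \<omega> y} < c" using c by (simp only:)
      then show ?thesis using \<omega> by blast
    qed
  qed
  moreover have "?R \<in> sets M"
  proof -
    have 1: "{\<omega> \<in> space M. \<exists>q\<in>?Q. P \<omega> q \<and> q < c} \<in> sets M"
    proof (rule sets.sets_Collect_countable_Ex'[OF _ cQ])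
      fix q assume "q \<in> ?Q"
      then show "{\<omega> \<in> space M. P \<omega> q \<and> q < c} \<in> sets M"
        using meas[of q] by (cases "q < c") auto
    qed
    have 2: "{\<omega> \<in> space M. \<exists>q\<in>?Q. P \<omega> q} \<in> sets M"
      by (rule sets.sets_Collect_countable_Ex'[OF _ cQ]) (use meas in auto)
    have "{\<omega> \<in> space M. \<not> (\<exists>q\<in>?Q. P \<omega> q) \<and> Inf ({}::real set) < c} \<in> sets M"
    proof (cases "Inf ({}::real set) < c")
      case True
      have "{\<omega> \<in> space M. \<not> (\<exists>q\<in>?Q. P \<omega> q) \<and> Inf ({}::real set) < c}
        = space M - {\<omega> \<in> space M. \<exists>q\<in>?Q. P \<omega> q}" using True by auto
      then show ?thesis using 2 by auto
    qed auto
    with 1 have "{\<omega> \<in> space M. \<exists>q\<in>?Q. P \<omega> q \<and> q < c} \<union>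
        {\<omega> \<in> space M. \<not> (\<exists>q\<in>?Q. P \<omega> q) \<and> Inf ({}::real set) < c} \<in> sets M" by blast
    also have "{\<omega> \<in> space M. \<exists>q\<in>?Q. P \<omega> q \<and> q < c} \<union>
        {\<omega> \<in> space M. \<not> (\<exists>q\<in>?Q. P \<omega> q) \<and> Inf ({}::real set) < c} = ?R" by blast
    finally show ?thesis .
  qed
  ultimately show "{\<omega> \<in> space M. Inf {y. 0 \<le> y \<and> P \<omega> y} < c} \<in> sets M" by simp
qed

lemma borel_measurable_upper_os [measurable]:
  assumes "\<And>l. l < n \<Longrightarrow> (\<lambda>\<omega>. z \<omega> l) \<in> borel_measurable M"
  shows "(\<lambda>\<omega>. upper_os (z \<omega>) n i) \<in> borel_measurable M"
  unfolding upper_os_def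
proof (rule borel_measurable_Inf_nonneg)
  fix \<omega> y y' assume *: "card {l. l < n \<and> y < z \<omega> l} \<le> i" "y \<le> (y'::real)"
  have "card {l. l < n \<and> y' < z \<omega> l} \<le> card {l. l < n \<and> y < z \<omega> l}"
    by (rule card_mono) (use * in auto)
  with * show "card {l. l < n \<and> y' < z \<omega> l} \<le> i" by simp
next
  fix y :: real
  have "real (card {l. l < n \<and> y < z \<omega> l}) = (\<Sum>l<n. of_bool (y < z \<omega> l))" for \<omega>
    by (auto simp: of_bool_def sum.If_cases intro!: arg_cong[where f=card])
  then have "{\<omega> \<in> space M. card {l. l < n \<and> y < z \<omega> l} \<le> i}
     = {\<omega> \<in> space M. (\<Sum>l<n. if y < z \<omega> l then 1 else 0) \<le> real i}"
    by (simp add: of_bool_def flip: of_nat_le_iff[where 'a=real])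
  moreover have "(\<lambda>\<omega>. \<Sum>l<n. if y < z \<omega> l then 1 else (0::real)) \<in> borel_measurable M"
    by (intro borel_measurable_sum measurable_If borel_measurable_const)
       (use assms in \<open>auto intro!: borel_measurable_less\<close>)
  ultimately show "{\<omega> \<in> space M. card {l. l < n \<and> y < z \<omega> l} \<le> i} \<in> sets M"
    by (simp add: borel_measurable_le)
qed

lemma borel_measurable_rho_os:
  assumes "\<And>l. l < n \<Longrightarrow> (\<lambda>\<omega>. z \<omega> l) \<in> borel_measurable M"
  shows "(\<lambda>\<omega>. rho_os (z \<omega>) n k) \<in> borel_measurable M"
proof -
  have [measurable]: "(\<lambda>\<omega>. upper_os (z \<omega>) n i) \<in> borel_measurable M" for i
    by (rule borel_measurable_upper_os) (use assms in auto)
  show ?thesis unfolding rho_os_def moment_os_def by measurable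
qed

section \<open>Convergence of the estimator from counts of exceedances\<close>

lemma integral_powr_unit:
  fixes b :: real
  assumes "0 \<le> b"
  shows "integrable lborel (\<lambda>w. indicator {0..1} w * w powr b)"
    and "(\<integral>w. indicator {0..1} w * w powr b \<partial>lborel) = 1 / (b + 1)"
proof -
  have cont: "continuous_on {0..1} (\<lambda>w::real. w powr b)" if "b \<noteq> 0"
    using assms that by (intro continuous_on_powr') (auto intro!: continuous_intros)
  have int: "set_integrable lborel {0..1} (\<lambda>w::real. w powr b)"
  proof (cases "b = 0")
    case False
    then show ?thesis by (intro borel_integrable_atLeastAtMost') (use cont in auto)
  next
    \<comment> \<open>\<open>w powr 0\<close> is 1 except at 0, where \<open>powr\<close> gives 0;
      the two integrands differ on a null set.\<close>
    case True
    have "set_integrable lborel {0..1} (\<lambda>w::real. 1::real)"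
      by (intro borel_integrable_atLeastAtMost') auto
    moreover have "AE w in lborel. indicator {0..1} w *\<^sub>R (1::real) = indicator {0..1} w *\<^sub>R w powr b"
      by (rule AE_I[where N="{0}"]) (auto simp: indicator_def True)
    ultimately show ?thesis unfolding set_integrable_def
      by (subst integrable_cong_AE[symmetric]) auto
  qed
  then show "integrable lborel (\<lambda>w. indicator {0..1} w * w powr b)"
    by (simp add: set_integrable_def)
  have "(\<integral>w. indicator {0..1} w * w powr b \<partial>lborel) = integral {0..1} (\<lambda>w. w powr b)"
    using set_borel_integral_eq_integral(2)[OF int] by (simp add: set_lebesgue_integral_def)
  also have "\<dots> = 1 / (b + 1)"
    using has_integral_powr_from_0[of b 1] assms by (intro integral_unique) simp
  finally show "(\<integral>w. indicator {0..1} w * w powr b \<partial>lborel) = 1 / (b + 1)" .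
qed

text \<open>Integrate the derivative of the power from \<open>W\<close> to \<open>\<omega>\<close>.
  Summed over a sample, the condition \<open>W < r\<close> becomes a count of exceedances, so that
  power sums turn into integrals of counting functions.\<close>

lemma layer_cake_power:
  fixes W \<omega> :: real
  assumes "0 \<le> W" "0 < j"
  shows "has_bochner_integral lborel
     (\<lambda>r. if 0 < r \<and> r \<le> \<omega> \<and> W < r then real j * (\<omega> - r) ^ (j - 1) else 0) ((max 0 (\<omega> - W)) ^ j)"
proof (cases "W < \<omega>")
  case True
  have "has_bochner_integral lborel (\<lambda>r. (real j * (\<omega> - r) ^ (j - 1)) * indicator {W..\<omega>} r)
     ((- ((\<omega> - \<omega>) ^ j)) - (- ((\<omega> - W) ^ j)))"
    by (rule has_bochner_integral_FTC_Icc_real)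
       (use True in \<open>auto intro!: derivative_eq_intros continuous_intros\<close>)
  moreover have "(- ((\<omega> - \<omega>) ^ j)) - (- ((\<omega> - W) ^ j)) = (max 0 (\<omega> - W)) ^ j"
    using True assms by simp
  moreover have "AE r in lborel. (real j * (\<omega> - r) ^ (j - 1)) * indicator {W..\<omega>} r =
     (if 0 < r \<and> r \<le> \<omega> \<and> W < r then real j * (\<omega> - r) ^ (j - 1) else 0)"
    by (rule AE_I[where N="{W}"]) (use assms in \<open>auto simp: indicator_def\<close>)
  ultimately show ?thesis
    by (subst has_bochner_integral_cong_AE[symmetric]) auto
next
  case False
  then have "(\<lambda>r. if 0 < r \<and> r \<le> \<omega> \<and> W < r then real j * (\<omega> - r) ^ (j - 1) else 0) = (\<lambda>r. 0)"
    by auto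
  then show ?thesis using False assms has_bochner_integral_zero by (simp add: max_def zero_power)
qed

lemma ln_ratio_bounds:
  fixes u v :: real
  assumes "0 < u" "u < v"
  shows "(v - u) / v \<le> ln (v / u)" "ln (v / u) \<le> (v - u) / u"
proof -
  have "ln (u / v) \<le> u / v - 1" using assms by (intro ln_le_minus_one) auto
  then show "(v - u) / v \<le> ln (v / u)" using assms by (simp add: ln_div diff_divide_distrib)
  have "ln (v / u) \<le> v / u - 1" using assms by (intro ln_le_minus_one) auto
  then show "ln (v / u) \<le> (v - u) / u" using assms by (simp add: diff_divide_distrib)
qed

section \<open>Deterministic limit of the estimator\<close>

context
  fixes z :: "nat \<Rightarrow> nat \<Rightarrow> real" and n k :: "nat \<Rightarrow> nat" and \<delta> :: "nat \<Rightarrow> real" and \<phi> \<rho> :: real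
  assumes \<phi>: "0 < \<phi>" and \<rho>: "0 < \<rho>" and \<delta>: "\<delta> \<longlonglongrightarrow> 0" "\<And>m. 0 < \<delta> m"
    and k: "\<And>m. 0 < k m" "\<And>m. k m < n m"
    and le: "\<And>m l. l < n m \<Longrightarrow> z m l \<le> \<phi>"
    and cnt: "\<And>r. 0 < r \<Longrightarrow>
      (\<lambda>m. real (card {l. l < n m \<and> \<phi> - r * \<delta> m < z m l}) / real (k m)) \<longlonglongrightarrow> r powr \<rho>"
begin

private definition N where
  "N m r = real (card {l. l < n m \<and> \<phi> - r * \<delta> m < z m l}) / real (k m)"
text \<open>The pivot, and next its distance from the frontier in units of
  \<open>\<delta> m\<close>.\<close>

private definition \<zeta> where "\<zeta> m = upper_os (z m) (n m) (k m)"
private definition \<omega> where "\<omega> m = (\<phi> - \<zeta> m) / \<delta> m"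
text \<open>The log-moment with the logarithm linearised at the frontier and distances measured in
  units of \<open>\<delta> m\<close>.\<close>

private definition I where
  "I j m = (1 / real (k m)) * (\<Sum>l<n m. (max 0 (\<omega> m - (\<phi> - z m l) / \<delta> m)) ^ j)"

private lemma eventually_level_nonneg: "eventually (\<lambda>m. 0 \<le> \<phi> - r * \<delta> m) sequentially"
proof -
  have "(\<lambda>m. \<phi> - r * \<delta> m) \<longlonglongrightarrow> \<phi> - r * 0" by (intro tendsto_intros \<delta>)
  then have "eventually (\<lambda>m. 0 < \<phi> - r * \<delta> m) sequentially"
    using \<phi> by (intro order_tendstoD(1)[where a=0]) auto
  then show ?thesis by eventually_elim simp
qed

text \<open>For r < 1 the normalised count tends to r^\<rho> < 1, so fewer than \<open>k m\<close>
  values lie within \<open>r * \<delta> m\<close> of the frontier and the pivot is further away. For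
  r > 1 the count exceeds \<open>k m\<close> and the pivot is closer.\<close>

private lemma \<omega>_tendsto: "\<omega> \<longlonglongrightarrow> 1"
proof (rule order_tendstoI)
  fix a :: real assume a: "a < 1"
  define r where "r = max (1/2) ((a + 1) / 2)"
  have r: "0 < r" "r < 1" "a < r" using a by (auto simp: r_def less_max_iff_disj field_simps)
  have "r powr \<rho> < 1" using r \<rho> powr_less_mono2[of \<rho> r 1] by simp
  then have "eventually (\<lambda>m. N m r < 1) sequentially"
    using cnt[OF r(1)] unfolding N_def by (intro order_tendstoD(2))
  with eventually_level_nonneg[of r] show "eventually (\<lambda>m. a < \<omega> m) sequentially"
  proof eventually_elim
    case (elim m)
    have "card {l. l < n m \<and> \<phi> - r * \<delta> m < z m l} \<le> k m"
      using elim(2) k[of m] by (simp add: N_def field_simps)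
    then have "\<zeta> m \<le> \<phi> - r * \<delta> m"
      unfolding \<zeta>_def using elim(1) by (subst upper_os_le_iff) auto
    then have "r \<le> \<omega> m" using \<delta>(2)[of m] by (simp add: \<omega>_def field_simps)
    with r show ?case by simp
  qed
next
  fix a :: real assume a: "1 < a"
  have "1 < a powr \<rho>" using a \<rho> powr_less_mono2[of \<rho> 1 a] by simp
  then have "eventually (\<lambda>m. 1 < N m a) sequentially"
    using cnt[of a] a unfolding N_def by (intro order_tendstoD(1)) auto
  with eventually_level_nonneg[of a] show "eventually (\<lambda>m. \<omega> m < a) sequentially"
  proof eventually_elim
    case (elim m)
    have "\<not> card {l. l < n m \<and> \<phi> - a * \<delta> m < z m l} \<le> k m"
      using elim(2) k[of m] by (simp add: N_def field_simps)
    then have "\<not> \<zeta> m \<le> \<phi> - a * \<delta> m"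
      unfolding \<zeta>_def using elim(1) by (subst upper_os_le_iff) auto
    then show "\<omega> m < a" using \<delta>(2)[of m] by (simp add: \<omega>_def field_simps)
  qed
qed

private lemma \<zeta>_tendsto: "\<zeta> \<longlonglongrightarrow> \<phi>"
proof -
  have "(\<lambda>m. \<phi> - \<omega> m * \<delta> m) \<longlonglongrightarrow> \<phi> - 1 * 0"
    by (intro tendsto_intros \<omega>_tendsto \<delta>)
  moreover have "\<phi> - \<omega> m * \<delta> m = \<zeta> m" for m using \<delta>(2)[of m] by (simp add: \<omega>_def)
  ultimately show ?thesis by simp
qed

private lemma I_eq:
  assumes "0 < j"
  shows "I j m = (\<integral>r. (if 0 < r \<and> r \<le> \<omega> m then real j * (\<omega> m - r) ^ (j - 1) else 0) * N m r \<partial>lborel)"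
proof -
  let ?W = "\<lambda>l. (\<phi> - z m l) / \<delta> m"
  let ?f = "\<lambda>l r. if 0 < r \<and> r \<le> \<omega> m \<and> ?W l < r then real j * (\<omega> m - r) ^ (j - 1) else 0"
  have hb: "has_bochner_integral lborel (?f l) ((max 0 (\<omega> m - ?W l)) ^ j)" if "l < n m" for l
    using le[OF that] \<delta>(2)[of m] assms by (intro layer_cake_power) auto
  have eq: "?W l < r \<longleftrightarrow> \<phi> - r * \<delta> m < z m l" for l r
    using \<delta>(2)[of m] by (simp add: field_simps)
  have "I j m = (1 / real (k m)) * (\<Sum>l<n m. \<integral>r. ?f l r \<partial>lborel)"
    unfolding I_def using hb
    by (intro arg_cong2[where f="(*)"] refl sum.cong has_bochner_integral_integral_eq[symmetric]) auto
  also have "\<dots> = (1 / real (k m)) * (\<integral>r. (\<Sum>l<n m. ?f l r) \<partial>lborel)"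
    using hb by (subst Bochner_Integration.integral_sum) (auto simp: has_bochner_integral_iff)
  also have "\<dots> = (\<integral>r. (1 / real (k m)) * (\<Sum>l<n m. ?f l r) \<partial>lborel)"
    by simp
  also have "\<dots> = (\<integral>r. (if 0 < r \<and> r \<le> \<omega> m then real j * (\<omega> m - r) ^ (j - 1) else 0) * N m r \<partial>lborel)"
  proof (rule Bochner_Integration.integral_cong[OF refl])
    fix r
    have "(\<Sum>l<n m. ?f l r) = (if 0 < r \<and> r \<le> \<omega> m then real j * (\<omega> m - r) ^ (j - 1) else 0)
        * (\<Sum>l<n m. if ?W l < r then 1 else 0)"
      by (auto simp: sum_distrib_left intro!: sum.cong)
    also have "(\<Sum>l<n m. if ?W l < r then 1 else 0) = real (card {l. l < n m \<and> \<phi> - r * \<delta> m < z m l})"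
      unfolding eq by (auto simp: sum.If_cases intro!: arg_cong[where f=card])
    finally show "(1 / real (k m)) * (\<Sum>l<n m. ?f l r) =
       (if 0 < r \<and> r \<le> \<omega> m then real j * (\<omega> m - r) ^ (j - 1) else 0) * N m r"
      by (simp add: N_def)
  qed
  finally show ?thesis .
qed

private lemma N_mono: "r \<le> r' \<Longrightarrow> N m r \<le> N m r'"
proof -
  assume r: "r \<le> r'"
  have "r * \<delta> m \<le> r' * \<delta> m" using r \<delta>(2)[of m] by (intro mult_right_mono) auto
  then have "card {l. l < n m \<and> \<phi> - r * \<delta> m < z m l} \<le> card {l. l < n m \<and> \<phi> - r' * \<delta> m < z m l}"
    by (intro card_mono) auto
  then show ?thesis by (simp add: N_def divide_right_mono)
qed

private lemma N_nonneg: "0 \<le> N m r"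
  by (simp add: N_def)

private lemma N_measurable [measurable]: "N m \<in> borel_measurable borel"
  by (rule borel_measurable_mono) (simp add: mono_def N_mono)

text \<open>Dominated convergence in \<open>I_eq\<close>. As \<open>N m\<close> is monotone, its
  value at 2 bounds it on the range of integration once \<open>\<omega> m < 2\<close>; shifting the
  sequence by \<open>m0\<close> makes both bounds available for every index.\<close>

private lemma I_tendsto:
  assumes j: "0 < j"
  shows "(\<lambda>m. I j m) \<longlonglongrightarrow>
    (\<integral>r. (if 0 < r \<and> r \<le> 1 then real j * (1 - r) ^ (j - 1) else 0) * r powr \<rho> \<partial>lborel)"
proof -
  have "eventually (\<lambda>m. \<omega> m < 2) sequentially"
    by (rule order_tendstoD(2)[OF \<omega>_tendsto]) simp
  moreover have "eventually (\<lambda>m. N m 2 < 2 powr \<rho> + 1) sequentially"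
    using cnt[of 2] unfolding N_def by (intro order_tendstoD(2)) auto
  ultimately have "eventually (\<lambda>m. \<omega> m < 2 \<and> N m 2 < 2 powr \<rho> + 1) sequentially"
    by eventually_elim simp
  then obtain m0 where m0: "\<And>m. m \<ge> m0 \<Longrightarrow> \<omega> m < 2 \<and> N m 2 < 2 powr \<rho> + 1"
    unfolding eventually_sequentially by auto
  have "(\<lambda>m. I j (m + m0)) \<longlonglongrightarrow>
    (\<integral>r. (if 0 < r \<and> r \<le> 1 then real j * (1 - r) ^ (j - 1) else 0) * r powr \<rho> \<partial>lborel)"
    unfolding I_eq[OF j]
  proof (rule integral_dominated_convergence
      [where w="\<lambda>r. (real j * 2 ^ (j - 1) * (2 powr \<rho> + 1)) * indicator {0..2} r"])
    show "integrable lborel (\<lambda>r::real. (real j * 2 ^ (j - 1) * (2 powr \<rho> + 1)) * indicator {0..2} r)"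
      by simp
    show "AE r in lborel. (\<lambda>m. (if 0 < r \<and> r \<le> \<omega> (m + m0) then real j * (\<omega> (m + m0) - r) ^ (j - 1) else 0) * N (m + m0) r)
      \<longlonglongrightarrow> (if 0 < r \<and> r \<le> 1 then real j * (1 - r) ^ (j - 1) else 0) * r powr \<rho>"
    \<comment> \<open>At \<open>r = 1\<close> the cut-off \<open>r \<le> \<omega> m\<close> need not
      settle, and for \<open>j = 1\<close> the integrand jumps there.\<close>
    proof (rule AE_I[where N="{1}"])
      show "{r \<in> space lborel. \<not> (\<lambda>m. (if 0 < r \<and> r \<le> \<omega> (m + m0) then real j * (\<omega> (m + m0) - r) ^ (j - 1) else 0) * N (m + m0) r)
      \<longlonglongrightarrow> (if 0 < r \<and> r \<le> 1 then real j * (1 - r) ^ (j - 1) else 0) * r powr \<rho>} \<subseteq> {1}"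
      proof (rule subsetI, rule ccontr, unfold mem_Collect_eq, elim conjE)
        fix r :: real assume "r \<notin> {1}"
        then have ne: "r \<noteq> 1" by simp
        assume "\<not> (\<lambda>m. (if 0 < r \<and> r \<le> \<omega> (m + m0) then real j * (\<omega> (m + m0) - r) ^ (j - 1) else 0) * N (m + m0) r)
          \<longlonglongrightarrow> (if 0 < r \<and> r \<le> 1 then real j * (1 - r) ^ (j - 1) else 0) * r powr \<rho>"
        moreover have "(\<lambda>m. (if 0 < r \<and> r \<le> \<omega> m then real j * (\<omega> m - r) ^ (j - 1) else 0) * N m r)
          \<longlonglongrightarrow> (if 0 < r \<and> r \<le> 1 then real j * (1 - r) ^ (j - 1) else 0) * r powr \<rho>"
        proof (cases "0 < r")
          case True
          have "(\<lambda>m. (if r \<le> \<omega> m then real j * (\<omega> m - r) ^ (j - 1) else 0))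
             \<longlonglongrightarrow> (if r \<le> 1 then real j * (1 - r) ^ (j - 1) else 0)"
          proof (cases "r < 1")
            case True
            have "eventually (\<lambda>m. r < \<omega> m) sequentially"
              by (rule order_tendstoD(1)[OF \<omega>_tendsto True])
            then have "eventually (\<lambda>m. real j * (\<omega> m - r) ^ (j - 1) = (if r \<le> \<omega> m then real j * (\<omega> m - r) ^ (j - 1) else 0)) sequentially"
              by eventually_elim simp
            moreover have "(\<lambda>m. real j * (\<omega> m - r) ^ (j - 1)) \<longlonglongrightarrow> real j * (1 - r) ^ (j - 1)"
              by (intro tendsto_intros \<omega>_tendsto)
            ultimately show ?thesis using True by (auto intro: Lim_transform_eventually)
          next
            case False
            with ne have "1 < r" by simp
            then have "eventually (\<lambda>m. \<omega> m < r) sequentially"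
              by (intro order_tendstoD(2)[OF \<omega>_tendsto])
            then have "eventually (\<lambda>m. 0 = (if r \<le> \<omega> m then real j * (\<omega> m - r) ^ (j - 1) else 0)) sequentially"
              by eventually_elim simp
            then show ?thesis using \<open>1 < r\<close> by (auto intro: Lim_transform_eventually)
          qed
          from tendsto_mult[OF this cnt[OF True]] True show ?thesis by (simp add: N_def)
        qed simp
        from LIMSEQ_ignore_initial_segment[OF this, of m0] calculation show False by simp
      qed
    qed simp_all
    show "AE r in lborel. norm ((if 0 < r \<and> r \<le> \<omega> (m + m0) then real j * (\<omega> (m + m0) - r) ^ (j - 1) else 0) * N (m + m0) r)
         \<le> (real j * 2 ^ (j - 1) * (2 powr \<rho> + 1)) * indicator {0..2} r" for m
    proof (rule AE_I2)
      fix r :: real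
      have m: "\<omega> (m + m0) < 2" "N (m + m0) 2 < 2 powr \<rho> + 1" using m0[of "m + m0"] by auto
      show "norm ((if 0 < r \<and> r \<le> \<omega> (m + m0) then real j * (\<omega> (m + m0) - r) ^ (j - 1) else 0) * N (m + m0) r)
         \<le> (real j * 2 ^ (j - 1) * (2 powr \<rho> + 1)) * indicator {0..2} r"
      proof (cases "0 < r \<and> r \<le> \<omega> (m + m0)")
        case True
        have "(\<omega> (m + m0) - r) ^ (j - 1) \<le> 2 ^ (j - 1)"
          using True m by (intro power_mono) auto
        moreover have "N (m + m0) r \<le> 2 powr \<rho> + 1"
          using N_mono[of r 2 "m + m0"] True m by linarith
        moreover have "0 \<le> (\<omega> (m + m0) - r) ^ (j - 1)" using True by simp
        ultimately have "real j * (\<omega> (m + m0) - r) ^ (j - 1) * N (m + m0) r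
            \<le> real j * 2 ^ (j - 1) * (2 powr \<rho> + 1)"
          using N_nonneg[of "m + m0" r] by (intro mult_mono) auto
        then show ?thesis using True m N_nonneg[of "m + m0" r]
          by (simp add: abs_mult)
      next
        case False
        then show ?thesis by (subst if_not_P) (auto simp: indicator_def)
      qed
    qed
  qed measurable
  then show ?thesis by (rule LIMSEQ_offset)
qed

private lemma I1: "I 1 \<longlonglongrightarrow> 1 / (\<rho> + 1)"
proof -
  have "(\<integral>r. (if 0 < r \<and> r \<le> 1 then real 1 * (1 - r) ^ (1 - 1) else 0) * r powr \<rho> \<partial>lborel)
     = (\<integral>r. indicator {0..1} r * r powr \<rho> \<partial>lborel)"
    by (intro Bochner_Integration.integral_cong) (auto simp: indicator_def)
  then show ?thesis using I_tendsto[of 1] integral_powr_unit(2)[of \<rho>] \<rho> by simp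
qed

private lemma I2: "I 2 \<longlonglongrightarrow> 2 / ((\<rho> + 1) * (\<rho> + 2))"
proof -
  have "(\<integral>r. (if 0 < r \<and> r \<le> 1 then real 2 * (1 - r) ^ (2 - 1) else 0) * r powr \<rho> \<partial>lborel)
     = (\<integral>r. 2 * (indicator {0..1} r * r powr \<rho>) - 2 * (indicator {0..1} r * r powr (\<rho> + 1)) \<partial>lborel)"
    by (intro Bochner_Integration.integral_cong) (auto simp: indicator_def powr_add algebra_simps)
  also have "\<dots> = 2 / (\<rho> + 1) - 2 / (\<rho> + 2)"
    using integral_powr_unit[of \<rho>] integral_powr_unit[of "\<rho> + 1"] \<rho>
    by (subst Bochner_Integration.integral_diff) (auto simp: add_ac)
  also have "\<dots> = 2 / ((\<rho> + 1) * (\<rho> + 2))" using \<rho> by (simp add: field_simps)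
  finally show ?thesis using I_tendsto[of 2] by simp
qed

text \<open>The elementary bounds (v - u) / v \<le> ln (v / u) \<le> (v - u) / u place the rescaled
  log-moment between \<open>I j m\<close> and \<open>(\<phi> / \<zeta> m) ^ j * I j m\<close>, and
  the pivot tends to the frontier.\<close>

private lemma moment_squeeze:
  assumes j: "0 < j" and lim: "I j \<longlonglongrightarrow> L"
  shows "(\<lambda>m. (\<phi> / \<delta> m) ^ j * moment_os (z m) (n m) (k m) j) \<longlonglongrightarrow> L"
proof -
  have ev: "eventually (\<lambda>m. 0 < \<zeta> m) sequentially"
    using \<phi> by (intro order_tendstoD(1)[OF \<zeta>_tendsto])
  have bounds: "I j m \<le> (\<phi> / \<delta> m) ^ j * moment_os (z m) (n m) (k m) j"
    "(\<phi> / \<delta> m) ^ j * moment_os (z m) (n m) (k m) j \<le> (\<phi> / \<zeta> m) ^ j * I j m" if "0 < \<zeta> m" for m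
  proof -
    have mo: "(\<phi> / \<delta> m) ^ j * moment_os (z m) (n m) (k m) j =
      (1 / real (k m)) * (\<Sum>l<n m. if \<zeta> m < z m l then (\<phi> / \<delta> m * ln (z m l / \<zeta> m)) ^ j else 0)"
    proof -
      have "moment_os (z m) (n m) (k m) j =
        (1 / real (k m)) * (\<Sum>l<n m. if \<zeta> m < z m l then (ln (z m l / \<zeta> m)) ^ j else 0)"
        unfolding \<zeta>_def using that by (intro moment_os_eq k j) (simp add: \<zeta>_def)
      then have "(\<phi> / \<delta> m) ^ j * moment_os (z m) (n m) (k m) j = (1 / real (k m)) *
        (\<Sum>l<n m. (\<phi> / \<delta> m) ^ j * (if \<zeta> m < z m l then (ln (z m l / \<zeta> m)) ^ j else 0))"
        by (simp add: sum_distrib_left mult_ac)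
      also have "\<dots> = (1 / real (k m)) *
        (\<Sum>l<n m. if \<zeta> m < z m l then (\<phi> / \<delta> m * ln (z m l / \<zeta> m)) ^ j else 0)"
        by (intro arg_cong2[where f="(*)"] refl sum.cong) (simp only: power_mult_distrib split: if_split, simp)
      finally show ?thesis .
    qed
    have eq: "\<omega> m - (\<phi> - z m l) / \<delta> m = (z m l - \<zeta> m) / \<delta> m" for l
      by (simp add: \<omega>_def diff_divide_distrib)
    have t1: "(max 0 (\<omega> m - (\<phi> - z m l) / \<delta> m)) ^ j \<le>
       (if \<zeta> m < z m l then (\<phi> / \<delta> m * ln (z m l / \<zeta> m)) ^ j else 0)"
     and t2: "(if \<zeta> m < z m l then (\<phi> / \<delta> m * ln (z m l / \<zeta> m)) ^ j else 0) \<le>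
       (\<phi> / \<zeta> m) ^ j * (max 0 (\<omega> m - (\<phi> - z m l) / \<delta> m)) ^ j"
     if l: "l < n m" for l
    proof -
      have "(max 0 (\<omega> m - (\<phi> - z m l) / \<delta> m)) ^ j \<le>
         (if \<zeta> m < z m l then (\<phi> / \<delta> m * ln (z m l / \<zeta> m)) ^ j else 0) \<and>
        (if \<zeta> m < z m l then (\<phi> / \<delta> m * ln (z m l / \<zeta> m)) ^ j else 0) \<le>
         (\<phi> / \<zeta> m) ^ j * (max 0 (\<omega> m - (\<phi> - z m l) / \<delta> m)) ^ j"
      proof (cases "\<zeta> m < z m l")
        case True
        have zl: "0 < z m l" "z m l \<le> \<phi>" using True \<open>0 < \<zeta> m\<close> le[OF l] by auto
        have d: "0 < \<delta> m" by (rule \<delta>)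
        have pos: "max 0 ((z m l - \<zeta> m) / \<delta> m) = (z m l - \<zeta> m) / \<delta> m"
          using True d by simp
        have "(z m l - \<zeta> m) / \<delta> m * 1 \<le> (z m l - \<zeta> m) / \<delta> m * (\<phi> / z m l)"
          using True d zl by (intro mult_left_mono) auto
        then have "(z m l - \<zeta> m) / \<delta> m \<le> (z m l - \<zeta> m) / \<delta> m * (\<phi> / z m l)" by simp
        also have "\<dots> = \<phi> / \<delta> m * ((z m l - \<zeta> m) / z m l)" by simp
        also have "\<dots> \<le> \<phi> / \<delta> m * ln (z m l / \<zeta> m)"
          using ln_ratio_bounds(1)[OF \<open>0 < \<zeta> m\<close> True] \<phi> d by (intro mult_left_mono) auto
        finally have a: "(z m l - \<zeta> m) / \<delta> m \<le> \<phi> / \<delta> m * ln (z m l / \<zeta> m)" .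
        have "\<phi> / \<delta> m * ln (z m l / \<zeta> m) \<le> \<phi> / \<delta> m * ((z m l - \<zeta> m) / \<zeta> m)"
          using ln_ratio_bounds(2)[OF \<open>0 < \<zeta> m\<close> True] \<phi> d by (intro mult_left_mono) auto
        then have b: "\<phi> / \<delta> m * ln (z m l / \<zeta> m) \<le> \<phi> / \<zeta> m * ((z m l - \<zeta> m) / \<delta> m)"
          by (simp add: mult.commute)
        have nn: "0 \<le> (z m l - \<zeta> m) / \<delta> m" using True d by simp
        have "((z m l - \<zeta> m) / \<delta> m) ^ j \<le> (\<phi> / \<delta> m * ln (z m l / \<zeta> m)) ^ j"
          by (rule power_mono[OF a nn])
        moreover have "(\<phi> / \<delta> m * ln (z m l / \<zeta> m)) ^ j \<le> (\<phi> / \<zeta> m * ((z m l - \<zeta> m) / \<delta> m)) ^ j"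
          using order_trans[OF nn a] by (rule power_mono[OF b])
        ultimately show ?thesis
          using True unfolding eq pos by (simp only: power_mult_distrib[symmetric] if_True simp_thms)
      next
        case False
        then have "max 0 (\<omega> m - (\<phi> - z m l) / \<delta> m) = 0"
          unfolding eq using \<delta>(2)[of m] by (simp add: max_def field_simps)
        then show ?thesis using False j by (simp add: zero_power)
      qed
      then show "(max 0 (\<omega> m - (\<phi> - z m l) / \<delta> m)) ^ j \<le>
         (if \<zeta> m < z m l then (\<phi> / \<delta> m * ln (z m l / \<zeta> m)) ^ j else 0)"
        and "(if \<zeta> m < z m l then (\<phi> / \<delta> m * ln (z m l / \<zeta> m)) ^ j else 0) \<le>
         (\<phi> / \<zeta> m) ^ j * (max 0 (\<omega> m - (\<phi> - z m l) / \<delta> m)) ^ j" by auto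
    qed
    show "I j m \<le> (\<phi> / \<delta> m) ^ j * moment_os (z m) (n m) (k m) j"
      unfolding mo I_def by (intro mult_left_mono sum_mono t1) auto
    have "(1 / real (k m)) * (\<Sum>l<n m. if \<zeta> m < z m l then (\<phi> / \<delta> m * ln (z m l / \<zeta> m)) ^ j else 0)
      \<le> (1 / real (k m)) * (\<Sum>l<n m. (\<phi> / \<zeta> m) ^ j * (max 0 (\<omega> m - (\<phi> - z m l) / \<delta> m)) ^ j)"
      by (intro mult_left_mono sum_mono t2) auto
    also have "\<dots> = (\<phi> / \<zeta> m) ^ j * I j m"
      by (simp add: I_def sum_distrib_left mult_ac)
    finally show "(\<phi> / \<delta> m) ^ j * moment_os (z m) (n m) (k m) j \<le> (\<phi> / \<zeta> m) ^ j * I j m"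
      unfolding mo .
  qed
  have "(\<lambda>m. (\<phi> / \<zeta> m) ^ j * I j m) \<longlonglongrightarrow> (\<phi> / \<phi>) ^ j * L"
    by (intro tendsto_intros lim \<zeta>_tendsto) (use \<phi> in auto)
  then have up: "(\<lambda>m. (\<phi> / \<zeta> m) ^ j * I j m) \<longlonglongrightarrow> L" using \<phi> by simp
  show ?thesis
    by (rule tendsto_sandwich[OF _ _ lim up]) (use ev bounds in \<open>auto elim: eventually_mono\<close>)
qed

text \<open>The scale \<open>\<phi> / \<delta> m\<close> cancels in the quotient of the squared
  first moment by the second, which therefore has a limit depending on \<rho> only; the first moment
  itself vanishes with \<open>\<delta> m\<close>. The bracket in the estimator then tends to - 1 /
  \<rho>.\<close>

lemma rho_os_tendsto: "(\<lambda>m. rho_os (z m) (n m) (k m)) \<longlonglongrightarrow> \<rho>"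
proof -
  let ?M = "\<lambda>j m. moment_os (z m) (n m) (k m) j"
  let ?L1 = "1 / (\<rho> + 1)" and ?L2 = "2 / ((\<rho> + 1) * (\<rho> + 2))"
  have Q1: "(\<lambda>m. \<phi> / \<delta> m * ?M 1 m) \<longlonglongrightarrow> ?L1"
    using moment_squeeze[OF _ I1] by (simp only: power_one_right zero_less_one)
  have Q2: "(\<lambda>m. (\<phi> / \<delta> m)\<^sup>2 * ?M 2 m) \<longlonglongrightarrow> ?L2"
    using moment_squeeze[OF _ I2] by simp
  have "(\<lambda>m. \<delta> m / \<phi> * (\<phi> / \<delta> m * ?M 1 m)) \<longlonglongrightarrow> 0 / \<phi> * ?L1"
    by (intro tendsto_intros Q1 \<delta>) (use \<phi> in auto)
  moreover have "\<delta> m / \<phi> * (\<phi> / \<delta> m * ?M 1 m) = ?M 1 m" for m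
    using \<phi> \<delta>(2)[of m] by simp
  ultimately have M1: "?M 1 \<longlonglongrightarrow> 0" by simp
  have "(\<lambda>m. (\<phi> / \<delta> m * ?M 1 m)\<^sup>2 / ((\<phi> / \<delta> m)\<^sup>2 * ?M 2 m)) \<longlonglongrightarrow> ?L1\<^sup>2 / ?L2"
    using \<rho> by (intro tendsto_intros Q1 Q2) auto
  moreover have "(\<phi> / \<delta> m * ?M 1 m)\<^sup>2 / ((\<phi> / \<delta> m)\<^sup>2 * ?M 2 m) = (?M 1 m)\<^sup>2 / ?M 2 m" for m
    using \<phi> \<delta>(2)[of m] by (subst power_mult_distrib) simp
  moreover have L: "?L1\<^sup>2 / ?L2 = (\<rho> + 2) / (2 * (\<rho> + 1))"
  proof -
    have "(1 / a)\<^sup>2 / (2 / (a * b)) = b / (2 * a)" if "a \<noteq> 0" "b \<noteq> 0" for a b :: real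
      using that by (simp add: power2_eq_square)
    from this[of "\<rho> + 1" "\<rho> + 2"] show ?thesis using \<rho> by linarith
  qed
  ultimately have R: "(\<lambda>m. (?M 1 m)\<^sup>2 / ?M 2 m) \<longlonglongrightarrow> (\<rho> + 2) / (2 * (\<rho> + 1))"
    by (simp only: L)
  have L': "1 - (\<rho> + 2) / (2 * (\<rho> + 1)) = \<rho> / (2 * (\<rho> + 1))"
    using \<rho> by (simp add: field_simps)
  have L'': "0 + 1 - 1 / 2 * inverse (1 - (\<rho> + 2) / (2 * (\<rho> + 1))) = - 1 / \<rho>"
    unfolding L' using \<rho> by (simp add: field_simps)
  have "(\<lambda>m. - inverse (?M 1 m + 1 - 1 / 2 * inverse (1 - (?M 1 m)\<^sup>2 / ?M 2 m)))
      \<longlonglongrightarrow> - inverse (0 + 1 - 1 / 2 * inverse (1 - (\<rho> + 2) / (2 * (\<rho> + 1))))"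
    by (intro tendsto_intros M1 R) (use \<rho> in \<open>simp_all only: L' L'', auto\<close>)
  then show ?thesis unfolding L'' using \<rho> by (simp add: rho_os_def)
qed

end

section \<open>Consistency\<close>

text \<open>The count is binomial; 1 + y \<le> exp y bounds its moment generating function by that
  of a Poisson variable with the same mean.\<close>

lemma (in prob_space) expectation_exp_count:
  fixes Z :: "nat \<Rightarrow> 'a \<Rightarrow> real"
  assumes ind: "indep_vars (\<lambda>_. borel) Z UNIV" and B: "B \<in> sets borel"
    and p: "\<And>l. prob {\<omega> \<in> space M. Z l \<omega> \<in> B} = p"
  shows "integrable M (\<lambda>\<omega>. exp (s * real (card {l. l < n \<and> Z l \<omega> \<in> B})))"
    and "expectation (\<lambda>\<omega>. exp (s * real (card {l. l < n \<and> Z l \<omega> \<in> B}))) \<le> exp (real n * p * (exp s - 1))"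
proof -
  have Zm [measurable]: "Z l \<in> borel_measurable M" for l
    using ind unfolding indep_vars_def by auto
  have [measurable]: "B \<in> sets borel" by fact
  let ?J = "\<lambda>l \<omega>. exp (s * indicator B (Z l \<omega>))"
  have eq: "exp (s * real (card {l. l < n \<and> Z l \<omega> \<in> B})) = (\<Prod>l<n. ?J l \<omega>)" for \<omega>
  proof -
    have "real (card {l. l < n \<and> Z l \<omega> \<in> B}) = (\<Sum>l<n. indicator B (Z l \<omega>))"
      by (auto simp: indicator_def sum.If_cases intro!: arg_cong[where f=card])
    then show ?thesis by (simp only: sum_distrib_left exp_sum finite_lessThan)
  qed
  have ind': "indep_vars (\<lambda>_. borel) ?J {..<n}"
    using indep_vars_subset[OF ind, of "{..<n}"]
    by (rule indep_vars_compose2[where Y="\<lambda>l x. exp (s * indicator B x)"]) auto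
  have Jeq: "?J l \<omega> = 1 + (exp s - 1) * indicator {\<omega> \<in> space M. Z l \<omega> \<in> B} \<omega>"
    if "\<omega> \<in> space M" for l \<omega> using that by (auto simp: indicator_def)
  have int: "integrable M (?J l)" for l
    by (subst Bochner_Integration.integrable_cong[OF refl Jeq])
       (auto intro!: Bochner_Integration.integrable_add integrable_mult_right integrable_real_indicator simp: emeasure_eq_measure)
  have E: "expectation (?J l) = 1 + (exp s - 1) * p" for l
    by (subst Bochner_Integration.integral_cong[OF refl Jeq], assumption, subst Bochner_Integration.integral_add)
       (auto simp: p prob_space emeasure_eq_measure)
  show "integrable M (\<lambda>\<omega>. exp (s * real (card {l. l < n \<and> Z l \<omega> \<in> B})))"
    unfolding eq by (intro indep_vars_integrable ind' int) auto
  have "expectation (\<lambda>\<omega>. exp (s * real (card {l. l < n \<and> Z l \<omega> \<in> B}))) = (1 + (exp s - 1) * p) ^ n"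
    unfolding eq by (subst indep_vars_lebesgue_integral[OF _ ind' int]) (auto simp: E)
  also have "\<dots> \<le> exp ((exp s - 1) * p) ^ n"
  proof (rule power_mono)
    have "0 \<le> expectation (?J 0)" by (rule integral_nonneg_AE) simp
    then show "0 \<le> 1 + (exp s - 1) * p" unfolding E .
  qed simp
  also have "\<dots> = exp (real n * p * (exp s - 1))"
    by (simp add: exp_of_nat_mult[symmetric] mult_ac)
  finally show "expectation (\<lambda>\<omega>. exp (s * real (card {l. l < n \<and> Z l \<omega> \<in> B})))
    \<le> exp (real n * p * (exp s - 1))" .
qed

lemma (in prob_space) measurable_count [measurable]:
  fixes Z :: "nat \<Rightarrow> 'a \<Rightarrow> real"
  assumes [measurable]: "\<And>l. Z l \<in> borel_measurable M" and B [measurable]: "B \<in> sets borel"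
  shows "(\<lambda>\<omega>. real (card {l. l < n \<and> Z l \<omega> \<in> B})) \<in> borel_measurable M"
proof -
  have "real (card {l. l < n \<and> Z l \<omega> \<in> B}) = (\<Sum>l<n. indicator B (Z l \<omega>))" for \<omega>
    by (auto simp: indicator_def sum.If_cases intro!: arg_cong[where f=card])
  then show ?thesis by simp
qed

lemma (in prob_space) count_deviation:
  fixes Z :: "nat \<Rightarrow> 'a \<Rightarrow> real"
  assumes ind: "indep_vars (\<lambda>_. borel) Z UNIV" and B: "B \<in> sets borel"
    and p: "\<And>l. prob {\<omega> \<in> space M. Z l \<omega> \<in> B} = p"
    and \<eta>: "0 < \<eta>" "\<eta> \<le> 1"
  shows "prob {\<omega> \<in> space M. \<eta> * (real n * p) \<le> \<bar>real (card {l. l < n \<and> Z l \<omega> \<in> B}) - real n * p\<bar>}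
    \<le> 2 * exp (- (real n * p * \<eta>\<^sup>2 / 4))"
proof -
  let ?C = "\<lambda>\<omega>. real (card {l. l < n \<and> Z l \<omega> \<in> B})"
  \<comment> \<open>Both tails lead to the exponent s^2 - s \<eta> times the mean, by exp s \<le> 1
    + s + s^2 and its analogue for - s. It is minimal at s = \<eta> / 2, with value - \<eta>^2 /
    4.\<close>
  let ?\<mu> = "real n * p" and ?s = "\<eta> / 2"
  have Zm [measurable]: "Z l \<in> borel_measurable M" for l
    using ind unfolding indep_vars_def by auto
  have Cm [measurable]: "?C \<in> borel_measurable M" by (rule measurable_count[OF Zm B])
  note E = expectation_exp_count[OF ind B p, of _ n]
  have p0: "0 \<le> ?\<mu>" using measure_nonneg[of M "{\<omega> \<in> space M. Z 0 \<omega> \<in> B}"] unfolding p by simp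
  have s: "0 < ?s" "?s \<le> 1" using \<eta> by auto
  have sp: "set_lebesgue_integral M (space M) f = expectation f" for f :: "'a \<Rightarrow> real"
    unfolding set_lebesgue_integral_def
    by (rule Bochner_Integration.integral_cong) auto
  have si: "set_integrable M (space M) f" if "integrable M f" for f :: "'a \<Rightarrow> real"
    unfolding set_integrable_def using that
    by (rule Bochner_Integration.integrable_cong[THEN iffD1, rotated -1]) auto
  have 1: "prob {\<omega> \<in> space M. (1 + \<eta>) * ?\<mu> \<le> ?C \<omega>} \<le> exp (- (?\<mu> * \<eta>\<^sup>2 / 4))"
  proof -
    have "prob {\<omega> \<in> space M. (1 + \<eta>) * ?\<mu> \<le> ?C \<omega>}
      \<le> exp (- ?s * ((1 + \<eta>) * ?\<mu>)) * (\<integral>\<omega>\<in>space M. exp (?s * ?C \<omega>) \<partial>M)"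
      by (rule Chernoff_ineq_ge[OF s(1) si[OF E(1)] sets.top])
    also have "\<dots> \<le> exp (- ?s * ((1 + \<eta>) * ?\<mu>)) * exp (?\<mu> * (exp ?s - 1))"
      unfolding sp by (intro mult_left_mono E(2)) auto
    also have "\<dots> = exp (?\<mu> * (exp ?s - 1 - ?s * (1 + \<eta>)))"
      by (simp add: exp_add[symmetric] algebra_simps)
    also have "\<dots> \<le> exp (- (?\<mu> * \<eta>\<^sup>2 / 4))"
    proof -
      have "exp ?s \<le> 1 + ?s + ?s\<^sup>2" using s by (intro exp_bound) auto
      then have "exp ?s - 1 - ?s * (1 + \<eta>) \<le> - (\<eta>\<^sup>2 / 4)"
        by (simp add: field_simps power2_eq_square)
      then have "?\<mu> * (exp ?s - 1 - ?s * (1 + \<eta>)) \<le> ?\<mu> * (- (\<eta>\<^sup>2 / 4))"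
        using p0 by (intro mult_left_mono)
      then show ?thesis by simp
    qed
    finally show ?thesis .
  qed
  have 2: "prob {\<omega> \<in> space M. ?C \<omega> \<le> (1 - \<eta>) * ?\<mu>} \<le> exp (- (?\<mu> * \<eta>\<^sup>2 / 4))"
  proof -
    have "prob {\<omega> \<in> space M. ?C \<omega> \<le> (1 - \<eta>) * ?\<mu>}
      \<le> exp (?s * ((1 - \<eta>) * ?\<mu>)) * (\<integral>\<omega>\<in>space M. exp (- ?s * ?C \<omega>) \<partial>M)"
      by (rule Chernoff_ineq_le[OF s(1) si[OF E(1)] sets.top])
    also have "\<dots> \<le> exp (?s * ((1 - \<eta>) * ?\<mu>)) * exp (?\<mu> * (exp (- ?s) - 1))"
      unfolding sp by (intro mult_left_mono E(2)) auto
    also have "\<dots> = exp (?\<mu> * (exp (- ?s) - 1 + ?s * (1 - \<eta>)))"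
      by (simp add: exp_add[symmetric] field_simps)
    also have "\<dots> \<le> exp (- (?\<mu> * \<eta>\<^sup>2 / 4))"
    proof -
      have "exp (- ?s) = 1 / exp ?s" by (simp add: exp_minus inverse_eq_divide)
      also have "\<dots> \<le> 1 / (1 + ?s)" using s by (intro divide_left_mono exp_ge_add_one_self) auto
      also have "\<dots> \<le> 1 - ?s + ?s\<^sup>2"
      proof -
        have "(1 - ?s + ?s\<^sup>2) * (1 + ?s) = 1 + ?s ^ 3" by (simp add: algebra_simps power2_eq_square power3_eq_cube)
        moreover have "0 \<le> ?s ^ 3" using s by simp
        ultimately have "1 \<le> (1 - ?s + ?s\<^sup>2) * (1 + ?s)" by simp
        then show ?thesis using s by (subst pos_divide_le_eq) auto
      qed
      finally have "exp (- ?s) - 1 + ?s * (1 - \<eta>) \<le> - (\<eta>\<^sup>2 / 4)"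
        by (simp add: field_simps power2_eq_square)
      then have "?\<mu> * (exp (- ?s) - 1 + ?s * (1 - \<eta>)) \<le> ?\<mu> * (- (\<eta>\<^sup>2 / 4))"
        using p0 by (intro mult_left_mono)
      then show ?thesis by simp
    qed
    finally show ?thesis .
  qed
  have "prob {\<omega> \<in> space M. \<eta> * ?\<mu> \<le> \<bar>?C \<omega> - ?\<mu>\<bar>}
    \<le> prob ({\<omega> \<in> space M. (1 + \<eta>) * ?\<mu> \<le> ?C \<omega>} \<union> {\<omega> \<in> space M. ?C \<omega> \<le> (1 - \<eta>) * ?\<mu>})"
    by (rule finite_measure_mono) (auto simp: algebra_simps abs_if split: if_splits)
  also have "\<dots> \<le> prob {\<omega> \<in> space M. (1 + \<eta>) * ?\<mu> \<le> ?C \<omega>} + prob {\<omega> \<in> space M. ?C \<omega> \<le> (1 - \<eta>) * ?\<mu>}"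
    by (rule measure_Un_le) measurable
  finally show ?thesis using 1 2 by simp
qed

lemma powr_between:
  fixes a r \<rho> :: real
  assumes "0 < r" "0 < \<rho>"
  shows "a < r powr \<rho> \<Longrightarrow> \<exists>q. 0 < q \<and> q < r \<and> a < q powr \<rho>"
    and "r powr \<rho> < a \<Longrightarrow> \<exists>q>r. q powr \<rho> < a"
proof -
  have c: "isCont (\<lambda>q. q powr \<rho>) r" using assms by (intro continuous_intros) auto
  { assume a: "a < r powr \<rho>"
    have "eventually (\<lambda>q. a < q powr \<rho>) (at_left r)"
      using c a unfolding isCont_def
      by (intro order_tendstoD(1)[of _ "r powr \<rho>"]) (auto intro: tendsto_mono[OF at_le])
    moreover have "eventually (\<lambda>q. q \<in> {0<..<r}) (at_left r)"
      by (rule eventually_at_leftI[of 0]) (use assms in auto)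
    ultimately have "eventually (\<lambda>q. 0 < q \<and> q < r \<and> a < q powr \<rho>) (at_left r)"
      by eventually_elim auto
    then show "\<exists>q. 0 < q \<and> q < r \<and> a < q powr \<rho>"
      using eventually_happens[of _ "at_left r"] trivial_limit_at_left_real by blast }
  { assume a: "r powr \<rho> < a"
    have "eventually (\<lambda>q. q powr \<rho> < a) (at_right r)"
      using c a unfolding isCont_def
      by (intro order_tendstoD(2)[of _ "r powr \<rho>"]) (auto intro: tendsto_mono[OF at_le])
    moreover have "eventually (\<lambda>q. q \<in> {r<..<r+1}) (at_right r)"
      by (rule eventually_at_rightI[of _ "r+1"]) auto
    ultimately have "eventually (\<lambda>q. q > r \<and> q powr \<rho> < a) (at_right r)"
      by eventually_elim auto
    then show "\<exists>q>r. q powr \<rho> < a"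
      using eventually_happens[of _ "at_right r"] trivial_limit_at_right_real by blast }
qed

text \<open>Here \<open>\<sigma> d\<close> is the probability of exceeding the level at distance \<open>d\<close> below the frontier.\<close>

locale regular_tail =
  fixes \<sigma> :: "real \<Rightarrow> real" and \<rho> :: real
  assumes \<rho>: "0 < \<rho>"
    and \<sigma>_mono: "\<And>d d'. d \<le> d' \<Longrightarrow> \<sigma> d \<le> \<sigma> d'"
    and \<sigma>_pos: "\<And>d. 0 < d \<Longrightarrow> 0 < \<sigma> d"
    and rv: "\<And>r. 0 < r \<Longrightarrow> ((\<lambda>d. \<sigma> (r * d) / \<sigma> d) \<longlongrightarrow> r powr \<rho>) (at_right 0)"
begin

lemma rv_seq:
  assumes "0 < r" "d \<longlonglongrightarrow> 0" "\<And>n. 0 < d n"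
  shows "(\<lambda>n. \<sigma> (r * d n) / \<sigma> (d n)) \<longlonglongrightarrow> r powr \<rho>"
proof -
  have "filterlim d (at_right 0) sequentially"
    using assms by (intro tendsto_imp_filterlim_at_right) auto
  from filterlim_compose[OF rv[OF assms(1)] this] show ?thesis by simp
qed

text \<open>A crude Potter bound. The ratio of consecutive values along u^i tends to u^\<rho>, hence
  stays below the larger \<theta> < 1 from some index on.\<close>

lemma \<sigma>_geometric:
  assumes u: "0 < u" "u < 1"
  obtains A \<theta> where "0 < \<theta>" "\<theta> < 1" "0 < A" "\<And>i. \<sigma> (u ^ i) \<le> A * \<theta> ^ i"
proof -
  define \<theta> where "\<theta> = (u powr \<rho> + 1) / 2"
  have up: "0 < u powr \<rho>" "u powr \<rho> < 1" using u \<rho> powr_less_mono2[of \<rho> u 1] by auto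
  then have \<theta>: "0 < \<theta>" "\<theta> < 1" "u powr \<rho> < \<theta>" by (simp_all add: \<theta>_def add_pos_pos)
  have "(\<lambda>i. \<sigma> (u * u ^ i) / \<sigma> (u ^ i)) \<longlonglongrightarrow> u powr \<rho>"
    using u by (intro rv_seq LIMSEQ_power_zero) auto
  from order_tendstoD(2)[OF this \<theta>(3)]
  obtain i0 where i0: "\<And>i. i \<ge> i0 \<Longrightarrow> \<sigma> (u * u ^ i) / \<sigma> (u ^ i) < \<theta>"
    unfolding eventually_sequentially by auto
  have step: "\<sigma> (u ^ (i0 + i)) \<le> \<sigma> (u ^ i0) * \<theta> ^ i" for i
  proof (induction i)
    case (Suc i)
    have "\<sigma> (u ^ (i0 + Suc i)) \<le> \<theta> * \<sigma> (u ^ (i0 + i))"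
      using i0[of "i0 + i"] \<sigma>_pos[of "u ^ (i0 + i)"] u by (simp add: field_simps)
    also have "\<dots> \<le> \<theta> * (\<sigma> (u ^ i0) * \<theta> ^ i)" using Suc \<theta> by (intro mult_left_mono) auto
    finally show ?case by (simp add: mult_ac)
  qed simp
  \<comment> \<open>Dividing by \<open>\<theta> ^ i0\<close> pays for the indices before
    \<open>i0\<close>, where only monotonicity is available.\<close>
  define A where "A = \<sigma> 1 / \<theta> ^ i0"
  show ?thesis
  proof (rule that[of \<theta> A])
    show "0 < A" using \<theta> \<sigma>_pos[of 1] by (simp add: A_def)
    show "\<sigma> (u ^ i) \<le> A * \<theta> ^ i" for i
    proof (cases "i0 \<le> i")
      case True
      then have "\<sigma> (u ^ i) \<le> \<sigma> (u ^ i0) * \<theta> ^ (i - i0)" using step[of "i - i0"] by simp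
      also have "\<dots> \<le> \<sigma> 1 * \<theta> ^ (i - i0)"
        using \<theta> u by (intro mult_right_mono \<sigma>_mono) (auto intro: power_le_one)
      also have "\<dots> = A * \<theta> ^ i" using True \<theta> by (simp add: A_def power_diff)
      finally show ?thesis .
    next
      case False
      have "\<sigma> (u ^ i) \<le> \<sigma> 1 * 1" using u by (simp add: \<sigma>_mono power_le_one)
      also have "\<dots> \<le> \<sigma> 1 * (\<theta> ^ i / \<theta> ^ i0)"
        using False \<theta> \<sigma>_pos[of 1] by (intro mult_left_mono) (auto simp: power_decreasing)
      finally show ?thesis by (simp add: A_def)
    qed
  qed (use \<theta> in auto)
qed

text \<open>The natural level solves \<open>\<sigma> d = \<kappa> n\<close>, but
  \<open>\<sigma>\<close> may jump across this value. The supremum of the d with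
  \<open>\<sigma> d \<le> \<kappa> n\<close> serves instead: multiplying it by a factor slightly
  below or above 1 puts \<open>\<sigma>\<close> on the correct side of \<open>\<kappa> n\<close>,
  and by regular variation such a factor changes \<open>\<sigma>\<close> by a ratio close to
  1.\<close>

lemma exists_levels:
  assumes \<kappa>: "\<kappa> \<longlonglongrightarrow> 0" "\<And>n. 0 < \<kappa> n"
  obtains \<delta> :: "nat \<Rightarrow> real" where "\<delta> \<longlonglongrightarrow> 0" "\<And>n. 0 < \<delta> n"
    "\<And>r. 0 < r \<Longrightarrow> (\<lambda>n. \<sigma> (r * \<delta> n) / \<kappa> n) \<longlonglongrightarrow> r powr \<rho>"
proof -
  define D where "D n = {d. 0 < d \<and> d \<le> 1 \<and> \<sigma> d \<le> \<kappa> n}" for n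
  define \<delta> where "\<delta> n = Sup (D n)" for n
  have ne: "D n \<noteq> {}" for n
  proof -
    obtain A \<theta> where A: "0 < \<theta>" "\<theta> < 1" "0 < A" "\<And>i. \<sigma> ((1/2) ^ i) \<le> A * \<theta> ^ i"
      by (rule \<sigma>_geometric[of "1/2"]) auto
    have "(\<lambda>i. A * \<theta> ^ i) \<longlonglongrightarrow> A * 0" using A by (intro tendsto_intros LIMSEQ_power_zero) auto
    then have "eventually (\<lambda>i. A * \<theta> ^ i < \<kappa> n) sequentially"
      using \<kappa>(2)[of n] by (intro order_tendstoD(2)) auto
    then obtain i where "A * \<theta> ^ i < \<kappa> n" unfolding eventually_sequentially by auto
    then have "(1/2) ^ i \<in> D n" using A(4)[of i] by (auto simp: D_def intro: power_le_one)
    then show ?thesis by auto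
  qed
  have bdd: "bdd_above (D n)" for n by (rule bdd_aboveI[of _ 1]) (auto simp: D_def)
  have pos: "0 < \<delta> n" for n
  proof -
    obtain d where "d \<in> D n" using ne[of n] by auto
    then show ?thesis using cSup_upper[OF _ bdd, of d n] by (auto simp: \<delta>_def D_def)
  qed
  have le: "\<sigma> (q * \<delta> n) \<le> \<kappa> n" if "q < 1" for q n
  proof -
    have "q * \<delta> n < \<delta> n" using pos[of n] that by simp
    then obtain d where "d \<in> D n" "q * \<delta> n < d"
      unfolding \<delta>_def using less_cSup_iff[OF ne bdd] by auto
    then show ?thesis using \<sigma>_mono[of "q * \<delta> n" d] by (auto simp: D_def)
  qed
  have lim0: "\<delta> \<longlonglongrightarrow> 0"
  proof (rule LIMSEQ_I)
    fix e :: real assume e: "0 < e"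
    have "eventually (\<lambda>n. \<kappa> n < \<sigma> (e / 2)) sequentially"
      using \<sigma>_pos[of "e/2"] e by (intro order_tendstoD(2)[OF \<kappa>(1)]) auto
    then obtain n0 where n0: "\<And>n. n \<ge> n0 \<Longrightarrow> \<kappa> n < \<sigma> (e / 2)"
      unfolding eventually_sequentially by auto
    have "norm (\<delta> n - 0) < e" if "n \<ge> n0" for n
    proof -
      have "\<delta> n \<le> e / 2" unfolding \<delta>_def
      proof (rule cSup_least[OF ne])
        fix d assume d: "d \<in> D n"
        show "d \<le> e / 2"
        proof (rule ccontr)
          assume "\<not> d \<le> e / 2"
          then show False using d n0[OF that] \<sigma>_mono[of "e/2" d] by (simp add: D_def)
        qed
      qed
      then show ?thesis using pos[of n] e by simp
    qed
    then show "\<exists>n0. \<forall>n\<ge>n0. norm (\<delta> n - 0) < e" by auto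
  qed
  have gt: "eventually (\<lambda>n. \<kappa> n < \<sigma> (q * \<delta> n)) sequentially" if "1 < q" for q
  proof -
    have "(\<lambda>n. q * \<delta> n) \<longlonglongrightarrow> q * 0" by (intro tendsto_intros lim0)
    then have "eventually (\<lambda>n. q * \<delta> n < 1) sequentially" by (intro order_tendstoD(2)) auto
    then show ?thesis
    proof eventually_elim
      case (elim n)
      show ?case
      proof (rule ccontr)
        assume "\<not> \<kappa> n < \<sigma> (q * \<delta> n)"
        then have "q * \<delta> n \<in> D n" using elim pos[of n] that by (auto simp: D_def)
        then have "q * \<delta> n \<le> \<delta> n" unfolding \<delta>_def by (rule cSup_upper[OF _ bdd])
        then show False using pos[of n] that by simp
      qed
    qed
  qed
  have one: "(\<lambda>n. \<sigma> (\<delta> n) / \<kappa> n) \<longlonglongrightarrow> 1"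
  proof (rule order_tendstoI)
    fix a :: real assume "a < 1"
    then have "a < 1 powr \<rho>" by simp
    from powr_between(1)[OF _ \<rho> this] obtain q' where q': "0 < q'" "q' < 1" "a < q' powr \<rho>" by auto
    have "(\<lambda>n. \<sigma> (q' * (1 / q' * \<delta> n)) / \<sigma> (1 / q' * \<delta> n)) \<longlonglongrightarrow> q' powr \<rho>"
    proof (rule rv_seq)
      have "(\<lambda>n. 1 / q' * \<delta> n) \<longlonglongrightarrow> 1 / q' * 0" by (intro tendsto_intros lim0)
      then show "(\<lambda>n. 1 / q' * \<delta> n) \<longlonglongrightarrow> 0" by simp
    qed (use q' pos in auto)
    then have "eventually (\<lambda>n. a < \<sigma> (q' * (1 / q' * \<delta> n)) / \<sigma> (1 / q' * \<delta> n)) sequentially"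
      by (rule order_tendstoD(1)[OF _ q'(3)])
    moreover have "1 < 1 / q'" using q' by simp
    note gt[OF this]
    ultimately show "eventually (\<lambda>n. a < \<sigma> (\<delta> n) / \<kappa> n) sequentially"
    proof eventually_elim
      case (elim n)
      have "a < \<sigma> (\<delta> n) / \<sigma> (1 / q' * \<delta> n)" using elim(1) q' by simp
      also have "\<dots> \<le> \<sigma> (\<delta> n) / \<kappa> n"
        using elim(2) \<kappa>(2)[of n] \<sigma>_pos[OF pos[of n]] by (intro divide_left_mono) auto
      finally show ?case .
    qed
  next
    fix a :: real assume "1 < a"
    then have "1 powr \<rho> < a" by simp
    from powr_between(2)[OF _ \<rho> this] obtain q' where q': "1 < q'" "q' powr \<rho> < a" by auto
    have "(\<lambda>n. \<sigma> (q' * (1 / q' * \<delta> n)) / \<sigma> (1 / q' * \<delta> n)) \<longlonglongrightarrow> q' powr \<rho>"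
    proof (rule rv_seq)
      have "(\<lambda>n. 1 / q' * \<delta> n) \<longlonglongrightarrow> 1 / q' * 0" by (intro tendsto_intros lim0)
      then show "(\<lambda>n. 1 / q' * \<delta> n) \<longlonglongrightarrow> 0" by simp
    qed (use q' pos in auto)
    then have "eventually (\<lambda>n. \<sigma> (q' * (1 / q' * \<delta> n)) / \<sigma> (1 / q' * \<delta> n) < a) sequentially"
      by (rule order_tendstoD(2)[OF _ q'(2)])
    then show "eventually (\<lambda>n. \<sigma> (\<delta> n) / \<kappa> n < a) sequentially"
    proof eventually_elim
      case (elim n)
      have "0 < \<sigma> (1 / q' * \<delta> n)" using pos[of n] q' by (intro \<sigma>_pos) auto
      then have "\<sigma> (\<delta> n) / \<kappa> n \<le> \<sigma> (\<delta> n) / \<sigma> (1 / q' * \<delta> n)"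
        using le[of "1 / q'" n] q' \<kappa>(2)[of n] \<sigma>_pos[OF pos[of n]] by (intro divide_left_mono) auto
      also have "\<dots> < a" using elim q' by simp
      finally show ?case .
    qed
  qed
  have "(\<lambda>n. \<sigma> (r * \<delta> n) / \<kappa> n) \<longlonglongrightarrow> r powr \<rho>" if r: "0 < r" for r
  proof -
    have "(\<lambda>n. \<sigma> (r * \<delta> n) / \<sigma> (\<delta> n) * (\<sigma> (\<delta> n) / \<kappa> n)) \<longlonglongrightarrow> r powr \<rho> * 1"
      by (intro tendsto_mult one rv_seq r lim0 pos)
    moreover have "(\<lambda>n. \<sigma> (r * \<delta> n) / \<sigma> (\<delta> n) * (\<sigma> (\<delta> n) / \<kappa> n)) = (\<lambda>n. \<sigma> (r * \<delta> n) / \<kappa> n)"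
    proof
      fix n
      have "\<sigma> (\<delta> n) \<noteq> 0" using \<sigma>_pos[OF pos[of n]] by simp
      then show "\<sigma> (r * \<delta> n) / \<sigma> (\<delta> n) * (\<sigma> (\<delta> n) / \<kappa> n) = \<sigma> (r * \<delta> n) / \<kappa> n" by simp
    qed
    ultimately show ?thesis by (simp only: mult_1_right)
  qed
  with lim0 pos show ?thesis by (rule that)
qed

end

section \<open>Reduction to finitely many levels\<close>

text \<open>Monotone functions with a continuous limit converge everywhere once they converge at
  rational points; so countably many levels are enough.\<close>

lemma tendsto_powr_dense:
  fixes N :: "nat \<Rightarrow> real \<Rightarrow> real"
  assumes mono: "\<And>m r r'. r \<le> r' \<Longrightarrow> N m r \<le> N m r'" and \<rho>: "0 < \<rho>"
    and lim: "\<And>q. q \<in> \<rat> \<Longrightarrow> 0 < q \<Longrightarrow> (\<lambda>m. N m q) \<longlonglongrightarrow> q powr \<rho>"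
    and r: "0 < r"
  shows "(\<lambda>m. N m r) \<longlonglongrightarrow> r powr \<rho>"
proof (rule order_tendstoI)
  fix a assume "a < r powr \<rho>"
  from powr_between(1)[OF r \<rho> this] obtain q where q: "0 < q" "q < r" "a < q powr \<rho>" by auto
  obtain q' where q': "q' \<in> \<rat>" "q < q'" "q' < r" using Rats_dense_in_real[OF q(2)] by auto
  have "a < q' powr \<rho>" using q q' \<rho> powr_less_mono2[of \<rho> q q'] by simp
  moreover have "0 < q'" using q q' by simp
  ultimately have "eventually (\<lambda>m. a < N m q') sequentially"
    by (intro order_tendstoD(1)[OF lim[OF q'(1)]])
  then show "eventually (\<lambda>m. a < N m r) sequentially"
    by eventually_elim (use mono[of q' r] q' in \<open>auto intro: less_le_trans\<close>)
next
  fix a assume "r powr \<rho> < a"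
  from powr_between(2)[OF r \<rho> this] obtain q where q: "r < q" "q powr \<rho> < a" by auto
  obtain q' where q': "q' \<in> \<rat>" "r < q'" "q' < q" using Rats_dense_in_real[OF q(1)] by auto
  have "q' powr \<rho> < a" using q q' r \<rho> powr_less_mono2[of \<rho> q' q] by simp
  moreover have "0 < q'" using r q' by simp
  ultimately have "eventually (\<lambda>m. N m q' < a) sequentially"
    by (intro order_tendstoD(2)[OF lim[OF q'(1)]])
  then show "eventually (\<lambda>m. N m r < a) sequentially"
    by eventually_elim (use mono[of r q'] q' in \<open>auto intro: le_less_trans\<close>)
qed

text \<open>A compactness argument turning the limit theorem into a criterion for one fixed sample
  size: the estimator is within \<epsilon> of \<rho> as soon as finitely many normalised counts are
  accurate. This is what a union bound can use. If it failed, counterexamples with shrinking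
  tolerance and growing sets of levels would contradict \<open>rho_os_tendsto\<close>.\<close>

lemma rho_os_finitely_many_levels:
  fixes k :: "nat \<Rightarrow> nat" and \<delta> :: "nat \<Rightarrow> real"
  assumes \<phi>: "0 < \<phi>" and \<rho>: "0 < \<rho>" and \<delta>: "\<delta> \<longlonglongrightarrow> 0" "\<And>n. 0 < \<delta> n"
    and k: "\<And>n. 2 \<le> n \<Longrightarrow> 0 < k n \<and> k n < n" and \<epsilon>: "0 < \<epsilon>"
  shows "\<exists>\<eta> Q n0. 0 < \<eta> \<and> finite Q \<and> (\<forall>q\<in>Q. 0 < q) \<and> 2 \<le> n0 \<and>
    (\<forall>n z. n0 \<le> n \<longrightarrow> (\<forall>l<n. z l \<le> \<phi>) \<longrightarrow>
       (\<forall>q\<in>Q. \<bar>real (card {l. l < n \<and> \<phi> - q * \<delta> n < z l}) / real (k n) - q powr \<rho>\<bar> < \<eta>) \<longrightarrow>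
       \<bar>rho_os z n (k n) - \<rho>\<bar> \<le> \<epsilon>)" (is "\<exists>\<eta> Q n0. ?C \<eta> Q n0")
proof (rule ccontr)
  assume neg: "\<not> (\<exists>\<eta> Q n0. ?C \<eta> Q n0)"
  let ?R = "{q::real. q \<in> \<rat> \<and> 0 < q}"
  define e where "e = from_nat_into ?R"
  have cR: "countable ?R" by (rule countable_subset[OF _ countable_rat]) auto
  have "1 \<in> ?R" by simp
  then have neR: "?R \<noteq> {}" by blast
  have e_range: "range e = ?R" unfolding e_def by (rule range_from_nat_into[OF neR cR])
  \<comment> \<open>The m-th counterexample: tolerance 1 / (m + 1) at the first m + 1 positive
    rationals in the enumeration \<open>e\<close>. Requiring \<open>m + 2 \<le> n\<close> sends the
    sample sizes to infinity.\<close>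
  define P where "P m n z \<longleftrightarrow> m + 2 \<le> n \<and> (\<forall>l<n. z l \<le> \<phi>) \<and>
      (\<forall>q\<in>e ` {..m}. \<bar>real (card {l. l < n \<and> \<phi> - q * \<delta> n < z l}) / real (k n) - q powr \<rho>\<bar> < 1 / real (m + 1)) \<and>
      \<not> \<bar>rho_os z n (k n) - \<rho>\<bar> \<le> \<epsilon>" for m n z
  have "\<exists>n z. P m n z" for m
  proof (rule ccontr)
    assume no: "\<nexists>n z. P m n z"
    have "?C (1 / real (m + 1)) (e ` {..m}) (m + 2)"
    proof (intro conjI ballI allI impI)
      fix q assume "q \<in> e ` {..m}"
      then have "q \<in> ?R" using e_range by blast
      then show "0 < q" by simp
    next
      fix n z assume "m + 2 \<le> n" "\<forall>l<n. z l \<le> \<phi>"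
        "\<forall>q\<in>e ` {..m}. \<bar>real (card {l. l < n \<and> \<phi> - q * \<delta> n < z l}) / real (k n) - q powr \<rho>\<bar> < 1 / real (m + 1)"
      with no show "\<bar>rho_os z n (k n) - \<rho>\<bar> \<le> \<epsilon>" unfolding P_def by blast
    qed auto
    with neg show False by blast
  qed
  then obtain n z where nz: "\<And>m. P m (n m) (z m)" by metis
  have n_ge: "m + 2 \<le> n m" for m using nz[of m] by (simp add: P_def)
  have n_top: "filterlim n at_top sequentially"
    by (rule filterlim_at_top_mono[OF filterlim_ident]) (use n_ge in \<open>auto intro!: always_eventually le_trans[OF _ n_ge]\<close>)
  let ?N = "\<lambda>m r. real (card {l. l < n m \<and> \<phi> - r * \<delta> (n m) < z m l}) / real (k (n m))"
  have "(\<lambda>m. rho_os (z m) (n m) (k (n m))) \<longlonglongrightarrow> \<rho>"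
  proof (rule rho_os_tendsto[OF \<phi> \<rho>, where \<delta>="\<lambda>m. \<delta> (n m)" and k="\<lambda>m. k (n m)"])
    show "(\<lambda>m. \<delta> (n m)) \<longlonglongrightarrow> 0" by (rule filterlim_compose[OF \<delta>(1) n_top])
    show "0 < k (n m)" "k (n m) < n m" for m using k[of "n m"] n_ge[of m] by auto
    show "z m l \<le> \<phi>" if "l < n m" for m l using nz[of m] that by (auto simp: P_def)
    show "(\<lambda>m. ?N m r) \<longlonglongrightarrow> r powr \<rho>" if "0 < r" for r
    proof (rule tendsto_powr_dense[OF _ \<rho> _ that, where N = ?N])
      fix m and r r' :: real assume r: "r \<le> r'"
      have "r * \<delta> (n m) \<le> r' * \<delta> (n m)" using r \<delta>(2)[of "n m"] by (intro mult_right_mono) auto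
      then show "?N m r \<le> ?N m r'"
        by (intro divide_right_mono of_nat_mono card_mono) auto
    next
      fix q :: real assume "q \<in> \<rat>" "0 < q"
      then have "q \<in> range e" unfolding e_range by simp
      then obtain j where j: "q = e j" by auto
      show "(\<lambda>m. ?N m q) \<longlonglongrightarrow> q powr \<rho>"
      proof (rule LIM_zero_cancel, rule tendsto_0_le[where K=1])
        show "(\<lambda>m. 1 / real (m + 1)) \<longlonglongrightarrow> 0" by real_asymp
        have "\<bar>?N m q - q powr \<rho>\<bar> \<le> 1 / real (m + 1)" if "j \<le> m" for m
        proof -
          have "q \<in> e ` {..m}" using that j by simp
          then show ?thesis using nz[of m] unfolding P_def by (meson less_imp_le)
        qed
        then show "eventually (\<lambda>m. norm (?N m q - q powr \<rho>) \<le> norm (1 / real (m + 1)) * 1) sequentially"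
          unfolding eventually_sequentially by (intro exI[of _ j]) auto
      qed
    qed
  qed (rule \<delta>)
  then have "eventually (\<lambda>m. dist (rho_os (z m) (n m) (k (n m))) \<rho> < \<epsilon>) sequentially"
    using \<epsilon> by (rule tendstoD)
  then obtain m where "dist (rho_os (z m) (n m) (k (n m))) \<rho> < \<epsilon>" unfolding eventually_sequentially by auto
  with nz[of m] show False by (auto simp: P_def dist_real_def)
qed

section \<open>Convergence in probability\<close>

text \<open>The bound \<open>d1\<close> confines \<open>tail_Z\<close> to levels close to the
  frontier: in the application Z is set to 0 off the event X \<le> x, and the identity is
  established for positive levels only.\<close>

locale tail_sample = prob_space M + regular_tail \<sigma> \<rho>
  for M :: "'a measure" and \<sigma> \<rho> +
  fixes Z :: "nat \<Rightarrow> 'a \<Rightarrow> real" and \<phi> d1 :: real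
  assumes indep_Z: "indep_vars (\<lambda>_. borel) Z UNIV"
    and Z_le: "\<And>l. AE \<omega> in M. Z l \<omega> \<le> \<phi>"
    and \<phi>: "0 < \<phi>" and d1: "0 < d1"
    and tail_Z: "\<And>l d. 0 < d \<Longrightarrow> d < d1 \<Longrightarrow> prob {\<omega> \<in> space M. \<phi> - d < Z l \<omega>} = \<sigma> d"
begin

lemma Z_measurable [measurable]: "Z l \<in> borel_measurable M"
  using indep_Z unfolding indep_vars_def by auto

lemma count_above_level_deviation:
  assumes "0 < d" "d < d1" "0 < \<eta>" "\<eta> \<le> 1"
  shows "prob {\<omega> \<in> space M. \<eta> * (real n * \<sigma> d) \<le>
    \<bar>real (card {l. l < n \<and> \<phi> - d < Z l \<omega>}) - real n * \<sigma> d\<bar>} \<le> 2 * exp (- (real n * \<sigma> d * \<eta>\<^sup>2 / 4))"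
  using count_deviation[OF indep_Z, of "{\<phi> - d<..}" "\<sigma> d" \<eta> n] tail_Z[OF assms(1,2)] assms(3,4)
  by simp

lemma measurable_count_Z [measurable]:
  "(\<lambda>\<omega>. real (card {l. l < n \<and> y < Z l \<omega>})) \<in> borel_measurable M"
  using measurable_count[OF Z_measurable, of "{y<..}" n] by simp

lemma AE_Z_le: "AE \<omega> in M. \<forall>l. Z l \<omega> \<le> \<phi>"
  unfolding AE_all_countable using Z_le by simp

lemma rho_os_converges_in_prob:
  fixes k :: "nat \<Rightarrow> nat"
  assumes k: "\<And>n. 2 \<le> n \<Longrightarrow> 0 < k n \<and> k n < n"
    and kn: "(\<lambda>n. real (k n) / real n) \<longlonglongrightarrow> 0" and k_top: "filterlim k at_top sequentially"
    and \<epsilon>: "0 < \<epsilon>"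
  shows "(\<lambda>n. prob {\<omega> \<in> space M. \<epsilon> < \<bar>rho_os (\<lambda>l. Z l \<omega>) n (k n) - \<rho>\<bar>}) \<longlonglongrightarrow> 0"
proof -
  \<comment> \<open>The value 1 for n < 2 only keeps \<open>\<kappa>\<close> positive, as
    \<open>exists_levels\<close> demands.\<close>
  define \<kappa> where "\<kappa> n = (if 2 \<le> n then real (k n) / real n else 1)" for n
  have \<kappa>_ev: "eventually (\<lambda>n. real (k n) / real n = \<kappa> n) sequentially"
    using eventually_ge_at_top[of 2] by eventually_elim (simp add: \<kappa>_def)
  have \<kappa>_pos: "0 < \<kappa> n" for n using k[of n] by (simp add: \<kappa>_def)
  obtain \<delta> where \<delta>: "\<delta> \<longlonglongrightarrow> 0" "\<And>n. 0 < \<delta> n"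
    "\<And>r. 0 < r \<Longrightarrow> (\<lambda>n. \<sigma> (r * \<delta> n) / \<kappa> n) \<longlonglongrightarrow> r powr \<rho>"
    by (rule exists_levels[OF Lim_transform_eventually[OF kn \<kappa>_ev] \<kappa>_pos]) (rule that)
  obtain \<eta> Q n0 where Q: "0 < \<eta>" "finite Q" "\<forall>q\<in>Q. 0 < q" "2 \<le> n0"
    "\<forall>n z. n0 \<le> n \<longrightarrow> (\<forall>l<n. z l \<le> \<phi>) \<longrightarrow>
       (\<forall>q\<in>Q. \<bar>real (card {l. l < n \<and> \<phi> - q * \<delta> n < z l}) / real (k n) - q powr \<rho>\<bar> < \<eta>) \<longrightarrow>
       \<bar>rho_os z n (k n) - \<rho>\<bar> \<le> \<epsilon>"
    using rho_os_finitely_many_levels[OF \<phi> \<rho> \<delta>(1,2) k \<epsilon>] by blast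
  let ?E = "\<lambda>q n. {\<omega> \<in> space M. \<eta> \<le> \<bar>real (card {l. l < n \<and> \<phi> - q * \<delta> n < Z l \<omega>}) / real (k n) - q powr \<rho>\<bar>}"
  have small: "(\<lambda>n. prob (?E q n)) \<longlonglongrightarrow> 0" if q: "0 < q" for q
  proof -
    \<comment> \<open>\<open>\<eta>'\<close> is a relative error. Eventually the expected count is
      at most \<open>q powr \<rho> + 1\<close> times \<open>k n\<close>, so the random error is
      below \<eta> / 4; the error of the expected count is another \<eta> / 4.\<close>
    define \<eta>' where "\<eta>' = min 1 (\<eta> / (4 * (q powr \<rho> + 1)))"
    have qp: "0 < q powr \<rho>" using q by simp
    have \<eta>': "0 < \<eta>'" "\<eta>' \<le> 1" "\<eta>' * (q powr \<rho> + 1) \<le> \<eta> / 4"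
      using Q(1) qp by (auto simp: \<eta>'_def min_def field_simps add_pos_pos)
    have lim: "(\<lambda>n. \<sigma> (q * \<delta> n) / \<kappa> n) \<longlonglongrightarrow> q powr \<rho>" by (rule \<delta>(3)[OF q])
    have "(\<lambda>n. q * \<delta> n) \<longlonglongrightarrow> q * 0" by (intro tendsto_intros \<delta>)
    then have "eventually (\<lambda>n. q * \<delta> n < d1) sequentially" using d1 by (intro order_tendstoD(2)) auto
    moreover have "eventually (\<lambda>n. \<sigma> (q * \<delta> n) / \<kappa> n < q powr \<rho> + 1) sequentially"
      by (rule order_tendstoD(2)[OF lim]) simp
    moreover have "eventually (\<lambda>n. q powr \<rho> / 2 < \<sigma> (q * \<delta> n) / \<kappa> n) sequentially"
      by (rule order_tendstoD(1)[OF lim]) (use qp in simp)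
    moreover have "eventually (\<lambda>n. \<bar>\<sigma> (q * \<delta> n) / \<kappa> n - q powr \<rho>\<bar> < \<eta> / 4) sequentially"
      using tendstoD[OF lim, of "\<eta> / 4"] Q(1) by (simp add: dist_real_def)
    ultimately have ev: "eventually (\<lambda>n. prob (?E q n) \<le> 2 * exp (- (q powr \<rho> / 2 * \<eta>'\<^sup>2 / 4) * real (k n))) sequentially"
      using eventually_ge_at_top[of 2]
    proof eventually_elim
      case (elim n)
      have kn: "0 < real (k n)" using k[OF elim(5)] by simp
      have \<kappa>n: "real n * (\<sigma> (q * \<delta> n)) = real (k n) * (\<sigma> (q * \<delta> n) / \<kappa> n)"
        using elim(5) kn by (simp add: \<kappa>_def)
      have sub: "?E q n \<subseteq> {\<omega> \<in> space M. \<eta>' * (real n * \<sigma> (q * \<delta> n)) \<le>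
        \<bar>real (card {l. l < n \<and> \<phi> - q * \<delta> n < Z l \<omega>}) - real n * \<sigma> (q * \<delta> n)\<bar>}"
      proof (rule subsetI, rule ccontr)
        fix \<omega> assume w: "\<omega> \<in> ?E q n" and "\<omega> \<notin> {\<omega> \<in> space M. \<eta>' * (real n * \<sigma> (q * \<delta> n)) \<le>
        \<bar>real (card {l. l < n \<and> \<phi> - q * \<delta> n < Z l \<omega>}) - real n * \<sigma> (q * \<delta> n)\<bar>}"
        then have "\<bar>real (card {l. l < n \<and> \<phi> - q * \<delta> n < Z l \<omega>}) - real n * \<sigma> (q * \<delta> n)\<bar> < \<eta>' * (real n * \<sigma> (q * \<delta> n))"
          by auto
        then have "\<bar>real (card {l. l < n \<and> \<phi> - q * \<delta> n < Z l \<omega>}) - real n * \<sigma> (q * \<delta> n)\<bar> / real (k n) < \<eta>' * (real n * \<sigma> (q * \<delta> n)) / real (k n)"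
          using kn by (rule divide_strict_right_mono)
        also have "\<dots> = \<eta>' * (\<sigma> (q * \<delta> n) / \<kappa> n)" unfolding \<kappa>n using kn by simp
        also have "\<dots> \<le> \<eta>' * (q powr \<rho> + 1)" using elim(2) \<eta>' by (intro mult_left_mono) auto
        also have "\<bar>real (card {l. l < n \<and> \<phi> - q * \<delta> n < Z l \<omega>}) - real n * \<sigma> (q * \<delta> n)\<bar> / real (k n)
          = \<bar>real (card {l. l < n \<and> \<phi> - q * \<delta> n < Z l \<omega>}) / real (k n) - \<sigma> (q * \<delta> n) / \<kappa> n\<bar>"
        proof -
          have "real (card {l. l < n \<and> \<phi> - q * \<delta> n < Z l \<omega>}) / real (k n) - \<sigma> (q * \<delta> n) / \<kappa> n
            = (real (card {l. l < n \<and> \<phi> - q * \<delta> n < Z l \<omega>}) - real n * \<sigma> (q * \<delta> n)) / real (k n)"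
            unfolding \<kappa>n using kn by (simp add: diff_divide_distrib)
          then show ?thesis using kn by simp
        qed
        finally have "\<bar>real (card {l. l < n \<and> \<phi> - q * \<delta> n < Z l \<omega>}) / real (k n) - \<sigma> (q * \<delta> n) / \<kappa> n\<bar> < \<eta> / 4"
          using \<eta>'(3) by linarith
        moreover have "\<eta> \<le> \<bar>real (card {l. l < n \<and> \<phi> - q * \<delta> n < Z l \<omega>}) / real (k n) - q powr \<rho>\<bar>"
          using w by simp
        ultimately show False using elim(4) Q(1) by linarith
      qed
      have "prob (?E q n) \<le> prob {\<omega> \<in> space M. \<eta>' * (real n * \<sigma> (q * \<delta> n)) \<le>
        \<bar>real (card {l. l < n \<and> \<phi> - q * \<delta> n < Z l \<omega>}) - real n * \<sigma> (q * \<delta> n)\<bar>}"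
        by (rule finite_measure_mono[OF sub]) measurable
      also have "\<dots> \<le> 2 * exp (- (real n * \<sigma> (q * \<delta> n) * \<eta>'\<^sup>2 / 4))"
        using elim(1) q \<delta>(2)[of n] \<eta>' by (intro count_above_level_deviation) auto
      also have "\<dots> \<le> 2 * exp (- (q powr \<rho> / 2 * \<eta>'\<^sup>2 / 4) * real (k n))"
      proof -
        have "q powr \<rho> / 2 * \<eta>'\<^sup>2 / 4 * real (k n) = (real (k n) * (q powr \<rho> / 2)) * (\<eta>'\<^sup>2 / 4)" by simp
        also have "\<dots> \<le> real n * \<sigma> (q * \<delta> n) * (\<eta>'\<^sup>2 / 4)"
          unfolding \<kappa>n using elim(3) kn by (intro mult_right_mono mult_left_mono) auto
        finally show ?thesis by simp
      qed
      finally show ?case .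
    qed
    have c: "0 < q powr \<rho> / 2 * \<eta>'\<^sup>2 / 4" using qp \<eta>' by simp
    have "((\<lambda>x. 2 * exp (- c * x)) \<longlongrightarrow> 0) at_top" if "0 < c" for c :: real
      using that by real_asymp
    from filterlim_compose[OF this[OF c] filterlim_compose[OF filterlim_real_sequentially k_top]]
    have "(\<lambda>n. 2 * exp (- (q powr \<rho> / 2 * \<eta>'\<^sup>2 / 4) * real (k n))) \<longlonglongrightarrow> 0" .
    from tendsto_sandwich[OF _ ev tendsto_const this]
    show ?thesis by simp
  qed
  have "(\<lambda>n. \<Sum>q\<in>Q. prob (?E q n)) \<longlonglongrightarrow> (\<Sum>q\<in>Q. 0)"
    by (intro tendsto_sum small) (use Q(3) in auto)
  then have lim: "(\<lambda>n. \<Sum>q\<in>Q. prob (?E q n)) \<longlonglongrightarrow> 0" by simp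
  have ev: "eventually (\<lambda>n. prob {\<omega> \<in> space M. \<epsilon> < \<bar>rho_os (\<lambda>l. Z l \<omega>) n (k n) - \<rho>\<bar>}
     \<le> (\<Sum>q\<in>Q. prob (?E q n))) sequentially"
    using eventually_ge_at_top[of n0]
  proof eventually_elim
    case (elim n)
    have "prob {\<omega> \<in> space M. \<epsilon> < \<bar>rho_os (\<lambda>l. Z l \<omega>) n (k n) - \<rho>\<bar>} \<le> prob (\<Union>q\<in>Q. ?E q n)"
    proof (rule finite_measure_mono_AE)
      show "AE \<omega> in M. \<omega> \<in> {\<omega> \<in> space M. \<epsilon> < \<bar>rho_os (\<lambda>l. Z l \<omega>) n (k n) - \<rho>\<bar>} \<longrightarrow> \<omega> \<in> (\<Union>q\<in>Q. ?E q n)"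
        using AE_Z_le
      proof eventually_elim
        case (elim \<omega>)
        then show ?case
          using Q(5)[rule_format, OF \<open>n0 \<le> n\<close>, of "\<lambda>l. Z l \<omega>"] by (force simp: not_le)
      qed
      show "(\<Union>q\<in>Q. ?E q n) \<in> sets M"
        by (rule sets.finite_UN[OF Q(2)]) measurable
    qed
    also have "\<dots> \<le> (\<Sum>q\<in>Q. prob (?E q n))"
      by (rule finite_measure_subadditive_finite[OF Q(2)]) (auto, measurable)
    finally show ?case .
  qed
  show ?thesis by (rule tendsto_sandwich[OF _ ev tendsto_const lim]) simp
qed

end

section \<open>Almost sure convergence along geometric grids\<close>

definition block :: "real \<Rightarrow> nat \<Rightarrow> nat" where
  "block \<gamma> m = nat \<lceil>\<gamma> ^ m\<rceil>"

lemma block_bounds: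
  assumes "1 < \<gamma>"
  shows "\<gamma> ^ m \<le> real (block \<gamma> m)" "real (block \<gamma> m) \<le> \<gamma> ^ m + 1"
proof -
  have "0 \<le> \<gamma> ^ m" using assms by simp
  then have "real (block \<gamma> m) = of_int \<lceil>\<gamma> ^ m\<rceil>" by (simp add: block_def)
  then show "\<gamma> ^ m \<le> real (block \<gamma> m)" "real (block \<gamma> m) \<le> \<gamma> ^ m + 1" by linarith+
qed

lemma block_le: "\<gamma> ^ m \<le> real n \<Longrightarrow> block \<gamma> m \<le> n"
  unfolding block_def by (metis ceiling_le_iff nat_le_iff of_int_of_nat_eq)

lemma exists_power_between:
  fixes \<gamma> y :: real
  assumes "1 < \<gamma>" "1 \<le> y"
  shows "\<exists>m. \<gamma> ^ m \<le> y \<and> y < \<gamma> ^ Suc m"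
proof -
  obtain m where m: "y < \<gamma> ^ m" using real_arch_pow[OF assms(1)] by auto
  define m' where "m' = (LEAST m. y < \<gamma> ^ m)"
  have 1: "y < \<gamma> ^ m'" unfolding m'_def by (rule LeastI[of "\<lambda>m. y < \<gamma> ^ m", OF m])
  then have "m' \<noteq> 0" using assms(2) by (cases m') auto
  then obtain m'' where m'': "m' = Suc m''" by (cases m') auto
  have "\<not> y < \<gamma> ^ m''" using not_less_Least[of m'' "\<lambda>m. y < \<gamma> ^ m"] m'' by (simp add: m'_def)
  with 1 m'' show ?thesis by (intro exI[of _ m'']) auto
qed

text \<open>The level \<open>(1/\<gamma>) ^ i\<close> and the sample size \<open>block \<gamma> m\<close> run through geometric grids; the
  monotonicity of \<open>K\<close> in both arguments fills the gaps.\<close>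

lemma (in regular_tail) grid_sandwich:
  fixes K :: "nat \<Rightarrow> real \<Rightarrow> real" and d :: "nat \<Rightarrow> real"
  assumes monoK: "\<And>n n' d d'. n \<le> n' \<Longrightarrow> d \<le> d' \<Longrightarrow> K n d \<le> K n' d'"
    and \<gamma>: "1 < \<gamma>" and \<eta>: "0 < \<eta>" and \<delta>: "0 < \<delta>"
    and good: "eventually (\<lambda>m. \<forall>i. i1 \<le> i \<and> i \<le> m * m \<and>
        (real m * ln \<gamma>) powr \<delta> \<le> real (block \<gamma> m) * \<sigma> ((1 / \<gamma>) ^ i) \<longrightarrow>
        \<bar>K (block \<gamma> m) ((1 / \<gamma>) ^ i) - real (block \<gamma> m) * \<sigma> ((1 / \<gamma>) ^ i)\<bar>
          \<le> \<eta> * (real (block \<gamma> m) * \<sigma> ((1 / \<gamma>) ^ i))) sequentially"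
    and d: "d \<longlonglongrightarrow> 0" "\<And>n. 0 < d n"
    and big: "filterlim (\<lambda>n. real n * \<sigma> (d n) / (ln (real n)) powr \<delta>) at_top sequentially"
  shows "eventually (\<lambda>n. (1 - \<eta>) / \<gamma> powr (\<rho> + 3) * (real n * \<sigma> (d n)) \<le> K n (d n) \<or> 1 < \<eta>) sequentially"
    and "eventually (\<lambda>n. K n (d n) \<le> (1 + \<eta>) * \<gamma> powr (\<rho> + 3) * (real n * \<sigma> (d n))) sequentially"
proof -
  define u where "u = 1 / \<gamma>"
  \<comment> \<open>Passing to the next grid point multiplies the sample size by at most \<gamma>^2
    (one factor for the grid, one for rounding up) and the tail by at most \<gamma>^(\<rho> + 1)
    (the limit \<gamma>^\<rho> and some slack).\<close>
  define c where "c = \<gamma> powr (\<rho> + 3)"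
  have u: "0 < u" "u < 1" using \<gamma> by (auto simp: u_def)
  have c: "1 < c" using \<gamma> \<rho> by (auto simp: c_def intro!: gr_one_powr)
  obtain A \<theta> where A: "0 < \<theta>" "\<theta> < 1" "0 < A" "\<And>i. \<sigma> (u ^ i) \<le> A * \<theta> ^ i"
    by (rule \<sigma>_geometric[OF u]) (rule that)
  have "(\<lambda>i. \<sigma> (u * u ^ i) / \<sigma> (u ^ i)) \<longlonglongrightarrow> u powr \<rho>"
    using u by (intro rv_seq LIMSEQ_power_zero) auto
  moreover have "u powr (\<rho> + 1) < u powr \<rho>" using u \<rho> by (intro powr_less_mono') auto
  ultimately have "eventually (\<lambda>i. u powr (\<rho> + 1) < \<sigma> (u * u ^ i) / \<sigma> (u ^ i)) sequentially"
    by (rule order_tendstoD(1))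
  then obtain i2 where i2: "\<And>i. i \<ge> i2 \<Longrightarrow> u powr (\<rho> + 1) < \<sigma> (u * u ^ i) / \<sigma> (u ^ i)"
    unfolding eventually_sequentially by auto
  have \<sigma>_step: "\<sigma> (u ^ i) \<le> \<gamma> powr (\<rho> + 1) * \<sigma> (u ^ Suc i)" if "i \<ge> i2" for i
  proof -
    have "u powr (\<rho> + 1) * \<sigma> (u ^ i) < \<sigma> (u ^ Suc i)"
      using i2[OF that] \<sigma>_pos[of "u ^ i"] u by (simp add: field_simps)
    moreover have "\<gamma> powr (\<rho> + 1) * u powr (\<rho> + 1) = 1"
      using \<gamma> by (simp add: u_def powr_divide)
    moreover have "0 < \<gamma> powr (\<rho> + 1)" using \<gamma> by simp
    ultimately show ?thesis
      by (metis less_imp_le mult.assoc mult_1 mult_le_cancel_left_pos)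
  qed
  \<comment> \<open>Levels with index beyond m^2 have tails of order at most \<theta>^(m^2), which
    even a sample of size about \<gamma>^m cannot compensate: its expected count falls below
    1.\<close>
  have "(\<lambda>m. 2 * A * (\<gamma> ^ m * \<theta> ^ (m * m))) \<longlonglongrightarrow> 0"
    using A \<gamma> by real_asymp
  then have m1: "eventually (\<lambda>m. 2 * A * (\<gamma> ^ m * \<theta> ^ (m * m)) < 1) sequentially"
    by (rule order_tendstoD(2)) simp
  have m2: "eventually (\<lambda>m. 1 \<le> \<gamma> ^ m * (\<gamma>\<^sup>2 - \<gamma>)) sequentially"
  proof -
    have "0 < \<gamma>\<^sup>2 - \<gamma>" using \<gamma> by (simp add: power2_eq_square)
    then have "filterlim (\<lambda>m. \<gamma> ^ m * (\<gamma>\<^sup>2 - \<gamma>)) at_top sequentially" using \<gamma> by real_asymp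
    then show ?thesis by (simp add: filterlim_at_top)
  qed
  from m1 m2 good eventually_ge_at_top[of 1]
  have "eventually (\<lambda>m. 2 * A * (\<gamma> ^ m * \<theta> ^ (m * m)) < 1 \<and> 1 \<le> \<gamma> ^ m * (\<gamma>\<^sup>2 - \<gamma>) \<and> 1 \<le> m \<and>
     (\<forall>i. i1 \<le> i \<and> i \<le> m * m \<and>
        (real m * ln \<gamma>) powr \<delta> \<le> real (block \<gamma> m) * \<sigma> (u ^ i) \<longrightarrow>
        \<bar>K (block \<gamma> m) (u ^ i) - real (block \<gamma> m) * \<sigma> (u ^ i)\<bar>
          \<le> \<eta> * (real (block \<gamma> m) * \<sigma> (u ^ i)))) sequentially"
    unfolding u_def by eventually_elim blast
  then obtain m0 where m0: "\<And>m. m0 \<le> m \<Longrightarrow> 2 * A * (\<gamma> ^ m * \<theta> ^ (m * m)) < 1 \<and> 1 \<le> \<gamma> ^ m * (\<gamma>\<^sup>2 - \<gamma>) \<and> 1 \<le> m \<and>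
     (\<forall>i. i1 \<le> i \<and> i \<le> m * m \<and>
        (real m * ln \<gamma>) powr \<delta> \<le> real (block \<gamma> m) * \<sigma> (u ^ i) \<longrightarrow>
        \<bar>K (block \<gamma> m) (u ^ i) - real (block \<gamma> m) * \<sigma> (u ^ i)\<bar>
          \<le> \<eta> * (real (block \<gamma> m) * \<sigma> (u ^ i)))"
    unfolding eventually_sequentially by auto
  have "eventually (\<lambda>n. d n < u ^ Suc (max i1 i2)) sequentially"
    using u by (intro order_tendstoD(2)[OF d(1)]) auto
  \<comment> \<open>The factor c is lost when moving to the lower grid point, and
    \<open>2 powr \<delta>\<close> covers the next block: (m + 1) ln \<gamma> \<le> 2 m ln \<gamma>
    \<le> 2 ln n.\<close>
  moreover have "eventually (\<lambda>n. c * 2 powr \<delta> \<le> real n * \<sigma> (d n) / (ln (real n)) powr \<delta>) sequentially"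
    using big by (simp add: filterlim_at_top)
  moreover have "eventually (\<lambda>n. real n > \<gamma> ^ Suc m0) sequentially" by real_asymp
  moreover have "eventually (\<lambda>n::nat. 1 \<le> ln (real n)) sequentially" by real_asymp
  ultimately have main: "eventually (\<lambda>n. ((1 - \<eta>) / c * (real n * \<sigma> (d n)) \<le> K n (d n) \<or> 1 < \<eta>) \<and>
     K n (d n) \<le> (1 + \<eta>) * c * (real n * \<sigma> (d n))) sequentially"
  proof eventually_elim
    case (elim n)
    let ?a = "real n * \<sigma> (d n)"
    have "1 \<le> \<gamma> ^ Suc m0" using \<gamma> by (intro one_le_power) simp
    then have n1: "1 \<le> real n" using elim(3) by linarith
    obtain m where m: "\<gamma> ^ m \<le> real n" "real n < \<gamma> ^ Suc m"
      using exists_power_between[OF \<gamma> n1] by auto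
    have "m0 \<le> m"
    proof (rule ccontr)
      assume "\<not> m0 \<le> m"
      then have "\<gamma> ^ Suc m \<le> \<gamma> ^ Suc m0" using \<gamma> by (intro power_increasing) auto
      then show False using m elim(3) by linarith
    qed
    note M = m0[OF this] and M' = m0[OF le_SucI[OF this]]
    let ?N = "block \<gamma> m" and ?N' = "block \<gamma> (Suc m)"
    have N: "?N \<le> n" by (rule block_le[OF m(1)])
    have N': "n \<le> ?N'" using block_bounds(1)[OF \<gamma>, of "Suc m"] m(2) by linarith
    have NN: "real ?N' \<le> \<gamma>\<^sup>2 * real ?N"
    proof -
      have "real ?N' \<le> \<gamma> * \<gamma> ^ m + 1" using block_bounds(2)[OF \<gamma>, of "Suc m"] by simp
      also have "\<dots> \<le> \<gamma> * \<gamma> ^ m + \<gamma> ^ m * (\<gamma>\<^sup>2 - \<gamma>)" using M by simp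
      also have "\<dots> = \<gamma>\<^sup>2 * \<gamma> ^ m" by (simp add: algebra_simps)
      also have "\<dots> \<le> \<gamma>\<^sup>2 * real ?N" using block_bounds(1)[OF \<gamma>, of m] by (intro mult_left_mono) auto
      finally show ?thesis .
    qed
    have "u ^ Suc (max i1 i2) \<le> 1" using u by (intro power_le_one) auto
    then have dn: "0 < d n" "d n < 1" using d(2)[of n] elim(1) by auto
    obtain i where "\<gamma> ^ i \<le> 1 / d n" "1 / d n < \<gamma> ^ Suc i"
      using exists_power_between[OF \<gamma>, of "1 / d n"] dn by auto
    then have i: "u ^ Suc i < d n" "d n \<le> u ^ i"
      using dn \<gamma> unfolding u_def power_one_over by (auto simp: field_simps)
    have imax: "max i1 i2 \<le> i"
    proof (rule ccontr)
      assume "\<not> max i1 i2 \<le> i"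
      then have "u ^ Suc (max i1 i2) \<le> u ^ Suc i" using u by (intro power_decreasing) auto
      then show False using i elim(1) by linarith
    qed
    let ?s = "real ?N * \<sigma> (u ^ Suc i)" and ?t = "real ?N' * \<sigma> (u ^ i)"
    have spos: "0 \<le> ?s" using \<sigma>_pos[of "u ^ Suc i"] u by simp
    have sa: "?s \<le> ?a"
      using N i \<sigma>_mono[of "u ^ Suc i" "d n"] \<sigma>_pos[of "u ^ Suc i"] u by (intro mult_mono) auto
    have at: "?a \<le> ?t"
      using N' i \<sigma>_mono[of "d n" "u ^ i"] \<sigma>_pos[OF dn(1)] by (intro mult_mono) auto
    have ts: "?t \<le> c * ?s"
    proof -
      have "?t \<le> (\<gamma>\<^sup>2 * real ?N) * (\<gamma> powr (\<rho> + 1) * \<sigma> (u ^ Suc i))"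
        using NN \<sigma>_step[of i] imax \<sigma>_pos[of "u ^ i"] u \<gamma> by (intro mult_mono) auto
      also have "\<gamma>\<^sup>2 * real ?N * (\<gamma> powr (\<rho> + 1) * \<sigma> (u ^ Suc i)) = c * ?s"
        using \<gamma> by (simp add: c_def powr_add power2_eq_square powr_numeral power3_eq_cube)
      finally show ?thesis .
    qed
    have lnn: "real m * ln \<gamma> \<le> ln (real n)"
    proof -
      have "ln (\<gamma> ^ m) \<le> ln (real n)" using m n1 \<gamma> by (subst ln_le_cancel_iff) auto
      then show ?thesis using \<gamma> by (simp add: ln_realpow)
    qed
    have "c * 2 powr \<delta> * (ln (real n)) powr \<delta> \<le> ?a"
      using elim(2,4) by (simp add: field_simps)
    also note at also note ts
    finally have s_big: "(2 * ln (real n)) powr \<delta> \<le> ?s"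
      using c elim(4) by (simp add: powr_mult)
    have s1: "1 \<le> ?s"
    proof -
      have "1 \<le> (2 * ln (real n)) powr \<delta>" using elim(4) \<delta> by (intro ge_one_powr_ge_zero) auto
      with s_big show ?thesis by simp
    qed
    have lnl: "0 \<le> ln \<gamma>" using \<gamma> by simp
    have ths: "(real m * ln \<gamma>) powr \<delta> \<le> ?s"
    proof -
      have "(real m * ln \<gamma>) powr \<delta> \<le> (2 * ln (real n)) powr \<delta>"
        using lnn lnl \<delta> elim(4) by (intro powr_mono2) auto
      with s_big show ?thesis by simp
    qed
    have tht: "(real (Suc m) * ln \<gamma>) powr \<delta> \<le> ?t"
    proof -
      have "real (Suc m) * ln \<gamma> \<le> (2 * real m) * ln \<gamma>" using M lnl by (intro mult_right_mono) auto
      also have "\<dots> \<le> 2 * ln (real n)" using lnn by simp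
      finally have "(real (Suc m) * ln \<gamma>) powr \<delta> \<le> (2 * ln (real n)) powr \<delta>"
        using lnl \<delta> by (intro powr_mono2) auto
      with s_big sa at show ?thesis by simp
    qed
    \<comment> \<open>The expected count at this level is at least 1 by \<open>s1\<close>, which
      rules out indices beyond m^2.\<close>
    have im: "Suc i \<le> m * m"
    proof (rule ccontr)
      assume "\<not> Suc i \<le> m * m"
      then have "\<theta> ^ Suc i \<le> \<theta> ^ (m * m)" using A by (intro power_decreasing) auto
      moreover have "real ?N \<le> 2 * \<gamma> ^ m"
      proof -
        have "1 \<le> \<gamma> ^ m" using \<gamma> by simp
        then show ?thesis using block_bounds(2)[OF \<gamma>, of m] by linarith
      qed
      moreover have "\<sigma> (u ^ Suc i) \<le> A * \<theta> ^ Suc i" by (rule A)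
      ultimately have "\<sigma> (u ^ Suc i) \<le> A * \<theta> ^ (m * m)" "real ?N \<le> 2 * \<gamma> ^ m"
        using A(3) by (auto intro: order_trans mult_left_mono)
      then have "?s \<le> (2 * \<gamma> ^ m) * (A * \<theta> ^ (m * m))"
        using \<sigma>_pos[of "u ^ Suc i"] u \<gamma> by (intro mult_mono) auto
      then show False using s1 M by (simp add: mult_ac)
    qed
    have Ks: "\<bar>K ?N (u ^ Suc i) - ?s\<bar> \<le> \<eta> * ?s"
      using M im imax ths by (auto simp del: power_Suc)
    have "i \<le> Suc m * Suc m" using im by simp
    then have Kt: "\<bar>K ?N' (u ^ i) - ?t\<bar> \<le> \<eta> * ?t"
      using M' imax tht by auto
    have "K n (d n) \<le> K ?N' (u ^ i)" using N' i by (intro monoK) auto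
    also have "\<dots> \<le> (1 + \<eta>) * ?t" using Kt by (simp add: algebra_simps)
    also have "\<dots> \<le> (1 + \<eta>) * (c * ?a)"
    proof -
      have "c * ?s \<le> c * ?a" using sa c by (intro mult_left_mono) auto
      with ts have "?t \<le> c * ?a" by linarith
      then show ?thesis using \<eta> by (intro mult_left_mono) auto
    qed
    finally have up: "K n (d n) \<le> (1 + \<eta>) * c * ?a" by (simp add: mult_ac)
    have "(1 - \<eta>) / c * ?a \<le> K n (d n)" if "\<eta> \<le> 1"
    proof -
      have "?a / c \<le> ?s" using at ts c by (simp add: field_simps)
      then have "(1 - \<eta>) * (?a / c) \<le> (1 - \<eta>) * ?s" using that by (intro mult_left_mono) auto
      also have "\<dots> \<le> K ?N (u ^ Suc i)" using Ks by (simp add: algebra_simps)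
      also have "\<dots> \<le> K n (d n)" using N i by (intro monoK) auto
      finally show ?thesis by simp
    qed
    with up show ?case by linarith
  qed
  show "eventually (\<lambda>n. (1 - \<eta>) / \<gamma> powr (\<rho> + 3) * (real n * \<sigma> (d n)) \<le> K n (d n) \<or> 1 < \<eta>) sequentially"
    using main unfolding c_def by eventually_elim blast
  show "eventually (\<lambda>n. K n (d n) \<le> (1 + \<eta>) * \<gamma> powr (\<rho> + 3) * (real n * \<sigma> (d n))) sequentially"
    using main unfolding c_def by eventually_elim blast
qed

text \<open>Borel-Cantelli over blocks. At most m^2 + 1 levels are considered in block m, and each
  fails with probability at most 2 exp (- (m ln \<gamma>)^\<delta> \<eta>^2 / 4). Since the sample
  size grows geometrically, a power of its logarithm is a power of m, and the sum over m converges
  for every \<delta> > 0.\<close>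

lemma (in tail_sample) AE_grid:
  assumes \<gamma>: "1 < \<gamma>" and \<eta>: "0 < \<eta>" "\<eta> \<le> 1" and \<delta>: "0 < \<delta>" and i1: "(1 / \<gamma>) ^ i1 < d1"
  shows "AE \<omega> in M. eventually (\<lambda>m. \<forall>i. i1 \<le> i \<and> i \<le> m * m \<and>
        (real m * ln \<gamma>) powr \<delta> \<le> real (block \<gamma> m) * \<sigma> ((1 / \<gamma>) ^ i) \<longrightarrow>
        \<bar>real (card {l. l < block \<gamma> m \<and> \<phi> - (1 / \<gamma>) ^ i < Z l \<omega>}) - real (block \<gamma> m) * \<sigma> ((1 / \<gamma>) ^ i)\<bar>
          \<le> \<eta> * (real (block \<gamma> m) * \<sigma> ((1 / \<gamma>) ^ i))) sequentially"
proof -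
  define u where "u = 1 / \<gamma>"
  have u: "0 < u" "u < 1" using \<gamma> by (auto simp: u_def)
  define I where "I m = {i. i1 \<le> i \<and> i \<le> m * m \<and> (real m * ln \<gamma>) powr \<delta> \<le> real (block \<gamma> m) * \<sigma> (u ^ i)}" for m
  define A where "A m i = {\<omega> \<in> space M. \<eta> * (real (block \<gamma> m) * \<sigma> (u ^ i)) \<le>
    \<bar>real (card {l. l < block \<gamma> m \<and> \<phi> - u ^ i < Z l \<omega>}) - real (block \<gamma> m) * \<sigma> (u ^ i)\<bar>}" for m i
  have I_sub: "I m \<subseteq> {..m * m}" for m by (auto simp: I_def)
  have finI: "finite (I m)" for m by (rule finite_subset[OF I_sub]) simp
  have Am [measurable]: "A m i \<in> sets M" for m i unfolding A_def by measurable
  have PA: "prob (A m i) \<le> 2 * exp (- ((real m * ln \<gamma>) powr \<delta> * \<eta>\<^sup>2 / 4))" if "i \<in> I m" for m i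
  proof -
    have "u ^ i \<le> u ^ i1" using that u by (intro power_decreasing) (auto simp: I_def)
    moreover have "u ^ i1 < d1" using i1 by (simp only: u_def)
    ultimately have "u ^ i < d1" by (rule le_less_trans)
    then have "prob (A m i) \<le> 2 * exp (- (real (block \<gamma> m) * \<sigma> (u ^ i) * \<eta>\<^sup>2 / 4))"
      unfolding A_def using \<eta> u by (intro count_above_level_deviation) auto
    also have "\<dots> \<le> 2 * exp (- ((real m * ln \<gamma>) powr \<delta> * \<eta>\<^sup>2 / 4))"
      using that \<eta> by (auto simp: I_def divide_right_mono mult_right_mono)
    finally show ?thesis .
  qed
  define h where "h m = (real (m * m) + 1) * (2 * exp (- ((real m * ln \<gamma>) powr \<delta> * \<eta>\<^sup>2 / 4)))" for m
  have PU: "prob (\<Union>i\<in>I m. A m i) \<le> h m" for m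
  proof -
    have "prob (\<Union>i\<in>I m. A m i) \<le> (\<Sum>i\<in>I m. prob (A m i))"
      by (rule finite_measure_subadditive_finite[OF finI]) auto
    also have "\<dots> \<le> (\<Sum>i\<in>I m. 2 * exp (- ((real m * ln \<gamma>) powr \<delta> * \<eta>\<^sup>2 / 4)))"
      by (intro sum_mono PA)
    also have "\<dots> = real (card (I m)) * (2 * exp (- ((real m * ln \<gamma>) powr \<delta> * \<eta>\<^sup>2 / 4)))" by simp
    also have "\<dots> \<le> h m"
    proof -
      have "card (I m) \<le> m * m + 1" using card_mono[OF _ I_sub, of m] by simp
      then have "real (card (I m)) \<le> real (m * m) + 1" by linarith
      then show ?thesis unfolding h_def by (intro mult_right_mono) auto
    qed
    finally show ?thesis .
  qed
  have "summable h"
  proof (rule summable_comparison_test_bigo[of "\<lambda>m. 1 / real m ^ 2"])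
    show "summable (\<lambda>m. norm (1 / real m ^ 2))"
      using inverse_power_summable[of 2, where 'a=real] by (simp add: inverse_eq_divide)
    have "0 < ln \<gamma>" "0 < \<eta>\<^sup>2" using \<gamma> \<eta> by auto
    then show "h \<in> O(\<lambda>m. 1 / real m ^ 2)" unfolding h_def using \<delta> by real_asymp
  qed
  then have "summable (\<lambda>m. prob (\<Union>i\<in>I m. A m i))"
    by (rule summable_comparison_test'[where N=0]) (use PU in auto)
  moreover have "(\<Union>i\<in>I m. A m i) \<in> sets M" for m
    by (rule sets.finite_UN[OF finI]) simp
  ultimately have "AE \<omega> in M. eventually (\<lambda>m. \<omega> \<in> space M - (\<Union>i\<in>I m. A m i)) sequentially"
    by (intro borel_cantelli_AE1) (auto simp: emeasure_eq_measure)
  then show ?thesis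
  proof eventually_elim
    case (elim \<omega>)
    then show ?case
      by eventually_elim (auto simp: A_def I_def u_def)
  qed
qed

lemma (in tail_sample) rho_os_converges_AE:
  fixes k :: "nat \<Rightarrow> nat"
  assumes k: "\<And>n. 2 \<le> n \<Longrightarrow> 0 < k n \<and> k n < n"
    and kn: "(\<lambda>n. real (k n) / real n) \<longlonglongrightarrow> 0" and \<delta>0: "0 < \<delta>0"
    and big: "filterlim (\<lambda>n. real (k n) / (ln (real n)) powr \<delta>0) at_top sequentially"
  shows "AE \<omega> in M. (\<lambda>n. rho_os (\<lambda>l. Z l \<omega>) n (k n)) \<longlonglongrightarrow> \<rho>"
proof -
  \<comment> \<open>The constants of \<open>grid_sandwich\<close> tend to 1 as \<gamma> -> 1 and
    \<eta> -> 0. Taking sequences keeps the number of exceptional null sets countable.\<close>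
  define \<gamma> where "\<gamma> j = 1 + 1 / real (Suc j)" for j
  have \<gamma>: "1 < \<gamma> j" for j by (simp add: \<gamma>_def)
  define \<eta> where "\<eta> j = 1 / real (Suc j)" for j
  have \<eta>: "0 < \<eta> j" "\<eta> j \<le> 1" for j by (auto simp: \<eta>_def)
  have "\<exists>i. (1 / \<gamma> j) ^ i < d1" for j
    using \<gamma>[of j] by (intro real_arch_pow_inv d1) auto
  then obtain i1 where i1: "\<And>j. (1 / \<gamma> j) ^ i1 j < d1" by metis
  define \<kappa> where "\<kappa> n = (if 2 \<le> n then real (k n) / real n else 1)" for n
  have \<kappa>_ev: "eventually (\<lambda>n. real (k n) / real n = \<kappa> n) sequentially"
    using eventually_ge_at_top[of 2] by eventually_elim (simp add: \<kappa>_def)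
  have \<kappa>_pos: "0 < \<kappa> n" for n using k[of n] by (simp add: \<kappa>_def)
  obtain \<delta> where \<delta>: "\<delta> \<longlonglongrightarrow> 0" "\<And>n. 0 < \<delta> n"
    "\<And>r. 0 < r \<Longrightarrow> (\<lambda>n. \<sigma> (r * \<delta> n) / \<kappa> n) \<longlonglongrightarrow> r powr \<rho>"
    by (rule exists_levels[OF Lim_transform_eventually[OF kn \<kappa>_ev] \<kappa>_pos]) (rule that)
  have "AE \<omega> in M. \<forall>j. eventually (\<lambda>m. \<forall>i. i1 j \<le> i \<and> i \<le> m * m \<and>
        (real m * ln (\<gamma> j)) powr \<delta>0 \<le> real (block (\<gamma> j) m) * \<sigma> ((1 / \<gamma> j) ^ i) \<longrightarrow>
        \<bar>real (card {l. l < block (\<gamma> j) m \<and> \<phi> - (1 / \<gamma> j) ^ i < Z l \<omega>}) - real (block (\<gamma> j) m) * \<sigma> ((1 / \<gamma> j) ^ i)\<bar>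
          \<le> \<eta> j * (real (block (\<gamma> j) m) * \<sigma> ((1 / \<gamma> j) ^ i))) sequentially"
    unfolding AE_all_countable by (intro allI AE_grid \<gamma> \<eta> \<delta>0 i1)
  then show ?thesis using AE_Z_le
  proof eventually_elim
    case (elim \<omega>)
    let ?K = "\<lambda>n d. real (card {l. l < n \<and> \<phi> - d < Z l \<omega>})"
    have lim: "(\<lambda>n. ?K n (r * \<delta> n) / real (k n)) \<longlonglongrightarrow> r powr \<rho>" if r: "0 < r" for r
    proof -
      let ?a = "\<lambda>n. real n * \<sigma> (r * \<delta> n)"
      have rd: "(\<lambda>n. r * \<delta> n) \<longlonglongrightarrow> 0" using tendsto_mult_right_zero[OF \<delta>(1)] by simp
      have ak: "eventually (\<lambda>n. \<sigma> (r * \<delta> n) / \<kappa> n = ?a n / real (k n)) sequentially"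
        using eventually_ge_at_top[of 2] by eventually_elim (simp add: \<kappa>_def)
      have ak_lim: "(\<lambda>n. ?a n / real (k n)) \<longlonglongrightarrow> r powr \<rho>"
        by (rule Lim_transform_eventually[OF \<delta>(3)[OF r] ak])
      have a_big: "filterlim (\<lambda>n. ?a n / (ln (real n)) powr \<delta>0) at_top sequentially"
      proof -
        have "filterlim (\<lambda>n. ?a n / real (k n) * (real (k n) / (ln (real n)) powr \<delta>0)) at_top sequentially"
          using r by (intro filterlim_tendsto_pos_mult_at_top[OF ak_lim _ big]) auto
        moreover have "eventually (\<lambda>n. ?a n / real (k n) * (real (k n) / (ln (real n)) powr \<delta>0) = ?a n / (ln (real n)) powr \<delta>0) sequentially"
          using eventually_ge_at_top[of 2] by eventually_elim (use k in auto)
        ultimately show ?thesis by (rule filterlim_mono_eventually[OF _ order_refl order_refl])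
      qed
      have mono: "?K n d \<le> ?K n' d'" if "n \<le> n'" "d \<le> d'" for n n' d d'
        using that by (intro of_nat_mono card_mono) auto
      have sand: "eventually (\<lambda>n. (1 - \<eta> j) / \<gamma> j powr (\<rho> + 3) * ?a n \<le> ?K n (r * \<delta> n)) sequentially"
        "eventually (\<lambda>n. ?K n (r * \<delta> n) \<le> (1 + \<eta> j) * \<gamma> j powr (\<rho> + 3) * ?a n) sequentially" for j
      proof -
        have *: "0 < r * \<delta> n" for n using r \<delta>(2)[of n] by simp
        have g: "eventually (\<lambda>n. (1 - \<eta> j) / \<gamma> j powr (\<rho> + 3) * ?a n \<le> ?K n (r * \<delta> n) \<or> 1 < \<eta> j) sequentially"
          by (rule grid_sandwich(1)[of ?K "\<gamma> j" "\<eta> j" \<delta>0 "i1 j" "\<lambda>n. r * \<delta> n",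
              OF _ \<gamma> \<eta>(1) \<delta>0 spec[OF elim(1), of j] rd * a_big]) (rule mono)
        show "eventually (\<lambda>n. ?K n (r * \<delta> n) \<le> (1 + \<eta> j) * \<gamma> j powr (\<rho> + 3) * ?a n) sequentially"
          by (rule grid_sandwich(2)[of ?K "\<gamma> j" "\<eta> j" \<delta>0 "i1 j" "\<lambda>n. r * \<delta> n",
              OF _ \<gamma> \<eta>(1) \<delta>0 spec[OF elim(1), of j] rd * a_big]) (rule mono)
        from g show "eventually (\<lambda>n. (1 - \<eta> j) / \<gamma> j powr (\<rho> + 3) * ?a n \<le> ?K n (r * \<delta> n)) sequentially"
          by eventually_elim (use \<eta>(2)[of j] in auto)
      qed
      have cj: "(\<lambda>j. (1 - \<eta> j) / \<gamma> j powr (\<rho> + 3) * (r powr \<rho>)) \<longlonglongrightarrow> r powr \<rho>"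
        "(\<lambda>j. (1 + \<eta> j) * \<gamma> j powr (\<rho> + 3) * (r powr \<rho>)) \<longlonglongrightarrow> r powr \<rho>"
      proof -
        have l: "\<gamma> \<longlonglongrightarrow> 1" unfolding \<gamma>_def by real_asymp
        have e: "\<eta> \<longlonglongrightarrow> 0" unfolding \<eta>_def by real_asymp
        have "(\<lambda>j. (1 - \<eta> j) / \<gamma> j powr (\<rho> + 3) * (r powr \<rho>)) \<longlonglongrightarrow> (1 - 0) / 1 powr (\<rho> + 3) * r powr \<rho>"
          by (intro tendsto_intros l e) auto
        then show "(\<lambda>j. (1 - \<eta> j) / \<gamma> j powr (\<rho> + 3) * (r powr \<rho>)) \<longlonglongrightarrow> r powr \<rho>" by simp
        have "(\<lambda>j. (1 + \<eta> j) * \<gamma> j powr (\<rho> + 3) * (r powr \<rho>)) \<longlonglongrightarrow> (1 + 0) * 1 powr (\<rho> + 3) * r powr \<rho>"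
          by (intro tendsto_intros l e) auto
        then show "(\<lambda>j. (1 + \<eta> j) * \<gamma> j powr (\<rho> + 3) * (r powr \<rho>)) \<longlonglongrightarrow> r powr \<rho>" by simp
      qed
      show ?thesis
      proof (rule order_tendstoI)
        fix b assume "b < r powr \<rho>"
        from order_tendstoD(1)[OF cj(1) this] obtain j where j: "b < (1 - \<eta> j) / \<gamma> j powr (\<rho> + 3) * (r powr \<rho>)"
          unfolding eventually_sequentially by auto
        have "(\<lambda>n. (1 - \<eta> j) / \<gamma> j powr (\<rho> + 3) * (?a n / real (k n))) \<longlonglongrightarrow> (1 - \<eta> j) / \<gamma> j powr (\<rho> + 3) * (r powr \<rho>)"
          by (intro tendsto_intros ak_lim)
        from order_tendstoD(1)[OF this j] sand(1)[of j] eventually_ge_at_top[of 2]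
        show "eventually (\<lambda>n. b < ?K n (r * \<delta> n) / real (k n)) sequentially"
        proof eventually_elim
          case (elim n)
          note elim(1)
          also have "(1 - \<eta> j) / \<gamma> j powr (\<rho> + 3) * (?a n / real (k n)) = ((1 - \<eta> j) / \<gamma> j powr (\<rho> + 3) * ?a n) / real (k n)"
            by simp
          also have "\<dots> \<le> ?K n (r * \<delta> n) / real (k n)"
            using elim(2) by (rule divide_right_mono) simp
          finally show ?case .
        qed
      next
        fix b assume "r powr \<rho> < b"
        from order_tendstoD(2)[OF cj(2) this] obtain j where j: "(1 + \<eta> j) * \<gamma> j powr (\<rho> + 3) * (r powr \<rho>) < b"
          unfolding eventually_sequentially by auto
        have "(\<lambda>n. (1 + \<eta> j) * \<gamma> j powr (\<rho> + 3) * (?a n / real (k n))) \<longlonglongrightarrow> (1 + \<eta> j) * \<gamma> j powr (\<rho> + 3) * (r powr \<rho>)"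
          by (intro tendsto_intros ak_lim)
        from order_tendstoD(2)[OF this j] sand(2)[of j]
        show "eventually (\<lambda>n. ?K n (r * \<delta> n) / real (k n) < b) sequentially"
        proof eventually_elim
          case (elim n)
          have "?K n (r * \<delta> n) / real (k n) \<le> ((1 + \<eta> j) * \<gamma> j powr (\<rho> + 3) * ?a n) / real (k n)"
            using elim(2) by (rule divide_right_mono) simp
          also have "\<dots> = (1 + \<eta> j) * \<gamma> j powr (\<rho> + 3) * (?a n / real (k n))" by simp
          also note elim(1)
          finally show ?case .
        qed
      qed
    qed
    have "(\<lambda>m. rho_os (\<lambda>l. Z l \<omega>) (m + 2) (k (m + 2))) \<longlonglongrightarrow> \<rho>"
    proof (rule rho_os_tendsto[OF \<phi> \<rho>, where \<delta>="\<lambda>m. \<delta> (m + 2)" and k="\<lambda>m. k (m + 2)" and n="\<lambda>m. m + 2" and z="\<lambda>m l. Z l \<omega>"])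
      show "(\<lambda>m. \<delta> (m + 2)) \<longlonglongrightarrow> 0" by (rule LIMSEQ_ignore_initial_segment[OF \<delta>(1)])
      show "0 < \<delta> (m + 2)" for m by (rule \<delta>)
      show "0 < k (m + 2)" "k (m + 2) < m + 2" for m using k[of "m + 2"] by auto
      show "Z l \<omega> \<le> \<phi>" for l using elim by simp
      show "(\<lambda>m. ?K (m + 2) (r * \<delta> (m + 2)) / real (k (m + 2))) \<longlonglongrightarrow> r powr \<rho>" if "0 < r" for r
        by (rule LIMSEQ_ignore_initial_segment[OF lim[OF that]])
    qed
    then show ?case by (rule LIMSEQ_offset)
  qed
qed

section \<open>The class $\Pi$\<close>

text \<open>Continuity from below: the sets of points that are good from index n on increase to the
  whole interval, of length 3.\<close>

lemma measure_eventually_large: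
  fixes P :: "nat \<Rightarrow> real \<Rightarrow> bool"
  assumes meas: "\<And>m. {v. P m v} \<in> sets borel"
    and ev: "\<And>v. v \<in> {0..3} \<Longrightarrow> eventually (\<lambda>m. P m v) sequentially"
  shows "eventually (\<lambda>n. 2 < measure lborel {v \<in> {0..3}. \<forall>m\<ge>n. P m v}) sequentially"
proof -
  define S where "S n = {v \<in> {0..3}. \<forall>m\<ge>n. P m v}" for n
  have Sm: "S n \<in> sets lborel" for n
  proof -
    have "S n = {0..3} \<inter> (\<Inter>m\<in>{n..}. {v. P m v})" by (auto simp: S_def)
    also have "\<dots> \<in> sets lborel" using meas by (intro sets.Int sets.countable_INT') auto
    finally show ?thesis .
  qed
  have U: "(\<Union>n. S n) = {0..3}"
    using ev unfolding S_def eventually_sequentially by blast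
  have "(\<lambda>n. emeasure lborel (S n)) \<longlonglongrightarrow> emeasure lborel (\<Union>n. S n)"
  proof (rule Lim_emeasure_incseq)
    show "range S \<subseteq> sets lborel" using Sm by blast
    show "incseq S" unfolding incseq_def S_def by (blast intro: order_trans)
  qed
  then have "(\<lambda>n. emeasure lborel (S n)) \<longlonglongrightarrow> ennreal 3" unfolding U by simp
  then have "(\<lambda>n. measure lborel (S n)) \<longlonglongrightarrow> 3"
    unfolding measure_def by (intro tendsto_enn2real) auto
  then show ?thesis unfolding S_def by (rule order_tendstoD(1)) simp
qed

text \<open>\<open>V\<close> and the translate of \<open>W\<close> by \<open>u\<close> both lie in
  an interval of length 4 and have total measure above 4, so they cannot be disjoint.\<close>

lemma measure_translated_meets:
  fixes u :: real
  assumes "V \<in> sets borel" "W \<in> sets borel" "V \<subseteq> {0..3}" "W \<subseteq> {0..3}" "0 \<le> u" "u \<le> 1"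
    and "2 < measure lborel V" "2 < measure lborel W"
  shows "\<exists>w\<in>W. u + w \<in> V"
proof (rule ccontr)
  assume no: "\<not> (\<exists>w\<in>W. u + w \<in> V)"
  let ?T = "(\<lambda>v. - u + v) -` W"
  have Tm: "?T \<in> sets borel" using measurable_sets[of "\<lambda>v. - u + v" borel borel W] assms(2) by simp
  have "emeasure lborel W = emeasure (distr lborel borel ((+) (- u))) W"
    by (simp add: lborel_distr_plus)
  also have "\<dots> = emeasure lborel ?T" using assms(2) by (subst emeasure_distr) auto
  finally have T: "measure lborel ?T = measure lborel W" by (simp add: measure_def)
  have sub: "V \<union> ?T \<subseteq> {0..4}" using assms(3-6) by force
  have disj: "V \<inter> ?T = {}" using no by force
  have fin: "emeasure lborel X \<noteq> \<infinity>" if "X \<subseteq> {0..4}" "X \<in> sets borel" for X :: "real set"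
    using emeasure_mono[OF that(1), of lborel] by (auto simp: top_unique)
  have "measure lborel V + measure lborel ?T = measure lborel (V \<union> ?T)"
    using sub Tm assms(1) fin by (intro measure_Union[symmetric] disj) auto
  also have "\<dots> \<le> measure lborel {0..4::real}"
    using Tm assms(1) by (intro measure_mono_fmeasurable sub) (auto simp: fmeasurable_def)
  finally show False using assms(7,8) T by simp
qed

text \<open>The argument behind the uniform convergence theorem: two large sets of
  good translations, seen from \<open>x\<close> and from \<open>x + u\<close>, must meet.\<close>

lemma pi_local_bounds:
  fixes h b :: "real \<Rightarrow> real"
  assumes h [measurable]: "h \<in> borel_measurable borel" and b: "\<And>x. 0 < b x"
    and lim: "\<And>u. ((\<lambda>x. (h (x + u) - h x) / b x) \<longlongrightarrow> u) at_top"
  shows "\<exists>X C. 0 < C \<and> (\<forall>x\<ge>X. \<forall>u\<in>{0..1}. \<bar>h (x + u) - h x\<bar> \<le> C * b x \<and> b (x + u) \<le> C * b x \<and> b x \<le> C * b (x + u))"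
proof (rule ccontr)
  assume neg: "\<not> ?thesis"
  \<comment> \<open>The constant 20 is 4 * 4 + 4: the contradiction below bounds the oscillation by
    4 b(y) + 4 b(x), where b(y) \<le> 4 b(x).\<close>
  have "\<exists>x u. x \<ge> real m \<and> 0 \<le> u \<and> u \<le> 1 \<and>
    \<not> (\<bar>h (x + u) - h x\<bar> \<le> 20 * b x \<and> b (x + u) \<le> 20 * b x \<and> b x \<le> 20 * b (x + u))" for m
  proof -
    have "\<not> (\<forall>x\<ge>real m. \<forall>u\<in>{0..1}. \<bar>h (x + u) - h x\<bar> \<le> 20 * b x \<and> b (x + u) \<le> 20 * b x \<and> b x \<le> 20 * b (x + u))"
    proof (rule notI, rule notE[OF neg], rule exI[of _ "real m"], rule exI[of _ 20], rule conjI)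
    qed auto
    then show ?thesis by (meson atLeastAtMost_iff)
  qed
  then obtain x u where x: "\<And>m. x m \<ge> real m" and u: "\<And>m. 0 \<le> u m" "\<And>m. u m \<le> 1"
    and bad: "\<And>m. \<not> (\<bar>h (x m + u m) - h (x m)\<bar> \<le> 20 * b (x m) \<and> b (x m + u m) \<le> 20 * b (x m) \<and> b (x m) \<le> 20 * b (x m + u m))"
    by metis
  \<comment> \<open>A good translation v shows \<open>b y\<close> through the increment of
    \<open>h\<close> over [y + v, y + v + 1]. Two points having a common increment can thus compare
    their values of \<open>b\<close>, with no regularity of \<open>b\<close> itself.\<close>
  define P where "P y v \<longleftrightarrow> \<bar>h (y + v) - h y\<bar> \<le> 4 * b y \<and>
     b y / 2 \<le> h (y + v + 1) - h (y + v) \<and> h (y + v + 1) - h (y + v) \<le> 2 * b y" for y v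
  have Pm: "{v. P y v} \<in> sets borel" for y
    unfolding P_def by measurable
  have Pev: "eventually (\<lambda>y. P y v) at_top" if v: "v \<in> {0..3}" for v
  proof -
    have d: "((\<lambda>y. (h (y + (v + 1)) - h y) / b y - (h (y + v) - h y) / b y) \<longlongrightarrow> (v + 1) - v) at_top"
      by (intro tendsto_diff lim)
    then have d: "((\<lambda>y. (h (y + v + 1) - h (y + v)) / b y) \<longlongrightarrow> 1) at_top"
      by (simp add: diff_divide_distrib add.assoc)
    have "eventually (\<lambda>y. \<bar>(h (y + v) - h y) / b y - v\<bar> < 1) at_top"
      using tendstoD[OF lim[of v], of 1] by (simp add: dist_real_def)
    moreover have "eventually (\<lambda>y. 1/2 < (h (y + v + 1) - h (y + v)) / b y) at_top"
      by (rule order_tendstoD(1)[OF d]) simp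
    moreover have "eventually (\<lambda>y. (h (y + v + 1) - h (y + v)) / b y < 2) at_top"
      by (rule order_tendstoD(2)[OF d]) simp
    ultimately show ?thesis
    proof eventually_elim
      case (elim y)
      have "\<bar>(h (y + v) - h y) / b y\<bar> \<le> 4" using elim(1) v by auto
      then show ?case using elim(2,3) b[of y] unfolding P_def
        by (simp add: field_simps abs_le_iff)
    qed
  qed
  have x_top: "filterlim x at_top sequentially"
    by (rule filterlim_at_top_mono[OF filterlim_real_sequentially]) (use x in auto)
  have y_top: "filterlim (\<lambda>m. x m + u m) at_top sequentially"
    by (rule filterlim_at_top_mono[OF x_top]) (use u in auto)
  have 1: "eventually (\<lambda>n. 2 < measure lborel {v \<in> {0..3}. \<forall>m\<ge>n. P (x m) v}) sequentially"
    using eventually_compose_filterlim[OF Pev x_top] Pm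
    by (intro measure_eventually_large) auto
  have 2: "eventually (\<lambda>n. 2 < measure lborel {v \<in> {0..3}. \<forall>m\<ge>n. P (x m + u m) v}) sequentially"
    using eventually_compose_filterlim[OF Pev y_top] Pm
    by (intro measure_eventually_large) auto
  from eventually_conj[OF 1 2] obtain n where
    n: "2 < measure lborel {v \<in> {0..3}. \<forall>m\<ge>n. P (x m) v}"
       "2 < measure lborel {v \<in> {0..3}. \<forall>m\<ge>n. P (x m + u m) v}"
    unfolding eventually_sequentially by auto
  have meas: "{v \<in> {0..3}. \<forall>m\<ge>n. P (y m) v} \<in> sets borel" for y
  proof -
    have "{v \<in> {0..3}. \<forall>m\<ge>n. P (y m) v} = {0..3} \<inter> (\<Inter>m\<in>{n..}. {v. P (y m) v})" by auto
    also have "\<dots> \<in> sets borel" using Pm by (intro sets.Int sets.countable_INT') auto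
    finally show ?thesis .
  qed
  \<comment> \<open>\<open>?x + (u n + w)\<close> and \<open>?y + w\<close> are the same point, good
    as seen from both ends.\<close>
  obtain w where w: "w \<in> {v \<in> {0..3}. \<forall>m\<ge>n. P (x m + u m) v}" "u n + w \<in> {v \<in> {0..3}. \<forall>m\<ge>n. P (x m) v}"
    using measure_translated_meets[OF meas meas _ _ u(1)[of n] u(2)[of n] n] by blast
  have Px: "P (x n) (u n + w)" and Py: "P (x n + u n) w" using w by auto
  let ?x = "x n" and ?y = "x n + u n"
  have eq: "?x + (u n + w) = ?y + w" by simp
  have byx: "b ?y \<le> 4 * b ?x" and bx: "b ?x \<le> 4 * b ?y"
    using Px Py unfolding P_def eq by auto
  have "\<bar>h ?y - h ?x\<bar> \<le> 4 * b ?y + 4 * b ?x"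
    using Px Py unfolding P_def eq by linarith
  with byx bx bad[of n] b[of ?x] b[of ?y] show False by linarith
qed

text \<open>Each full unit step gains the factor \<open>r\<close>; the last fraction of a step costs
  the factor \<open>C\<close>.\<close>

lemma geometric_decay:
  fixes L :: "real \<Rightarrow> real"
  assumes r: "0 < r" "r \<le> 1" and C: "0 < C" and L: "\<And>x. x \<ge> X \<Longrightarrow> 0 \<le> L x"
    and step: "\<And>x. x \<ge> X \<Longrightarrow> L (x + 1) \<le> r * L x"
    and loc: "\<And>x u. x \<ge> X \<Longrightarrow> 0 \<le> u \<Longrightarrow> u \<le> 1 \<Longrightarrow> L (x + u) \<le> C * L x"
    and x: "x \<ge> X" and y: "y \<ge> x + real m"
  shows "L y \<le> C * r ^ m * L x"
proof -
  have it: "L (x + real i) \<le> r ^ i * L x" for i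
  proof (induction i)
    case (Suc i)
    have "L (x + real (Suc i)) = L (x + real i + 1)" by (simp add: add_ac)
    also have "\<dots> \<le> r * L (x + real i)" using x by (intro step) auto
    also have "\<dots> \<le> r * (r ^ i * L x)" using Suc r by (intro mult_left_mono) auto
    finally show ?case by (simp add: mult_ac)
  qed simp
  define i where "i = nat \<lfloor>y - x\<rfloor>"
  have yx: "0 \<le> y - x" using y by simp
  have i: "real i \<le> y - x" "y - x < real i + 1" using yx by (auto simp: i_def)
  have mi: "m \<le> i" unfolding i_def using y by (simp add: le_nat_iff le_floor_iff)
  have "L y = L (x + real i + (y - x - real i))" by simp
  also have "\<dots> \<le> C * L (x + real i)" using i x by (intro loc) auto
  also have "\<dots> \<le> C * (r ^ i * L x)" using it C by (intro mult_left_mono) auto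
  also have "\<dots> \<le> C * (r ^ m * L x)"
    using mi r C L[OF x] by (intro mult_left_mono mult_right_mono power_decreasing) auto
  finally show ?thesis by (simp add: mult_ac)
qed

section \<open>Second-order bounds in logarithmic time\<close>

locale pi_varying =
  fixes V B :: "real \<Rightarrow> real" and a s :: real
  assumes a: "0 < a" and s: "s = 1 \<or> s = -1"
    and V_antimono: "\<And>t t'. 0 < t \<Longrightarrow> t \<le> t' \<Longrightarrow> V t' \<le> V t"
    and V_nonneg: "\<And>t. 0 < t \<Longrightarrow> 0 \<le> V t"
    and B_pos: "\<And>t. 0 < t \<Longrightarrow> 0 < B t"
    and pi_lim: "\<And>z. 0 < z \<Longrightarrow>
      ((\<lambda>t. (s * ((t * z) powr a * V (t * z)) - s * (t powr a * V t)) / B t) \<longlongrightarrow> ln z) at_top"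
begin

text \<open>With t = exp x multiplicative shifts become translations. In the application V t =
  \<phi> - U t and a = 1 / \<rho>, and \<open>h\<close> carries the sign, so that its increments
  divided by \<open>b\<close> tend to the length of the shift in both cases.\<close>

definition g where "g x = exp (a * x) * V (exp x)"
definition b where "b x = B (exp x)"
definition h where "h x = s * g x"

lemma b_pos: "0 < b x" by (simp add: b_def B_pos)
lemma g_nonneg: "0 \<le> g x" by (simp add: g_def V_nonneg)
lemma g_eq: "g x = s * h x" using s by (auto simp: h_def)

lemma h_measurable [measurable]: "h \<in> borel_measurable borel"
proof -
  have "mono (\<lambda>x. - V (exp x))" by (auto simp: mono_def intro!: V_antimono)
  then have [measurable]: "(\<lambda>x. - V (exp x)) \<in> borel_measurable borel" by (rule borel_measurable_mono)
  have "h = (\<lambda>x. - s * (exp (a * x) * (- V (exp x))))" by (auto simp: h_def g_def)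
  moreover have "(\<lambda>x. - s * (exp (a * x) * (- V (exp x)))) \<in> borel_measurable borel" by measurable
  ultimately show ?thesis by (simp only:)
qed

lemma h_lim: "((\<lambda>x. (h (x + u) - h x) / b x) \<longlongrightarrow> u) at_top"
proof -
  have "((\<lambda>x. (s * ((exp x * exp u) powr a * V (exp x * exp u)) - s * (exp x powr a * V (exp x))) / B (exp x)) \<longlongrightarrow> ln (exp u)) at_top"
    by (rule filterlim_compose[OF pi_lim exp_at_top]) simp
  then show ?thesis
    by (simp add: h_def g_def b_def powr_def exp_add[symmetric] distrib_left)
qed

text \<open>A shift by \<open>- s * (\<bar>Z\<bar> + 1)\<close> lowers \<open>g\<close> by nearly
  \<bar>Z\<bar> + 1 times \<open>b x\<close>. As \<open>g\<close> remains nonnegative, it must have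
  been that large before.\<close>

lemma g_over_b: "filterlim (\<lambda>x. g x / b x) at_top at_top"
  unfolding filterlim_at_top
proof
  fix Z :: real
  have "((\<lambda>x. s * ((h (x + - s * (\<bar>Z\<bar> + 1)) - h x) / b x)) \<longlongrightarrow> s * (- s * (\<bar>Z\<bar> + 1))) at_top"
    by (intro tendsto_mult_left h_lim)
  moreover have "s * (- s * (\<bar>Z\<bar> + 1)) < - Z" using s by auto
  ultimately have "eventually (\<lambda>x. s * ((h (x + - s * (\<bar>Z\<bar> + 1)) - h x) / b x) < - Z) at_top"
    by (rule order_tendstoD(2))
  then show "eventually (\<lambda>x. Z \<le> g x / b x) at_top"
  proof eventually_elim
    case (elim x)
    let ?y = "x + - s * (\<bar>Z\<bar> + 1)"
    have "s * ((h ?y - h x) / b x) = g ?y / b x - g x / b x"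
      by (simp add: g_eq diff_divide_distrib right_diff_distrib)
    moreover have "0 \<le> g ?y / b x" using g_nonneg b_pos[of x] by (simp add: less_imp_le)
    ultimately show ?case using elim by linarith
  qed
qed

text \<open>The increment of \<open>h\<close> over [x + 1, x + 2] is asymptotic to
  \<open>b x\<close> and, by the limit taken at x + 1, also to \<open>b (x + 1)\<close>.\<close>

lemma b_ratio: "((\<lambda>x. b (x + 1) / b x) \<longlongrightarrow> 1) at_top"
proof -
  have "((\<lambda>x. (h (x + 2) - h x) / b x - (h (x + 1) - h x) / b x) \<longlongrightarrow> 2 - 1) at_top"
    by (intro tendsto_diff h_lim)
  then have 1: "((\<lambda>x. (h (x + 2) - h (x + 1)) / b x) \<longlongrightarrow> 1) at_top" by (simp add: diff_divide_distrib)
  have "filterlim (\<lambda>x::real. x + 1) at_top at_top" by real_asymp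
  from filterlim_compose[OF h_lim[of 1] this]
  have 2: "((\<lambda>x. (h (x + 2) - h (x + 1)) / b (x + 1)) \<longlongrightarrow> 1) at_top" by (simp add: add.assoc)
  have "((\<lambda>x. ((h (x + 2) - h (x + 1)) / b x) / ((h (x + 2) - h (x + 1)) / b (x + 1))) \<longlongrightarrow> 1 / 1) at_top"
    by (intro tendsto_divide 1 2) simp
  moreover have "eventually (\<lambda>x. 0 < (h (x + 2) - h (x + 1)) / b x) at_top"
    by (rule order_tendstoD(1)[OF 1]) simp
  then have "eventually (\<lambda>x. ((h (x + 2) - h (x + 1)) / b x) / ((h (x + 2) - h (x + 1)) / b (x + 1)) = b (x + 1) / b x) at_top"
  proof eventually_elim
    case (elim x)
    then have "h (x + 2) - h (x + 1) \<noteq> 0" by auto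
    then show ?case using b_pos[of x] b_pos[of "x + 1"] by simp
  qed
  ultimately show ?thesis by (auto intro: Lim_transform_eventually)
qed

definition Ax where "Ax x = b x / g x"

lemma Ax_lim: "(Ax \<longlongrightarrow> 0) at_top"
proof -
  have "((\<lambda>x. inverse (g x / b x)) \<longlongrightarrow> 0) at_top"
    by (rule tendsto_inverse_0_at_top[OF g_over_b])
  then show ?thesis by (simp add: Ax_def[abs_def])
qed

lemma g_pos: "eventually (\<lambda>x. 0 < g x) at_top"
proof -
  have "eventually (\<lambda>x. 1 \<le> g x / b x) at_top" using g_over_b by (simp add: filterlim_at_top)
  then show ?thesis
  proof eventually_elim
    case (elim x)
    then show ?case using b_pos[of x] by (auto simp: field_simps)
  qed
qed

lemma g_ratio: "((\<lambda>x. g (x + 1) / g x) \<longlongrightarrow> 1) at_top"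
proof -
  have "((\<lambda>x. 1 + s * ((h (x + 1) - h x) / b x) * Ax x) \<longlongrightarrow> 1 + s * 1 * 0) at_top"
    by (intro tendsto_intros h_lim Ax_lim)
  moreover have "eventually (\<lambda>x. 1 + s * ((h (x + 1) - h x) / b x) * Ax x = g (x + 1) / g x) at_top"
    using g_pos
  proof eventually_elim
    case (elim x)
    have "s * s = 1" using s by auto
    then have "s * ((h (x + 1) - h x) / b x) = (g (x + 1) - g x) / b x"
      by (simp add: h_def right_diff_distrib mult.assoc[symmetric])
    then have "1 + s * ((h (x + 1) - h x) / b x) * Ax x = 1 + (g (x + 1) - g x) / b x * (b x / g x)"
      by (simp only: Ax_def)
    also have "\<dots> = 1 + (g (x + 1) - g x) / g x" using b_pos[of x] by simp
    also have "\<dots> = g (x + 1) / g x" using elim by (simp add: diff_divide_distrib)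
    finally show ?case .
  qed
  ultimately show ?thesis by (auto intro: Lim_transform_eventually)
qed

text \<open>In terms of \<open>t = exp x\<close>: \<open>J\<close> is \<open>(At t)\<^sup>2 / t\<close> for the relative error \<open>At\<close> below, so that the function inverted in the
  growth condition on \<open>k\<close> is asymptotically \<open>1 / (\<phi>\<^sup>2 J)\<close>, and \<open>\<psi>\<close> is \<open>V t / At t\<close>.\<close>

definition J where "J x = (Ax x)\<^sup>2 * exp (- x)"
definition \<psi> where "\<psi> x = exp (- (a * x)) * (g x)\<^sup>2 / b x"

text \<open>The ratios of \<open>b\<close> and of \<open>g\<close> over a unit step tend to 1, so
  that of \<open>J\<close> tends to exp (-1), which is below 1/2.\<close>

lemma J_halves: "eventually (\<lambda>x. J (x + 1) \<le> 1/2 * J x) at_top"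
proof -
  have "((\<lambda>x. ((b (x + 1) / b x) / (g (x + 1) / g x))\<^sup>2 * exp (- 1)) \<longlongrightarrow> (1 / 1)\<^sup>2 * exp (- 1)) at_top"
    by (intro tendsto_intros b_ratio g_ratio) simp
  moreover have "(1 / 1)\<^sup>2 * exp (- 1) < (1/2 :: real)"
  proof -
    have "(1 + 1/2)\<^sup>2 \<le> (exp (1/2 :: real))\<^sup>2" by (intro power_mono exp_ge_add_one_self) auto
    also have "\<dots> = exp 1" by (simp add: exp_double[symmetric])
    finally have "2 < exp (1::real)" by (simp add: power2_eq_square)
    then show ?thesis by (simp add: exp_minus field_simps)
  qed
  ultimately have "eventually (\<lambda>x. ((b (x + 1) / b x) / (g (x + 1) / g x))\<^sup>2 * exp (- 1) < 1/2) at_top"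
    by (rule order_tendstoD(2))
  moreover have "filterlim (\<lambda>x::real. x + 1) at_top at_top" by real_asymp
  note eventually_compose_filterlim[OF g_pos this]
  ultimately show ?thesis using g_pos
  proof eventually_elim
    case (elim x)
    have "J (x + 1) = ((b (x + 1) / b x) / (g (x + 1) / g x))\<^sup>2 * exp (- 1) * J x"
      using elim(2,3) b_pos[of x] by (simp add: J_def Ax_def power_divide exp_add[symmetric] exp_diff exp_minus field_simps)
    also have "\<dots> \<le> 1/2 * J x" using elim(1) by (intro mult_right_mono) (auto simp: J_def)
    finally show ?case .
  qed
qed

text \<open>The ratio over a unit step tends to exp (- a) < 1. Boundedness of \<open>\<psi>\<close>
  is what makes \<open>V t\<close> at most a multiple of \<open>At t\<close>.\<close>

lemma \<psi>_nonincreasing: "eventually (\<lambda>x. \<psi> (x + 1) \<le> 1 * \<psi> x) at_top"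
proof -
  have "((\<lambda>x. (g (x + 1) / g x)\<^sup>2 / (b (x + 1) / b x) * exp (- a)) \<longlongrightarrow> 1\<^sup>2 / 1 * exp (- a)) at_top"
    by (intro tendsto_intros b_ratio g_ratio) simp
  moreover have "1\<^sup>2 / 1 * exp (- a) < 1" using a by simp
  ultimately have "eventually (\<lambda>x. (g (x + 1) / g x)\<^sup>2 / (b (x + 1) / b x) * exp (- a) < 1) at_top"
    by (rule order_tendstoD(2))
  then show ?thesis using g_pos
  proof eventually_elim
    case (elim x)
    have "\<psi> (x + 1) = (g (x + 1) / g x)\<^sup>2 / (b (x + 1) / b x) * exp (- a) * \<psi> x"
      using elim(2) b_pos[of x] b_pos[of "x + 1"]
      by (simp add: \<psi>_def power_divide exp_add[symmetric] exp_diff exp_minus distrib_left field_simps)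
    also have "\<dots> \<le> 1 * \<psi> x" using elim(1) b_pos[of x] by (intro mult_right_mono) (auto simp: \<psi>_def)
    finally show ?case .
  qed
qed

text \<open>Increments over unit intervals are bounded by a geometric sequence with ratio
  \<open>q\<close>, which is summed. The bound is uniform over all shifts \<open>u\<close>, at the
  price of the factor \<open>q powr u\<close>.\<close>

lemma g_growth:
  assumes C: "0 < C" and q: "1 < q"
    and loc: "\<And>x u. x \<ge> X \<Longrightarrow> 0 \<le> u \<Longrightarrow> u \<le> 1 \<Longrightarrow> \<bar>h (x + u) - h x\<bar> \<le> C * b x"
    and step: "\<And>x. x \<ge> X \<Longrightarrow> b (x + 1) \<le> q * b x"
    and x: "x \<ge> X" and u: "0 \<le> u"
  shows "\<bar>h (x + u) - h x\<bar> \<le> C * (1 + 1 / (q - 1)) * b x * q powr u"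
proof -
  have bi: "b (x + real i) \<le> q ^ i * b x" for i
  proof (induction i)
    case (Suc i)
    have "b (x + real (Suc i)) = b (x + real i + 1)" by (simp add: add_ac)
    also have "\<dots> \<le> q * b (x + real i)" using x by (intro step) auto
    also have "\<dots> \<le> q * (q ^ i * b x)" using Suc q by (intro mult_left_mono) auto
    finally show ?case by (simp add: mult_ac)
  qed simp
  have hi: "\<bar>h (x + real i) - h x\<bar> \<le> C * b x * ((q ^ i - 1) / (q - 1))" for i
  proof (induction i)
    case (Suc i)
    have "\<bar>h (x + real i + 1) - h (x + real i)\<bar> \<le> C * b (x + real i)" using x by (intro loc) auto
    also have "\<dots> \<le> C * (q ^ i * b x)" using bi C by (intro mult_left_mono) auto
    finally have "\<bar>h (x + real (Suc i)) - h x\<bar> \<le> C * b x * q ^ i + C * b x * ((q ^ i - 1) / (q - 1))"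
      using Suc by (simp add: add_ac mult_ac)
    also have "\<dots> = C * b x * (q ^ i + (q ^ i - 1) / (q - 1))" by (simp add: distrib_left)
    also have "q ^ i + (q ^ i - 1) / (q - 1) = (q ^ Suc i - 1) / (q - 1)" using q by (simp add: field_simps)
    finally show ?case .
  qed simp
  define i where "i = nat \<lfloor>u\<rfloor>"
  have i: "real i \<le> u" "u < real i + 1" using u by (auto simp: i_def)
  have "\<bar>h (x + real i + (u - real i)) - h (x + real i)\<bar> \<le> C * b (x + real i)"
    using i x by (intro loc) auto
  also have "\<dots> \<le> C * (q ^ i * b x)" using bi C by (intro mult_left_mono) auto
  finally have "\<bar>h (x + u) - h x\<bar> \<le> C * b x * q ^ i + C * b x * ((q ^ i - 1) / (q - 1))"
    using hi[of i] by (simp add: mult_ac)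
  also have "\<dots> \<le> C * b x * q ^ i + C * b x * (q ^ i / (q - 1))"
    using C q b_pos[of x] by (intro add_left_mono mult_left_mono divide_right_mono) auto
  also have "\<dots> = C * (1 + 1 / (q - 1)) * b x * q ^ i" by (simp add: algebra_simps)
  also have "\<dots> \<le> C * (1 + 1 / (q - 1)) * b x * q powr u"
  proof -
    have "q ^ i = q powr real i" using q by (simp add: powr_realpow)
    also have "\<dots> \<le> q powr u" using i q by (intro powr_mono) auto
    finally show ?thesis using C q b_pos[of x] by (intro mult_left_mono) auto
  qed
  finally show ?thesis .
qed

definition At where "At t = B t / (t powr a * V t)"

lemma At_exp: "At (exp x) = Ax x"
proof -
  have "exp x powr a = exp (a * x)" by (simp add: powr_def)
  then show ?thesis by (simp add: At_def Ax_def b_def g_def)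
qed

text \<open>Each clause has its own use. The bound on V (t / w) / V t is the bias of the rescaled
  values, uniformly in w down to 0. The range 1/2 \<le> z \<le> 2 covers the random position of the
  pivot around t = n / k. The geometric decay serves to exploit the growth condition on k.\<close>

lemma second_order_bounds:
  "\<exists>T C. 0 < T \<and> 0 < C \<and> (\<forall>t\<ge>T. 0 < V t \<and> 0 < At t \<and> V t \<le> C * At t \<and>
     (\<forall>w. 0 < w \<and> w \<le> 1 \<longrightarrow> \<bar>V (t / w) / V t - w powr a\<bar> \<le> C * At t) \<and>
     (\<forall>z. 1/2 \<le> z \<and> z \<le> 2 \<longrightarrow> At (t * z) \<le> C * At t) \<and>
     (\<forall>t' m. t * exp (real m) \<le> t' \<longrightarrow> (At t')\<^sup>2 / t' \<le> C * (1/2) ^ m * ((At t)\<^sup>2 / t)))"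
proof -
  obtain X1 C where C: "0 < C" and loc1: "\<And>x u. x \<ge> X1 \<Longrightarrow> 0 \<le> u \<Longrightarrow> u \<le> 1 \<Longrightarrow>
      \<bar>h (x + u) - h x\<bar> \<le> C * b x \<and> b (x + u) \<le> C * b x \<and> b x \<le> C * b (x + u)"
    using pi_local_bounds[OF h_measurable b_pos h_lim] by fastforce
  \<comment> \<open>The ratio q = exp a is chosen so that the factor exp (- a u) in V (t / w) / V t,
    with w = exp (- u), exactly cancels the growth bound for \<open>g\<close>.\<close>
  have q: "1 < exp a" using a by simp
  have "eventually (\<lambda>x. b (x + 1) / b x < exp a) at_top" by (rule order_tendstoD(2)[OF b_ratio q])
  \<comment> \<open>Then the local oscillation \<open>C * b x\<close> is at most half of
    \<open>g x\<close>, which keeps \<open>g\<close> comparable with itself over unit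
    shifts.\<close>
  moreover have "eventually (\<lambda>x. Ax x < 1 / (2 * C)) at_top" using C by (intro order_tendstoD(2)[OF Ax_lim]) auto
  ultimately have "eventually (\<lambda>x. b (x + 1) / b x < exp a \<and> Ax x < 1 / (2 * C) \<and>
      0 < g x \<and> J (x + 1) \<le> 1/2 * J x \<and> \<psi> (x + 1) \<le> 1 * \<psi> x) at_top"
    using g_pos J_halves \<psi>_nonincreasing by eventually_elim blast
  then obtain X2 where X2: "\<And>x. x \<ge> X2 \<Longrightarrow> b (x + 1) / b x < exp a \<and> Ax x < 1 / (2 * C) \<and>
      0 < g x \<and> J (x + 1) \<le> 1/2 * J x \<and> \<psi> (x + 1) \<le> 1 * \<psi> x"
    unfolding eventually_at_top_linorder by auto
  define X where "X = max X1 X2"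
  have XX: "X1 \<le> X" "X2 \<le> X" by (auto simp: X_def)
  have gp: "0 < g x" if "x \<ge> X" for x using X2[of x] XX that by auto
  have loc_g: "g x / 2 \<le> g (x + u)" "g (x + u) \<le> 3 / 2 * g x" if "x \<ge> X" "0 \<le> u" "u \<le> 1" for x u
  proof -
    have "\<bar>g (x + u) - g x\<bar> = \<bar>h (x + u) - h x\<bar>" using s by (auto simp: h_def)
    also have "\<dots> \<le> C * b x" using loc1[of x u] that XX by auto
    also have "\<dots> \<le> g x / 2"
      using X2[of x] XX that C by (auto simp: Ax_def field_simps)
    finally have "\<bar>g (x + u) - g x\<bar> \<le> g x / 2" .
    then show "g x / 2 \<le> g (x + u)" "g (x + u) \<le> 3 / 2 * g x" by linarith+
  qed
  have loc_A: "Ax (x + u) \<le> 2 * C * Ax x" "Ax x \<le> 2 * C * Ax (x + u)" if "x \<ge> X" "0 \<le> u" "u \<le> 1" for x u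
  proof -
    note l = loc_g[OF that]
    have l1: "b (x + u) \<le> C * b x" "b x \<le> C * b (x + u)" using loc1[of x u] that XX by auto
    have gx: "0 < g x" "0 < g (x + u)" using that gp by auto
    have "Ax (x + u) \<le> (C * b x) / (g x / 2)"
      unfolding Ax_def using l(1) l1(1) gx C b_pos[of x] by (intro frac_le mult_nonneg_nonneg) linarith+
    then show "Ax (x + u) \<le> 2 * C * Ax x" by (simp add: Ax_def mult_ac)
    have "Ax x \<le> (C * b (x + u)) / (2 / 3 * g (x + u))"
      unfolding Ax_def using l(2) l1(2) gx C b_pos[of "x + u"] by (intro frac_le mult_nonneg_nonneg) linarith+
    also have "\<dots> = 3 / 2 * (C * Ax (x + u))" by (simp add: Ax_def)
    also have "\<dots> \<le> 2 * (C * Ax (x + u))"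
      using C gx b_pos[of "x + u"] by (intro mult_right_mono) (auto simp: Ax_def less_imp_le)
    finally show "Ax x \<le> 2 * C * Ax (x + u)" by simp
  qed
  have Ap: "0 < Ax x" if "x \<ge> X" for x using gp[OF that] b_pos[of x] by (simp add: Ax_def)
  have loc_J: "J (x + u) \<le> (2 * C)\<^sup>2 * J x" if "x \<ge> X" "0 \<le> u" "u \<le> 1" for x u
  proof -
    have "(Ax (x + u))\<^sup>2 \<le> (2 * C * Ax x)\<^sup>2"
      using loc_A[OF that] Ap[of "x + u"] that by (intro power_mono) auto
    moreover have "exp (- (x + u)) \<le> exp (- x)" using that by simp
    ultimately have "J (x + u) \<le> (2 * C * Ax x)\<^sup>2 * exp (- x)" unfolding J_def by (intro mult_mono) auto
    then show ?thesis by (simp add: J_def power_mult_distrib mult_ac)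
  qed
  have \<psi>_nonneg: "0 \<le> \<psi> x" for x using b_pos[of x] by (simp add: \<psi>_def less_imp_le)
  have loc_\<psi>: "\<psi> (x + u) \<le> (9 / 4 * C) * \<psi> x" if "x \<ge> X" "0 \<le> u" "u \<le> 1" for x u
  proof -
    have gx: "0 < g x" "0 < g (x + u)" using that gp by auto
    have "(g (x + u))\<^sup>2 \<le> (3 / 2 * g x)\<^sup>2" using loc_g[OF that] gx by (intro power_mono) auto
    moreover have "exp (- (a * (x + u))) \<le> exp (- (a * x))" using that a by simp
    ultimately have "exp (- (a * (x + u))) * (g (x + u))\<^sup>2 \<le> exp (- (a * x)) * (3 / 2 * g x)\<^sup>2"
      by (intro mult_mono) auto
    moreover have "b x / C \<le> b (x + u)" using loc1[of x u] that XX C by (simp add: field_simps)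
    ultimately have "\<psi> (x + u) \<le> exp (- (a * x)) * (3 / 2 * g x)\<^sup>2 / (b x / C)"
      unfolding \<psi>_def using b_pos[of x] C by (intro frac_le) auto
    then show ?thesis by (simp add: \<psi>_def power_mult_distrib power_divide mult_ac)
  qed
  have J_decay: "J y \<le> (2 * C)\<^sup>2 * (1/2) ^ m * J x" if "x \<ge> X" "y \<ge> x + real m" for x y m
  proof (rule geometric_decay[where X = X and L = J and r = "1/2" and C = "(2 * C)\<^sup>2"])
    show "J (x + 1) \<le> 1 / 2 * J x" if "x \<ge> X" for x using X2[of x] XX that by auto
    show "J (x + u) \<le> (2 * C)\<^sup>2 * J x" if "x \<ge> X" "0 \<le> u" "u \<le> 1" for x u by (rule loc_J[OF that])
    show "0 \<le> J x" for x by (simp add: J_def)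
  qed (use that C in auto)
  have \<psi>_decay: "\<psi> y \<le> 9 / 4 * C * \<psi> X" if "y \<ge> X" for y
  proof -
    have "\<psi> y \<le> (9 / 4 * C) * 1 ^ 0 * \<psi> X"
    proof (rule geometric_decay[where X = X and L = \<psi> and r = 1 and C = "9 / 4 * C"])
      show "\<psi> (x + 1) \<le> 1 * \<psi> x" if "x \<ge> X" for x using X2[of x] XX that by auto
      show "\<psi> (x + u) \<le> (9 / 4 * C) * \<psi> x" if "x \<ge> X" "0 \<le> u" "u \<le> 1" for x u by (rule loc_\<psi>[OF that])
      show "0 \<le> \<psi> x" for x by (rule \<psi>_nonneg)
    qed (use that C in auto)
    then show ?thesis by simp
  qed
  define Cg where "Cg = C * (1 + 1 / (exp a - 1))"
  have growth: "\<bar>h (x + u) - h x\<bar> \<le> Cg * b x * exp a powr u" if "x \<ge> X" "0 \<le> u" for x u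
    unfolding Cg_def
  proof (rule g_growth[OF C q, where X = X])
    show "\<bar>h (x + u) - h x\<bar> \<le> C * b x" if "x \<ge> X" "0 \<le> u" "u \<le> 1" for x u
      using loc1[of x u] that XX by auto
    show "b (x + 1) \<le> exp a * b x" if "x \<ge> X" for x
      using X2[of x] XX that b_pos[of x] by (auto simp: field_simps)
  qed (use that in auto)
  define C' where "C' = max (max (9 / 4 * C * \<psi> X) Cg) (max (2 * C) ((2 * C)\<^sup>2))"
  have C': "9 / 4 * C * \<psi> X \<le> C'" "Cg \<le> C'" "2 * C \<le> C'" "(2 * C)\<^sup>2 \<le> C'" by (auto simp: C'_def)
  have C'pos: "0 < C'" using C' C by linarith
  \<comment> \<open>One unit above \<open>X\<close> is left free because z \<ge> 1/2 means a shift u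
    \<ge> -1, after which the local bounds are still applied.\<close>
  have "0 < V t \<and> 0 < At t \<and> V t \<le> C' * At t \<and>
     (\<forall>w. 0 < w \<and> w \<le> 1 \<longrightarrow> \<bar>V (t / w) / V t - w powr a\<bar> \<le> C' * At t) \<and>
     (\<forall>z. 1/2 \<le> z \<and> z \<le> 2 \<longrightarrow> At (t * z) \<le> C' * At t) \<and>
     (\<forall>t' m. t * exp (real m) \<le> t' \<longrightarrow> (At t')\<^sup>2 / t' \<le> C' * (1/2) ^ m * ((At t)\<^sup>2 / t))"
    if t: "exp (X + 1) \<le> t" for t
  proof -
    define x where "x = ln t"
    have t0: "0 < t" using t by (meson exp_gt_zero less_le_trans)
    then have tx: "t = exp x" by (simp add: x_def)
    have xX: "X + 1 \<le> x" using t unfolding tx by simp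
    then have xX': "X \<le> x" by simp
    have Vg: "V (exp y) = exp (- (a * y)) * g y" for y by (simp add: g_def exp_minus)
    have r1: "0 < V t" unfolding tx Vg using gp[OF xX'] by simp
    have r2: "0 < At t" unfolding tx At_exp by (rule Ap[OF xX'])
    have r3: "V t \<le> C' * At t"
    proof -
      have "V t = \<psi> x * Ax x" unfolding tx Vg \<psi>_def Ax_def
        using gp[OF xX'] b_pos[of x] by (simp add: power2_eq_square)
      also have "\<dots> \<le> C' * Ax x"
        using \<psi>_decay[OF xX'] C' Ap[OF xX'] by (intro mult_right_mono) auto
      finally show ?thesis unfolding tx At_exp .
    qed
    have r4: "\<bar>V (t / w) / V t - w powr a\<bar> \<le> C' * At t" if w: "0 < w \<and> w \<le> 1" for w
    proof -
      define u where "u = - ln w"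
      have u: "0 \<le> u" using w by (simp add: u_def)
      have we: "w = exp (- u)" using w by (simp add: u_def)
      have tw: "t / w = exp (x + u)" by (simp add: tx we exp_add exp_minus field_simps)
      have e1: "exp (- (a * (x + u))) = exp (- (a * x)) * exp (- (a * u))"
        by (subst exp_add[symmetric]) (simp add: distrib_left)
      have wp: "w powr a = exp (- (a * u))" unfolding we by (simp add: powr_def)
      have "V (t / w) / V t = exp (- (a * u)) * (g (x + u) / g x)"
        unfolding tw unfolding tx Vg e1 by simp
      then have "V (t / w) / V t - w powr a = exp (- (a * u)) * ((g (x + u) - g x) / g x)"
        unfolding wp using gp[OF xX'] by (simp add: diff_divide_distrib right_diff_distrib)
      then have "\<bar>V (t / w) / V t - w powr a\<bar> = exp (- (a * u)) * (\<bar>g (x + u) - g x\<bar> / g x)"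
        using gp[OF xX'] by (simp add: abs_mult)
      also have "\<bar>g (x + u) - g x\<bar> = \<bar>h (x + u) - h x\<bar>" using s by (auto simp: h_def)
      also have "exp (- (a * u)) * (\<bar>h (x + u) - h x\<bar> / g x) \<le> exp (- (a * u)) * ((Cg * b x * exp a powr u) / g x)"
        using growth[OF xX' u] gp[OF xX'] by (intro mult_left_mono divide_right_mono) auto
      also have "\<dots> = Cg * Ax x"
        by (simp add: Ax_def powr_def exp_minus mult_ac)
      also have "\<dots> \<le> C' * Ax x" using C' Ap[OF xX'] by (intro mult_right_mono) auto
      finally show ?thesis unfolding tx At_exp .
    qed
    have r5: "At (t * z) \<le> C' * At t" if z: "1 / 2 \<le> z \<and> z \<le> 2" for z
    proof -
      define u where "u = ln z"
      have zu: "z = exp u" using z by (simp add: u_def)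
      have e2: "2 \<le> exp (1::real)" using exp_ge_add_one_self[of "1::real"] by simp
      have "exp (- 1) \<le> (1/2 :: real)" using e2 by (simp add: exp_minus field_simps)
      then have "exp (- 1) \<le> exp u" "exp u \<le> exp 1" using z e2 unfolding zu by linarith+
      then have u: "- 1 \<le> u" "u \<le> 1" by simp_all
      have tz: "t * z = exp (x + u)" by (simp add: tx zu exp_add)
      have "Ax (x + u) \<le> 2 * C * Ax x"
      proof (cases "0 \<le> u")
        case True
        then show ?thesis using loc_A(1)[OF xX' True u(2)] by simp
      next
        case False
        then show ?thesis using loc_A(2)[of "x + u" "- u"] u xX by simp
      qed
      also have "\<dots> \<le> C' * Ax x" using C' Ap[OF xX'] by (intro mult_right_mono) auto
      finally have "At (exp (x + u)) \<le> C' * At (exp x)" unfolding At_exp .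
      then show ?thesis by (simp only: tz tx[symmetric])
    qed
    have r6: "(At t')\<^sup>2 / t' \<le> C' * (1 / 2) ^ m * ((At t)\<^sup>2 / t)" if t': "t * exp (real m) \<le> t'" for t' m
    proof -
      define y where "y = ln t'"
      have "0 < t * exp (real m)" using t0 by simp
      then have "0 < t'" using t' by linarith
      then have ty: "t' = exp y" by (simp add: y_def)
      have "exp (x + real m) \<le> exp y" using t' unfolding tx ty by (simp add: exp_add)
      then have yx: "y \<ge> x + real m" by simp
      have Jt: "(At (exp v))\<^sup>2 / exp v = J v" for v unfolding At_exp J_def by (simp add: exp_minus field_simps)
      have "J y \<le> (2 * C)\<^sup>2 * (1 / 2) ^ m * J x" by (rule J_decay[OF xX' yx])
      also have "\<dots> \<le> C' * (1 / 2) ^ m * J x" using C' by (intro mult_right_mono) (auto simp: J_def)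
      finally show ?thesis unfolding tx ty Jt .
    qed
    from r1 r2 r3 r4 r5 r6 show ?thesis by blast
  qed
  then show ?thesis using C'pos exp_gt_zero[of "X + 1"] by blast
qed

end

section \<open>The growth condition on k\<close>

context pi_varying
begin

lemma At_lim: "(At \<longlongrightarrow> 0) at_top"
proof -
  have "((\<lambda>t. Ax (ln t)) \<longlongrightarrow> 0) at_top" by (rule filterlim_compose[OF Ax_lim ln_at_top])
  moreover have "eventually (\<lambda>t. Ax (ln t) = At t) at_top"
    using eventually_gt_at_top[of 0] by eventually_elim (simp add: At_exp[symmetric])
  ultimately show ?thesis by (rule Lim_transform_eventually)
qed

text \<open>With L t = (At t)^2 / t, the function \<open>G\<close> lies between 1 / (\<phi>^2 L t)
  and 4 / (\<phi>^2 L t). A near-minimal t with n \<le> G t has n L(t) \<le> 4 / \<phi>^2. The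
  condition on k pushes n / k beyond t exp m for each m, and the decay of L gives k At(n / k)^2 = n
  L(n / k) \<le> 4 C 2^(-m) / \<phi>^2.\<close>

lemma level_condition:
  fixes k :: "nat \<Rightarrow> nat" and \<phi> :: real
  defines "G \<equiv> \<lambda>t. t powr (1 + 2 * a) * ((ln \<phi> - ln (\<phi> - V t)) / B t)\<^sup>2"
  assumes \<phi>: "0 < \<phi>" and k: "\<And>n. 2 \<le> n \<Longrightarrow> 0 < k n \<and> k n < n"
  shows "\<exists>T. \<forall>t0\<ge>T. (\<lambda>n. real (k n)) \<in> o(\<lambda>n. real n / gen_inverse_from t0 G (real n)) \<longrightarrow>
     (\<lambda>n. sqrt (real (k n)) * At (real n / real (k n))) \<longlonglongrightarrow> 0 \<and>
     filterlim (\<lambda>n. real n / real (k n)) at_top sequentially"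
proof -
  obtain T0 C where T0: "0 < T0" and C: "0 < C" and mb: "\<And>t. t \<ge> T0 \<Longrightarrow> 0 < V t \<and> 0 < At t \<and> V t \<le> C * At t \<and>
     (\<forall>t' m. t * exp (real m) \<le> t' \<longrightarrow> (At t')\<^sup>2 / t' \<le> C * (1/2) ^ m * ((At t)\<^sup>2 / t))"
    using second_order_bounds by metis
  have "eventually (\<lambda>t. At t < \<phi> / (2 * C)) at_top"
    using \<phi> C by (intro order_tendstoD(2)[OF At_lim]) auto
  then obtain T1 where T1: "\<And>t. t \<ge> T1 \<Longrightarrow> At t < \<phi> / (2 * C)" unfolding eventually_at_top_linorder by auto
  \<comment> \<open>Beyond \<open>T1\<close> one has V t \<le> \<phi> / 2, so that ln \<phi> - ln
    (\<phi> - V t) is between V t / \<phi> and twice this value.\<close>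
  define T where "T = max T0 T1"
  have T: "0 < T" "T0 \<le> T" "T1 \<le> T" using T0 by (auto simp: T_def)
  define L where "L t = (At t)\<^sup>2 / t" for t
  have Lpos: "0 < L t" if "t \<ge> T" for t using mb[of t] that T by (auto simp: L_def)
  have decay: "L t' \<le> C * (1/2) ^ m * L t" if "t \<ge> T" "t * exp (real m) \<le> t'" for t t' m
    using mb[of t] that T unfolding L_def by auto
  have G: "1 / (\<phi>\<^sup>2 * L t) \<le> G t" "G t \<le> 4 / (\<phi>\<^sup>2 * L t)" if t: "t \<ge> T" for t
  proof -
    have tp: "0 < t" using t T by linarith
    have Vp: "0 < V t" and Ap: "0 < At t" and VA: "V t \<le> C * At t" using mb[of t] t T by auto
    have "C * At t \<le> \<phi> / 2" using T1[of t] t T C by (auto simp: field_simps)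
    then have V2: "V t \<le> \<phi> / 2" using VA by linarith
    have Bp: "0 < B t" by (rule B_pos[OF tp])
    let ?l = "ln \<phi> - ln (\<phi> - V t)"
    have "?l = ln (\<phi> / (\<phi> - V t))" using \<phi> V2 by (subst ln_div) auto
    then have l1: "V t / \<phi> \<le> ?l" and l2: "?l \<le> V t / (\<phi> - V t)"
      using ln_ratio_bounds[of "\<phi> - V t" \<phi>] Vp V2 \<phi> by auto
    have "V t / (\<phi> - V t) \<le> V t / (\<phi> / 2)" using V2 Vp \<phi> by (intro divide_left_mono) auto
    with l2 have l2: "?l \<le> 2 * (V t / \<phi>)" by (simp add: mult.commute)
    have eq: "t powr (1 + 2 * a) * (V t / \<phi> / B t)\<^sup>2 = 1 / (\<phi>\<^sup>2 * L t)"
    proof -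
      have "t powr (1 + 2 * a) = t * (t powr a)\<^sup>2"
      proof -
        have "1 + 2 * a = 1 + (a + a)" by simp
        then show ?thesis using tp by (simp only: powr_add powr_one power2_eq_square less_imp_le)
      qed
      then have "t powr (1 + 2 * a) * (V t / \<phi> / B t)\<^sup>2 = t * (t powr a * V t / B t)\<^sup>2 / \<phi>\<^sup>2"
        by (simp add: power_mult_distrib power_divide mult_ac)
      also have "t powr a * V t / B t = 1 / At t" by (simp add: At_def)
      finally show ?thesis by (simp add: L_def power_divide)
    qed
    have "1 / (\<phi>\<^sup>2 * L t) \<le> t powr (1 + 2 * a) * (?l / B t)\<^sup>2"
      unfolding eq[symmetric] using l1 Vp \<phi> Bp
      by (intro mult_left_mono power_mono divide_right_mono) auto
    then show "1 / (\<phi>\<^sup>2 * L t) \<le> G t" by (simp add: G_def)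
    have "t powr (1 + 2 * a) * (?l / B t)\<^sup>2 \<le> t powr (1 + 2 * a) * (2 * (V t / \<phi>) / B t)\<^sup>2"
    proof (intro mult_left_mono power_mono divide_right_mono l2)
      have "0 \<le> V t / \<phi>" using Vp \<phi> by simp
      then have "0 \<le> ?l" using l1 by linarith
      then show "0 \<le> ?l / B t" using Bp by simp
    qed (use Bp in auto)
    also have "\<dots> = 4 * (t powr (1 + 2 * a) * (V t / \<phi> / B t)\<^sup>2)" by (simp add: power_mult_distrib power_divide)
    finally show "G t \<le> 4 / (\<phi>\<^sup>2 * L t)" unfolding eq by (simp add: G_def)
  qed
  have main: "(\<lambda>n. sqrt (real (k n)) * At (real n / real (k n))) \<longlonglongrightarrow> 0 \<and>
     filterlim (\<lambda>n. real n / real (k n)) at_top sequentially"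
    if t0: "t0 \<ge> T" and o: "(\<lambda>n. real (k n)) \<in> o(\<lambda>n. real n / gen_inverse_from t0 G (real n))" for t0
  proof -
    define \<tau> where "\<tau> n = gen_inverse_from t0 G (real n)" for n
    have t0p: "0 < t0" using t0 T by linarith
    have ne: "{t. t0 \<le> t \<and> real n \<le> G t} \<noteq> {}" for n
    proof -
      have "(\<lambda>m. \<phi>\<^sup>2 * (C * (1/2) ^ m * L t0)) \<longlonglongrightarrow> \<phi>\<^sup>2 * (C * 0 * L t0)"
        by (intro tendsto_intros LIMSEQ_power_zero) auto
      then have "eventually (\<lambda>m. \<phi>\<^sup>2 * (C * (1/2) ^ m * L t0) < 1 / (real n + 1)) sequentially"
        by (intro order_tendstoD(2)) auto
      then obtain m where m: "\<phi>\<^sup>2 * (C * (1/2) ^ m * L t0) < 1 / (real n + 1)"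
        unfolding eventually_sequentially by auto
      define t where "t = t0 * exp (real m)"
      have "t0 * 1 \<le> t" unfolding t_def using t0p by (intro mult_left_mono) auto
      then have tt: "t0 \<le> t" by simp
      have "\<phi>\<^sup>2 * L t \<le> \<phi>\<^sup>2 * (C * (1/2) ^ m * L t0)"
        by (intro mult_left_mono decay t0) (auto simp: t_def)
      also note m
      finally have "\<phi>\<^sup>2 * L t < 1 / (real n + 1)" .
      moreover have "0 < \<phi>\<^sup>2 * L t" using Lpos[of t] t0 tt \<phi> by auto
      ultimately have "real n + 1 \<le> 1 / (\<phi>\<^sup>2 * L t)" by (simp add: field_simps)
      also have "\<dots> \<le> G t" using t0 tt by (intro G) auto
      finally show ?thesis using tt by auto
    qed
    have bb: "bdd_below {t. t0 \<le> t \<and> real n \<le> G t}" for n by (rule bdd_belowI[of _ t0]) auto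
    have \<tau>_ge: "t0 \<le> \<tau> n" for n
      unfolding \<tau>_def gen_inverse_from_def by (rule cInf_greatest[OF ne]) auto
    \<comment> \<open>The infimum need not be attained, since \<open>G\<close> is irregular.
      Doubling it leaves room for an actual point of the set.\<close>
    have \<tau>_ex: "\<exists>t. t0 \<le> t \<and> t < 2 * \<tau> n \<and> real n \<le> G t" for n
    proof -
      have "\<tau> n < 2 * \<tau> n" using \<tau>_ge[of n] t0p by simp
      then show ?thesis
        using cInf_less_iff[OF ne bb, of n "2 * \<tau> n"] unfolding \<tau>_def gen_inverse_from_def by auto
    qed
    have ev: "eventually (\<lambda>n. real n / real (k n) \<ge> exp (real m) * t0 \<and>
        real (k n) * (At (real n / real (k n)))\<^sup>2 \<le> 4 * C / \<phi>\<^sup>2 * (1/2) ^ m) sequentially" for m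
    proof -
      \<comment> \<open>The 2 offsets the doubling in \<open>\<tau>_ex\<close>, and exp m provides
        the m unit steps of decay.\<close>
      have "0 < 1 / (2 * exp (real m))" by simp
      from landau_o.smallD[OF o this] eventually_ge_at_top[of 2]
      show ?thesis
      proof eventually_elim
        case (elim n)
        have kn: "0 < real (k n)" and n0: "0 < real n" using k[OF elim(2)] elim(2) by auto
        have \<tau>0: "0 < \<tau> n" using \<tau>_ge[of n] t0p by linarith
        have "real (k n) \<le> 1 / (2 * exp (real m)) * (real n / \<tau> n)"
          using elim(1) \<tau>0 unfolding \<tau>_def[symmetric] by simp
        then have nk: "2 * \<tau> n * exp (real m) \<le> real n / real (k n)"
          using kn \<tau>0 by (simp add: field_simps)
        obtain t where t: "t0 \<le> t" "t < 2 * \<tau> n" "real n \<le> G t" using \<tau>_ex by blast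
        have "t * exp (real m) \<le> 2 * \<tau> n * exp (real m)" using t by (intro mult_right_mono) auto
        with nk have tn: "t * exp (real m) \<le> real n / real (k n)" by linarith
        have "exp (real m) * t0 \<le> t * exp (real m)" using t by (simp add: mult.commute)
        then have 1: "exp (real m) * t0 \<le> real n / real (k n)" using tn by (rule order_trans)
        have tT: "T \<le> t" using t t0 by linarith
        have "real (k n) * (At (real n / real (k n)))\<^sup>2 = real n * L (real n / real (k n))"
          using kn n0 by (simp add: L_def)
        also have "\<dots> \<le> real n * (C * (1/2) ^ m * L t)"
          using n0 by (intro mult_left_mono decay tn tT) auto
        also have "\<dots> \<le> (4 / (\<phi>\<^sup>2 * L t)) * (C * (1/2) ^ m * L t)"
          using t(3) G(2)[OF tT] C Lpos[OF tT] by (intro mult_right_mono) auto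
        also have "\<dots> = 4 * C / \<phi>\<^sup>2 * (1/2) ^ m" using Lpos[OF tT] by simp
        finally show ?case using 1 by simp
      qed
    qed
    have "filterlim (\<lambda>n. real n / real (k n)) at_top sequentially"
      unfolding filterlim_at_top
    proof
      fix Z :: real
      have "filterlim (\<lambda>m. exp (real m) * t0) at_top sequentially" using t0p by real_asymp
      then obtain m where m: "Z \<le> exp (real m) * t0"
        unfolding filterlim_at_top eventually_sequentially by auto
      from ev[of m] show "eventually (\<lambda>n. Z \<le> real n / real (k n)) sequentially"
        by eventually_elim (use m in auto)
    qed
    moreover have "(\<lambda>n. real (k n) * (At (real n / real (k n)))\<^sup>2) \<longlonglongrightarrow> 0"
    proof (rule tendstoI)
      fix e :: real assume e: "0 < e"
      have "(\<lambda>m. 4 * C / \<phi>\<^sup>2 * (1/2) ^ m) \<longlonglongrightarrow> 4 * C / \<phi>\<^sup>2 * 0"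
        by (intro tendsto_intros LIMSEQ_power_zero) auto
      then have "eventually (\<lambda>m. 4 * C / \<phi>\<^sup>2 * (1/2) ^ m < e) sequentially"
        using e by (intro order_tendstoD(2)) auto
      then obtain m where m: "4 * C / \<phi>\<^sup>2 * (1/2) ^ m < e" unfolding eventually_sequentially by auto
      from ev[of m] show "eventually (\<lambda>n. dist (real (k n) * (At (real n / real (k n)))\<^sup>2) 0 < e) sequentially"
        by eventually_elim (use m in \<open>auto simp: dist_real_def\<close>)
    qed
    then have "(\<lambda>n. sqrt (real (k n) * (At (real n / real (k n)))\<^sup>2)) \<longlonglongrightarrow> sqrt 0"
      by (rule tendsto_real_sqrt)
    then have "(\<lambda>n. \<bar>sqrt (real (k n)) * At (real n / real (k n))\<bar>) \<longlonglongrightarrow> 0"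
      by (simp add: real_sqrt_mult abs_mult)
    then have "(\<lambda>n. sqrt (real (k n)) * At (real n / real (k n))) \<longlonglongrightarrow> 0"
      by (rule tendsto_rabs_zero_cancel)
    ultimately show ?thesis by simp
  qed
  then show ?thesis by blast
qed

end

section \<open>Uniform order statistics\<close>

definition unif :: "real measure" where
  "unif = density lborel (indicator {0<..<1})"

lemma sets_unif [simp, measurable_cong]: "sets unif = sets borel"
  and space_unif [simp]: "space unif = UNIV"
  by (simp_all add: unif_def)

lemma nn_integral_unif:
  assumes [measurable]: "f \<in> borel_measurable borel"
  shows "(\<integral>\<^sup>+x. f x \<partial>unif) = (\<integral>\<^sup>+x. indicator {0<..<1} x * f x \<partial>lborel)"
  unfolding unif_def by (subst nn_integral_density) auto

lemma prob_space_unif: "prob_space unif"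
  by (rule prob_spaceI) (simp add: unif_def emeasure_density)

interpretation unif: prob_space unif by (rule prob_space_unif)

interpretation unif_prod: product_sigma_finite "\<lambda>_. unif"
  by (simp add: product_sigma_finite_def unif.sigma_finite_measure_axioms)

lemma AE_unif: "AE x in unif. 0 < x \<and> x < 1"
  unfolding unif_def by (subst AE_density) (auto simp: indicator_def intro!: AE_I2)

section \<open>Scaling of uniform variables\<close>

lemma nn_integral_unif_scale:
  assumes [measurable]: "f \<in> borel_measurable borel" and \<theta>: "0 < \<theta>" "\<theta> < 1"
  shows "(\<integral>\<^sup>+y. indicator {..<\<theta>} y * f y \<partial>unif) = ennreal \<theta> * (\<integral>\<^sup>+y. f (\<theta> * y) \<partial>unif)"
proof -
  have "(\<integral>\<^sup>+y. indicator {..<\<theta>} y * f y \<partial>unif) = (\<integral>\<^sup>+y. indicator {0<..<\<theta>} y * f y \<partial>lborel)"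
    by (subst nn_integral_unif) (use \<theta> in \<open>auto intro!: nn_integral_cong simp: indicator_def\<close>)
  also have "\<dots> = ennreal \<bar>\<theta>\<bar> * (\<integral>\<^sup>+y. indicator {0<..<\<theta>} (0 + \<theta> * y) * f (0 + \<theta> * y) \<partial>lborel)"
    by (rule nn_integral_real_affine) (use \<theta> in auto)
  also have "(\<integral>\<^sup>+y. indicator {0<..<\<theta>} (0 + \<theta> * y) * f (0 + \<theta> * y) \<partial>lborel)
      = (\<integral>\<^sup>+y. indicator {0<..<1} y * f (\<theta> * y) \<partial>lborel)"
    by (rule nn_integral_cong) (use \<theta> in \<open>auto simp: indicator_def zero_less_mult_iff\<close>)
  also have "\<dots> = (\<integral>\<^sup>+y. f (\<theta> * y) \<partial>unif)" by (subst nn_integral_unif) auto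
  finally show ?thesis using \<theta> by simp
qed

abbreviation PU :: "nat set \<Rightarrow> (nat \<Rightarrow> real) measure" where
  "PU I \<equiv> Pi\<^sub>M I (\<lambda>_. unif)"

lemma sets_PU [measurable_cong]: "sets (PU I) = sets (Pi\<^sub>M I (\<lambda>_. borel))"
  by (rule sets_PiM_cong) auto

lemma prob_space_PU: "prob_space (PU I)"
  by (rule prob_space_PiM) (rule prob_space_unif)

text \<open>One coordinate at a time: a uniform variable restricted to lie below \<theta> is
  \<theta> times a uniform variable, with mass \<theta>. This is how the pivot drops out of the law
  of the smaller variables.\<close>

lemma nn_integral_PU_scale:
  assumes S: "finite S" and f: "f \<in> borel_measurable (PU S)" and \<theta>: "0 < \<theta>" "\<theta> < 1"
  shows "(\<integral>\<^sup>+w. (\<Prod>i\<in>S. indicator {..<\<theta>} (w i)) * f w \<partial>PU S)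
    = ennreal \<theta> ^ card S * (\<integral>\<^sup>+w. f (\<lambda>i\<in>S. \<theta> * w i) \<partial>PU S)"
  using S f
proof (induction S arbitrary: f rule: finite_induct)
  case empty
  have "(\<Prod>i\<in>{}. indicator {..<\<theta>} (w i)) * f w = f (\<lambda>i\<in>{}. \<theta> * w i)" if "w \<in> space (PU {})" for w
  proof -
    have "w = (\<lambda>i\<in>{}. \<theta> * w i)" using that by (simp add: space_PiM PiE_empty_domain restrict_def)
    then show ?thesis by (metis mult_1 prod.empty)
  qed
  then have "(\<integral>\<^sup>+w. (\<Prod>i\<in>{}. indicator {..<\<theta>} (w i)) * f w \<partial>PU {}) = (\<integral>\<^sup>+w. f (\<lambda>i\<in>{}. \<theta> * w i) \<partial>PU {})"
    by (rule nn_integral_cong)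
  then show ?case by (simp only: card.empty power_0 mult_1)
next
  case (insert i I)
  note f [measurable] = insert.prems
  let ?F = "\<lambda>w. \<integral>\<^sup>+y. f (w(i := \<theta> * y)) \<partial>unif"
  have upd: "(\<lambda>(w, y). w(i := y)) \<in> PU I \<Otimes>\<^sub>M unif \<rightarrow>\<^sub>M PU (insert i I)"
    using measurable_add_dim[of i I "\<lambda>_. unif"] by simp
  have upd\<theta>: "(\<lambda>(w, y). w(i := \<theta> * y)) \<in> PU I \<Otimes>\<^sub>M unif \<rightarrow>\<^sub>M PU (insert i I)"
  proof -
    have "(\<lambda>(w, y). (w, \<theta> * y)) \<in> PU I \<Otimes>\<^sub>M unif \<rightarrow>\<^sub>M PU I \<Otimes>\<^sub>M unif" by measurable
    from measurable_compose[OF this upd] show ?thesis by (simp add: case_prod_unfold)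
  qed
  have f1: "(\<lambda>(w, y). f (w(i := \<theta> * y))) \<in> borel_measurable (PU I \<Otimes>\<^sub>M unif)"
    using measurable_compose[OF upd\<theta> f] by (simp add: case_prod_unfold)
  have F [measurable]: "?F \<in> borel_measurable (PU I)"
    by (rule unif.borel_measurable_nn_integral) (rule f1)
  have scal: "(\<lambda>w. \<lambda>j\<in>insert i I. \<theta> * w j) \<in> PU (insert i I) \<rightarrow>\<^sub>M PU (insert i I)"
    by (rule measurable_restrict) measurable
  have f2: "(\<lambda>w. f (\<lambda>j\<in>insert i I. \<theta> * w j)) \<in> borel_measurable (PU (insert i I))"
    by (rule measurable_compose[OF scal f])
  have prodm: "(\<lambda>w. \<Prod>j\<in>insert i I. indicator {..<\<theta>} (w j) :: ennreal) \<in> borel_measurable (PU (insert i I))"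
    by measurable
  have "(\<integral>\<^sup>+w. (\<Prod>j\<in>insert i I. indicator {..<\<theta>} (w j)) * f w \<partial>PU (insert i I))
    = (\<integral>\<^sup>+w. (\<integral>\<^sup>+y. (\<Prod>j\<in>insert i I. indicator {..<\<theta>} ((w(i := y)) j)) * f (w(i := y)) \<partial>unif) \<partial>PU I)"
    using prodm f by (intro unif_prod.product_nn_integral_insert insert.hyps) auto
  also have "\<dots> = (\<integral>\<^sup>+w. (\<Prod>j\<in>I. indicator {..<\<theta>} (w j)) * (ennreal \<theta> * ?F w) \<partial>PU I)"
  proof (rule nn_integral_cong)
    fix w assume w: "w \<in> space (PU I)"
    have fw: "(\<lambda>y. f (w(i := y))) \<in> borel_measurable borel"
    proof -
      have "(\<lambda>y. (w, y)) \<in> unif \<rightarrow>\<^sub>M PU I \<Otimes>\<^sub>M unif" using w by measurable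
      from measurable_compose[OF measurable_compose[OF this upd] f]
      have "(\<lambda>y. f (w(i := y))) \<in> borel_measurable unif" by (simp only: prod.case)
      then show ?thesis by (simp add: measurable_cong_sets[OF sets_unif refl])
    qed
    have "(\<Prod>j\<in>insert i I. indicator {..<\<theta>} ((w(i := y)) j)) = indicator {..<\<theta>} y * (\<Prod>j\<in>I. indicator {..<\<theta>} (w j) :: ennreal)" for y
      using insert.hyps by (subst prod.insert) (auto intro!: arg_cong2[where f="(*)"] prod.cong)
    then have "(\<integral>\<^sup>+y. (\<Prod>j\<in>insert i I. indicator {..<\<theta>} ((w(i := y)) j)) * f (w(i := y)) \<partial>unif)
      = (\<integral>\<^sup>+y. (\<Prod>j\<in>I. indicator {..<\<theta>} (w j)) * (indicator {..<\<theta>} y * f (w(i := y))) \<partial>unif)"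
      by (simp add: mult_ac)
    also have "\<dots> = (\<Prod>j\<in>I. indicator {..<\<theta>} (w j)) * (\<integral>\<^sup>+y. indicator {..<\<theta>} y * f (w(i := y)) \<partial>unif)"
      using fw by (intro nn_integral_cmult) simp
    also have "(\<integral>\<^sup>+y. indicator {..<\<theta>} y * f (w(i := y)) \<partial>unif) = ennreal \<theta> * ?F w"
      by (rule nn_integral_unif_scale[OF fw \<theta>])
    finally show "(\<integral>\<^sup>+y. (\<Prod>j\<in>insert i I. indicator {..<\<theta>} ((w(i := y)) j)) * f (w(i := y)) \<partial>unif)
      = (\<Prod>j\<in>I. indicator {..<\<theta>} (w j)) * (ennreal \<theta> * ?F w)" .
  qed
  also have "\<dots> = ennreal \<theta> ^ card I * (\<integral>\<^sup>+w. ennreal \<theta> * ?F (\<lambda>j\<in>I. \<theta> * w j) \<partial>PU I)"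
    by (rule insert.IH) measurable
  also have "(\<integral>\<^sup>+w. ennreal \<theta> * ?F (\<lambda>j\<in>I. \<theta> * w j) \<partial>PU I) = ennreal \<theta> * (\<integral>\<^sup>+w. ?F (\<lambda>j\<in>I. \<theta> * w j) \<partial>PU I)"
  proof (rule nn_integral_cmult)
    have "(\<lambda>w. \<lambda>j\<in>I. \<theta> * w j) \<in> PU I \<rightarrow>\<^sub>M PU I" by (rule measurable_restrict) measurable
    from measurable_compose[OF this F] show "(\<lambda>w. ?F (\<lambda>j\<in>I. \<theta> * w j)) \<in> borel_measurable (PU I)" .
  qed
  also have "(\<integral>\<^sup>+w. ?F (\<lambda>j\<in>I. \<theta> * w j) \<partial>PU I) = (\<integral>\<^sup>+w. (\<integral>\<^sup>+y. f (\<lambda>j\<in>insert i I. \<theta> * (w(i := y)) j) \<partial>unif) \<partial>PU I)"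
  proof (intro nn_integral_cong arg_cong[where f=f] ext)
    fix w y j
    show "((\<lambda>j\<in>I. \<theta> * w j)(i := \<theta> * y)) j = (\<lambda>j\<in>insert i I. \<theta> * (w(i := y)) j) j"
      by (auto simp: restrict_def)
  qed
  also have "\<dots> = (\<integral>\<^sup>+w. f (\<lambda>j\<in>insert i I. \<theta> * w j) \<partial>PU (insert i I))"
    using f2 by (intro unif_prod.product_nn_integral_insert[symmetric] insert.hyps) auto
  finally show ?case by (simp only: card_insert_disjoint[OF insert.hyps] power_Suc mult_ac)
qed

lemma PU_reindex:
  assumes f: "inj_on f I" "f ` I \<subseteq> K"
  shows "distr (PU K) (PU I) (\<lambda>\<omega>. \<lambda>n\<in>I. \<omega> (f n)) = PU I"
  using distr_PiM_reindex[of K "\<lambda>_. unif" f I] f prob_space_unif by auto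

lemma PU_no_ties:
  assumes I: "finite I" and ij: "i \<in> I" "j \<in> I" "i \<noteq> j"
  shows "AE w in PU I. w i \<noteq> w j"
proof -
  define I' where "I' = I - {i}"
  have I': "finite I'" "i \<notin> I'" "I = insert i I'" "j \<in> I'" using I ij by (auto simp: I'_def)
  have [measurable]: "(\<lambda>w. w i) \<in> borel_measurable (PU I)" "(\<lambda>w. w j) \<in> borel_measurable (PU I)"
    using measurable_component_singleton[of i I "\<lambda>_. unif"] measurable_component_singleton[of j I "\<lambda>_. unif"] ij by auto
  have m: "{w \<in> space (PU I). w i = w j} \<in> sets (PU I)" by measurable
  have "emeasure (PU I) {w \<in> space (PU I). w i = w j} = (\<integral>\<^sup>+w. indicator {w \<in> space (PU I). w i = w j} w \<partial>PU I)"
    using m by simp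
  also have "\<dots> = (\<integral>\<^sup>+w. (\<integral>\<^sup>+y. indicator {w \<in> space (PU I). w i = w j} (w(i := y)) \<partial>unif) \<partial>PU I')"
    unfolding I'(3) by (rule unif_prod.product_nn_integral_insert) (use I' m in auto)
  also have "\<dots> \<le> (\<integral>\<^sup>+w. (\<integral>\<^sup>+y. indicator {w j} y \<partial>unif) \<partial>PU I')"
    by (intro nn_integral_mono) (use ij in \<open>auto simp: indicator_def\<close>)
  also have "(\<lambda>w. \<integral>\<^sup>+y. indicator {w j} y \<partial>unif) = (\<lambda>w. 0)"
  proof
    fix w :: "nat \<Rightarrow> real"
    have "emeasure lborel ({w j} \<inter> {0<..<1}) \<le> emeasure lborel {w j}" by (rule emeasure_mono) auto
    then show "(\<integral>\<^sup>+y. indicator {w j} y \<partial>unif) = 0"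
      by (simp add: unif_def emeasure_density nn_integral_indicator_finite indicator_inter_arith[symmetric] Int_commute)
  qed
  finally have "emeasure (PU I) {w \<in> space (PU I). w i = w j} = 0" by simp
  then show ?thesis using m by (intro AE_I'[of "{w \<in> space (PU I). w i = w j}"]) (auto simp: null_sets_def)
qed

lemma AE_PU_unit:
  assumes "finite I"
  shows "AE w in PU I. \<forall>i\<in>I. 0 < w i \<and> w i < 1"
proof (rule AE_finite_allI[OF assms])
  fix i assume i: "i \<in> I"
  show "AE w in PU I. 0 < w i \<and> w i < 1"
    by (rule AE_PiM_component[OF prob_space_unif i AE_unif])
qed

text \<open>The \<open>(k + 1)\<close>-st smallest of \<open>w 0, \<dots>, w (n - 1)\<close> is \<open>w j\<close>, and \<open>S\<close> is the set of indices of the smaller ones.\<close>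

definition conf :: "(nat \<Rightarrow> real) \<Rightarrow> nat \<Rightarrow> nat \<Rightarrow> nat \<Rightarrow> nat set \<Rightarrow> bool" where
  "conf w n k j S \<longleftrightarrow> j < n \<and> S \<subseteq> {..<n} - {j} \<and> card S = k \<and>
     (\<forall>i\<in>S. w i < w j) \<and> (\<forall>i\<in>{..<n} - insert j S. w j < w i)"

section \<open>Ranks in a sample without ties\<close>

lemma conf_S:
  assumes "conf w n k j S"
  shows "S = {i. i < n \<and> w i < w j}"
proof (intro set_eqI iffI)
  fix x assume "x \<in> S"
  then show "x \<in> {i. i < n \<and> w i < w j}" using assms unfolding conf_def by blast
next
  fix x assume x: "x \<in> {i. i < n \<and> w i < w j}"
  show "x \<in> S"
  proof (rule ccontr)
    assume "x \<notin> S"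
    then have "w j < w x" using assms x unfolding conf_def by blast
    with x show False by simp
  qed
qed

lemma conf_unique:
  assumes "conf w n k j S" "conf w n k j' S'"
  shows "j = j' \<and> S = S'"
proof -
  have le: "w j' \<le> w j" if "conf w n k j S" "conf w n k j' S'" for j j' S S'
  proof (rule ccontr)
    assume "\<not> w j' \<le> w j"
    then have "insert j S \<subseteq> S'" using conf_S[OF that(1)] conf_S[OF that(2)] that by (auto simp: conf_def)
    moreover have "finite S'" unfolding conf_S[OF that(2)] by simp
    ultimately have "card (insert j S) \<le> card S'" by (rule card_mono[rotated])
    moreover have "finite S" unfolding conf_S[OF that(1)] by simp
    then have "card (insert j S) = Suc (card S)" using that by (subst card_insert_disjoint) (auto simp: conf_def)
    ultimately show False using that by (simp add: conf_def)
  qed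
  have eq: "w j = w j'" using le[OF assms] le[OF assms(2,1)] by simp
  have "j = j'"
  proof (rule ccontr)
    assume "j \<noteq> j'"
    moreover have "j' \<notin> S" using conf_S[OF assms(1)] eq by simp
    ultimately have "w j < w j'" using assms by (auto simp: conf_def)
    with eq show False by simp
  qed
  with conf_S[OF assms(1)] conf_S[OF assms(2)] show ?thesis by simp
qed

text \<open>Without ties, the rank is an injective map from the n indices to {0, ..., n - 1}, hence
  onto; take the index of rank \<open>k\<close>.\<close>

lemma conf_exists:
  assumes "\<And>i j. i < n \<Longrightarrow> j < n \<Longrightarrow> i \<noteq> j \<Longrightarrow> w i \<noteq> w j" "k < n"
  shows "\<exists>j S. conf w n k j S"
proof -
  define r where "r j = card {i. i < n \<and> w i < w j}" for j
  have less: "r i < r j" if "w i < w j" "i < n" for i j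
    unfolding r_def by (rule psubset_card_mono) (use that in auto)
  have inj: "inj_on r {..<n}"
  proof (rule inj_onI, rule ccontr)
    fix i j assume "i \<in> {..<n}" "j \<in> {..<n}" "r i = r j" "i \<noteq> j"
    then show False using less[of i j] less[of j i] assms(1)[of i j] by (auto simp: neq_iff)
  qed
  have sub: "r ` {..<n} \<subseteq> {..<n}"
  proof
    fix x assume "x \<in> r ` {..<n}"
    then obtain j where j: "j < n" "x = r j" by auto
    have "r j < card {..<n}" unfolding r_def by (rule psubset_card_mono) (use j in auto)
    then show "x \<in> {..<n}" using j by simp
  qed
  have "r ` {..<n} = {..<n}" by (rule endo_inj_surj[OF _ sub inj]) simp
  then have "k \<in> r ` {..<n}" using assms(2) by simp
  then obtain j where j: "j < n" "k = r j" by auto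
  have "conf w n k j {i. i < n \<and> w i < w j}"
    unfolding conf_def
  proof (intro conjI ballI)
    fix i assume "i \<in> {..<n} - insert j {i. i < n \<and> w i < w j}"
    then have "i < n" "i \<noteq> j" "\<not> w i < w j" by auto
    with assms(1)[of i j] j show "w j < w i" by simp
  qed (use j in \<open>auto simp: r_def\<close>)
  then show ?thesis by blast
qed

text \<open>\<open>H\<close> may be constant on intervals, so distinct uniform variables can give
  tied values. Both counting bounds survive: at most the \<open>k\<close> indices of
  \<open>S\<close> exceed \<open>H (w j)\<close>, and any lower level is exceeded by at least
  \<open>k + 1\<close>.\<close>

lemma conf_upper_os:
  assumes c: "conf w n k j S" and pos: "\<And>i. i < n \<Longrightarrow> 0 < w i"
    and anti: "\<And>u v. 0 < u \<Longrightarrow> u \<le> v \<Longrightarrow> H v \<le> H u" and nn: "0 \<le> H (w j)"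
  shows "upper_os (\<lambda>l. H (w l)) n k = H (w j)"
proof (rule antisym)
  have jn: "j < n" and Sk: "card S = k" using c by (auto simp: conf_def)
  have S: "S = {i. i < n \<and> w i < w j}" by (rule conf_S[OF c])
  have finS: "finite S" unfolding S by simp
  have "{l. l < n \<and> H (w j) < H (w l)} \<subseteq> S"
  proof (rule subsetI, rule ccontr)
    fix l assume l: "l \<in> {l. l < n \<and> H (w j) < H (w l)}" "l \<notin> S"
    then have "w j \<le> w l" unfolding S by auto
    from anti[OF pos[OF jn] this] l show False by auto
  qed
  from card_mono[OF finS this] show "upper_os (\<lambda>l. H (w l)) n k \<le> H (w j)"
    using nn Sk by (simp add: upper_os_le_iff)
  show "H (w j) \<le> upper_os (\<lambda>l. H (w l)) n k"
  proof (rule ccontr)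
    let ?y = "upper_os (\<lambda>l. H (w l)) n k"
    assume neg: "\<not> H (w j) \<le> ?y"
    have "card {l. l < n \<and> ?y < H (w l)} \<le> k" by (rule upper_os_le_iff[THEN iffD1, OF upper_os_nonneg order_refl])
    moreover have "insert j S \<subseteq> {l. l < n \<and> ?y < H (w l)}"
    proof
      fix l assume "l \<in> insert j S"
      then have l: "l < n" "w l \<le> w j" using jn unfolding S by auto
      have "H (w j) \<le> H (w l)" by (rule anti[OF pos[OF l(1)] l(2)])
      with neg l show "l \<in> {l. l < n \<and> ?y < H (w l)}" by auto
    qed
    then have "card (insert j S) \<le> card {l. l < n \<and> ?y < H (w l)}" by (intro card_mono) auto
    moreover have "card (insert j S) = Suc k" using finS Sk by (subst card_insert_disjoint) (auto simp: S)
    ultimately show False by simp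
  qed
qed

text \<open>Reflection at 1 reduces small order statistics to \<open>upper_os\<close> and so
  inherits its measurability; \<open>conf_theta\<close> identifies the value with the pivot.\<close>

definition theta :: "(nat \<Rightarrow> real) \<Rightarrow> nat \<Rightarrow> nat \<Rightarrow> real" where
  "theta w n k = 1 - upper_os (\<lambda>l. 1 - w l) n k"

lemma conf_theta:
  assumes "conf w n k j S" "\<And>i. i < n \<Longrightarrow> 0 < w i \<and> w i < 1"
  shows "theta w n k = w j"
proof -
  have "j < n" using assms by (simp add: conf_def)
  then have "upper_os (\<lambda>l. 1 - w l) n k = 1 - w j"
    using conf_upper_os[OF assms(1), of "\<lambda>u. 1 - u"] assms(2) by (auto simp: less_imp_le)
  then show ?thesis by (simp add: theta_def)
qed

definition below_sum :: "(real \<Rightarrow> real) \<Rightarrow> nat \<Rightarrow> nat \<Rightarrow> (nat \<Rightarrow> real) \<Rightarrow> real" where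
  "below_sum \<xi> n k w = (\<Sum>l<n. if w l < theta w n k then \<xi> (w l / theta w n k) else 0)"

lemma conf_below_sum:
  assumes "conf w n k j S" "\<And>i. i < n \<Longrightarrow> 0 < w i \<and> w i < 1"
  shows "below_sum \<xi> n k w = (\<Sum>l\<in>S. \<xi> (w l / w j))"
proof -
  have S: "S = {i. i < n \<and> w i < w j}" by (rule conf_S[OF assms(1)])
  have "below_sum \<xi> n k w = (\<Sum>l<n. if w l < w j then \<xi> (w l / w j) else 0)"
  proof -
    have "theta w n k = w j" by (rule conf_theta[OF assms(1)]) (use assms(2) in auto)
    then show ?thesis unfolding below_sum_def by (simp only:)
  qed
  also have "\<dots> = (\<Sum>l\<in>S. \<xi> (w l / w j))"
    unfolding S by (rule sum.mono_neutral_cong_right) auto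
  finally show ?thesis .
qed

lemma PU_component: "i \<in> I \<Longrightarrow> (\<lambda>w. w i) \<in> borel_measurable (PU I)"
  using measurable_component_singleton[of i I "\<lambda>_. unif"] by simp

lemma theta_measurable [measurable]: "(\<lambda>w. theta w n k) \<in> borel_measurable (PU {..<n})"
  unfolding theta_def by (intro borel_measurable_diff borel_measurable_upper_os) auto

lemma below_sum_measurable [measurable]:
  assumes [measurable]: "\<xi> \<in> borel_measurable borel"
  shows "below_sum \<xi> n k \<in> borel_measurable (PU {..<n})"
proof -
  have [measurable]: "(\<lambda>w. w l) \<in> borel_measurable (PU {..<n})" if "l \<in> {..<n}" for l
    using that by measurable
  show ?thesis
    unfolding below_sum_def
    by (intro borel_measurable_sum measurable_If) measurable
qed

lemma AE_PU_conf:
  assumes "k < n"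
  shows "AE w in PU {..<n}. (\<forall>i<n. 0 < w i \<and> w i < 1) \<and> (\<exists>j S. conf w n k j S)"
proof -
  have "AE w in PU {..<n}. \<forall>i\<in>{..<n}. \<forall>j\<in>{..<n} - {i}. w i \<noteq> w j"
    by (intro AE_finite_allI PU_no_ties) auto
  with AE_PU_unit[OF finite_lessThan, of n] show ?thesis
    by eventually_elim (use conf_exists[of n _ k] assms in auto)
qed

section \<open>The law of the variables below the pivot\<close>

context
  fixes \<xi> :: "real \<Rightarrow> real"
  assumes \<xi> [measurable]: "\<xi> \<in> borel_measurable borel"
begin

private lemma sum_measurable:
  "finite S \<Longrightarrow> (\<lambda>w. \<Sum>i\<in>S. \<xi> (w i)) \<in> borel_measurable (PU S)"
  by (intro borel_measurable_sum measurable_compose[OF PU_component \<xi>]) auto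

private definition Q where
  "Q S A = emeasure (PU S) {w \<in> space (PU S). (\<Sum>i\<in>S. \<xi> (w i)) \<in> A}"

private lemma Q_eq:
  assumes "finite S" "card S = k" and A: "A \<in> sets borel"
  shows "Q S A = Q {..<k} A"
proof -
  obtain \<pi> where \<pi>: "bij_betw \<pi> {..<k} S"
    using assms by (metis ex_bij_betw_nat_finite atLeast0LessThan)
  let ?r = "\<lambda>\<omega>. \<lambda>n\<in>{..<k}. \<omega> (\<pi> n)"
  have d: "distr (PU S) (PU {..<k}) ?r = PU {..<k}"
    using \<pi> by (intro PU_reindex) (auto simp: bij_betw_def)
  have rm: "?r \<in> PU S \<rightarrow>\<^sub>M PU {..<k}"
  proof (rule measurable_restrict)
    fix i assume "i \<in> {..<k}"
    then have "\<pi> i \<in> S" using \<pi> by (auto simp: bij_betw_def)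
    then show "(\<lambda>\<omega>. \<omega> (\<pi> i)) \<in> PU S \<rightarrow>\<^sub>M unif" by (rule measurable_component_singleton)
  qed
  have m: "{w \<in> space (PU {..<k}). (\<Sum>i<k. \<xi> (w i)) \<in> A} \<in> sets (PU {..<k})"
    using A by measurable
  have "Q {..<k} A = emeasure (distr (PU S) (PU {..<k}) ?r) {w \<in> space (PU {..<k}). (\<Sum>i<k. \<xi> (w i)) \<in> A}"
    unfolding Q_def d ..
  also have "\<dots> = emeasure (PU S) (?r -` {w \<in> space (PU {..<k}). (\<Sum>i<k. \<xi> (w i)) \<in> A} \<inter> space (PU S))"
    by (rule emeasure_distr[OF rm m])
  also have "?r -` {w \<in> space (PU {..<k}). (\<Sum>i<k. \<xi> (w i)) \<in> A} \<inter> space (PU S)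
     = {w \<in> space (PU S). (\<Sum>i\<in>S. \<xi> (w i)) \<in> A}"
  proof -
    have "(\<Sum>i<k. \<xi> (?r w i)) = (\<Sum>i\<in>S. \<xi> (w i))" for w
    proof -
      have "(\<Sum>i<k. \<xi> (?r w i)) = (\<Sum>i<k. \<xi> (w (\<pi> i)))" by (intro sum.cong) auto
      also have "\<dots> = (\<Sum>i\<in>S. \<xi> (w i))" by (rule sum.reindex_bij_betw[OF \<pi>])
      finally show ?thesis .
    qed
    moreover have "?r w \<in> space (PU {..<k})" if "w \<in> space (PU S)" for w
      using measurable_space[OF rm that] .
    ultimately show ?thesis by auto
  qed
  finally show ?thesis by (simp add: Q_def)
qed

text \<open>The probability that all variables indexed by \<open>R\<close> exceed \<open>y\<close>.
  Its value is never computed: it enters only through a total which is found by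
  normalisation.\<close>

private definition cfac where
  "cfac R y = (\<integral>\<^sup>+r. (\<Prod>i\<in>R. indicator {y<..} (r i)) \<partial>PU R)"

text \<open>Fubini with the pivot y fixed. The larger variables contribute \<open>cfac\<close>, the
  smaller ones the factor y^k times the law of an unconstrained sum, because \<xi> is applied to the
  variables divided by y. That law is free of y and factors out.\<close>

private lemma conf_integral:
  assumes j: "j < n" and S: "S \<subseteq> {..<n} - {j}" "card S = k" and A [measurable]: "A \<in> sets borel"
  shows "(\<integral>\<^sup>+w. indicator {w. conf w n k j S \<and> (\<Sum>i\<in>S. \<xi> (w i / w j)) \<in> A} w \<partial>PU {..<n})
    = (\<integral>\<^sup>+y. cfac ({..<n} - insert j S) y * ennreal y ^ k \<partial>unif) * Q S A"
proof -
  define R where "R = {..<n} - insert j S"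
  have finS: "finite S" and finR: "finite R" using finite_subset[OF S(1)] by (auto simp: R_def)
  have RS: "R \<inter> S = {}" and n_eq: "{..<n} = insert j (R \<union> S)" and jn: "j \<notin> R \<union> S" using S j by (auto simp: R_def)
  let ?f = "\<lambda>w. indicator {w. conf w n k j S \<and> (\<Sum>i\<in>S. \<xi> (w i / w j)) \<in> A} w :: ennreal"
  have comp: "i \<in> insert j (R \<union> S) \<Longrightarrow> (\<lambda>w. w i) \<in> borel_measurable (PU (insert j (R \<union> S)))" for i
    by (rule PU_component)
  have fprod: "?f w = (\<Prod>i\<in>R. indicator {w j<..} (w i)) * ((\<Prod>i\<in>S. indicator {..<w j} (w i)) * indicator A (\<Sum>i\<in>S. \<xi> (w i / w j)))" for w
  proof (cases "conf w n k j S")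
    case True
    then show ?thesis by (simp add: conf_def R_def indicator_def)
  next
    case False
    then have "(\<exists>i\<in>R. \<not> w j < w i) \<or> (\<exists>i\<in>S. \<not> w i < w j)" using j S by (auto simp: conf_def R_def)
    then have "(\<Prod>i\<in>R. indicator {w j<..} (w i)) = (0::ennreal) \<or> (\<Prod>i\<in>S. indicator {..<w j} (w i)) = (0::ennreal)"
      using finS finR by (auto simp: indicator_def)
    then show ?thesis using False by auto
  qed
  have fm: "?f \<in> borel_measurable (PU (insert j (R \<union> S)))"
  proof -
    have "(\<lambda>w. \<Sum>i\<in>S. \<xi> (w i / w j)) \<in> borel_measurable (PU (insert j (R \<union> S)))"
      by (intro borel_measurable_sum measurable_compose[OF _ \<xi>] borel_measurable_divide comp) auto
    then have 1: "(\<lambda>w. indicator A (\<Sum>i\<in>S. \<xi> (w i / w j)) :: ennreal) \<in> borel_measurable (PU (insert j (R \<union> S)))"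
      by (rule measurable_compose) simp
    have 2: "(\<lambda>w. \<Prod>i\<in>S. indicator {..<w j} (w i) :: ennreal) \<in> borel_measurable (PU (insert j (R \<union> S)))"
    proof (rule borel_measurable_prod_ennreal)
      fix i assume "i \<in> S"
      then have [measurable]: "(\<lambda>w. w i) \<in> borel_measurable (PU (insert j (R \<union> S)))" by (intro comp) auto
      have [measurable]: "(\<lambda>w. w j) \<in> borel_measurable (PU (insert j (R \<union> S)))" by (intro comp) auto
      have "(\<lambda>w. if w i < w j then 1 else 0 :: ennreal) \<in> borel_measurable (PU (insert j (R \<union> S)))" by measurable
      then show "(\<lambda>w. indicator {..<w j} (w i) :: ennreal) \<in> borel_measurable (PU (insert j (R \<union> S)))"
        by (simp add: indicator_def)
    qed
    have 3: "(\<lambda>w. \<Prod>i\<in>R. indicator {w j<..} (w i) :: ennreal) \<in> borel_measurable (PU (insert j (R \<union> S)))"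
    proof (rule borel_measurable_prod_ennreal)
      fix i assume "i \<in> R"
      then have [measurable]: "(\<lambda>w. w i) \<in> borel_measurable (PU (insert j (R \<union> S)))" by (intro comp) auto
      have [measurable]: "(\<lambda>w. w j) \<in> borel_measurable (PU (insert j (R \<union> S)))" by (intro comp) auto
      have "(\<lambda>w. if w j < w i then 1 else 0 :: ennreal) \<in> borel_measurable (PU (insert j (R \<union> S)))" by measurable
      then show "(\<lambda>w. indicator {w j<..} (w i) :: ennreal) \<in> borel_measurable (PU (insert j (R \<union> S)))"
        by (simp add: indicator_def)
    qed
    show ?thesis unfolding fprod using 1 2 3 by measurable
  qed
  have "(\<integral>\<^sup>+w. ?f w \<partial>PU {..<n}) = (\<integral>\<^sup>+y. (\<integral>\<^sup>+x. ?f (x(j := y)) \<partial>PU (R \<union> S)) \<partial>unif)"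
    unfolding n_eq by (rule unif_prod.product_nn_integral_insert_rev) (use finR finS jn fm in auto)
  also have "\<dots> = (\<integral>\<^sup>+y. cfac R y * ennreal y ^ k * Q S A \<partial>unif)"
  proof (rule nn_integral_cong_AE, use AE_unif in eventually_elim)
    fix y :: real assume y: "0 < y \<and> y < 1"
    have upd: "(\<lambda>x. x(j := y)) \<in> PU (R \<union> S) \<rightarrow>\<^sub>M PU (insert j (R \<union> S))"
    proof -
      have "(\<lambda>x. (x, y)) \<in> PU (R \<union> S) \<rightarrow>\<^sub>M PU (R \<union> S) \<Otimes>\<^sub>M unif" by measurable
      from measurable_compose[OF this measurable_add_dim[of j "R \<union> S" "\<lambda>_. unif"]]
      show ?thesis by (simp only: prod.case)
    qed
    let ?g = "\<lambda>s. indicator A (\<Sum>i\<in>S. \<xi> (s i / y)) :: ennreal"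
    have gm: "?g \<in> borel_measurable (PU S)"
    proof -
      have "(\<lambda>w. \<Sum>i\<in>S. \<xi> (w i / y)) \<in> borel_measurable (PU S)"
        by (intro borel_measurable_sum measurable_compose[OF _ \<xi>] borel_measurable_divide PU_component) auto
      then show ?thesis by (rule measurable_compose) simp
    qed
    have sm: "(\<lambda>s. \<Prod>i\<in>S. indicator {..<y} (s i) :: ennreal) \<in> borel_measurable (PU S)"
      by (intro borel_measurable_prod_ennreal measurable_compose[OF PU_component]) auto
    have rm: "(\<lambda>r. \<Prod>i\<in>R. indicator {y<..} (r i) :: ennreal) \<in> borel_measurable (PU R)"
      by (intro borel_measurable_prod_ennreal measurable_compose[OF PU_component]) auto
    have "(\<integral>\<^sup>+x. ?f (x(j := y)) \<partial>PU (R \<union> S)) = (\<integral>\<^sup>+r. (\<integral>\<^sup>+s. ?f ((merge R S (r, s))(j := y)) \<partial>PU S) \<partial>PU R)"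
      by (rule unif_prod.product_nn_integral_fold[OF RS finR finS]) (rule measurable_compose[OF upd fm])
    also have "\<dots> = (\<integral>\<^sup>+r. (\<integral>\<^sup>+s. (\<Prod>i\<in>R. indicator {y<..} (r i)) * ((\<Prod>i\<in>S. indicator {..<y} (s i)) * ?g s) \<partial>PU S) \<partial>PU R)"
    proof (intro nn_integral_cong)
      fix r s
      let ?m = "(merge R S (r, s))(j := y)"
      have mR: "?m i = r i" if "i \<in> R" for i using that jn by (auto simp: merge_def)
      have mS: "?m i = s i" if "i \<in> S" for i using that jn RS by (auto simp: merge_def)
      have mj: "?m j = y" by simp
      have 1: "(\<Prod>i\<in>R. indicator {y<..} (?m i)) = (\<Prod>i\<in>R. indicator {y<..} (r i) :: ennreal)"
        by (rule prod.cong[OF refl]) (simp only: mR)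
      have 2: "(\<Prod>i\<in>S. indicator {..<y} (?m i)) = (\<Prod>i\<in>S. indicator {..<y} (s i) :: ennreal)"
        by (rule prod.cong[OF refl]) (simp only: mS)
      have 3: "(\<Sum>i\<in>S. \<xi> (?m i / y)) = (\<Sum>i\<in>S. \<xi> (s i / y))"
        by (rule sum.cong[OF refl]) (simp only: mS)
      show "?f ?m = (\<Prod>i\<in>R. indicator {y<..} (r i)) * ((\<Prod>i\<in>S. indicator {..<y} (s i)) * ?g s)"
        unfolding fprod mj 1 2 3 ..
    qed
    also have "\<dots> = (\<integral>\<^sup>+r. (\<Prod>i\<in>R. indicator {y<..} (r i)) * (\<integral>\<^sup>+s. (\<Prod>i\<in>S. indicator {..<y} (s i)) * ?g s \<partial>PU S) \<partial>PU R)"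
      by (intro nn_integral_cong nn_integral_cmult borel_measurable_times_ennreal sm gm)
    also have "(\<integral>\<^sup>+s. (\<Prod>i\<in>S. indicator {..<y} (s i)) * ?g s \<partial>PU S) = ennreal y ^ card S * (\<integral>\<^sup>+s. ?g (\<lambda>i\<in>S. y * s i) \<partial>PU S)"
      by (rule nn_integral_PU_scale[OF finS gm]) (use y in auto)
    also have "(\<integral>\<^sup>+s. ?g (\<lambda>i\<in>S. y * s i) \<partial>PU S) = (\<integral>\<^sup>+s. indicator {w \<in> space (PU S). (\<Sum>i\<in>S. \<xi> (w i)) \<in> A} s \<partial>PU S)"
      by (rule nn_integral_cong) (use y in \<open>simp add: indicator_def\<close>)
    also have "\<dots> = Q S A"
      unfolding Q_def by (rule nn_integral_indicator) (use measurable_sets[OF sum_measurable[OF finS] A] in \<open>simp add: vimage_def Int_def conj_commute\<close>)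
    also have "(\<integral>\<^sup>+r. (\<Prod>i\<in>R. indicator {y<..} (r i)) * (ennreal y ^ card S * Q S A) \<partial>PU R) = cfac R y * (ennreal y ^ card S * Q S A)"
      unfolding cfac_def by (rule nn_integral_multc[OF rm])
    finally show "(\<integral>\<^sup>+x. ?f (x(j := y)) \<partial>PU (R \<union> S)) = cfac R y * ennreal y ^ k * Q S A"
      by (simp only: S(2) mult_ac)
  qed
  also have "\<dots> = (\<integral>\<^sup>+y. cfac R y * ennreal y ^ k \<partial>unif) * Q S A"
  proof (rule nn_integral_multc)
    have "(\<lambda>y. cfac R y) \<in> borel_measurable unif"
      unfolding cfac_def
    proof (rule sigma_finite_measure.borel_measurable_nn_integral)
      interpret P: prob_space "PU R" by (rule prob_space_PU)
      show "sigma_finite_measure (PU R)" by unfold_locales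
      have "(\<lambda>p. \<Prod>i\<in>R. if fst p < snd p i then 1 else 0 :: ennreal) \<in> borel_measurable (unif \<Otimes>\<^sub>M PU R)"
      proof (rule borel_measurable_prod_ennreal)
        fix i assume i: "i \<in> R"
        have [measurable]: "(\<lambda>p. snd p i) \<in> borel_measurable (unif \<Otimes>\<^sub>M PU R)"
          by (rule measurable_compose[OF measurable_snd PU_component[OF i]])
        have [measurable]: "(\<lambda>p. fst p) \<in> borel_measurable (unif \<Otimes>\<^sub>M PU R)"
          using measurable_fst[of unif "PU R"] by simp
        show "(\<lambda>p. if fst p < snd p i then 1 else 0 :: ennreal) \<in> borel_measurable (unif \<Otimes>\<^sub>M PU R)"
          by measurable
      qed
      then show "(\<lambda>(y, r). \<Prod>i\<in>R. indicator {y<..} (r i) :: ennreal) \<in> borel_measurable (unif \<Otimes>\<^sub>M PU R)"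
        by (simp add: case_prod_unfold indicator_def)
    qed
    moreover have "(\<lambda>y. ennreal y ^ k) \<in> borel_measurable borel" by measurable
    then have "(\<lambda>y. ennreal y ^ k) \<in> borel_measurable unif"
      by (simp add: measurable_cong_sets[OF sets_unif refl])
    ultimately show "(\<lambda>y. cfac R y * ennreal y ^ k) \<in> borel_measurable unif"
      by (rule borel_measurable_times_ennreal)
  qed
  finally show ?thesis unfolding R_def .
qed

text \<open>Given the \<open>(k+1)\<close>-st smallest of \<open>n\<close> independent uniform variables, the smaller ones divided by it
  are independent and uniform.\<close>

lemma below_sum_law:
  assumes k: "k < n" and A [measurable]: "A \<in> sets borel"
  shows "emeasure (PU {..<n}) {w \<in> space (PU {..<n}). below_sum \<xi> n k w \<in> A}
    = emeasure (PU {..<k}) {w \<in> space (PU {..<k}). (\<Sum>i<k. \<xi> (w i)) \<in> A}"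
proof -
  \<comment> \<open>The possible pairs of a pivot index and a set of smaller indices. By
    \<open>conf_unique\<close> and \<open>AE_PU_conf\<close> exactly one of them occurs, almost
    surely.\<close>
  define F where "F = (SIGMA j:{..<n}. {S. S \<subseteq> {..<n} - {j} \<and> card S = k})"
  have finF: "finite F" unfolding F_def
    by (intro finite_SigmaI finite_Collect_conjI disjI1) auto
  define c where "c p = (\<integral>\<^sup>+y. cfac ({..<n} - insert (fst p) (snd p)) y * ennreal y ^ k \<partial>unif)" for p :: "nat \<times> nat set"
  have main: "emeasure (PU {..<n}) {w \<in> space (PU {..<n}). below_sum \<xi> n k w \<in> A} = (\<Sum>p\<in>F. c p) * Q {..<k} A"
    if A [measurable]: "A \<in> sets borel" for A
  proof -
    let ?f = "\<lambda>p w. indicator {w. conf w n k (fst p) (snd p) \<and> (\<Sum>i\<in>snd p. \<xi> (w i / w (fst p))) \<in> A} w :: ennreal"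
    have "emeasure (PU {..<n}) {w \<in> space (PU {..<n}). below_sum \<xi> n k w \<in> A}
      = (\<integral>\<^sup>+w. indicator {w \<in> space (PU {..<n}). below_sum \<xi> n k w \<in> A} w \<partial>PU {..<n})"
      by (rule nn_integral_indicator[symmetric]) measurable
    also have "\<dots> = (\<integral>\<^sup>+w. (\<Sum>p\<in>F. ?f p w) \<partial>PU {..<n})"
    proof (rule nn_integral_cong_AE, use AE_PU_conf[OF k] AE_space in eventually_elim)
      fix w assume w: "(\<forall>i<n. 0 < w i \<and> w i < 1) \<and> (\<exists>j S. conf w n k j S)" "w \<in> space (PU {..<n})"
      then obtain j S where c: "conf w n k j S" by blast
      have pF: "(j, S) \<in> F" using c by (auto simp: F_def conf_def)
      have "(\<Sum>p\<in>F. ?f p w) = (\<Sum>p\<in>{(j, S)}. ?f p w)"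
      proof (rule sum.mono_neutral_right[OF finF])
        show "\<forall>p\<in>F - {(j, S)}. ?f p w = 0"
          using conf_unique[OF c] by (auto simp: indicator_def)
      qed (use pF in auto)
      also have "\<dots> = indicator {w \<in> space (PU {..<n}). below_sum \<xi> n k w \<in> A} w"
        using c w conf_below_sum[OF c, of \<xi>] by (simp add: indicator_def)
      finally show "indicator {w \<in> space (PU {..<n}). below_sum \<xi> n k w \<in> A} w = (\<Sum>p\<in>F. ?f p w)" ..
    qed
    also have "\<dots> = (\<Sum>p\<in>F. \<integral>\<^sup>+w. ?f p w \<partial>PU {..<n})"
    proof (rule nn_integral_sum)
      fix p assume "p \<in> F"
      then have S: "snd p \<subseteq> {..<n}" "fst p < n" by (auto simp: F_def)
      have comp [measurable]: "i \<in> {..<n} \<Longrightarrow> (\<lambda>w. w i) \<in> borel_measurable (PU {..<n})" for i by (rule PU_component)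
      have 1: "(\<lambda>w. \<Sum>i\<in>snd p. \<xi> (w i / w (fst p))) \<in> borel_measurable (PU {..<n})"
        by (intro borel_measurable_sum measurable_compose[OF _ \<xi>] borel_measurable_divide comp) (use S in auto)
      have "{w \<in> space (PU {..<n}). (\<forall>i\<in>snd p. w i < w (fst p)) \<and> (\<forall>i\<in>{..<n} - insert (fst p) (snd p). w (fst p) < w i) \<and>
           (\<Sum>i\<in>snd p. \<xi> (w i / w (fst p))) \<in> A} \<in> sets (PU {..<n})"
      proof (intro sets.sets_Collect_conj)
        show "{w \<in> space (PU {..<n}). \<forall>i\<in>snd p. w i < w (fst p)} \<in> sets (PU {..<n})"
          by (intro sets.sets_Collect_finite_All finite_subset[OF S(1)] borel_measurable_less comp) (use S in auto)
        show "{w \<in> space (PU {..<n}). \<forall>i\<in>{..<n} - insert (fst p) (snd p). w (fst p) < w i} \<in> sets (PU {..<n})"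
          by (intro sets.sets_Collect_finite_All borel_measurable_less comp) (use S in auto)
        show "{w \<in> space (PU {..<n}). (\<Sum>i\<in>snd p. \<xi> (w i / w (fst p))) \<in> A} \<in> sets (PU {..<n})"
          using measurable_sets[OF 1 A] by (simp add: vimage_def Int_def conj_commute)
      qed
      then have "(\<lambda>w. indicator {w \<in> space (PU {..<n}). (\<forall>i\<in>snd p. w i < w (fst p)) \<and> (\<forall>i\<in>{..<n} - insert (fst p) (snd p). w (fst p) < w i) \<and>
           (\<Sum>i\<in>snd p. \<xi> (w i / w (fst p))) \<in> A} w :: ennreal) \<in> borel_measurable (PU {..<n})" by simp
      then show "?f p \<in> borel_measurable (PU {..<n})"
        by (rule measurable_cong[THEN iffD1, rotated]) (use \<open>p \<in> F\<close> in \<open>auto simp: indicator_def conf_def F_def\<close>)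
    qed
    also have "\<dots> = (\<Sum>p\<in>F. c p * Q {..<k} A)"
    proof (rule sum.cong[OF refl])
      fix p assume "p \<in> F"
      then have p: "fst p < n" "snd p \<subseteq> {..<n} - {fst p}" "card (snd p) = k" by (auto simp: F_def)
      have "finite (snd p)" using finite_subset[OF p(2)] by simp
      with conf_integral[OF p A] Q_eq[OF _ p(3) A] show "(\<integral>\<^sup>+w. ?f p w \<partial>PU {..<n}) = c p * Q {..<k} A"
        by (simp add: c_def)
    qed
    finally show ?thesis by (simp add: sum_distrib_right)
  qed
  have sp: "emeasure (PU I) (space (PU I)) = 1" for I by (rule prob_space.emeasure_space_1[OF prob_space_PU])
  \<comment> \<open>Taking the whole line for \<open>A\<close> evaluates the total of the constants
    without any beta integral.\<close>
  have "(\<Sum>p\<in>F. c p) = 1" using main[of UNIV] sp by (simp add: Q_def)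
  with main[OF A] show ?thesis by (simp add: Q_def)
qed

end

section \<open>Asymptotic normality for a uniform sample\<close>

lemma integral_unif:
  assumes [measurable]: "f \<in> borel_measurable borel"
  shows "(\<integral>x. f x \<partial>unif) = (\<integral>x. indicator {0..1} x * f x \<partial>lborel)"
    and "integrable unif f \<longleftrightarrow> integrable lborel (\<lambda>x. indicator {0..1} x * f x :: real)"
proof -
  have u: "unif = density lborel (\<lambda>x. ennreal (indicator {0<..<1} x))"
    by (simp add: unif_def ennreal_indicator)
  have ae: "AE x in lborel. indicator {0<..<1} x * f x = indicator {0..1} x * f x"
    using AE_lborel_singleton[of 0] AE_lborel_singleton[of 1]
    by eventually_elim (auto simp: indicator_def)
  have "(\<integral>x. f x \<partial>unif) = (\<integral>x. indicator {0<..<1} x * f x \<partial>lborel)"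
    unfolding u by (subst integral_real_density) auto
  also have "\<dots> = (\<integral>x. indicator {0..1} x * f x \<partial>lborel)"
    by (rule integral_cong_AE) (use ae in auto)
  finally show "(\<integral>x. f x \<partial>unif) = (\<integral>x. indicator {0..1} x * f x \<partial>lborel)" .
  have "integrable unif f \<longleftrightarrow> integrable lborel (\<lambda>x. indicator {0<..<1} x * f x)"
    unfolding u by (subst integrable_real_density) auto
  also have "\<dots> \<longleftrightarrow> integrable lborel (\<lambda>x. indicator {0..1} x * f x)"
    by (rule integrable_cong_AE) (use ae in auto)
  finally show "integrable unif f \<longleftrightarrow> integrable lborel (\<lambda>x. indicator {0..1} x * f x)" .
qed

section \<open>Limit theorems for sums of bounded functions of uniform variables\<close>

lemma PU_indep: "prob_space.indep_vars (PU UNIV) (\<lambda>_. unif) (\<lambda>i \<omega>. \<omega> i) UNIV"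
proof -
  interpret prob_space "PU UNIV" by (rule prob_space_PU)
  have "distr (PU UNIV) unif (\<lambda>\<omega>. \<omega> i) = unif" for i
    by (rule distr_PiM_component) (auto intro: prob_space_unif)
  moreover have "distr (PU UNIV) (PU UNIV) (\<lambda>x. \<lambda>i\<in>UNIV. x i) = PU UNIV"
    by (simp add: restrict_def distr_id)
  ultimately show ?thesis
    by (subst indep_vars_iff_distr_eq_PiM) auto
qed

text \<open>The space \<open>PU {..<k}\<close> varies with k, while the central limit theorem wants
  an infinite sequence on a single space; an event about the first k coordinates has the same
  probability on both.\<close>

lemma measure_PU_initial:
  assumes "{w \<in> space (PU {..<k}). P w} \<in> sets (PU {..<k})"
    and "\<And>w. P (restrict w {..<k}) = P w"
  shows "measure (PU {..<k}) {w \<in> space (PU {..<k}). P w} = measure (PU UNIV) {w \<in> space (PU UNIV). P w}"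
proof -
  let ?r = "\<lambda>\<omega>. \<lambda>n\<in>{..<k}. \<omega> (id n)"
  have d: "distr (PU UNIV) (PU {..<k}) ?r = PU {..<k}" by (rule PU_reindex) auto
  have rm: "?r \<in> PU UNIV \<rightarrow>\<^sub>M PU {..<k}"
    by (rule measurable_restrict) (auto intro!: measurable_component_singleton)
  have "measure (PU {..<k}) {w \<in> space (PU {..<k}). P w}
    = measure (distr (PU UNIV) (PU {..<k}) ?r) {w \<in> space (PU {..<k}). P w}" unfolding d ..
  also have "\<dots> = measure (PU UNIV) (?r -` {w \<in> space (PU {..<k}). P w} \<inter> space (PU UNIV))"
    by (rule measure_distr[OF rm assms(1)])
  also have "?r -` {w \<in> space (PU {..<k}). P w} \<inter> space (PU UNIV) = {w \<in> space (PU UNIV). P w}"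
    using assms(2) measurable_space[OF rm] by auto
  finally show ?thesis .
qed

context
  fixes \<xi> :: "real \<Rightarrow> real" and K :: real
  assumes \<xi> [measurable]: "\<xi> \<in> borel_measurable borel"
    and bound: "\<And>v. 0 < v \<Longrightarrow> v < 1 \<Longrightarrow> \<bar>\<xi> v\<bar> \<le> K"
    and mean: "(\<integral>v. \<xi> v \<partial>unif) = 0"
begin

lemma sum_PU_measurable: "(\<lambda>w. \<Sum>i<k. \<xi> (w i)) \<in> borel_measurable (PU {..<k})"
  by (intro borel_measurable_sum measurable_compose[OF PU_component \<xi>]) auto

lemma component_measurable: "(\<lambda>\<omega>. \<xi> (\<omega> i)) \<in> borel_measurable (PU UNIV)"
  by (rule measurable_compose[OF PU_component \<xi>]) simp

lemma \<xi>_indep: "prob_space.indep_vars (PU UNIV) (\<lambda>_. borel) (\<lambda>i \<omega>. \<xi> (\<omega> i)) UNIV"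
proof -
  interpret prob_space "PU UNIV" by (rule prob_space_PU)
  have "\<xi> \<in> borel_measurable unif" by (simp add: measurable_cong_sets[OF sets_unif refl])
  then show ?thesis by (intro indep_vars_compose2[OF PU_indep]) simp
qed

lemma \<xi>_distr: "distr (PU UNIV) borel (\<lambda>\<omega>. \<xi> (\<omega> i)) = distr unif borel \<xi>"
proof -
  have "distr (PU UNIV) borel (\<lambda>\<omega>. \<xi> (\<omega> i)) = distr (distr (PU UNIV) unif (\<lambda>\<omega>. \<omega> i)) borel \<xi>"
    by (subst distr_distr) (auto simp: comp_def measurable_cong_sets[OF sets_unif refl])
  also have "distr (PU UNIV) unif (\<lambda>\<omega>. \<omega> i) = unif"
    by (rule distr_PiM_component) (auto intro: prob_space_unif)
  finally show ?thesis .
qed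

lemma \<xi>_integral:
  assumes [measurable]: "f \<in> borel_measurable borel"
  shows "(\<integral>\<omega>. f (\<xi> (\<omega> i)) \<partial>PU UNIV) = (\<integral>v. f (\<xi> v) \<partial>unif :: real)"
proof -
  note [measurable] = component_measurable
  have "(\<integral>\<omega>. f (\<xi> (\<omega> i)) \<partial>PU UNIV) = (\<integral>x. f x \<partial>distr (PU UNIV) borel (\<lambda>\<omega>. \<xi> (\<omega> i)))"
    by (rule integral_distr[symmetric]) auto
  also have "\<dots> = (\<integral>v. f (\<xi> v) \<partial>unif)"
    unfolding \<xi>_distr by (rule integral_distr) (auto simp: measurable_cong_sets[OF sets_unif refl])
  finally show ?thesis .
qed

lemma \<xi>_AE_bound: "AE \<omega> in PU UNIV. \<bar>\<xi> (\<omega> i)\<bar> \<le> K"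
proof -
  have "AE \<omega> in PU UNIV. 0 < \<omega> i \<and> \<omega> i < 1"
    by (rule AE_PiM_component[OF prob_space_unif _ AE_unif]) auto
  then show ?thesis by eventually_elim (use bound in auto)
qed

lemma K_nonneg: "0 \<le> K"
  using bound[of "1/2"] by linarith

lemma clt_PU:
  assumes var: "(\<integral>v. (\<xi> v)\<^sup>2 \<partial>unif) = \<sigma>\<^sup>2" and \<sigma>: "0 < \<sigma>"
  shows "(\<lambda>k. measure (PU {..<k}) {w \<in> space (PU {..<k}). (\<Sum>i<k. \<xi> (w i)) \<le> sqrt (real k) * y})
    \<longlonglongrightarrow> cdf std_normal_distribution (y / \<sigma>)"
proof -
  note [measurable] = sum_PU_measurable component_measurable
  interpret prob_space "PU UNIV" by (rule prob_space_PU)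
  have int2: "integrable (PU UNIV) (\<lambda>\<omega>. (\<xi> (\<omega> i))\<^sup>2)" for i
  proof (rule integrable_const_bound[where B = "K\<^sup>2"])
    show "AE \<omega> in PU UNIV. norm ((\<xi> (\<omega> i))\<^sup>2) \<le> K\<^sup>2"
      using \<xi>_AE_bound[of i]
      by eventually_elim (metis K_nonneg abs_le_square_iff abs_of_nonneg norm_power power2_abs real_norm_def)
  qed measurable
  have "weak_conv_m (\<lambda>n. distr (PU UNIV) borel (\<lambda>x. (\<Sum>i<n. \<xi> (x i)) / sqrt (real n * \<sigma>\<^sup>2))) std_normal_distribution"
  proof (rule central_limit_theorem_zero_mean[OF \<xi>_indep _ \<sigma> int2 _ \<xi>_distr])
    show m: "expectation (\<lambda>\<omega>. \<xi> (\<omega> n)) = 0" for n using \<xi>_integral[of "\<lambda>x. x" n] mean by simp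
    show "variance (\<lambda>\<omega>. \<xi> (\<omega> n)) = \<sigma>\<^sup>2" for n
      unfolding m using \<xi>_integral[of "\<lambda>x. x\<^sup>2" n] var by simp
  qed
  moreover interpret N: real_distribution std_normal_distribution by (rule real_dist_normal_dist)
  have "isCont (cdf std_normal_distribution) z" for z
    unfolding N.isCont_cdf measure_def by (subst emeasure_density) (auto simp: nn_integral_indicator_finite)
  ultimately have lim: "(\<lambda>n. cdf (distr (PU UNIV) borel (\<lambda>x. (\<Sum>i<n. \<xi> (x i)) / sqrt (real n * \<sigma>\<^sup>2))) (y / \<sigma>))
      \<longlonglongrightarrow> cdf std_normal_distribution (y / \<sigma>)"
    unfolding weak_conv_m_def weak_conv_def by blast
  have "eventually (\<lambda>n. cdf (distr (PU UNIV) borel (\<lambda>x. (\<Sum>i<n. \<xi> (x i)) / sqrt (real n * \<sigma>\<^sup>2))) (y / \<sigma>)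
      = measure (PU {..<n}) {w \<in> space (PU {..<n}). (\<Sum>i<n. \<xi> (w i)) \<le> sqrt (real n) * y}) sequentially"
    using eventually_gt_at_top[of 0]
  proof eventually_elim
    case (elim n)
    have "cdf (distr (PU UNIV) borel (\<lambda>x. (\<Sum>i<n. \<xi> (x i)) / sqrt (real n * \<sigma>\<^sup>2))) (y / \<sigma>)
      = measure (PU UNIV) {x \<in> space (PU UNIV). (\<Sum>i<n. \<xi> (x i)) / sqrt (real n * \<sigma>\<^sup>2) \<le> y / \<sigma>}"
      unfolding cdf_def by (subst measure_distr) (auto intro!: arg_cong[where f="measure (PU UNIV)"])
    also have "{x \<in> space (PU UNIV). (\<Sum>i<n. \<xi> (x i)) / sqrt (real n * \<sigma>\<^sup>2) \<le> y / \<sigma>}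
      = {x \<in> space (PU UNIV). (\<Sum>i<n. \<xi> (x i)) \<le> sqrt (real n) * y}"
    proof -
      have "s / sqrt (real n * \<sigma>\<^sup>2) \<le> y / \<sigma> \<longleftrightarrow> s \<le> sqrt (real n) * y" for s
      proof -
        have "sqrt (real n * \<sigma>\<^sup>2) = sqrt (real n) * \<sigma>" using \<sigma> by (simp add: real_sqrt_mult)
        then have "s / sqrt (real n * \<sigma>\<^sup>2) \<le> y / \<sigma> \<longleftrightarrow> s \<le> y / \<sigma> * (sqrt (real n) * \<sigma>)"
          using elim \<sigma> by (simp add: pos_divide_le_eq)
        also have "y / \<sigma> * (sqrt (real n) * \<sigma>) = sqrt (real n) * y" using \<sigma> by simp
        finally show ?thesis .
      qed
      then show ?thesis by simp
    qed
    also have "measure (PU UNIV) {x \<in> space (PU UNIV). (\<Sum>i<n. \<xi> (x i)) \<le> sqrt (real n) * y}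
      = measure (PU {..<n}) {w \<in> space (PU {..<n}). (\<Sum>i<n. \<xi> (w i)) \<le> sqrt (real n) * y}"
    proof (rule measure_PU_initial[symmetric])
      show "{w \<in> space (PU {..<n}). (\<Sum>i<n. \<xi> (w i)) \<le> sqrt (real n) * y} \<in> sets (PU {..<n})" by measurable
      show "((\<Sum>i<n. \<xi> (restrict w {..<n} i)) \<le> sqrt (real n) * y) = ((\<Sum>i<n. \<xi> (w i)) \<le> sqrt (real n) * y)" for w
        by (intro arg_cong[where f="\<lambda>s. s \<le> sqrt (real n) * y"] sum.cong) auto
    qed
    finally show ?case .
  qed
  with lim show ?thesis by (rule Lim_transform_eventually)
qed

lemma hoeffding_PU:
  assumes k: "0 < k" and \<epsilon>: "0 \<le> \<epsilon>" and K: "0 < K"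
  shows "measure (PU {..<k}) {w \<in> space (PU {..<k}). \<epsilon> \<le> \<bar>\<Sum>i<k. \<xi> (w i)\<bar>} \<le> 2 * exp (- \<epsilon>\<^sup>2 / (2 * real k * K\<^sup>2))"
proof -
  note [measurable] = sum_PU_measurable component_measurable
  interpret prob_space "PU UNIV" by (rule prob_space_PU)
  interpret H: Hoeffding_ineq "PU UNIV" "{..<k}" "\<lambda>i \<omega>. \<xi> (\<omega> i)" "\<lambda>_. -K" "\<lambda>_. K" 0
  proof unfold_locales
    show "indep_vars (\<lambda>_. borel) (\<lambda>i \<omega>. \<xi> (\<omega> i)) {..<k}" by (rule indep_vars_subset[OF \<xi>_indep]) simp
    show "AE x in PU UNIV. \<xi> (x i) \<in> {- K..K}" for i
      using \<xi>_AE_bound[of i] by eventually_elim auto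
    have "expectation (\<lambda>\<omega>. \<xi> (\<omega> i)) = 0" for i using \<xi>_integral[of "\<lambda>x. x" i] mean by simp
    then show "0 \<equiv> \<Sum>i<k. expectation (\<lambda>\<omega>. \<xi> (\<omega> i))" by simp
  qed auto
  have "measure (PU {..<k}) {w \<in> space (PU {..<k}). \<epsilon> \<le> \<bar>\<Sum>i<k. \<xi> (w i)\<bar>}
    = prob {w \<in> space (PU UNIV). \<epsilon> \<le> \<bar>\<Sum>i<k. \<xi> (w i)\<bar>}"
  proof (rule measure_PU_initial)
    show "{w \<in> space (PU {..<k}). \<epsilon> \<le> \<bar>\<Sum>i<k. \<xi> (w i)\<bar>} \<in> sets (PU {..<k})" by measurable
    show "(\<epsilon> \<le> \<bar>\<Sum>i<k. \<xi> (restrict w {..<k} i)\<bar>) = (\<epsilon> \<le> \<bar>\<Sum>i<k. \<xi> (w i)\<bar>)" for w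
      by (intro arg_cong[where f="\<lambda>s. \<epsilon> \<le> \<bar>s\<bar>"] sum.cong) auto
  qed
  also have "\<dots> \<le> 2 * exp (-2 * \<epsilon>\<^sup>2 / (\<Sum>i<k. (K - (- K))\<^sup>2))"
    using H.Hoeffding_ineq_abs_ge[OF \<epsilon>] K k by simp
  also have "(\<Sum>i<k. (K - (- K))\<^sup>2) = 4 * real k * K\<^sup>2" by (simp add: power2_eq_square)
  also have "-2 * \<epsilon>\<^sup>2 / (4 * real k * K\<^sup>2) = - \<epsilon>\<^sup>2 / (2 * real k * K\<^sup>2)" by simp
  finally show ?thesis .
qed

text \<open>The scale k^(3/4) is above the fluctuations of order k^(1/2), so Hoeffding gives a bound
  exp (- c k^(1/2)). Divided by k it becomes k^(-1/4), whose square is still balanced by the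
  normalisation k^(1/2); quadratic remainders thus stay under control.\<close>

lemma tight_PU:
  assumes \<eta>: "0 < \<eta>"
  shows "(\<lambda>k. measure (PU {..<k}) {w \<in> space (PU {..<k}). \<eta> * real k powr (3/4) \<le> \<bar>\<Sum>i<k. \<xi> (w i)\<bar>}) \<longlonglongrightarrow> 0"
proof (cases "0 < K")
  case True
  define c where "c = \<eta>\<^sup>2 / (2 * K\<^sup>2)"
  have c: "0 < c" using True \<eta> by (simp add: c_def)
  have "eventually (\<lambda>k. measure (PU {..<k}) {w \<in> space (PU {..<k}). \<eta> * real k powr (3/4) \<le> \<bar>\<Sum>i<k. \<xi> (w i)\<bar>}
     \<le> 2 * exp (- c * sqrt (real k))) sequentially"
    using eventually_gt_at_top[of 0]
  proof eventually_elim
    case (elim k)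
    have "measure (PU {..<k}) {w \<in> space (PU {..<k}). \<eta> * real k powr (3/4) \<le> \<bar>\<Sum>i<k. \<xi> (w i)\<bar>}
      \<le> 2 * exp (- (\<eta> * real k powr (3/4))\<^sup>2 / (2 * real k * K\<^sup>2))"
      using elim \<eta> True by (intro hoeffding_PU) auto
    also have "- (\<eta> * real k powr (3/4))\<^sup>2 / (2 * real k * K\<^sup>2) = - c * sqrt (real k)"
    proof -
      have "(real k powr (3/4))\<^sup>2 = real k powr (3/2)" by (simp add: power2_eq_square powr_add[symmetric])
      also have "\<dots> = real k powr (1 + 1/2)" by simp
      also have "\<dots> = real k * sqrt (real k)" by (subst powr_add) (simp add: powr_half_sqrt)
      finally show ?thesis using elim by (simp add: power_mult_distrib c_def)
    qed
    finally show ?case .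
  qed
  note ev = this
  have lim: "(\<lambda>k. 2 * exp (- c * sqrt (real k))) \<longlonglongrightarrow> 0" using c by real_asymp
  show ?thesis by (rule tendsto_sandwich[OF _ ev tendsto_const lim]) simp
next
  case False
  then have K: "K = 0" using K_nonneg by simp
  have "eventually (\<lambda>k. measure (PU {..<k}) {w \<in> space (PU {..<k}). \<eta> * real k powr (3/4) \<le> \<bar>\<Sum>i<k. \<xi> (w i)\<bar>} = 0) sequentially"
    using eventually_gt_at_top[of 0]
  proof eventually_elim
    case (elim k)
    have "AE w in PU {..<k}. w \<notin> {w \<in> space (PU {..<k}). \<eta> * real k powr (3/4) \<le> \<bar>\<Sum>i<k. \<xi> (w i)\<bar>}"
      using AE_PU_unit[OF finite_lessThan, of k]
    proof eventually_elim
      case w: (elim w)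
      have "(\<Sum>i<k. \<xi> (w i)) = 0" using w bound K by (intro sum.neutral) auto
      moreover have "0 < \<eta> * real k powr (3/4)" using \<eta> elim by simp
      ultimately show ?case by auto
    qed
    then have "measure (PU {..<k}) {w \<in> space (PU {..<k}). \<eta> * real k powr (3/4) \<le> \<bar>\<Sum>i<k. \<xi> (w i)\<bar>} = measure (PU {..<k}) {}"
      by (intro measure_eq_AE) auto
    then show ?case by simp
  qed
  then show ?thesis by (simp add: tendsto_eventually)
qed

end

section \<open>Moments of powers of a uniform variable\<close>

definition pw :: "real \<Rightarrow> real \<Rightarrow> real" where
  "pw \<rho> v = v powr (1 / \<rho>)"

lemma pw_measurable [measurable]: "pw \<rho> \<in> borel_measurable borel"
  unfolding pw_def[abs_def] by measurable

lemma integral_pw: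
  assumes \<rho>: "0 < \<rho>"
  shows "integrable unif (\<lambda>v. pw \<rho> v ^ j)" "(\<integral>v. pw \<rho> v ^ j \<partial>unif) = \<rho> / (\<rho> + real j)"
proof -
  have eq: "indicator {0..1} v * pw \<rho> v ^ j = indicator {0..1} v * v powr (real j / \<rho>)" if "v \<noteq> 0" for v
  proof (cases "v \<in> {0..1}")
    case True
    then have "0 < v" using that by simp
    then have "pw \<rho> v ^ j = (v powr (1 / \<rho>)) powr real j" unfolding pw_def by (subst powr_realpow) auto
    also have "\<dots> = v powr (real j / \<rho>)" by (simp add: powr_powr)
    finally show ?thesis by simp
  qed simp
  have ae: "AE v in lborel. indicator {0..1} v * pw \<rho> v ^ j = indicator {0..1} v * v powr (real j / \<rho>)"
    using AE_lborel_singleton[of 0] by eventually_elim (rule eq)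
  have j: "0 \<le> real j / \<rho>" using \<rho> by simp
  have "integrable lborel (\<lambda>v. indicator {0..1} v * pw \<rho> v ^ j)"
  proof (rule integrable_cong_AE_imp[OF integral_powr_unit(1)[OF j]])
    show "(\<lambda>v. indicator {0..1} v * pw \<rho> v ^ j) \<in> borel_measurable lborel" by measurable
    show "AE v in lborel. indicator {0..1} v * v powr (real j / \<rho>) = indicator {0..1} v * pw \<rho> v ^ j"
      using ae by eventually_elim (rule sym)
  qed
  then show "integrable unif (\<lambda>v. pw \<rho> v ^ j)" by (subst integral_unif(2)) auto
  have "(\<integral>v. pw \<rho> v ^ j \<partial>unif) = (\<integral>v. indicator {0..1} v * pw \<rho> v ^ j \<partial>lborel)"
    by (rule integral_unif) measurable
  also have "\<dots> = (\<integral>v. indicator {0..1} v * v powr (real j / \<rho>) \<partial>lborel)"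
    by (rule integral_cong_AE[OF _ _ ae]) measurable
  also have "\<dots> = 1 / (real j / \<rho> + 1)" by (rule integral_powr_unit(2)[OF j])
  also have "\<dots> = \<rho> / (\<rho> + real j)" using \<rho> by (simp add: field_simps)
  finally show "(\<integral>v. pw \<rho> v ^ j \<partial>unif) = \<rho> / (\<rho> + real j)" .
qed

text \<open>Degree 4 because \<open>infl\<close> is quadratic in \<open>pw\<close> and its square is
  integrated for the variance.\<close>

lemma integral_pw_poly:
  assumes \<rho>: "0 < \<rho>"
  shows "(\<integral>v. c0 + c1 * pw \<rho> v + c2 * (pw \<rho> v)\<^sup>2 + c3 * (pw \<rho> v) ^ 3 + c4 * (pw \<rho> v) ^ 4 \<partial>unif)
    = c0 + c1 * (\<rho> / (\<rho> + 1)) + c2 * (\<rho> / (\<rho> + 2)) + c3 * (\<rho> / (\<rho> + 3)) + c4 * (\<rho> / (\<rho> + 4))"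
proof -
  note i = integral_pw[OF \<rho>]
  have 1: "integrable unif (\<lambda>v. pw \<rho> v)" "(\<integral>v. pw \<rho> v \<partial>unif) = \<rho> / (\<rho> + 1)"
    using i[of 1] by simp_all
  have sp: "measure unif UNIV = 1" using unif.prob_space by simp
  show ?thesis
    using i[of 2] i[of 3] i[of 4] 1 sp by (simp add: unif.prob_space)
qed

text \<open>The linearization of the estimator: to first order its error is the mean of \<open>infl \<rho>\<close> over the \<open>k\<close> smallest
  uniform variables divided by the next one.\<close>

definition infl :: "real \<Rightarrow> real \<Rightarrow> real" where
  "infl \<rho> v = (\<rho> + 1)\<^sup>2 * (\<rho> + 2) * ((1 + \<rho> / 2) * (1 - pw \<rho> v)\<^sup>2 - 2 * (1 - pw \<rho> v) + 1 / (\<rho> + 1))"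

lemma infl_measurable [measurable]: "infl \<rho> \<in> borel_measurable borel"
  unfolding infl_def[abs_def] by measurable

lemma pw_range:
  assumes "0 < \<rho>" "0 < v" "v < 1"
  shows "0 < pw \<rho> v" "pw \<rho> v < 1"
  using assms powr_less_mono2[of "1 / \<rho>" v 1] by (auto simp: pw_def)

lemma infl_eq:
  "infl \<rho> v = (\<rho> + 1)\<^sup>2 * (\<rho> + 2) *
     ((\<rho> / 2 - 1 + 1 / (\<rho> + 1)) + (- \<rho>) * pw \<rho> v + (1 + \<rho> / 2) * (pw \<rho> v)\<^sup>2)"
proof -
  have "(1 + \<rho> / 2) * (1 - p)\<^sup>2 - 2 * (1 - p) + c = (\<rho> / 2 - 1 + c) + (- \<rho>) * p + (1 + \<rho> / 2) * p\<^sup>2" for p c :: real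
    by (simp add: power2_eq_square algebra_simps)
  then show ?thesis unfolding infl_def by (simp only:)
qed

lemma infl_mean:
  assumes "0 < \<rho>"
  shows "(\<integral>v. infl \<rho> v \<partial>unif) = 0"
proof -
  have "(\<integral>v. (\<rho> / 2 - 1 + 1 / (\<rho> + 1)) + (- \<rho>) * pw \<rho> v + (1 + \<rho> / 2) * (pw \<rho> v)\<^sup>2 + 0 * (pw \<rho> v) ^ 3 + 0 * (pw \<rho> v) ^ 4 \<partial>unif)
    = (\<rho> / 2 - 1 + 1 / (\<rho> + 1)) + (- \<rho>) * (\<rho> / (\<rho> + 1)) + (1 + \<rho> / 2) * (\<rho> / (\<rho> + 2)) + 0 * (\<rho> / (\<rho> + 3)) + 0 * (\<rho> / (\<rho> + 4))"
    by (rule integral_pw_poly[OF assms])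
  also have "\<dots> = 0"
    using assms by (simp add: divide_simps) (simp add: algebra_simps)
  finally have "(\<integral>v. (\<rho> / 2 - 1 + 1 / (\<rho> + 1)) + (- \<rho>) * pw \<rho> v + (1 + \<rho> / 2) * (pw \<rho> v)\<^sup>2 \<partial>unif) = 0"
    by (simp only: mult_zero_left add_0_right)
  then show ?thesis unfolding infl_eq by (simp only: integral_mult_right_zero mult_zero_right)
qed

lemma infl_variance:
  assumes "0 < \<rho>"
  shows "(\<integral>v. (infl \<rho> v)\<^sup>2 \<partial>unif) = asymp_variance \<rho>"
proof -
  define A B C where "A = 1 + \<rho> / 2" and "B = - \<rho>" and "C = \<rho> / 2 - 1 + 1 / (\<rho> + 1)"
  define k where "k = (\<rho> + 1)\<^sup>2 * (\<rho> + 2)"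
  have "(infl \<rho> v)\<^sup>2 = k\<^sup>2 * (C\<^sup>2 + (2 * B * C) * pw \<rho> v + (B\<^sup>2 + 2 * A * C) * (pw \<rho> v)\<^sup>2
     + (2 * A * B) * (pw \<rho> v) ^ 3 + A\<^sup>2 * (pw \<rho> v) ^ 4)" for v
  proof -
    have "(infl \<rho> v)\<^sup>2 = k\<^sup>2 * (C + B * pw \<rho> v + A * (pw \<rho> v)\<^sup>2)\<^sup>2"
      unfolding infl_eq A_def B_def C_def k_def by (simp only: power_mult_distrib)
    also have "(C + B * pw \<rho> v + A * (pw \<rho> v)\<^sup>2)\<^sup>2 = C\<^sup>2 + (2 * B * C) * pw \<rho> v + (B\<^sup>2 + 2 * A * C) * (pw \<rho> v)\<^sup>2
     + (2 * A * B) * (pw \<rho> v) ^ 3 + A\<^sup>2 * (pw \<rho> v) ^ 4" by algebra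
    finally show ?thesis .
  qed
  then have "(\<integral>v. (infl \<rho> v)\<^sup>2 \<partial>unif) = k\<^sup>2 * (C\<^sup>2 + 2 * B * C * (\<rho> / (\<rho> + 1)) + (B\<^sup>2 + 2 * A * C) * (\<rho> / (\<rho> + 2))
      + 2 * A * B * (\<rho> / (\<rho> + 3)) + A\<^sup>2 * (\<rho> / (\<rho> + 4)))"
    by (simp only: integral_mult_right_zero integral_pw_poly[OF assms])
  also have "\<dots> = asymp_variance \<rho>"
  proof -
    have nz: "\<rho> + 1 \<noteq> 0" "\<rho> + 2 \<noteq> 0" "\<rho> + 3 \<noteq> 0" "\<rho> + 4 \<noteq> 0" using assms by auto
    have C: "C = (\<rho>\<^sup>2 - \<rho>) / (2 * (\<rho> + 1))" unfolding C_def using nz by (simp add: field_simps power2_eq_square)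
    show ?thesis unfolding A_def B_def C k_def asymp_variance_def using nz
      by (simp add: divide_simps add.commute[of 1 \<rho>] add.commute[of 2 \<rho>] add.commute[of 3 \<rho>] add.commute[of 4 \<rho>]) algebra
  qed
  finally show ?thesis .
qed

text \<open>As \<open>\<mu>2 / 2 - \<mu>1\<^sup>2 = - 1 / \<kappa>\<close>, the denominators in \<open>T\<close> have a fixed sign, and clearing them turns \<open>r * (T - \<rho>) \<le> y\<close>
  into a polynomial inequality in the moments.\<close>

lemma moment_estimate:
  fixes \<rho> y h c m1 m2 p1 p2 \<epsilon> r q :: real
  defines "\<kappa> \<equiv> (\<rho> + 1)\<^sup>2 * (\<rho> + 2)"
    and "\<mu>1 \<equiv> 1 / (\<rho> + 1)" and "\<mu>2 \<equiv> 2 / ((\<rho> + 1) * (\<rho> + 2))"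
    and "T \<equiv> - inverse (c * m1 + 1 - 1 / 2 * inverse (1 - m1\<^sup>2 / m2))"
  defines "L \<equiv> \<kappa> * r * ((1 + \<rho> / 2) * p2 - 2 * p1 + 1 / (\<rho> + 1))"
    and "C \<equiv> \<kappa> * (8 + 6 * \<rho> + 7 * \<bar>y\<bar>)"
  assumes \<rho>: "0 < \<rho>" and r: "1 \<le> r" and q: "0 \<le> q" "q \<le> 1" "r * q\<^sup>2 \<le> 1"
    and h: "0 \<le> h" "h \<le> 1" "7 * \<kappa> * h < 1" "7 * \<kappa> * h < \<rho>"
    and p1: "\<bar>p1 - \<mu>1\<bar> \<le> h * q" and p2: "\<bar>p2 - \<mu>2\<bar> \<le> h * q"
    and m1: "\<bar>m1 - p1\<bar> \<le> \<epsilon>" and m2: "\<bar>m2 - p2\<bar> \<le> 2 * \<epsilon>"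
    and range: "0 \<le> m1" "m1 \<le> 1" "0 \<le> m2" "m2 \<le> 1"
    and c: "0 \<le> c" "c \<le> \<epsilon>" and \<epsilon>: "r * \<epsilon> \<le> h" and ry: "\<bar>y\<bar> < r * \<rho>"
  shows "r * (T - \<rho>) \<le> y \<Longrightarrow> L \<le> y + C * h"
    and "L \<le> y - C * h \<Longrightarrow> r * (T - \<rho>) \<le> y"
proof -
  have \<kappa>: "0 < \<kappa>" using \<rho> by (simp add: \<kappa>_def)
  have nz: "\<rho> + 1 \<noteq> 0" "\<rho> + 2 \<noteq> 0" using \<rho> by auto
  have \<epsilon>0: "0 \<le> \<epsilon>" using c by linarith
  have "1 * \<epsilon> \<le> r * \<epsilon>" using r \<epsilon>0 by (rule mult_right_mono)
  then have \<epsilon>h: "\<epsilon> \<le> h" using \<epsilon> by linarith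
  have hq: "h * q \<le> h" using mult_left_mono[OF q(2) h(1)] by simp
  define D where "D = m2 - m1\<^sup>2"
  define E where "E = m2 / 2 - m1\<^sup>2"
  have \<mu>1r: "0 < \<mu>1" "\<mu>1 \<le> 1" using \<rho> by (auto simp: \<mu>1_def field_simps)
  have dm1: "\<bar>m1 - \<mu>1\<bar> \<le> h * q + \<epsilon>" using m1 p1 by linarith
  have dm2: "\<bar>m2 - \<mu>2\<bar> \<le> h * q + 2 * \<epsilon>" using m2 p2 by linarith
  have sq: "\<bar>m1\<^sup>2 - \<mu>1\<^sup>2\<bar> \<le> 2 * (h * q) + 2 * \<epsilon>"
  proof -
    have "\<bar>m1\<^sup>2 - \<mu>1\<^sup>2\<bar> = \<bar>m1 - \<mu>1\<bar> * \<bar>m1 + \<mu>1\<bar>"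
      by (simp add: abs_mult[symmetric] power2_eq_square algebra_simps)
    also have "\<dots> \<le> (h * q + \<epsilon>) * 2"
      using dm1 range \<mu>1r by (intro mult_mono) auto
    finally show ?thesis by simp
  qed
  have D\<mu>: "\<mu>2 - \<mu>1\<^sup>2 = \<rho> / \<kappa>" and E\<mu>: "\<mu>2 / 2 - \<mu>1\<^sup>2 = - 1 / \<kappa>"
    using nz by (simp_all add: \<mu>1_def \<mu>2_def \<kappa>_def divide_simps) (simp_all add: power2_eq_square algebra_simps)
  \<comment> \<open>The errors 4 h in the squared first moment and 3 h in the second add up to 7 h,
    so 7 \<kappa> h < \<rho> keeps \<open>D\<close> positive. For \<open>E\<close> the error is 4 h
    + 3/2 h, and the term with \<open>c\<close> adds at most h, so 7 \<kappa> h < 1 keeps the sum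
    negative.\<close>
  have sq': "m1\<^sup>2 \<le> \<mu>1\<^sup>2 + 4 * h" "\<mu>1\<^sup>2 - 4 * h \<le> m1\<^sup>2"
    using hq \<epsilon>h abs_le_D1[OF sq] abs_le_D2[OF sq] by linarith+
  have dm2': "m2 \<le> \<mu>2 + 3 * h" "\<mu>2 - 3 * h \<le> m2"
    using hq \<epsilon>h abs_le_D1[OF dm2] abs_le_D2[OF dm2] by linarith+
  have "\<rho> / \<kappa> - 7 * h \<le> D"
    unfolding D\<mu>[symmetric] D_def using sq' dm2' by linarith
  moreover have "7 * h < \<rho> / \<kappa>" using h \<kappa> by (simp add: field_simps)
  ultimately have Dpos: "0 < D" by linarith
  have Em: "\<bar>E + 1 / \<kappa>\<bar> \<le> 11/2 * h"
  proof -
    have "1 / \<kappa> = \<mu>1\<^sup>2 - \<mu>2 / 2" using E\<mu> by simp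
    then show ?thesis unfolding E_def abs_le_iff using sq' dm2' by linarith
  qed
  have m2pos: "0 < m2" using Dpos by (simp add: D_def) (smt (verit) zero_le_power2)
  have D1: "D \<le> 1" using range by (simp add: D_def) (smt (verit) zero_le_power2)
  have cmD: "0 \<le> c * m1 * D" "c * m1 * D \<le> c"
  proof -
    show "0 \<le> c * m1 * D" using c range Dpos by simp
    have "m1 * D \<le> 1 * 1" using range Dpos D1 by (intro mult_mono) auto
    then have "c * (m1 * D) \<le> c * 1" using c by (intro mult_left_mono) auto
    then show "c * m1 * D \<le> c" by (simp add: mult.assoc)
  qed
  define G where "G = c * m1 + 1 - 1 / 2 * inverse (1 - m1\<^sup>2 / m2)"
  have GD: "G * D = c * m1 * D + E"
  proof -
    have "inverse (1 - m1\<^sup>2 / m2) = m2 / D" using m2pos by (simp add: D_def field_simps)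
    then have "G * D = c * m1 * D + D - m2 / 2" using Dpos unfolding G_def by (simp add: algebra_simps)
    then show ?thesis by (simp add: D_def E_def)
  qed
  have "7 * h < 1 / \<kappa>" using h \<kappa> by (simp add: field_simps)
  then have "c * m1 * D + E < 0" using Em cmD \<epsilon>h c h by linarith
  then have "G * D < 0" unfolding GD .
  then have Gneg: "G < 0" using Dpos by (simp add: mult_less_0_iff)
  \<comment> \<open>The inequality to be decided is \<open>T \<le> y'\<close>; the hypothesis on
    \<bar>y\<bar> makes this bound positive, so that it can be multiplied by the negative
    \<open>G\<close>.\<close>
  define y' where "y' = \<rho> + y / r"
  have y': "0 < y'" "y' \<le> \<rho> + \<bar>y\<bar>"
  proof -
    have "- \<rho> < y / r" using ry r by (simp add: field_simps abs_less_iff)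
    then show "0 < y'" by (simp add: y'_def)
    have "y / r \<le> \<bar>y\<bar> / r" using r by (intro divide_right_mono) auto
    also have "\<bar>y\<bar> / r \<le> \<bar>y\<bar> / 1" using r by (intro divide_left_mono) auto
    finally show "y' \<le> \<rho> + \<bar>y\<bar>" by (simp add: y'_def)
  qed
  define N where "N = (1 + \<rho> / 2) * m2 - (1 + \<rho>) * m1\<^sup>2"
  define F where "F = N + y / r * E + y' * (c * m1 * D)"
  have iff: "r * (T - \<rho>) \<le> y \<longleftrightarrow> F \<le> 0"
  proof -
    have "r * (T - \<rho>) \<le> y \<longleftrightarrow> T \<le> y'" using r by (simp add: y'_def field_simps)
    also have "\<dots> \<longleftrightarrow> y' * G \<le> - 1"
      using Gneg unfolding T_def G_def[symmetric] by (simp add: field_simps)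
    also have "\<dots> \<longleftrightarrow> 1 + y' * G \<le> 0" by linarith
    also have "\<dots> \<longleftrightarrow> (1 + y' * G) * D \<le> 0" using Dpos by (simp add: mult_le_0_iff)
    also have "(1 + y' * G) * D = D + y' * (G * D)" by (simp add: algebra_simps)
    also have "\<dots> = D + y' * (c * m1 * D) + y' * E" unfolding GD by (simp add: algebra_simps)
    also have "\<dots> = F"
      unfolding F_def N_def by (simp add: y'_def D_def E_def algebra_simps)
    finally show ?thesis .
  qed
  \<comment> \<open>Since (1 + \<rho>) \<mu>1 = 1, completing the square at \<mu>1 turns the
    quadratic term into a linear one, up to a remainder in (m1 - \<mu>1)^2. This is the whole
    linearisation.\<close>
  have NL: "N - ((1 + \<rho> / 2) * p2 - 2 * p1 + 1 / (\<rho> + 1)) = (1 + \<rho> / 2) * (m2 - p2) - 2 * (m1 - p1) - (1 + \<rho>) * (m1 - \<mu>1)\<^sup>2"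
  proof -
    have 1: "(1 + \<rho>) * \<mu>1 = 1" using nz by (simp add: \<mu>1_def field_simps)
    have "(1 + \<rho>) * (m1 - \<mu>1)\<^sup>2 = (1 + \<rho>) * m1\<^sup>2 - 2 * m1 * ((1 + \<rho>) * \<mu>1) + ((1 + \<rho>) * \<mu>1) * \<mu>1"
      by (simp add: power2_eq_square algebra_simps)
    also have "\<dots> = (1 + \<rho>) * m1\<^sup>2 - 2 * m1 + 1 / (\<rho> + 1)" unfolding 1 by (simp add: \<mu>1_def)
    finally have X: "(1 + \<rho>) * (m1 - \<mu>1)\<^sup>2 = (1 + \<rho>) * m1\<^sup>2 - 2 * m1 + 1 / (\<rho> + 1)" .
    show ?thesis unfolding N_def X right_diff_distrib by linarith
  qed
  have a1: "r * \<bar>(1 + \<rho> / 2) * (m2 - p2) - 2 * (m1 - p1)\<bar> \<le> (4 + \<rho>) * h"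
  proof -
    have "\<bar>(1 + \<rho> / 2) * (m2 - p2) - 2 * (m1 - p1)\<bar> \<le> \<bar>(1 + \<rho> / 2) * (m2 - p2)\<bar> + \<bar>2 * (m1 - p1)\<bar>" by linarith
    also have "\<dots> = (1 + \<rho> / 2) * \<bar>m2 - p2\<bar> + 2 * \<bar>m1 - p1\<bar>" using \<rho> by (simp only: abs_mult)
    also have "\<dots> \<le> (1 + \<rho> / 2) * (2 * \<epsilon>) + 2 * \<epsilon>"
      using m1 m2 \<rho> by (intro add_mono mult_left_mono) auto
    also have "\<dots> = (4 + \<rho>) * \<epsilon>" by (simp add: algebra_simps)
    finally have "r * \<bar>(1 + \<rho> / 2) * (m2 - p2) - 2 * (m1 - p1)\<bar> \<le> r * ((4 + \<rho>) * \<epsilon>)" using r by (intro mult_left_mono) auto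
    also have "\<dots> = (4 + \<rho>) * (r * \<epsilon>)" by simp
    also have "\<dots> \<le> (4 + \<rho>) * h" using \<epsilon> \<rho> by (intro mult_left_mono) auto
    finally show ?thesis .
  qed
  have a2: "r * ((1 + \<rho>) * (m1 - \<mu>1)\<^sup>2) \<le> (1 + \<rho>) * (4 * h)"
  proof -
    have "(m1 - \<mu>1)\<^sup>2 \<le> (h * q + \<epsilon>)\<^sup>2" using dm1 by (metis abs_ge_zero order_trans power2_abs power_mono)
    also have "\<dots> \<le> 2 * (h * q)\<^sup>2 + 2 * \<epsilon>\<^sup>2"
      using sum_squares_bound[of "h * q" \<epsilon>] by (simp add: power2_sum)
    finally have "r * (m1 - \<mu>1)\<^sup>2 \<le> r * (2 * (h * q)\<^sup>2 + 2 * \<epsilon>\<^sup>2)" using r by (intro mult_left_mono) auto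
    also have "\<dots> = 2 * h\<^sup>2 * (r * q\<^sup>2) + 2 * ((r * \<epsilon>) * \<epsilon>)" by (simp add: power2_eq_square algebra_simps)
    also have "\<dots> \<le> 2 * h\<^sup>2 * 1 + 2 * (h * h)"
      using q \<epsilon> \<epsilon>h \<epsilon>0 h r by (intro add_mono mult_left_mono mult_mono) auto
    also have "\<dots> = 4 * (h * h)" by (simp add: power2_eq_square)
    also have "h * h \<le> h * 1" using h by (intro mult_left_mono) auto
    finally have "r * (m1 - \<mu>1)\<^sup>2 \<le> 4 * h" by simp
    then have "(1 + \<rho>) * (r * (m1 - \<mu>1)\<^sup>2) \<le> (1 + \<rho>) * (4 * h)" using \<rho> by (intro mult_left_mono) auto
    then show ?thesis by (simp add: mult_ac)
  qed
  have a3: "\<bar>y * (E + 1 / \<kappa>)\<bar> \<le> \<bar>y\<bar> * (11/2 * h)"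
    unfolding abs_mult using Em by (intro mult_left_mono) auto
  have a4: "0 \<le> r * (y' * (c * m1 * D))" "r * (y' * (c * m1 * D)) \<le> (\<rho> + \<bar>y\<bar>) * h"
  proof -
    show "0 \<le> r * (y' * (c * m1 * D))" using r y' cmD by simp
    have "r * (c * m1 * D) \<le> r * \<epsilon>" using cmD c r by (intro mult_left_mono) auto
    then have "r * (c * m1 * D) \<le> h" using \<epsilon> by linarith
    then have "y' * (r * (c * m1 * D)) \<le> (\<rho> + \<bar>y\<bar>) * h"
      using y' cmD r h by (intro mult_mono) auto
    then show "r * (y' * (c * m1 * D)) \<le> (\<rho> + \<bar>y\<bar>) * h" by (simp add: mult_ac)
  qed
  have "r * F - (r * ((1 + \<rho> / 2) * p2 - 2 * p1 + 1 / (\<rho> + 1)) - y / \<kappa>)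
    = r * ((1 + \<rho> / 2) * (m2 - p2) - 2 * (m1 - p1)) - r * ((1 + \<rho>) * (m1 - \<mu>1)\<^sup>2) + y * (E + 1 / \<kappa>) + r * (y' * (c * m1 * D))"
  proof -
    have "r * F = r * N + y * E + r * (y' * (c * m1 * D))" using r by (simp add: F_def algebra_simps)
    moreover have "r * N - r * ((1 + \<rho> / 2) * p2 - 2 * p1 + 1 / (\<rho> + 1)) = r * ((1 + \<rho> / 2) * (m2 - p2) - 2 * (m1 - p1)) - r * ((1 + \<rho>) * (m1 - \<mu>1)\<^sup>2)"
      unfolding right_diff_distrib[symmetric] NL ..
    ultimately show ?thesis by (simp add: algebra_simps)
  qed
  moreover have "\<bar>r * ((1 + \<rho> / 2) * (m2 - p2) - 2 * (m1 - p1))\<bar> \<le> (4 + \<rho>) * h"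
    using a1 r by (simp add: abs_mult)
  moreover have "0 \<le> r * ((1 + \<rho>) * (m1 - \<mu>1)\<^sup>2)" using r \<rho> by simp
  \<comment> \<open>The four error terms, in this order, come from the approximation of the moments,
    the quadratic remainder, the deviation of \<open>E\<close> from - 1 / \<kappa>, and the summand
    with \<open>c\<close>.\<close>
  moreover have "(4 + \<rho>) * h + (1 + \<rho>) * (4 * h) + \<bar>y\<bar> * (11/2 * h) + (\<rho> + \<bar>y\<bar>) * h \<le> (8 + 6 * \<rho> + 7 * \<bar>y\<bar>) * h"
    using h by (simp add: algebra_simps)
  ultimately have "\<bar>r * F - (r * ((1 + \<rho> / 2) * p2 - 2 * p1 + 1 / (\<rho> + 1)) - y / \<kappa>)\<bar> \<le> (8 + 6 * \<rho> + 7 * \<bar>y\<bar>) * h"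
    using a2 a3 a4 by linarith
  then have "\<kappa> * \<bar>r * F - (r * ((1 + \<rho> / 2) * p2 - 2 * p1 + 1 / (\<rho> + 1)) - y / \<kappa>)\<bar> \<le> C * h"
    unfolding C_def mult.assoc using \<kappa> by (intro mult_left_mono) auto
  moreover have "\<kappa> * \<bar>r * F - (r * ((1 + \<rho> / 2) * p2 - 2 * p1 + 1 / (\<rho> + 1)) - y / \<kappa>)\<bar> = \<bar>\<kappa> * (r * F) - (L - y)\<bar>"
  proof -
    have "\<kappa> * (r * F - (r * ((1 + \<rho> / 2) * p2 - 2 * p1 + 1 / (\<rho> + 1)) - y / \<kappa>)) = \<kappa> * (r * F) - (L - y)"
      using \<kappa> by (simp add: L_def right_diff_distrib mult.assoc)
    then show ?thesis using \<kappa> by (metis abs_mult abs_of_pos)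
  qed
  ultimately have fin: "\<bar>\<kappa> * (r * F) - (L - y)\<bar> \<le> C * h" by simp
  show "r * (T - \<rho>) \<le> y \<Longrightarrow> L \<le> y + C * h"
  proof -
    assume "r * (T - \<rho>) \<le> y"
    then have "F \<le> 0" unfolding iff .
    then have "\<kappa> * (r * F) \<le> 0" using \<kappa> r by (simp add: mult_le_0_iff)
    then show "L \<le> y + C * h" using fin by linarith
  qed
  show "L \<le> y - C * h \<Longrightarrow> r * (T - \<rho>) \<le> y"
  proof -
    assume "L \<le> y - C * h"
    then have "\<kappa> * (r * F) \<le> 0" using fin by linarith
    then have "F \<le> 0" using \<kappa> r by (simp add: mult_le_0_iff)
    then show "r * (T - \<rho>) \<le> y" unfolding iff .
  qed
qed

lemma unif_count_deviation:
  assumes p: "0 < p" "p < 1" and \<eta>: "0 < \<eta>" "\<eta> \<le> 1"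
  shows "measure (PU {..<n}) {w \<in> space (PU {..<n}). \<eta> * (real n * p) \<le> \<bar>real (card {l. l < n \<and> w l < p}) - real n * p\<bar>}
    \<le> 2 * exp (- (real n * p * \<eta>\<^sup>2 / 4))"
proof -
  interpret prob_space "PU UNIV" by (rule prob_space_PU)
  have id: "(\<lambda>x::real. x) \<in> unif \<rightarrow>\<^sub>M borel" by (simp add: measurable_cong_sets[OF sets_unif refl])
  have ind: "indep_vars (\<lambda>_. borel) (\<lambda>l \<omega>. \<omega> l) UNIV"
    using indep_vars_compose2[OF PU_indep, of "\<lambda>_ x. x" "\<lambda>_. borel"] id by simp
  have pr: "prob {\<omega> \<in> space (PU UNIV). \<omega> l \<in> {..<p}} = p" for l
  proof -
    have m: "(\<lambda>\<omega>. \<omega> l) \<in> PU UNIV \<rightarrow>\<^sub>M unif" by (rule measurable_component_singleton) simp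
    have "prob {\<omega> \<in> space (PU UNIV). \<omega> l \<in> {..<p}} = measure (distr (PU UNIV) unif (\<lambda>\<omega>. \<omega> l)) {..<p}"
      using m by (subst measure_distr) (auto simp: vimage_def Int_def conj_commute)
    also have "distr (PU UNIV) unif (\<lambda>\<omega>. \<omega> l) = unif"
      by (rule distr_PiM_component) (auto intro: prob_space_unif)
    also have "measure unif {..<p} = p"
    proof -
      have "emeasure unif {..<p} = (\<integral>\<^sup>+x. indicator {0<..<1} x * indicator {..<p} x \<partial>lborel)"
        unfolding unif_def by (subst emeasure_density) auto
      also have "\<dots> = (\<integral>\<^sup>+x. indicator {0<..<p} x \<partial>lborel)"
        by (rule nn_integral_cong) (use p in \<open>auto simp: indicator_def\<close>)
      also have "\<dots> = ennreal p" using p by simp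
      finally show ?thesis using p by (simp add: measure_def)
    qed
    finally show ?thesis .
  qed
  have comp: "(\<lambda>w. w l) \<in> borel_measurable (PU {..<n})" if "l < n" for l using that by (intro PU_component) simp
  have cm: "(\<lambda>w. real (card {l. l < n \<and> w l < p})) \<in> borel_measurable (PU {..<n})"
  proof -
    have "real (card {l. l < n \<and> w l < p}) = (\<Sum>l<n. if w l < p then 1 else 0)" for w :: "nat \<Rightarrow> real"
      by (auto simp: sum.If_cases intro!: arg_cong[where f=card])
    moreover have "(\<lambda>w. \<Sum>l<n. if w l < p then 1 else 0 :: real) \<in> borel_measurable (PU {..<n})"
      by (intro borel_measurable_sum measurable_If borel_measurable_const)
         (use comp in \<open>auto intro!: borel_measurable_less\<close>)
    ultimately show ?thesis by simp
  qed
  have "measure (PU {..<n}) {w \<in> space (PU {..<n}). \<eta> * (real n * p) \<le> \<bar>real (card {l. l < n \<and> w l < p}) - real n * p\<bar>}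
    = prob {w \<in> space (PU UNIV). \<eta> * (real n * p) \<le> \<bar>real (card {l. l < n \<and> w l < p}) - real n * p\<bar>}"
  proof (rule measure_PU_initial)
    show "{w \<in> space (PU {..<n}). \<eta> * (real n * p) \<le> \<bar>real (card {l. l < n \<and> w l < p}) - real n * p\<bar>} \<in> sets (PU {..<n})"
      using cm by measurable
    have "{l. l < n \<and> restrict w {..<n} l < p} = {l. l < n \<and> w l < p}" for w :: "nat \<Rightarrow> real" by auto
    then show "(\<eta> * (real n * p) \<le> \<bar>real (card {l. l < n \<and> restrict w {..<n} l < p}) - real n * p\<bar>) =
      (\<eta> * (real n * p) \<le> \<bar>real (card {l. l < n \<and> w l < p}) - real n * p\<bar>)" for w :: "nat \<Rightarrow> real" by simp
  qed
  also have "\<dots> \<le> 2 * exp (- (real n * p * \<eta>\<^sup>2 / 4))"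
    using count_deviation[OF ind _ pr \<eta>, of n] by simp
  finally show ?thesis .
qed

definition dev1 :: "real \<Rightarrow> real \<Rightarrow> real" where
  "dev1 \<rho> v = (1 - pw \<rho> v) - 1 / (\<rho> + 1)"

definition dev2 :: "real \<Rightarrow> real \<Rightarrow> real" where
  "dev2 \<rho> v = (1 - pw \<rho> v)\<^sup>2 - 2 / ((\<rho> + 1) * (\<rho> + 2))"

lemma dev_measurable [measurable]:
  "dev1 \<rho> \<in> borel_measurable borel" "dev2 \<rho> \<in> borel_measurable borel"
  unfolding dev1_def[abs_def] dev2_def[abs_def] by measurable

lemma dev_mean:
  assumes "0 < \<rho>"
  shows "(\<integral>v. dev1 \<rho> v \<partial>unif) = 0" "(\<integral>v. dev2 \<rho> v \<partial>unif) = 0"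
proof -
  have "(\<integral>v. dev1 \<rho> v \<partial>unif) = (\<integral>v. (1 - 1 / (\<rho> + 1)) + (- 1) * pw \<rho> v + 0 * (pw \<rho> v)\<^sup>2 + 0 * (pw \<rho> v) ^ 3 + 0 * (pw \<rho> v) ^ 4 \<partial>unif)"
    by (intro Bochner_Integration.integral_cong) (auto simp: dev1_def)
  also have "\<dots> = 0" unfolding integral_pw_poly[OF assms] using assms by (simp add: field_simps)
  finally show "(\<integral>v. dev1 \<rho> v \<partial>unif) = 0" .
  have "(\<integral>v. dev2 \<rho> v \<partial>unif) = (\<integral>v. (1 - 2 / ((\<rho> + 1) * (\<rho> + 2))) + (- 2) * pw \<rho> v + 1 * (pw \<rho> v)\<^sup>2 + 0 * (pw \<rho> v) ^ 3 + 0 * (pw \<rho> v) ^ 4 \<partial>unif)"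
    by (intro Bochner_Integration.integral_cong) (auto simp: dev2_def power2_eq_square algebra_simps)
  also have "\<dots> = 0" unfolding integral_pw_poly[OF assms] using assms
    by (simp add: divide_simps) (simp add: algebra_simps)
  finally show "(\<integral>v. dev2 \<rho> v \<partial>unif) = 0" .
qed

lemma dev_bound:
  assumes "0 < \<rho>" "0 < v" "v < 1"
  shows "\<bar>dev1 \<rho> v\<bar> \<le> 1" "\<bar>dev2 \<rho> v\<bar> \<le> 1"
proof -
  note p = pw_range[OF assms]
  have m: "0 < 1 / (\<rho> + 1)" "1 / (\<rho> + 1) < 1" using assms by auto
  show "\<bar>dev1 \<rho> v\<bar> \<le> 1" unfolding dev1_def using p m by linarith
  have "0 \<le> (1 - pw \<rho> v)\<^sup>2" "(1 - pw \<rho> v)\<^sup>2 \<le> 1" using p by (auto intro: power_le_one)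
  moreover have "0 < 2 / ((\<rho> + 1) * (\<rho> + 2))" "2 / ((\<rho> + 1) * (\<rho> + 2)) \<le> 1"
  proof -
    have "1 * 2 \<le> (\<rho> + 1) * (\<rho> + 2)" using assms by (intro mult_mono) auto
    then show "0 < 2 / ((\<rho> + 1) * (\<rho> + 2))" "2 / ((\<rho> + 1) * (\<rho> + 2)) \<le> 1"
      using assms by (auto simp: divide_le_eq_1)
  qed
  ultimately show "\<bar>dev2 \<rho> v\<bar> \<le> 1" unfolding dev2_def by linarith
qed

lemma infl_bound:
  assumes "0 < \<rho>" "0 < v" "v < 1"
  shows "\<bar>infl \<rho> v\<bar> \<le> (\<rho> + 1)\<^sup>2 * (\<rho> + 2) * (\<rho> + 5)"
proof -
  define P where "P = 1 - pw \<rho> v"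
  have P: "0 < P" "P < 1" using pw_range[OF assms] by (auto simp: P_def)
  have 1: "0 \<le> P\<^sup>2" "P\<^sup>2 \<le> 1" using P by (auto intro: power_le_one)
  have 2: "0 \<le> (1 + \<rho> / 2) * P\<^sup>2" "(1 + \<rho> / 2) * P\<^sup>2 \<le> 1 + \<rho> / 2"
    using 1 assms mult_left_mono[of "P\<^sup>2" 1 "1 + \<rho> / 2"] by auto
  have m: "0 < 1 / (\<rho> + 1)" "1 / (\<rho> + 1) < 1" using assms by auto
  have "\<bar>(1 + \<rho> / 2) * P\<^sup>2 - 2 * P + 1 / (\<rho> + 1)\<bar> \<le> \<rho> + 5"
    using 2 m P assms by linarith
  then have "(\<rho> + 1)\<^sup>2 * (\<rho> + 2) * \<bar>(1 + \<rho> / 2) * P\<^sup>2 - 2 * P + 1 / (\<rho> + 1)\<bar> \<le> (\<rho> + 1)\<^sup>2 * (\<rho> + 2) * (\<rho> + 5)"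
    using assms by (intro mult_left_mono) auto
  then show ?thesis using assms unfolding infl_def P_def[symmetric] by (simp add: abs_mult)
qed

lemma asymp_variance_pos:
  assumes "0 < \<rho>"
  shows "0 < asymp_variance \<rho>"
proof -
  have "4 - 8 * ((2 + \<rho>) / (3 + \<rho>)) + (11 + 5 * \<rho>) * (2 + \<rho>) / ((3 + \<rho>) * (4 + \<rho>))
     = (\<rho>\<^sup>2 + \<rho> + 6) / ((3 + \<rho>) * (4 + \<rho>))"
    using assms by (simp add: divide_simps power2_eq_square) (simp add: algebra_simps)
  moreover have "0 < (\<rho>\<^sup>2 + \<rho> + 6) / ((3 + \<rho>) * (4 + \<rho>))"
    using assms by (intro divide_pos_pos) (auto simp: add_pos_pos)
  ultimately have "0 < 4 - 8 * ((2 + \<rho>) / (3 + \<rho>)) + (11 + 5 * \<rho>) * (2 + \<rho>) / ((3 + \<rho>) * (4 + \<rho>))"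
    by (simp only:)
  then show ?thesis using assms unfolding asymp_variance_def by (intro mult_pos_pos) auto
qed

section \<open>From the uniform sample to the estimator\<close>

context pi_varying
begin

text \<open>Everything here concerns one fixed configuration. The logarithms ln (H (w l) / \<zeta>)
  have the form c d_l with a common small c, which cancels in the quotient of moments and survives
  only in the first moment. The d_l are close to 1 - u^(1/\<rho>) for the rescaled variables u = w l
  / w j, so \<open>moment_estimate\<close> compares the estimator with
  \<open>below_sum (infl \<rho>)\<close>.\<close>

lemma moment_event:
  fixes \<phi> \<rho> h y C T :: real and w :: "nat \<Rightarrow> real"
  defines "H \<equiv> \<lambda>u. \<phi> - V (1 / u)"
  assumes \<phi>: "0 < \<phi>" and \<rho>: "a = 1 / \<rho>" "0 < \<rho>" and V_le: "\<And>t. 0 < t \<Longrightarrow> V t \<le> \<phi>"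
    and C: "0 < C" and T: "0 < T" and Vhalf: "\<And>t. t \<ge> T \<Longrightarrow> V t \<le> \<phi> / 2"
    and mb: "\<And>t. t \<ge> T \<Longrightarrow> 0 < V t \<and> 0 < At t \<and> V t \<le> C * At t \<and>
     (\<forall>w. 0 < w \<and> w \<le> 1 \<longrightarrow> \<bar>V (t / w) / V t - w powr a\<bar> \<le> C * At t) \<and>
     (\<forall>z. 1/2 \<le> z \<and> z \<le> 2 \<longrightarrow> At (t * z) \<le> C * At t)"
    and cf: "conf w n k j S" and w01: "\<And>i. i < n \<Longrightarrow> 0 < w i \<and> w i < 1" and k: "0 < k" "k < n"
    and \<theta>: "real k / (2 * real n) \<le> w j" "w j \<le> 2 * real k / real n" and nT: "2 * T \<le> real n / real k"
    and h: "0 < h" "h \<le> 1" "7 * ((\<rho> + 1)\<^sup>2 * (\<rho> + 2)) * h < 1" "7 * ((\<rho> + 1)\<^sup>2 * (\<rho> + 2)) * h < \<rho>"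
    and d1: "\<bar>below_sum (dev1 \<rho>) n k w\<bar> \<le> h * real k powr (3/4)"
    and d2: "\<bar>below_sum (dev2 \<rho>) n k w\<bar> \<le> h * real k powr (3/4)"
    and small: "sqrt (real k) * ((2 * C / \<phi> + C) * C * At (real n / real k)) \<le> h"
    and ky: "\<bar>y\<bar> < sqrt (real k) * \<rho>"
  shows "sqrt (real k) * (rho_os (\<lambda>l. H (w l)) n k - \<rho>) \<le> y \<Longrightarrow>
      below_sum (infl \<rho>) n k w \<le> sqrt (real k) * (y + ((\<rho> + 1)\<^sup>2 * (\<rho> + 2) * (8 + 6 * \<rho> + 7 * \<bar>y\<bar>)) * h)"
    and "below_sum (infl \<rho>) n k w \<le> sqrt (real k) * (y - ((\<rho> + 1)\<^sup>2 * (\<rho> + 2) * (8 + 6 * \<rho> + 7 * \<bar>y\<bar>)) * h) \<Longrightarrow>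
      sqrt (real k) * (rho_os (\<lambda>l. H (w l)) n k - \<rho>) \<le> y"
proof -
  define \<theta> where "\<theta> = w j"
  define t where "t = 1 / \<theta>"
  have S: "S = {i. i < n \<and> w i < w j}" by (rule conf_S[OF cf])
  have finS: "finite S" unfolding S by simp
  have jn: "j < n" and Sk: "card S = k" using cf by (auto simp: conf_def)
  have kp: "0 < real k" "0 < real n" using k by auto
  have \<theta>p: "0 < \<theta>" using w01[OF jn] by (simp add: \<theta>_def)
  have tz: "t = real n / real k * (real k / (real n * \<theta>))" using kp by (simp add: t_def)
  \<comment> \<open>The argument t = 1 / w j is n / k up to a factor between 1/2 and 2, so
    \<open>At t\<close> is bounded by a nonrandom quantity.\<close>
  have z: "1/2 \<le> real k / (real n * \<theta>)" "real k / (real n * \<theta>) \<le> 2"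
    using \<theta> kp \<theta>p by (auto simp: \<theta>_def[symmetric] field_simps)
  have nkT: "T \<le> real n / real k" using nT T by linarith
  have tT: "T \<le> t"
  proof -
    have "T = 2 * T * (1/2)" by simp
    also have "\<dots> \<le> real n / real k * (real k / (real n * \<theta>))" using nT z T kp by (intro mult_mono) auto
    finally show ?thesis unfolding tz .
  qed
  have tp: "0 < t" using tT T by linarith
  have Vt: "0 < V t" and At: "0 < At t" and VA: "V t \<le> C * At t"
    and Vw: "\<And>w. 0 < w \<Longrightarrow> w \<le> 1 \<Longrightarrow> \<bar>V (t / w) / V t - w powr a\<bar> \<le> C * At t"
    using mb[OF tT] by auto
  have Atn: "At t \<le> C * At (real n / real k)" using mb[OF nkT] z unfolding tz by blast
  define \<zeta> where "\<zeta> = \<phi> - V t"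
  have \<zeta>: "\<phi> / 2 \<le> \<zeta>" "0 < \<zeta>" using Vhalf[OF tT] \<phi> by (auto simp: \<zeta>_def)
  \<comment> \<open>The relative distance of the pivot from the frontier: H (w l) / \<zeta> = 1 + c
    q_l with q_l in [0, 1].\<close>
  define c where "c = V t / \<zeta>"
  have cp: "0 < c" using Vt \<zeta> by (simp add: c_def)
  have cA: "c \<le> 2 * C / \<phi> * At t"
  proof -
    have "c \<le> V t / (\<phi> / 2)" unfolding c_def using \<zeta> Vt \<phi> by (intro divide_left_mono) auto
    also have "\<dots> = 2 / \<phi> * V t" by simp
    also have "\<dots> \<le> 2 / \<phi> * (C * At t)" using VA \<phi> by (intro mult_left_mono) auto
    finally show ?thesis by simp
  qed
  \<comment> \<open>One bound for two errors: at most c from replacing ln (1 + c q) / c by q, and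
    \<open>C * At t\<close> from replacing q by its limit 1 - u^(1/\<rho>).\<close>
  define \<epsilon> where "\<epsilon> = (2 * C / \<phi> + C) * C * At (real n / real k)"
  have \<epsilon>A: "(2 * C / \<phi> + C) * At t \<le> \<epsilon>"
    unfolding \<epsilon>_def mult.assoc using Atn C \<phi> by (intro mult_left_mono) auto
  have cCA: "c + C * At t \<le> \<epsilon>" using cA \<epsilon>A by (simp add: distrib_right)
  have CA0: "0 \<le> C * At t" using C At by simp
  have c\<epsilon>: "c \<le> \<epsilon>" using cCA CA0 by linarith
  define u where "u l = w l / \<theta>" for l
  define q where "q l = 1 - V (t / u l) / V t" for l
  define d where "d l = ln (1 + c * q l) / c" for l
  define p where "p l = 1 - pw \<rho> (u l)" for l
  have H_eq: "H (w l) = \<phi> - V (t / u l)" for l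
    using \<theta>p by (simp add: H_def t_def u_def)
  have Hj: "H (w j) = \<zeta>" by (simp add: H_def \<zeta>_def t_def \<theta>_def)
  have anti: "H v \<le> H u" if "0 < u" "u \<le> v" for u v
  proof -
    have "V (1 / u) \<le> V (1 / v)" using that by (intro V_antimono) (auto simp: frac_le)
    then show ?thesis by (simp add: H_def)
  qed
  have os: "upper_os (\<lambda>l. H (w l)) n k = \<zeta>"
    using conf_upper_os[OF cf, of H] w01 anti Hj \<zeta> by simp
  have inS: "0 < u l \<and> u l < 1 \<and> 0 \<le> q l \<and> q l \<le> 1 \<and> H (w l) / \<zeta> = 1 + c * q l \<and>
      0 \<le> d l \<and> d l \<le> 1 \<and> \<bar>d l - p l\<bar> \<le> \<epsilon> \<and> 0 \<le> p l \<and> p l \<le> 1" if l: "l \<in> S" for l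
  proof -
    have ln: "l < n" "w l < \<theta>" using l by (auto simp: S \<theta>_def)
    have u1: "0 < u l" "u l < 1" using w01[OF ln(1)] ln(2) \<theta>p by (auto simp: u_def)
    have tu: "t \<le> t / u l" "0 < t / u l" using u1 tp by (auto simp: field_simps)
    have "0 \<le> V (t / u l)" "V (t / u l) \<le> V t" using tu tp by (auto intro: V_nonneg V_antimono)
    then have q1: "0 \<le> q l" "q l \<le> 1" using Vt by (auto simp: q_def field_simps)
    have "H (w l) = \<zeta> + V t * q l" using Vt by (simp add: H_eq \<zeta>_def q_def right_diff_distrib)
    then have Hr: "H (w l) / \<zeta> = 1 + c * q l" using \<zeta> by (simp add: c_def add_divide_distrib)
    have cq: "0 \<le> c * q l" using cp q1 by simp
    have l1: "ln (1 + c * q l) \<le> c * q l" using cq by (rule ln_add_one_self_le_self)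
    have l2: "c * q l / (1 + c * q l) \<le> ln (1 + c * q l)"
    proof (cases "c * q l = 0")
      case False
      then have "1 < 1 + c * q l" using cq by linarith
      from ln_ratio_bounds(1)[OF zero_less_one this] show ?thesis by simp
    next
      case True
      show ?thesis unfolding True by simp
    qed
    have dq: "d l \<le> q l" using l1 cp by (simp add: d_def field_simps)
    have "c * q l - (c * q l)\<^sup>2 \<le> c * q l / (1 + c * q l)"
    proof -
      have "(c * q l - (c * q l)\<^sup>2) * (1 + c * q l) = c * q l - (c * q l) ^ 3"
        by (simp add: power2_eq_square power3_eq_cube algebra_simps)
      also have "\<dots> \<le> c * q l" using cq by simp
      finally show ?thesis using cq by (subst pos_le_divide_eq) auto
    qed
    with l2 have "c * q l - (c * q l)\<^sup>2 \<le> ln (1 + c * q l)" by linarith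
    then have "(c * q l - (c * q l)\<^sup>2) / c \<le> d l" unfolding d_def using cp by (intro divide_right_mono) auto
    moreover have "(c * q l - (c * q l)\<^sup>2) / c = q l - c * (q l)\<^sup>2"
      using cp by (simp add: power2_eq_square field_simps)
    moreover have "c * (q l)\<^sup>2 \<le> c * 1" using cp q1 by (intro mult_left_mono) (auto intro: power_le_one)
    ultimately have dq2: "q l - c \<le> d l" by linarith
    have d0: "0 \<le> d l" using cq cp by (simp add: d_def)
    have "pw \<rho> (u l) = u l powr a" by (simp add: pw_def \<rho>)
    then have qp: "\<bar>q l - p l\<bar> \<le> C * At t" using Vw[of "u l"] u1 unfolding q_def p_def by auto
    have dp: "\<bar>d l - p l\<bar> \<le> \<epsilon>" using dq dq2 qp cCA cp by linarith
    have pp: "0 \<le> p l" "p l \<le> 1" using pw_range[OF \<rho>(2) u1] by (auto simp: p_def)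
    have "d l \<le> 1" using dq q1 by linarith
    with u1 q1 Hr d0 dp pp show ?thesis by blast
  qed
  define m where "m i = (1 / real k) * (\<Sum>l\<in>S. d l ^ i)" for i :: nat
  define pm where "pm i = (1 / real k) * (\<Sum>l\<in>S. p l ^ i)" for i :: nat
  have mo: "moment_os (\<lambda>l. H (w l)) n k i = c ^ i * m i" if i: "0 < i" for i
  proof -
    have "moment_os (\<lambda>l. H (w l)) n k i = (1 / real k) * (\<Sum>l<n. if \<zeta> < H (w l) then (ln (H (w l) / \<zeta>)) ^ i else 0)"
      using moment_os_eq[OF k(2), of "\<lambda>l. H (w l)" i] \<zeta> i unfolding os by simp
    also have "(\<Sum>l<n. if \<zeta> < H (w l) then (ln (H (w l) / \<zeta>)) ^ i else 0) = (\<Sum>l\<in>S. c ^ i * d l ^ i)"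
    proof (rule sum.mono_neutral_cong_right)
      show "\<forall>l\<in>{..<n} - S. (if \<zeta> < H (w l) then (ln (H (w l) / \<zeta>)) ^ i else 0) = 0"
      proof
        fix l assume l: "l \<in> {..<n} - S"
        then have "w j \<le> w l" by (auto simp: S)
        then have "H (w l) \<le> \<zeta>" using anti[of "w j" "w l"] w01[OF jn] Hj by simp
        then show "(if \<zeta> < H (w l) then (ln (H (w l) / \<zeta>)) ^ i else 0) = 0" by simp
      qed
      show "(if \<zeta> < H (w l) then (ln (H (w l) / \<zeta>)) ^ i else 0) = c ^ i * d l ^ i" if l: "l \<in> S" for l
      proof -
        have "c ^ i * d l ^ i = ln (H (w l) / \<zeta>) ^ i"
          using inS[OF l] cp by (simp add: d_def power_mult_distrib[symmetric])
        \<comment> \<open>A smaller uniform variable may still give a value tied with the pivot; its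
          logarithm is then 0 and both sides agree.\<close>
        moreover have "H (w l) \<le> \<zeta> \<Longrightarrow> ln (H (w l) / \<zeta>) = 0"
        proof -
          assume "H (w l) \<le> \<zeta>"
          then have "1 + c * q l \<le> 1" using inS[OF l] \<zeta> by (metis divide_le_eq_1_pos)
          moreover have "0 \<le> c * q l" using inS[OF l] cp by simp
          ultimately have "c * q l = 0" by linarith
          moreover have "H (w l) / \<zeta> = 1 + c * q l" using inS[OF l] by blast
          ultimately have "H (w l) / \<zeta> = 1" by (simp only: add_0_right)
          then show "ln (H (w l) / \<zeta>) = 0" by (simp only: ln_one)
        qed
        ultimately show ?thesis using i by (auto simp: not_less zero_power)
      qed
    qed (auto simp: S)
    also have "(1 / real k) * (\<Sum>l\<in>S. c ^ i * d l ^ i) = c ^ i * m i"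
      by (simp add: m_def sum_distrib_left mult_ac)
    finally show ?thesis .
  qed
  have avg: "(1 / real k) * (\<Sum>l\<in>S. f l) \<le> B" if "\<And>l. l \<in> S \<Longrightarrow> f l \<le> B" for f B
  proof -
    have "(\<Sum>l\<in>S. f l) \<le> real k * B" using sum_bounded_above[of S f B] that Sk by simp
    then show ?thesis using kp by (simp add: field_simps)
  qed
  have avg0: "0 \<le> (1 / real k) * (\<Sum>l\<in>S. f l)" if "\<And>l. l \<in> S \<Longrightarrow> 0 \<le> f l" for f
    using that by (intro mult_nonneg_nonneg sum_nonneg) auto
  have mrange: "0 \<le> m i" "m i \<le> 1" for i
  proof -
    show "0 \<le> m i" unfolding m_def by (rule avg0) (use inS in simp)
    show "m i \<le> 1" unfolding m_def by (rule avg) (use inS in \<open>simp add: power_le_one\<close>)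
  qed
  have diff: "m i - pm i = (1 / real k) * (\<Sum>l\<in>S. d l ^ i - p l ^ i)" for i
    by (simp add: m_def pm_def sum_subtractf right_diff_distrib)
  have absavg: "\<bar>(1 / real k) * (\<Sum>l\<in>S. f l)\<bar> \<le> B" if "\<And>l. l \<in> S \<Longrightarrow> \<bar>f l\<bar> \<le> B" for f B
  proof -
    have "\<bar>(1 / real k) * (\<Sum>l\<in>S. f l)\<bar> \<le> (1 / real k) * (\<Sum>l\<in>S. \<bar>f l\<bar>)"
      using sum_abs[of f S] kp by (simp add: abs_mult divide_right_mono)
    also have "\<dots> \<le> B" by (rule avg) (rule that)
    finally show ?thesis .
  qed
  have mp1: "\<bar>m 1 - pm 1\<bar> \<le> \<epsilon>" unfolding diff by (rule absavg) (use inS in simp)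
  have mp2: "\<bar>m 2 - pm 2\<bar> \<le> 2 * \<epsilon>" unfolding diff
  proof (rule absavg)
    fix l assume l: "l \<in> S"
    have "\<bar>d l ^ 2 - p l ^ 2\<bar> = \<bar>d l + p l\<bar> * \<bar>d l - p l\<bar>"
      by (simp add: abs_mult[symmetric] power2_eq_square algebra_simps)
    also have "\<dots> \<le> 2 * \<epsilon>" using inS[OF l] by (intro mult_mono) auto
    finally show "\<bar>d l ^ 2 - p l ^ 2\<bar> \<le> 2 * \<epsilon>" .
  qed
  have bs: "below_sum \<xi> n k w = (\<Sum>l\<in>S. \<xi> (u l))" for \<xi>
    unfolding u_def \<theta>_def by (rule conf_below_sum[OF cf]) (rule w01)
  define r where "r = sqrt (real k)"
  \<comment> \<open>The deviation bound h k^(3/4) divided by k; its square times k^(1/2) equals 1,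
    as \<open>moment_estimate\<close> requires.\<close>
  define qq where "qq = real k powr (- 1/4)"
  have rr: "r * r = real k" by (simp add: r_def)
  have r1: "1 \<le> r" using k by (simp add: r_def)
  have k34: "real k powr (3/4) = real k * qq"
    using kp powr_add[of "real k" 1 "- 1/4"] by (simp add: qq_def)
  have q1: "0 \<le> qq" "qq \<le> 1" "r * qq\<^sup>2 \<le> 1"
  proof -
    show "0 \<le> qq" by (simp add: qq_def)
    show "qq \<le> 1" using k powr_mono[of "- 1/4" 0 "real k"] by (simp add: qq_def)
    have "qq\<^sup>2 = real k powr (- 1/2)" by (simp add: qq_def power2_eq_square powr_add[symmetric])
    also have "\<dots> = inverse r" using kp by (simp add: r_def powr_minus powr_half_sqrt[symmetric])
    finally show "r * qq\<^sup>2 \<le> 1" using r1 by simp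
  qed
  have pm1: "\<bar>pm 1 - 1 / (\<rho> + 1)\<bar> \<le> h * qq"
  proof -
    have "below_sum (dev1 \<rho>) n k w = (\<Sum>l\<in>S. p l - 1 / (\<rho> + 1))" unfolding bs by (simp add: dev1_def p_def)
    also have "\<dots> = real k * (pm 1 - 1 / (\<rho> + 1))"
      using kp Sk by (simp add: pm_def sum_subtractf right_diff_distrib)
    finally have "real k * \<bar>pm 1 - 1 / (\<rho> + 1)\<bar> \<le> real k * (h * qq)"
      using d1 unfolding k34 by (simp add: abs_mult mult_ac)
    then show ?thesis using kp by simp
  qed
  have pm2: "\<bar>pm 2 - 2 / ((\<rho> + 1) * (\<rho> + 2))\<bar> \<le> h * qq"
  proof -
    have "below_sum (dev2 \<rho>) n k w = (\<Sum>l\<in>S. (p l)\<^sup>2 - 2 / ((\<rho> + 1) * (\<rho> + 2)))" unfolding bs by (simp add: dev2_def p_def)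
    also have "\<dots> = real k * (pm 2 - 2 / ((\<rho> + 1) * (\<rho> + 2)))"
      using kp Sk by (simp only: pm_def sum_subtractf right_diff_distrib sum_constant) simp
    finally have "real k * \<bar>pm 2 - 2 / ((\<rho> + 1) * (\<rho> + 2))\<bar> \<le> real k * (h * qq)"
      using d2 unfolding k34 by (simp add: abs_mult mult_ac)
    then show ?thesis using kp by simp
  qed
  have infl: "below_sum (infl \<rho>) n k w = r * ((\<rho> + 1)\<^sup>2 * (\<rho> + 2) * r * ((1 + \<rho> / 2) * pm 2 - 2 * pm 1 + 1 / (\<rho> + 1)))"
  proof -
    have "below_sum (infl \<rho>) n k w = (\<Sum>l\<in>S. (\<rho> + 1)\<^sup>2 * (\<rho> + 2) * ((1 + \<rho> / 2) * (p l)\<^sup>2 - 2 * p l + 1 / (\<rho> + 1)))"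
      unfolding bs infl_def p_def ..
    also have "\<dots> = (\<rho> + 1)\<^sup>2 * (\<rho> + 2) * ((1 + \<rho> / 2) * (\<Sum>l\<in>S. (p l)\<^sup>2) - 2 * (\<Sum>l\<in>S. p l) + real k * (1 / (\<rho> + 1)))"
      by (simp only: sum_distrib_left[symmetric] sum.distrib sum_subtractf sum_constant Sk)
    also have "(\<Sum>l\<in>S. (p l)\<^sup>2) = real k * pm 2" using kp by (simp add: pm_def)
    also have "(\<Sum>l\<in>S. p l) = real k * pm 1" using kp by (simp add: pm_def)
    also have "(\<rho> + 1)\<^sup>2 * (\<rho> + 2) * ((1 + \<rho> / 2) * (real k * pm 2) - 2 * (real k * pm 1) + real k * (1 / (\<rho> + 1)))
      = real k * ((\<rho> + 1)\<^sup>2 * (\<rho> + 2) * ((1 + \<rho> / 2) * pm 2 - 2 * pm 1 + 1 / (\<rho> + 1)))"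
      by (simp add: algebra_simps)
    finally show ?thesis unfolding rr[symmetric] by (simp only: mult_ac)
  qed
  have rho: "rho_os (\<lambda>l. H (w l)) n k = - inverse (c * m 1 + 1 - 1 / 2 * inverse (1 - (m 1)\<^sup>2 / m 2))"
  proof -
    have "(c * m 1)\<^sup>2 / (c\<^sup>2 * m 2) = (m 1)\<^sup>2 / m 2" using cp by (simp add: power_mult_distrib)
    then show ?thesis unfolding rho_os_def mo[OF zero_less_one] mo[OF zero_less_numeral] by simp
  qed
  have \<epsilon>h: "r * \<epsilon> \<le> h" using small by (simp add: r_def \<epsilon>_def)
  have ry: "\<bar>y\<bar> < r * \<rho>" using ky by (simp add: r_def)
  have c0: "0 \<le> c" using cp by simp
  have h0: "0 \<le> h" using h by simp
  note est = moment_estimate[OF \<rho>(2) r1 q1 h0 h(2,3,4) pm1 pm2 mp1 mp2 mrange[of 1] mrange[of 2] c0 c\<epsilon> \<epsilon>h ry, folded rho]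
  show "sqrt (real k) * (rho_os (\<lambda>l. H (w l)) n k - \<rho>) \<le> y \<Longrightarrow>
      below_sum (infl \<rho>) n k w \<le> sqrt (real k) * (y + ((\<rho> + 1)\<^sup>2 * (\<rho> + 2) * (8 + 6 * \<rho> + 7 * \<bar>y\<bar>)) * h)"
    unfolding r_def[symmetric] infl using r1 by (intro mult_left_mono est(1)) auto
  show "below_sum (infl \<rho>) n k w \<le> sqrt (real k) * (y - ((\<rho> + 1)\<^sup>2 * (\<rho> + 2) * (8 + 6 * \<rho> + 7 * \<bar>y\<bar>)) * h) \<Longrightarrow>
      sqrt (real k) * (rho_os (\<lambda>l. H (w l)) n k - \<rho>) \<le> y"
    unfolding r_def[symmetric] infl using r1 by (intro est(2)) (simp add: mult_le_cancel_left)
qed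

end

lemma isCont_std_normal_cdf: "isCont (cdf std_normal_distribution) z"
proof -
  interpret N: real_distribution std_normal_distribution by (rule real_dist_normal_dist)
  show ?thesis
    unfolding N.isCont_cdf measure_def by (subst emeasure_density) (auto simp: nn_integral_indicator_finite)
qed

context pi_varying
begin

text \<open>Outside an event of vanishing probability, the event for the estimator lies between two
  events for \<open>below_sum (infl \<rho>)\<close> with thresholds \<open>y - D * h\<close> and
  \<open>y + D * h\<close>. Their probabilities are those for a sum of \<open>k n\<close>
  independent variables. First n tends to infinity, then h to 0, using continuity of the normal
  distribution function.\<close>

lemma clt_uniform:
  fixes \<phi> \<rho> y :: real and k :: "nat \<Rightarrow> nat"
  defines "H \<equiv> \<lambda>u. \<phi> - V (1 / u)" and "\<sigma> \<equiv> sqrt (asymp_variance \<rho>)"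
  assumes \<phi>: "0 < \<phi>" and \<rho>: "a = 1 / \<rho>" "0 < \<rho>" and V_le: "\<And>t. 0 < t \<Longrightarrow> V t \<le> \<phi>"
    and Hm: "H \<in> borel_measurable borel"
    and k: "\<And>n. 2 \<le> n \<Longrightarrow> 0 < k n \<and> k n < n" and k_top: "filterlim k at_top sequentially"
    and nk: "filterlim (\<lambda>n. real n / real (k n)) at_top sequentially"
    and small: "(\<lambda>n. sqrt (real (k n)) * At (real n / real (k n))) \<longlonglongrightarrow> 0"
  shows "(\<lambda>n. measure (PU {..<n}) {w \<in> space (PU {..<n}).
      sqrt (real (k n)) * (rho_os (\<lambda>l. H (w l)) n (k n) - \<rho>) \<le> y})
    \<longlonglongrightarrow> cdf std_normal_distribution (y / \<sigma>)"
proof -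
  obtain T0 C where T0: "0 < T0" and C: "0 < C" and mb0: "\<And>t. t \<ge> T0 \<Longrightarrow> 0 < V t \<and> 0 < At t \<and> V t \<le> C * At t \<and>
     (\<forall>w. 0 < w \<and> w \<le> 1 \<longrightarrow> \<bar>V (t / w) / V t - w powr a\<bar> \<le> C * At t) \<and>
     (\<forall>z. 1/2 \<le> z \<and> z \<le> 2 \<longrightarrow> At (t * z) \<le> C * At t)"
    using second_order_bounds by metis
  have "eventually (\<lambda>t. At t < \<phi> / (2 * C)) at_top"
    using \<phi> C by (intro order_tendstoD(2)[OF At_lim]) auto
  then obtain T1 where T1: "\<And>t. t \<ge> T1 \<Longrightarrow> At t < \<phi> / (2 * C)" unfolding eventually_at_top_linorder by auto
  define T where "T = max T0 T1"
  have T: "0 < T" "T0 \<le> T" "T1 \<le> T" using T0 by (auto simp: T_def)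
  have mb: "0 < V t \<and> 0 < At t \<and> V t \<le> C * At t \<and>
     (\<forall>w. 0 < w \<and> w \<le> 1 \<longrightarrow> \<bar>V (t / w) / V t - w powr a\<bar> \<le> C * At t) \<and>
     (\<forall>z. 1/2 \<le> z \<and> z \<le> 2 \<longrightarrow> At (t * z) \<le> C * At t)" if "t \<ge> T" for t
    by (rule mb0) (use that T in linarith)
  have Vhalf: "V t \<le> \<phi> / 2" if t: "t \<ge> T" for t
  proof -
    have "C * At t \<le> \<phi> / 2" using T1[of t] t T C by (auto simp: field_simps)
    then show ?thesis using mb[OF t] by linarith
  qed
  define \<kappa> where "\<kappa> = (\<rho> + 1)\<^sup>2 * (\<rho> + 2)"
  have \<kappa>: "0 < \<kappa>" using \<rho> by (simp add: \<kappa>_def)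
  define D where "D = \<kappa> * (8 + 6 * \<rho> + 7 * \<bar>y\<bar>)"
  have D: "0 \<le> D" using \<kappa> \<rho> by (simp add: D_def)
  have \<sigma>: "0 < \<sigma>" using asymp_variance_pos[OF \<rho>(2)] by (simp add: \<sigma>_def)
  define \<Psi> where "\<Psi> n = {w \<in> space (PU {..<n}). sqrt (real (k n)) * (rho_os (\<lambda>l. H (w l)) n (k n) - \<rho>) \<le> y}" for n
  have \<Psi>m: "\<Psi> n \<in> sets (PU {..<n})" for n
  proof -
    have [measurable]: "(\<lambda>w. rho_os (\<lambda>l. H (w l)) n (k n)) \<in> borel_measurable (PU {..<n})"
      by (rule borel_measurable_rho_os) (auto intro!: measurable_compose[OF PU_component Hm])
    show ?thesis unfolding \<Psi>_def by measurable
  qed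
  define \<Lambda> where "\<Lambda> k x = measure (PU {..<k}) {w \<in> space (PU {..<k}). (\<Sum>i<k. infl \<rho> (w i)) \<le> sqrt (real k) * x}" for k x
  define \<tau>1 where "\<tau>1 h k = measure (PU {..<k}) {w \<in> space (PU {..<k}). h * real k powr (3/4) \<le> \<bar>\<Sum>i<k. dev1 \<rho> (w i)\<bar>}" for h k
  define \<tau>2 where "\<tau>2 h k = measure (PU {..<k}) {w \<in> space (PU {..<k}). h * real k powr (3/4) \<le> \<bar>\<Sum>i<k. dev2 \<rho> (w i)\<bar>}" for h k
  \<comment> \<open>Bounds for four exceptional events: a large deviation of either moment, a pivot
    above 2 k / n, and a pivot below k / (2 n).\<close>
  define bad where "bad h k = \<tau>1 h k + \<tau>2 h k + (2 * exp (- (real k / 8)) + 2 * exp (- (real k / 8)))" for h k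
  have bad_lim: "(\<lambda>n. bad h (k n)) \<longlonglongrightarrow> 0" if h: "0 < h" for h
  proof -
    have 1: "(\<lambda>k. \<tau>1 h k) \<longlonglongrightarrow> 0" unfolding \<tau>1_def
      by (rule tight_PU[of "dev1 \<rho>" 1]) (use dev_mean dev_bound \<rho> h in auto)
    have 2: "(\<lambda>k. \<tau>2 h k) \<longlonglongrightarrow> 0" unfolding \<tau>2_def
      by (rule tight_PU[of "dev2 \<rho>" 1]) (use dev_mean dev_bound \<rho> h in auto)
    have 3: "(\<lambda>k. 2 * exp (- (real k / 8)) + 2 * exp (- (real k / 8))) \<longlonglongrightarrow> 0" by real_asymp
    have "(\<lambda>k. bad h k) \<longlonglongrightarrow> 0 + 0 + 0" unfolding bad_def by (intro tendsto_add 1 2 3)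
    then have "(\<lambda>k. bad h k) \<longlonglongrightarrow> 0" by simp
    then show ?thesis by (rule filterlim_compose[OF _ k_top])
  qed
  have \<Lambda>_lim: "(\<lambda>n. \<Lambda> (k n) x) \<longlonglongrightarrow> cdf std_normal_distribution (x / \<sigma>)" for x
  proof -
    have "(\<lambda>k. \<Lambda> k x) \<longlonglongrightarrow> cdf std_normal_distribution (x / \<sigma>)"
      unfolding \<Lambda>_def
    proof (rule clt_PU[OF _ infl_bound[OF \<rho>(2)] infl_mean[OF \<rho>(2)] _ \<sigma>])
      show "(\<integral>v. (infl \<rho> v)\<^sup>2 \<partial>unif) = \<sigma>\<^sup>2"
        using infl_variance[OF \<rho>(2)] asymp_variance_pos[OF \<rho>(2)] by (simp add: \<sigma>_def)
    qed auto
    then show ?thesis by (rule filterlim_compose[OF _ k_top])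
  qed
  have law: "measure (PU {..<n}) {w \<in> space (PU {..<n}). below_sum \<xi> n k w \<in> A}
    = measure (PU {..<k}) {w \<in> space (PU {..<k}). (\<Sum>i<k. \<xi> (w i)) \<in> A}"
    if "\<xi> \<in> borel_measurable borel" "k < n" "A \<in> sets borel" for \<xi> k n A
    using below_sum_law[OF that] by (simp add: measure_def)
  have sand: "eventually (\<lambda>n. measure (PU {..<n}) (\<Psi> n) \<le> \<Lambda> (k n) (y + D * h) + bad h (k n) \<and>
      \<Lambda> (k n) (y - D * h) \<le> measure (PU {..<n}) (\<Psi> n) + bad h (k n)) sequentially"
    if h: "0 < h" "h \<le> 1" "7 * \<kappa> * h < 1" "7 * \<kappa> * h < \<rho>" for h
  proof -
    have "(\<lambda>n. (2 * C / \<phi> + C) * C * (sqrt (real (k n)) * At (real n / real (k n)))) \<longlonglongrightarrow> (2 * C / \<phi> + C) * C * 0"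
      by (intro tendsto_intros small)
    then have "eventually (\<lambda>n. (2 * C / \<phi> + C) * C * (sqrt (real (k n)) * At (real n / real (k n))) < h) sequentially"
      using h by (intro order_tendstoD(2)) auto
    moreover have "eventually (\<lambda>n. max (2 * T) 4 \<le> real n / real (k n)) sequentially"
      using nk unfolding filterlim_at_top by blast
    moreover have "filterlim (\<lambda>k. sqrt (real k) * \<rho>) at_top sequentially" using \<rho> by real_asymp
    then have "filterlim (\<lambda>n. sqrt (real (k n)) * \<rho>) at_top sequentially"
      by (rule filterlim_compose[OF _ k_top])
    then have "eventually (\<lambda>n. \<bar>y\<bar> + 1 \<le> sqrt (real (k n)) * \<rho>) sequentially"
      unfolding filterlim_at_top by blast
    ultimately show ?thesis using eventually_ge_at_top[of 2]
    proof eventually_elim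
      case (elim n)
      interpret P: prob_space "PU {..<n}" by (rule prob_space_PU)
      let ?k = "k n"
      have kn: "0 < ?k" "?k < n" using k[OF elim(4)] by auto
      have n0: "0 < real n" using kn by simp
      have k4: "4 * real ?k \<le> real n" using elim(2) kn by (simp add: field_simps)
      let ?p = "2 * real ?k / real n" and ?p' = "real ?k / (2 * real n)"
      have p: "0 < ?p" "?p < 1" "0 < ?p'" "?p' < 1" using kn n0 k4 by (auto simp: field_simps)
      define B1 where "B1 = {w \<in> space (PU {..<n}). below_sum (dev1 \<rho>) n ?k w \<in> {x. h * real ?k powr (3/4) \<le> \<bar>x\<bar>}}"
      define B2 where "B2 = {w \<in> space (PU {..<n}). below_sum (dev2 \<rho>) n ?k w \<in> {x. h * real ?k powr (3/4) \<le> \<bar>x\<bar>}}"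
      \<comment> \<open>A pivot above 2 k / n leaves at most k variables below a level where 2 k are
        expected; a pivot below k / (2 n) puts at least k where k / 2 are expected. With relative
        errors 1/2 and 1 both exponents are k / 8.\<close>
      define B3 where "B3 = {w \<in> space (PU {..<n}). 1/2 * (real n * ?p) \<le> \<bar>real (card {l. l < n \<and> w l < ?p}) - real n * ?p\<bar>}"
      define B4 where "B4 = {w \<in> space (PU {..<n}). 1 * (real n * ?p') \<le> \<bar>real (card {l. l < n \<and> w l < ?p'}) - real n * ?p'\<bar>}"
      define I where "I x = {w \<in> space (PU {..<n}). below_sum (infl \<rho>) n ?k w \<in> {..sqrt (real ?k) * x}}" for x
      have As: "{x. h * real ?k powr (3/4) \<le> \<bar>x\<bar>} \<in> sets borel" by measurable
      have comp: "(\<lambda>w. w l) \<in> borel_measurable (PU {..<n})" if "l < n" for l using that by (intro PU_component) simp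
      have cm: "(\<lambda>w. real (card {l. l < n \<and> w l < q})) \<in> borel_measurable (PU {..<n})" for q
      proof -
        have "real (card {l. l < n \<and> w l < q}) = (\<Sum>l<n. if w l < q then 1 else 0)" for w :: "nat \<Rightarrow> real"
          by (auto simp: sum.If_cases intro!: arg_cong[where f=card])
        moreover have "(\<lambda>w. \<Sum>l<n. if w l < q then 1 else 0 :: real) \<in> borel_measurable (PU {..<n})"
          by (intro borel_measurable_sum measurable_If borel_measurable_const)
             (use comp in \<open>auto intro!: borel_measurable_less\<close>)
        ultimately show ?thesis by simp
      qed
      note [measurable] = cm below_sum_measurable
      have Bm: "B1 \<in> sets (PU {..<n})" "B2 \<in> sets (PU {..<n})" "B3 \<in> sets (PU {..<n})" "B4 \<in> sets (PU {..<n})"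
        "I x \<in> sets (PU {..<n})" for x
        unfolding B1_def B2_def B3_def B4_def I_def by measurable
      have B1: "P.prob B1 = \<tau>1 h ?k" unfolding B1_def \<tau>1_def by (subst law[OF _ kn(2) As]) auto
      have B2: "P.prob B2 = \<tau>2 h ?k" unfolding B2_def \<tau>2_def by (subst law[OF _ kn(2) As]) auto
      have B3: "P.prob B3 \<le> 2 * exp (- (real ?k / 8))"
        using unif_count_deviation[OF p(1,2), of "1/2" n] n0 unfolding B3_def by (simp add: power2_eq_square)
      have B4: "P.prob B4 \<le> 2 * exp (- (real ?k / 8))"
        using unif_count_deviation[OF p(3,4), of 1 n] n0 unfolding B4_def by simp
      have I: "P.prob (I x) = \<Lambda> ?k x" for x unfolding I_def \<Lambda>_def by (subst law[OF _ kn(2)]) auto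
      have PB: "P.prob (A \<union> (B1 \<union> B2 \<union> (B3 \<union> B4))) \<le> P.prob A + bad h ?k" if "A \<in> sets (PU {..<n})" for A
      proof -
        have "P.prob (A \<union> (B1 \<union> B2 \<union> (B3 \<union> B4))) \<le> P.prob A + P.prob (B1 \<union> B2 \<union> (B3 \<union> B4))"
          using that Bm by (intro measure_Un_le) auto
        moreover have "P.prob (B1 \<union> B2 \<union> (B3 \<union> B4)) \<le> P.prob (B1 \<union> B2) + P.prob (B3 \<union> B4)"
          using Bm by (intro measure_Un_le) auto
        moreover have "P.prob (B1 \<union> B2) \<le> P.prob B1 + P.prob B2" "P.prob (B3 \<union> B4) \<le> P.prob B3 + P.prob B4"
          using Bm by (auto intro: measure_Un_le)
        ultimately show ?thesis using B1 B2 B3 B4 unfolding bad_def by linarith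
      qed
      have key: "AE w in PU {..<n}. w \<notin> B1 \<union> B2 \<union> (B3 \<union> B4) \<longrightarrow> (w \<in> \<Psi> n \<longrightarrow> w \<in> I (y + D * h)) \<and> (w \<in> I (y - D * h) \<longrightarrow> w \<in> \<Psi> n)"
        using AE_PU_conf[OF kn(2)] AE_space
      proof eventually_elim
        case w: (elim w)
        show ?case
        proof
          assume nb: "w \<notin> B1 \<union> B2 \<union> (B3 \<union> B4)"
          obtain j S where cf: "conf w n ?k j S" using w by blast
          have w01: "\<And>i. i < n \<Longrightarrow> 0 < w i \<and> w i < 1" using w by blast
          have S: "S = {i. i < n \<and> w i < w j}" by (rule conf_S[OF cf])
          have finS: "finite S" unfolding S by simp
          have jn: "j < n" and Sk: "card S = ?k" using cf by (auto simp: conf_def)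
          have \<theta>1: "real ?k / (2 * real n) \<le> w j"
          proof (rule ccontr)
            assume lt: "\<not> ?p' \<le> w j"
            then have "insert j S \<subseteq> {l. l < n \<and> w l < ?p'}" using jn by (auto simp: S)
            then have "card (insert j S) \<le> card {l. l < n \<and> w l < ?p'}" by (intro card_mono) auto
            moreover have "card (insert j S) = Suc ?k" using finS Sk by (subst card_insert_disjoint) (auto simp: S)
            ultimately have "real ?k \<le> real (card {l. l < n \<and> w l < ?p'})" by simp
            moreover have "real n * ?p' = real ?k / 2" using n0 by simp
            ultimately have "1 * (real n * ?p') \<le> \<bar>real (card {l. l < n \<and> w l < ?p'}) - real n * ?p'\<bar>" by linarith
            then have "w \<in> B4" unfolding B4_def using w by blast
            with nb show False by blast
          qed
          have \<theta>2: "w j \<le> 2 * real ?k / real n"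
          proof (rule ccontr)
            assume lt: "\<not> w j \<le> ?p"
            then have "{l. l < n \<and> w l < ?p} \<subseteq> S" by (auto simp: S)
            then have "card {l. l < n \<and> w l < ?p} \<le> ?k" using card_mono[OF finS] Sk by metis
            then have "real (card {l. l < n \<and> w l < ?p}) \<le> real ?k" by simp
            then have "1/2 * (2 * real ?k) \<le> \<bar>real (card {l. l < n \<and> w l < ?p}) - 2 * real ?k\<bar>" by linarith
            moreover have np: "real n * ?p = 2 * real ?k" using n0 by simp
            ultimately have "1/2 * (real n * ?p) \<le> \<bar>real (card {l. l < n \<and> w l < ?p}) - real n * ?p\<bar>"
              unfolding np by blast
            then have "w \<in> B3" unfolding B3_def using w by blast
            with nb show False by blast
          qed
          have d1: "\<bar>below_sum (dev1 \<rho>) n ?k w\<bar> \<le> h * real ?k powr (3/4)"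
            using nb w unfolding B1_def by (auto simp: not_le less_imp_le)
          have d2: "\<bar>below_sum (dev2 \<rho>) n ?k w\<bar> \<le> h * real ?k powr (3/4)"
            using nb w unfolding B2_def by (auto simp: not_le less_imp_le)
          have nT: "2 * T \<le> real n / real ?k" using elim(2) by simp
          have sm: "sqrt (real ?k) * ((2 * C / \<phi> + C) * C * At (real n / real ?k)) \<le> h"
            using elim(1) by (simp add: mult_ac)
          have ky: "\<bar>y\<bar> < sqrt (real ?k) * \<rho>" using elim(3) by linarith
          have ev1: "sqrt (real ?k) * (rho_os (\<lambda>l. H (w l)) n ?k - \<rho>) \<le> y \<Longrightarrow>
              below_sum (infl \<rho>) n ?k w \<le> sqrt (real ?k) * (y + D * h)"
            unfolding D_def \<kappa>_def H_def
            by (rule moment_event(1)[OF \<phi> \<rho> _ C T(1) _ _ cf _ kn \<theta>1 \<theta>2 nT h[unfolded \<kappa>_def] d1 d2 sm ky])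
               (assumption | rule V_le Vhalf mb w01)+
          have ev2: "below_sum (infl \<rho>) n ?k w \<le> sqrt (real ?k) * (y - D * h) \<Longrightarrow>
              sqrt (real ?k) * (rho_os (\<lambda>l. H (w l)) n ?k - \<rho>) \<le> y"
            unfolding D_def \<kappa>_def H_def
            by (rule moment_event(2)[OF \<phi> \<rho> _ C T(1) _ _ cf _ kn \<theta>1 \<theta>2 nT h[unfolded \<kappa>_def] d1 d2 sm ky])
               (assumption | rule V_le Vhalf mb w01)+
          show "(w \<in> \<Psi> n \<longrightarrow> w \<in> I (y + D * h)) \<and> (w \<in> I (y - D * h) \<longrightarrow> w \<in> \<Psi> n)"
            using ev1 ev2 w unfolding \<Psi>_def I_def by auto
        qed
      qed
      have "P.prob (\<Psi> n) \<le> P.prob (I (y + D * h) \<union> (B1 \<union> B2 \<union> (B3 \<union> B4)))"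
        by (rule P.finite_measure_mono_AE) (use key Bm in auto)
      also have "\<dots> \<le> \<Lambda> ?k (y + D * h) + bad h ?k" using PB[OF Bm(5)] unfolding I .
      finally have r1: "P.prob (\<Psi> n) \<le> \<Lambda> ?k (y + D * h) + bad h ?k" .
      have "P.prob (I (y - D * h)) \<le> P.prob (\<Psi> n \<union> (B1 \<union> B2 \<union> (B3 \<union> B4)))"
        by (rule P.finite_measure_mono_AE) (use key Bm \<Psi>m in auto)
      also have "\<dots> \<le> P.prob (\<Psi> n) + bad h ?k" by (rule PB[OF \<Psi>m])
      finally have "\<Lambda> ?k (y - D * h) \<le> P.prob (\<Psi> n) + bad h ?k" unfolding I .
      with r1 show ?case by simp
    qed
  qed
  have hsmall: "eventually (\<lambda>h. 0 < h \<and> h \<le> 1 \<and> 7 * \<kappa> * h < 1 \<and> 7 * \<kappa> * h < \<rho>) (at_right 0)"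
  proof -
    define h0 where "h0 = min 1 (min (1 / (7 * \<kappa>)) (\<rho> / (7 * \<kappa>)))"
    have "0 < h0" using \<kappa> \<rho> by (simp add: h0_def)
    then show ?thesis
    proof (rule eventually_at_rightI[rotated])
      fix h assume "h \<in> {0<..<h0}"
      then have "0 < h" "h < 1" "h < 1 / (7 * \<kappa>)" "h < \<rho> / (7 * \<kappa>)" by (auto simp: h0_def)
      then show "0 < h \<and> h \<le> 1 \<and> 7 * \<kappa> * h < 1 \<and> 7 * \<kappa> * h < \<rho>" using \<kappa> by (simp add: field_simps)
    qed
  qed
  have cont: "((\<lambda>h. cdf std_normal_distribution ((y + D' * h) / \<sigma>)) \<longlongrightarrow> cdf std_normal_distribution (y / \<sigma>)) (at_right 0)" for D'
  proof -
    have "((\<lambda>h. (y + D' * h) / \<sigma>) \<longlongrightarrow> (y + D' * 0) / \<sigma>) (at_right 0)"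
      using \<sigma> by (intro tendsto_intros) auto
    then have l: "((\<lambda>h. (y + D' * h) / \<sigma>) \<longlongrightarrow> y / \<sigma>) (at_right 0)" by simp
    show ?thesis by (rule isCont_tendsto_compose[OF isCont_std_normal_cdf l])
  qed
  have "(\<lambda>n. measure (PU {..<n}) (\<Psi> n)) \<longlonglongrightarrow> cdf std_normal_distribution (y / \<sigma>)"
  proof (rule order_tendstoI)
    fix b assume "cdf std_normal_distribution (y / \<sigma>) < b"
    from eventually_conj[OF order_tendstoD(2)[OF cont[of D] this] hsmall]
    obtain h where hb: "cdf std_normal_distribution ((y + D * h) / \<sigma>) < b"
      and h: "0 < h" "h \<le> 1" "7 * \<kappa> * h < 1" "7 * \<kappa> * h < \<rho>"
      using eventually_happens[of _ "at_right (0::real)"] trivial_limit_at_right_real by blast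
    have "(\<lambda>n. \<Lambda> (k n) (y + D * h) + bad h (k n)) \<longlonglongrightarrow> cdf std_normal_distribution ((y + D * h) / \<sigma>) + 0"
      by (intro tendsto_add \<Lambda>_lim bad_lim h)
    then have "eventually (\<lambda>n. \<Lambda> (k n) (y + D * h) + bad h (k n) < b) sequentially"
      using hb by (intro order_tendstoD(2)) auto
    with sand[OF h] show "eventually (\<lambda>n. measure (PU {..<n}) (\<Psi> n) < b) sequentially"
      by eventually_elim linarith
  next
    fix b assume "b < cdf std_normal_distribution (y / \<sigma>)"
    from eventually_conj[OF order_tendstoD(1)[OF cont[of "- D"] this] hsmall]
    obtain h where hb: "b < cdf std_normal_distribution ((y + - D * h) / \<sigma>)"
      and h: "0 < h" "h \<le> 1" "7 * \<kappa> * h < 1" "7 * \<kappa> * h < \<rho>"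
      using eventually_happens[of _ "at_right (0::real)"] trivial_limit_at_right_real by blast
    have "(\<lambda>n. \<Lambda> (k n) (y - D * h) - bad h (k n)) \<longlonglongrightarrow> cdf std_normal_distribution ((y - D * h) / \<sigma>) - 0"
      by (intro tendsto_diff \<Lambda>_lim bad_lim h)
    then have "eventually (\<lambda>n. b < \<Lambda> (k n) (y - D * h) - bad h (k n)) sequentially"
      using hb by (intro order_tendstoD(1)) auto
    with sand[OF h] show "eventually (\<lambda>n. b < measure (PU {..<n}) (\<Psi> n)) sequentially"
      by eventually_elim linarith
  qed
  then show ?thesis unfolding \<Psi>_def .
qed

end

section \<open>Reduction to a univariate sample\<close>

lemma upper_os_cong: "(\<And>l. l < n \<Longrightarrow> z l = z' l) \<Longrightarrow> upper_os z n i = upper_os z' n i"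
  unfolding upper_os_def by (intro arg_cong[where f=Inf] Collect_cong conj_cong refl arg_cong2[where f="(\<le>)"] arg_cong[where f=card]) auto

lemma rho_os_cong:
  assumes "\<And>l. l < n \<Longrightarrow> z l = z' l"
  shows "rho_os z n k = rho_os z' n k"
proof -
  have "upper_os z n i = upper_os z' n i" for i using assms by (rule upper_os_cong)
  then show ?thesis unfolding rho_os_def moment_os_def by simp
qed

text \<open>Only the joint law of the sample matters, and by independence it is the image of the
  uniform product law under \<open>H\<close> in each coordinate.\<close>

lemma (in prob_space) rho_os_law:
  assumes indep: "indep_vars (\<lambda>_. borel) Z {..<n}" and n: "0 < n"
    and law: "\<And>l. l < n \<Longrightarrow> distr M borel (Z l) = distr unif borel H"
    and Hm: "H \<in> borel_measurable borel" and A: "A \<in> sets borel"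
  shows "prob {\<omega> \<in> space M. rho_os (\<lambda>l. Z l \<omega>) n k \<in> A}
    = measure (PU {..<n}) {w \<in> space (PU {..<n}). rho_os (\<lambda>l. H (w l)) n k \<in> A}"
proof -
  let ?I = "{..<n}"
  let ?P = "Pi\<^sub>M ?I (\<lambda>_. borel :: real measure)"
  have Zm: "Z l \<in> borel_measurable M" if "l < n" for l using indep that by (auto simp: indep_vars_def)
  have I: "?I \<noteq> {}" using n by auto
  have Hm': "H \<in> measurable unif borel" using Hm by (simp add: measurable_def)
  define E where "E = {v \<in> space ?P. rho_os v n k \<in> A}"
  have E: "E \<in> sets ?P"
  proof -
    have "(\<lambda>v. rho_os v n k) \<in> borel_measurable ?P"
      by (rule borel_measurable_rho_os) auto
    then show ?thesis unfolding E_def using A by measurable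
  qed
  have "distr M ?P (\<lambda>\<omega>. \<lambda>i\<in>?I. Z i \<omega>) = (\<Pi>\<^sub>M i\<in>?I. distr M borel (Z i))"
    using indep_vars_iff_distr_eq_PiM'[OF I, where X = Z and M' = "\<lambda>_. borel"] Zm indep by auto
  also have "\<dots> = (\<Pi>\<^sub>M i\<in>?I. distr unif borel H)"
    by (rule PiM_cong) (use law in auto)
  \<comment> \<open>The target space is renamed to the image law itself, which has the same
    measurable sets as \<open>borel\<close> but is a probability space, as the product rule applied
    next demands.\<close>
  also have "\<dots> = (\<Pi>\<^sub>M i\<in>?I. distr unif (distr unif borel H) H)"
    by (intro PiM_cong refl distr_cong) auto
  also have "\<dots> = distr (PU ?I) (\<Pi>\<^sub>M i\<in>?I. distr unif borel H) (compose ?I H)"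
    by (rule distr_PiM_finite_prob_space'[symmetric])
       (use Hm' in \<open>auto intro: prob_space_unif unif.prob_space_distr\<close>)
  also have "\<dots> = distr (PU ?I) ?P (compose ?I H)"
    by (intro distr_cong refl sets_PiM_cong) auto
  finally have eq: "distr M ?P (\<lambda>\<omega>. \<lambda>i\<in>?I. Z i \<omega>) = distr (PU ?I) ?P (compose ?I H)" .
  have 1: "(\<lambda>\<omega>. \<lambda>i\<in>?I. Z i \<omega>) \<in> measurable M ?P" by (rule measurable_restrict) (use Zm in auto)
  have 2: "compose ?I H \<in> measurable (PU ?I) ?P"
    unfolding compose_def by (rule measurable_restrict) (auto intro!: measurable_compose[OF PU_component Hm])
  have r: "rho_os (\<lambda>i\<in>?I. z i) n k = rho_os z n k" for z by (rule rho_os_cong) auto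
  have "prob {\<omega> \<in> space M. rho_os (\<lambda>l. Z l \<omega>) n k \<in> A} = prob ((\<lambda>\<omega>. \<lambda>i\<in>?I. Z i \<omega>) -` E \<inter> space M)"
    by (intro arg_cong[where f=prob]) (use measurable_space[OF 1] in \<open>auto simp: E_def r\<close>)
  also have "\<dots> = measure (PU ?I) (compose ?I H -` E \<inter> space (PU ?I))"
    using arg_cong[OF eq, of "\<lambda>D. measure D E"] by (simp add: measure_distr 1 2 E)
  also have "\<dots> = measure (PU ?I) {w \<in> space (PU ?I). rho_os (\<lambda>l. H (w l)) n k \<in> A}"
    by (intro arg_cong[where f="measure (PU ?I)"])
       (use measurable_space[OF 2] r[of "\<lambda>l. H (w l)" for w] in \<open>auto simp: E_def compose_def\<close>)
  finally show ?thesis .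
qed

lemma cdf_centered_normal:
  assumes \<sigma>: "0 < \<sigma>"
  shows "cdf (density lborel (normal_density 0 \<sigma>)) y = cdf std_normal_distribution (y / \<sigma>)"
proof -
  interpret N: prob_space "density lborel (normal_density 0 \<sigma>)" by (rule prob_space_normal_density[OF \<sigma>])
  let ?N = "density lborel (normal_density 0 \<sigma>)"
  have "distributed ?N lborel (\<lambda>x. x) (normal_density 0 \<sigma>)"
    by (auto simp: distributed_def distr_id2)
  then have "distributed ?N lborel (\<lambda>x. (x - 0) / \<sigma>) std_normal_density"
    using N.normal_standard_normal_convert[OF \<sigma>, of "\<lambda>x. x" 0] by simp
  then have d: "distr ?N lborel (\<lambda>x. x / \<sigma>) = density lborel std_normal_density"
    by (simp add: distributed_def)
  have "cdf std_normal_distribution (y / \<sigma>) = measure (distr ?N lborel (\<lambda>x. x / \<sigma>)) {..y / \<sigma>}"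
    unfolding d cdf_def ..
  also have "\<dots> = measure ?N {..y}"
    by (subst measure_distr) (use \<sigma> in \<open>auto intro!: arg_cong[where f="measure _"] simp: divide_le_cancel\<close>)
  finally show ?thesis by (simp add: cdf_def)
qed

lemma filterlim_at_right_0_inverse_iff:
  fixes f :: "real \<Rightarrow> 'b"
  shows "filterlim f F (at_right 0) \<longleftrightarrow> filterlim (\<lambda>t. f (1 / t)) F at_top"
  by (simp add: at_right_to_top filterlim_filtermap divide_inverse)

section \<open>The sample of pairs\<close>

locale frontier_sample = prob_space M for M :: "'a measure" +
  fixes X :: "'a \<Rightarrow> real ^ 'p" and Y :: "'a \<Rightarrow> real"
    and Xs :: "nat \<Rightarrow> 'a \<Rightarrow> real ^ 'p" and Ys :: "nat \<Rightarrow> 'a \<Rightarrow> real"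
    and x :: "real ^ 'p"
  assumes X_measurable [measurable]: "X \<in> borel_measurable M"
    and Y_measurable [measurable]: "Y \<in> borel_measurable M"
    and Y_nonneg: "AE \<omega> in M. 0 \<le> Y \<omega>"
    and indep: "indep_vars (\<lambda>_. borel) (\<lambda>i \<omega>. (Xs i \<omega>, Ys i \<omega>)) UNIV"
    and copies: "\<And>i. distr M borel (\<lambda>\<omega>. (Xs i \<omega>, Ys i \<omega>)) = distr M borel (\<lambda>\<omega>. (X \<omega>, Y \<omega>))"
    and FX_pos: "0 < marginal_df M X x"
    and frontier_finite: "bdd_above {y. 0 \<le> y \<and> cond_df M X Y x y < 1}"
begin

abbreviation "FX \<equiv> marginal_df M X x"
abbreviation "\<phi> \<equiv> frontier_fun M X Y x"

definition S where "S y = prob {\<omega> \<in> space M. X \<omega> \<le> x \<and> y < Y \<omega>}"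
text \<open>\<open>Y\<close> is nonnegative only almost surely; the truncation makes
  \<open>Z\<close> nonnegative everywhere, so that order statistics, which are cut at 0, lose
  nothing.\<close>

definition Z where "Z l \<omega> = (if Xs l \<omega> \<le> x then max 0 (Ys l \<omega>) else 0)"
definition N where "N n \<omega> = card {l. l < n \<and> Xs l \<omega> \<le> x}"

lemma pair_measurable [measurable]: "(\<lambda>\<omega>. (Xs l \<omega>, Ys l \<omega>)) \<in> borel_measurable M"
  using indep by (auto simp: indep_vars_def)

lemma Xs_measurable [measurable]: "Xs l \<in> borel_measurable M"
  and Ys_measurable [measurable]: "Ys l \<in> borel_measurable M"
proof -
  have "(\<lambda>\<omega>. (Xs l \<omega>, Ys l \<omega>)) \<in> measurable M (borel \<Otimes>\<^sub>M borel)"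
    using pair_measurable[of l] by (simp add: borel_prod)
  from measurable_compose[OF this measurable_fst] measurable_compose[OF this measurable_snd]
  show "Xs l \<in> borel_measurable M" "Ys l \<in> borel_measurable M" by simp_all
qed

lemma atMost_borel [measurable]: "Measurable.pred borel (\<lambda>v :: real ^ 'p. v \<le> x)"
proof -
  have "{v. v \<le> x} \<in> sets borel" using closed_eucl_atMost[of x] by (simp add: atMost_def borel_closed)
  then show ?thesis by (simp add: pred_def)
qed

lemma copy_prob:
  assumes [measurable]: "A \<in> sets borel"
  shows "prob {\<omega> \<in> space M. Xs l \<omega> \<le> x \<and> Ys l \<omega> \<in> A} = prob {\<omega> \<in> space M. X \<omega> \<le> x \<and> Y \<omega> \<in> A}"
proof -
  let ?E = "{v :: real ^ 'p. v \<le> x} \<times> A"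
  have xm: "{v :: real ^ 'p. v \<le> x} \<in> sets borel" using atMost_borel by (simp add: pred_def)
  have E: "?E \<in> sets borel" unfolding borel_prod[symmetric] by (rule pair_measureI[OF xm assms])
  have m: "(\<lambda>\<omega>. (X \<omega>, Y \<omega>)) \<in> borel_measurable M" by measurable
  have "measure (distr M borel (\<lambda>\<omega>. (Xs l \<omega>, Ys l \<omega>))) ?E = measure (distr M borel (\<lambda>\<omega>. (X \<omega>, Y \<omega>))) ?E"
    by (simp only: copies)
  then have "prob ((\<lambda>\<omega>. (Xs l \<omega>, Ys l \<omega>)) -` ?E \<inter> space M) = prob ((\<lambda>\<omega>. (X \<omega>, Y \<omega>)) -` ?E \<inter> space M)"
    by (simp only: measure_distr[OF pair_measurable E] measure_distr[OF m E])
  also have "(\<lambda>\<omega>. (Xs l \<omega>, Ys l \<omega>)) -` ?E \<inter> space M = {\<omega> \<in> space M. Xs l \<omega> \<le> x \<and> Ys l \<omega> \<in> A}" by auto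
  also have "(\<lambda>\<omega>. (X \<omega>, Y \<omega>)) -` ?E \<inter> space M = {\<omega> \<in> space M. X \<omega> \<le> x \<and> Y \<omega> \<in> A}" by auto
  finally show ?thesis .
qed

lemma Z_measurable [measurable]: "Z l \<in> borel_measurable M"
  unfolding Z_def[abs_def] by measurable

lemma Z_tail: "0 \<le> y \<Longrightarrow> prob {\<omega> \<in> space M. y < Z l \<omega>} = S y"
proof -
  assume y: "0 \<le> y"
  have "{\<omega> \<in> space M. y < Z l \<omega>} = {\<omega> \<in> space M. Xs l \<omega> \<le> x \<and> Ys l \<omega> \<in> {y<..}}"
    using y by (auto simp: Z_def)
  then show ?thesis using copy_prob[of "{y<..}" l] by (simp add: S_def)
qed

lemma Z_indep: "indep_vars (\<lambda>_. borel) Z I"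
proof -
  have "indep_vars (\<lambda>_. borel) (\<lambda>l \<omega>. (\<lambda>l p. if fst p \<le> x then max 0 (snd p) else 0) l (Xs l \<omega>, Ys l \<omega>)) UNIV"
  proof (rule indep_vars_compose2[OF indep])
    show "(\<lambda>p :: (real ^ 'p) \<times> real. if fst p \<le> x then max 0 (snd p) else 0) \<in> borel_measurable borel"
      unfolding borel_prod[symmetric] by measurable
  qed
  also have "(\<lambda>l \<omega>. (\<lambda>l p. if fst p \<le> x then max 0 (snd p) else 0) l (Xs l \<omega>, Ys l \<omega>)) = Z"
    by (simp add: Z_def fun_eq_iff)
  finally have "indep_vars (\<lambda>_. borel) Z UNIV" .
  then show ?thesis by (rule indep_vars_subset) simp
qed

lemma S_joint: "joint_df M X Y x y = FX - S y"
proof -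
  have "FX = prob ({\<omega> \<in> space M. X \<omega> \<le> x \<and> Y \<omega> \<le> y} \<union> {\<omega> \<in> space M. X \<omega> \<le> x \<and> y < Y \<omega>})"
    unfolding marginal_df_def by (intro arg_cong[where f=prob]) auto
  also have "\<dots> = joint_df M X Y x y + S y"
    unfolding joint_df_def S_def by (rule finite_measure_Union) auto
  finally show ?thesis by simp
qed

lemma cond_df_eq: "1 - cond_df M X Y x y = S y / FX"
  using FX_pos by (simp add: cond_df_def S_joint diff_divide_distrib)

lemma S_nonneg: "0 \<le> S y" and S_le_1: "S y \<le> 1"
  by (auto simp: S_def)

lemma S_antimono: "y \<le> y' \<Longrightarrow> S y' \<le> S y"
  unfolding S_def by (rule finite_measure_mono) auto

lemma S_neg: "y < 0 \<Longrightarrow> S y = FX"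
  unfolding S_def marginal_df_def by (rule measure_eq_AE) (use Y_nonneg in auto)

lemma S_cdf: "0 \<le> y \<Longrightarrow> S y = 1 - cdf (distr M borel (Z l)) y"
proof -
  assume y: "0 \<le> y"
  have "cdf (distr M borel (Z l)) y = prob {\<omega> \<in> space M. Z l \<omega> \<le> y}"
    unfolding cdf_def by (subst measure_distr) (auto intro!: arg_cong[where f=prob])
  also have "\<dots> = prob (space M - {\<omega> \<in> space M. y < Z l \<omega>})"
    by (intro arg_cong[where f=prob]) auto
  also have "\<dots> = 1 - S y" using Z_tail[OF y, of l] by (subst prob_compl) auto
  finally show ?thesis by simp
qed

lemma Z_distribution: "real_distribution (distr M borel (Z l))"
  by (rule real_distribution_distr) simp

lemma S_right_cont:
  assumes "0 \<le> y"
  shows "(S \<longlongrightarrow> S y) (at_right y)"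
proof -
  interpret R: real_distribution "distr M borel (Z 0)" by (rule Z_distribution)
  have "((\<lambda>v. 1 - cdf (distr M borel (Z 0)) v) \<longlongrightarrow> 1 - cdf (distr M borel (Z 0)) y) (at_right y)"
    using R.cdf_is_right_cont[of y] by (intro tendsto_intros) (simp add: continuous_within)
  moreover have "eventually (\<lambda>v. 1 - cdf (distr M borel (Z 0)) v = S v) (at_right y)"
    using assms by (intro eventually_at_right_less[THEN eventually_mono]) (simp add: S_cdf[of _ 0])
  ultimately show ?thesis using S_cdf[OF assms, of 0] Lim_transform_eventually by simp
qed

text \<open>Right continuity of \<open>S\<close> makes the infimum satisfy its own inequality, so
  that the generalised inverse and the tail are equivalent descriptions.\<close>

lemma S_Inf_le_iff:
  assumes ne: "\<exists>y\<ge>0. S y \<le> u" and y: "0 \<le> y"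
  shows "Inf {y. 0 \<le> y \<and> S y \<le> u} \<le> y \<longleftrightarrow> S y \<le> u"
proof
  assume "S y \<le> u"
  then show "Inf {y. 0 \<le> y \<and> S y \<le> u} \<le> y" using y by (intro cInf_lower bdd_belowI[of _ 0]) auto
next
  assume le: "Inf {y. 0 \<le> y \<and> S y \<le> u} \<le> y"
  have "eventually (\<lambda>v. S v \<le> u) (at_right y)"
    using eventually_at_right_less
  proof eventually_elim
    case (elim v)
    then have "Inf {y. 0 \<le> y \<and> S y \<le> u} < v" using le by simp
    then obtain c where "0 \<le> c" "S c \<le> u" "c < v"
      using ne by (subst (asm) cInf_less_iff) (auto intro: bdd_belowI[of _ 0])
    then show ?case using S_antimono[of c v] by simp
  qed
  then show "S y \<le> u" by (rule tendsto_upperbound[OF S_right_cont[OF y]]) simp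
qed

lemma cond_df_less_1: "cond_df M X Y x y < 1 \<longleftrightarrow> 0 < S y"
proof -
  have "0 < S y \<longleftrightarrow> 0 < S y / FX" using FX_pos by (simp add: zero_less_divide_iff)
  then show ?thesis unfolding cond_df_eq[symmetric] by simp
qed

lemma frontier_eq: "\<phi> = Sup {y. 0 \<le> y \<and> 0 < S y}"
  by (simp add: cond_df_less_1 frontier_fun_def upper_endpoint_def)

text \<open>\<open>S 0 > 0\<close> makes the set whose supremum is the frontier nonempty; otherwise
  the supremum would be an unspecified number. The tail vanishes at the frontier itself by right
  continuity.\<close>

lemma tail_at_frontier:
  assumes "0 < S 0"
  shows "0 < \<phi>" "S \<phi> = 0" "\<And>y. y < \<phi> \<Longrightarrow> 0 < S y"
proof -
  have bdd: "bdd_above {y. 0 \<le> y \<and> 0 < S y}" using frontier_finite by (simp add: cond_df_less_1)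
  have ge: "y \<le> \<phi>" if "0 \<le> y" "0 < S y" for y
    unfolding frontier_eq using that by (intro cSup_upper bdd) auto
  have \<phi>0: "0 \<le> \<phi>" by (rule ge) (use assms in auto)
  have "eventually (\<lambda>v. S v \<le> 0) (at_right \<phi>)"
    using eventually_at_right_less
  proof eventually_elim
    case (elim v)
    then show ?case using ge[of v] \<phi>0 by (auto simp: not_less[symmetric])
  qed
  then have "S \<phi> \<le> 0" by (rule tendsto_upperbound[OF S_right_cont[OF \<phi>0]]) simp
  then show S\<phi>: "S \<phi> = 0" using S_nonneg[of \<phi>] by simp
  show "0 < \<phi>" using \<phi>0 S\<phi> assms by (cases "\<phi> = 0") auto
  show "0 < S y" if "y < \<phi>" for y
  proof -
    have "\<exists>v\<in>{y. 0 \<le> y \<and> 0 < S y}. y < v"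
      using that assms unfolding frontier_eq by (subst (asm) less_cSup_iff) (use bdd in auto)
    then obtain v where "0 < S v" "y < v" by blast
    then show ?thesis using S_antimono[of y v] by linarith
  qed
qed

lemma N_eventually_pos:
  shows "(\<lambda>n. prob {\<omega> \<in> space M. N n \<omega> = 0}) \<longlonglongrightarrow> 0"
    and "AE \<omega> in M. eventually (\<lambda>n. 0 < N n \<omega>) sequentially"
proof -
  define Q where "Q n = {\<omega> \<in> space M. N n \<omega> = 0}" for n
  have Qeq: "Q n = {\<omega> \<in> space M. \<forall>l<n. \<not> Xs l \<omega> \<le> x}" for n
    by (auto simp: Q_def N_def card_eq_0_iff)
  have Qm: "Q n \<in> events" for n unfolding Qeq by measurable
  have p: "prob {\<omega> \<in> space M. Xs l \<omega> \<le> x} = FX" for l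
    using copy_prob[of UNIV l] by (simp add: marginal_df_def)
  have np: "prob {\<omega> \<in> space M. \<not> Xs l \<omega> \<le> x} = 1 - FX" for l
  proof -
    have "prob {\<omega> \<in> space M. \<not> Xs l \<omega> \<le> x} = prob (space M - {\<omega> \<in> space M. Xs l \<omega> \<le> x})"
      by (intro arg_cong[where f=prob]) auto
    then show ?thesis by (simp add: prob_compl p)
  qed
  have prob: "prob (Q n) = (1 - FX) ^ n" if n: "0 < n" for n
  proof -
    have "prob (\<Inter>l\<in>{..<n}. (\<lambda>\<omega>. (Xs l \<omega>, Ys l \<omega>)) -` (UNIV - {p. fst p \<le> x}) \<inter> space M)
      = (\<Prod>l\<in>{..<n}. prob ((\<lambda>\<omega>. (Xs l \<omega>, Ys l \<omega>)) -` (UNIV - {p. fst p \<le> x}) \<inter> space M))"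
    proof (rule indep_varsD[OF indep])
      have "(\<lambda>p :: (real ^ 'p) \<times> real. fst p \<le> x) \<in> measurable (borel \<Otimes>\<^sub>M borel) (count_space UNIV)"
        by (rule measurable_compose[OF measurable_fst atMost_borel])
      then have "{p :: (real ^ 'p) \<times> real. fst p \<le> x} \<in> sets borel"
        by (simp add: pred_def borel_prod)
      then show "UNIV - {p. fst p \<le> x} \<in> sets (borel :: ((real ^ 'p) \<times> real) measure)" by auto
    qed (use n in auto)
    moreover have "(\<Inter>l\<in>{..<n}. (\<lambda>\<omega>. (Xs l \<omega>, Ys l \<omega>)) -` (UNIV - {p. fst p \<le> x}) \<inter> space M) = Q n"
      unfolding Qeq using n by auto
    moreover have "(\<lambda>\<omega>. (Xs l \<omega>, Ys l \<omega>)) -` (UNIV - {p. fst p \<le> x}) \<inter> space M = {\<omega> \<in> space M. \<not> Xs l \<omega> \<le> x}" for l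
      by auto
    ultimately show ?thesis by (simp add: np)
  qed
  have FX1: "FX \<le> 1" by (simp add: marginal_df_def)
  have "(\<lambda>n. (1 - FX) ^ n) \<longlonglongrightarrow> 0" using FX_pos FX1 by (intro LIMSEQ_power_zero) auto
  moreover have "eventually (\<lambda>n. (1 - FX) ^ n = prob (Q n)) sequentially"
    using eventually_gt_at_top[of 0] by eventually_elim (simp add: prob)
  ultimately have lim: "(\<lambda>n. prob (Q n)) \<longlonglongrightarrow> 0" by (rule Lim_transform_eventually)
  then show "(\<lambda>n. prob {\<omega> \<in> space M. N n \<omega> = 0}) \<longlonglongrightarrow> 0" unfolding Q_def .
  have dec: "decseq Q" by (rule decseq_SucI) (auto simp: Qeq)
  have "(\<lambda>n. prob (Q n)) \<longlonglongrightarrow> prob (\<Inter>n. Q n)"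
    by (rule finite_Lim_measure_decseq) (use Qm dec in auto)
  then have "prob (\<Inter>n. Q n) = 0" using lim LIMSEQ_unique by blast
  then have "AE \<omega> in M. \<omega> \<notin> (\<Inter>n. Q n)"
    using Qm by (intro AE_not_in) (auto simp: null_sets_def emeasure_eq_measure)
  then show "AE \<omega> in M. eventually (\<lambda>n. 0 < N n \<omega>) sequentially"
    using AE_space
  proof eventually_elim
    case (elim \<omega>)
    then obtain n where "\<omega> \<notin> Q n" by auto
    then have "\<omega> \<notin> Q m" if "n \<le> m" for m using that dec by (auto simp: decseq_def)
    then show ?case using elim(2) unfolding eventually_sequentially Q_def by auto
  qed
qed

lemma rho_moment_eq:
  assumes "0 < N n \<omega>"
  shows "rho_moment Xs Ys x k n \<omega> = rho_os (\<lambda>l. Z l \<omega>) n k"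
proof -
  have n: "0 < n" using assms by (cases n) (auto simp: N_def)
  have marg: "emp_marginal_df Xs n \<omega> x = real (N n \<omega>) / real n"
    by (simp add: emp_marginal_df_def N_def of_bool_def sum.If_cases Int_def)
  have cnt: "emp_joint_df Xs Ys n \<omega> x y = (real (N n \<omega>) - real (card {l. l < n \<and> y < Z l \<omega>})) / real n"
    if y: "0 \<le> y" for y
  proof -
    have "N n \<omega> = card ({l. l < n \<and> Xs l \<omega> \<le> x \<and> Ys l \<omega> \<le> y} \<union> {l. l < n \<and> y < Z l \<omega>})"
      unfolding N_def using y by (intro arg_cong[where f=card]) (auto simp: Z_def split: if_splits)
    also have "\<dots> = card {l. l < n \<and> Xs l \<omega> \<le> x \<and> Ys l \<omega> \<le> y} + card {l. l < n \<and> y < Z l \<omega>}"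
      by (rule card_Un_disjoint) (use y in \<open>auto simp: Z_def split: if_splits\<close>)
    finally show ?thesis
      by (simp add: emp_joint_df_def of_bool_def sum.If_cases Int_def)
  qed
  \<comment> \<open>The equivalence with a count holds for every rank, also for ranks at least
    \<open>N n \<omega>\<close>, where the order is not positive and both infima are 0.\<close>
  have q: "emp_quantile Xs Ys n \<omega> x (1 - real i / (real n * emp_marginal_df Xs n \<omega> x)) = upper_os (\<lambda>l. Z l \<omega>) n i" for i
  proof -
    have "1 - real i / (real n * emp_marginal_df Xs n \<omega> x) \<le> emp_cond_df Xs Ys n \<omega> x y
      \<longleftrightarrow> card {l. l < n \<and> y < Z l \<omega>} \<le> i" if y: "0 \<le> y" for y
    proof -
      have "emp_cond_df Xs Ys n \<omega> x y = 1 - real (card {l. l < n \<and> y < Z l \<omega>}) / real (N n \<omega>)"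
        using assms n unfolding emp_cond_df_def cnt[OF y] marg by (simp add: field_simps)
      moreover have "real n * emp_marginal_df Xs n \<omega> x = real (N n \<omega>)" using n by (simp add: marg)
      ultimately show ?thesis using assms by (simp add: divide_le_cancel)
    qed
    then show ?thesis unfolding emp_quantile_def quantile_of_def upper_os_def
      by (intro arg_cong[where f=Inf]) auto
  qed
  show ?thesis unfolding rho_moment_def rho_os_def log_moment_def moment_os_def q ..
qed

lemma rho_moment_measurable [measurable]: "(\<lambda>\<omega>. rho_moment Xs Ys x k n \<omega>) \<in> borel_measurable M"
proof -
  have m [measurable]: "(\<lambda>\<omega>. emp_marginal_df Xs n \<omega> x) \<in> borel_measurable M"
    unfolding emp_marginal_df_def of_bool_def by measurable
  have c [measurable]: "(\<lambda>\<omega>. emp_cond_df Xs Ys n \<omega> x y) \<in> borel_measurable M" for y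
    unfolding emp_cond_df_def emp_joint_df_def of_bool_def by measurable
  have [measurable]: "(\<lambda>\<omega>. emp_quantile Xs Ys n \<omega> x (1 - real i / (real n * emp_marginal_df Xs n \<omega> x))) \<in> borel_measurable M" for i
    unfolding emp_quantile_def quantile_of_def
  proof (rule borel_measurable_Inf_nonneg)
    fix \<omega> and y y' :: real
    assume le: "1 - real i / (real n * emp_marginal_df Xs n \<omega> x) \<le> emp_cond_df Xs Ys n \<omega> x y" and y: "y \<le> y'"
    have "emp_joint_df Xs Ys n \<omega> x y \<le> emp_joint_df Xs Ys n \<omega> x y'"
      unfolding emp_joint_df_def using y by (intro divide_right_mono sum_mono) auto
    moreover have "0 \<le> emp_marginal_df Xs n \<omega> x" by (auto simp: emp_marginal_df_def intro!: divide_nonneg_nonneg sum_nonneg)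
    ultimately have "emp_cond_df Xs Ys n \<omega> x y \<le> emp_cond_df Xs Ys n \<omega> x y'"
      unfolding emp_cond_df_def by (rule divide_right_mono)
    with le show "1 - real i / (real n * emp_marginal_df Xs n \<omega> x) \<le> emp_cond_df Xs Ys n \<omega> x y'" by linarith
  next
    fix y :: real
    show "{\<omega> \<in> space M. 1 - real i / (real n * emp_marginal_df Xs n \<omega> x) \<le> emp_cond_df Xs Ys n \<omega> x y} \<in> events"
      by measurable
  qed
  show ?thesis unfolding rho_moment_def log_moment_def by measurable
qed

end

lemma measure_unif_atLeast:
  assumes "0 \<le> c" "c \<le> 1"
  shows "measure unif {c..} = 1 - c"
proof -
  have "emeasure unif {c..} = (\<integral>\<^sup>+u. indicator {0<..<1} u * indicator {c..} u \<partial>lborel)"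
    unfolding unif_def by (subst emeasure_density) auto
  also have "\<dots> = (\<integral>\<^sup>+u. indicator {c..1} u \<partial>lborel)"
    using AE_lborel_singleton[of 0] AE_lborel_singleton[of 1]
    by (intro nn_integral_cong_AE, eventually_elim) (use assms in \<open>auto simp: indicator_def\<close>)
  also have "\<dots> = ennreal (1 - c)" using assms by simp
  finally show ?thesis using assms by (simp add: measure_def)
qed

section \<open>Transfer to the empirical estimator\<close>

context frontier_sample
begin

lemma tail_sample_of_rv:
  assumes \<rho>: "0 < \<rho>" and rv: "rv_frontier M X Y x \<rho>"
  shows "tail_sample M (\<lambda>d. S (\<phi> - d)) \<rho> Z \<phi> \<phi>"
proof -
  have rvS: "((\<lambda>t. S (\<phi> - 1 / (t * z)) / S (\<phi> - 1 / t)) \<longlongrightarrow> z powr (- \<rho>)) at_top" if "0 < z" for z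
    using rv that FX_pos unfolding rv_frontier_def cond_df_eq by simp
  have S0: "0 < S 0"
  proof (rule ccontr)
    assume "\<not> 0 < S 0"
    then have Sy: "S y = 0" if "0 \<le> y" for y using S_antimono[OF that] S_nonneg[of y] by linarith
    \<comment> \<open>If \<open>S 0 = 0\<close>, the frontier is the supremum of the empty set.
      Depending on the sign of that number, the ratio in the condition is eventually 0 / 0 = 0 or FX
      / FX = 1, and neither equals 2^(-\<rho>).\<close>
    have two: "(2 :: real) powr (- \<rho>) < 1" "(2 :: real) powr (- \<rho>) \<noteq> 0"
      using \<rho> by (auto simp: powr_less_one)
    show False
    proof (cases "0 < \<phi>")
      case True
      have "eventually (\<lambda>t. S (\<phi> - 1 / (t * 2)) / S (\<phi> - 1 / t) = 0) at_top"
        using eventually_gt_at_top[of "1 / \<phi>"] eventually_gt_at_top[of 0]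
      proof eventually_elim
        case (elim t)
        then have "1 / (t * 2) \<le> 1 / t" "1 / t < \<phi>" using True by (auto simp: field_simps)
        then show ?case by (simp add: Sy)
      qed
      with rvS[of 2] have "((\<lambda>t. 0) \<longlongrightarrow> (2 :: real) powr (- \<rho>)) (at_top :: real filter)"
        by (auto intro: Lim_transform_eventually)
      then show False using two by (simp add: tendsto_const_iff)
    next
      case False
      have "eventually (\<lambda>t. S (\<phi> - 1 / (t * 2)) / S (\<phi> - 1 / t) = 1) at_top"
        using eventually_gt_at_top[of 0]
      proof eventually_elim
        case (elim t)
        then have "0 < 1 / (t * 2)" "0 < 1 / t" by auto
        then have "\<phi> - 1 / (t * 2) < 0" "\<phi> - 1 / t < 0" using False by linarith+
        then show ?case using FX_pos by (simp only: S_neg) simp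
      qed
      with rvS[of 2] have "((\<lambda>t. 1) \<longlongrightarrow> (2 :: real) powr (- \<rho>)) (at_top :: real filter)"
        by (auto intro: Lim_transform_eventually)
      then show False using two by (simp add: tendsto_const_iff)
    qed
  qed
  note fr = tail_at_frontier[OF S0]
  show ?thesis
  proof unfold_locales
    show "0 < \<rho>" by fact
    show "S (\<phi> - d) \<le> S (\<phi> - d')" if "d \<le> d'" for d d' using that by (intro S_antimono) auto
    show "0 < S (\<phi> - d)" if "0 < d" for d using that by (intro fr(3)) auto
    show "((\<lambda>d. S (\<phi> - r * d) / S (\<phi> - d)) \<longlongrightarrow> r powr \<rho>) (at_right 0)" if r: "0 < r" for r
    proof -
      have "(1 / r) powr (- \<rho>) = r powr \<rho>" using r by (simp add: powr_divide powr_minus_divide)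
      then show ?thesis using rvS[of "1 / r"] r by (simp add: filterlim_at_right_0_inverse_iff)
    qed
    show "indep_vars (\<lambda>_. borel) Z UNIV" by (rule Z_indep)
    show "AE \<omega> in M. Z l \<omega> \<le> \<phi>" for l
    proof -
      have "prob {\<omega> \<in> space M. \<phi> < Z l \<omega>} = 0" using Z_tail[of \<phi> l] fr by simp
      then have "AE \<omega> in M. \<omega> \<notin> {\<omega> \<in> space M. \<phi> < Z l \<omega>}"
        by (intro AE_not_in) (auto simp: null_sets_def emeasure_eq_measure)
      then show ?thesis using AE_space by eventually_elim (simp add: not_less)
    qed
    show "0 < \<phi>" by (rule fr)
    show "prob {\<omega> \<in> space M. \<phi> - d < Z l \<omega>} = S (\<phi> - d)" if "0 < d" "d < \<phi>" for l d
      using that by (intro Z_tail) auto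
  qed
qed

lemma N_event: "{\<omega> \<in> space M. N n \<omega> = 0} \<in> events"
proof -
  have "{\<omega> \<in> space M. N n \<omega> = 0} = {\<omega> \<in> space M. \<forall>l<n. \<not> Xs l \<omega> \<le> x}"
    by (auto simp: N_def card_eq_0_iff)
  also have "\<dots> \<in> events" by measurable
  finally show ?thesis .
qed

lemma rho_os_Z_measurable [measurable]: "(\<lambda>\<omega>. rho_os (\<lambda>l. Z l \<omega>) n k) \<in> borel_measurable M"
  by (rule borel_measurable_rho_os) simp

lemma prob_rho_moment_diff:
  assumes A: "A \<in> sets borel"
  shows "\<bar>prob {\<omega> \<in> space M. rho_moment Xs Ys x k n \<omega> \<in> A} - prob {\<omega> \<in> space M. rho_os (\<lambda>l. Z l \<omega>) n k \<in> A}\<bar>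
    \<le> prob {\<omega> \<in> space M. N n \<omega> = 0}"
proof -
  let ?E = "{\<omega> \<in> space M. rho_moment Xs Ys x k n \<omega> \<in> A}" and ?F = "{\<omega> \<in> space M. rho_os (\<lambda>l. Z l \<omega>) n k \<in> A}"
    and ?Q = "{\<omega> \<in> space M. N n \<omega> = 0}"
  have m: "?E \<in> events" "?F \<in> events" "?Q \<in> events" using A N_event by auto
  have "prob ?E \<le> prob (?F \<union> ?Q)" using m by (intro finite_measure_mono) (auto simp: rho_moment_eq)
  also have "\<dots> \<le> prob ?F + prob ?Q" using m by (intro measure_Un_le)
  finally have 1: "prob ?E \<le> prob ?F + prob ?Q" .
  have "prob ?F \<le> prob (?E \<union> ?Q)" using m by (intro finite_measure_mono) (auto simp: rho_moment_eq)
  also have "\<dots> \<le> prob ?E + prob ?Q" using m by (intro measure_Un_le)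
  finally show ?thesis using 1 by linarith
qed

lemma rho_moment_limit:
  assumes A: "\<And>n. A n \<in> sets borel"
    and lim: "(\<lambda>n. prob {\<omega> \<in> space M. rho_os (\<lambda>l. Z l \<omega>) n (k n) \<in> A n}) \<longlonglongrightarrow> c"
  shows "(\<lambda>n. prob {\<omega> \<in> space M. rho_moment Xs Ys x (k n) n \<omega> \<in> A n}) \<longlonglongrightarrow> c"
proof -
  let ?d = "\<lambda>n. prob {\<omega> \<in> space M. rho_moment Xs Ys x (k n) n \<omega> \<in> A n} - prob {\<omega> \<in> space M. rho_os (\<lambda>l. Z l \<omega>) n (k n) \<in> A n}"
  have "?d \<longlonglongrightarrow> 0"
    by (rule Lim_null_comparison[OF _ N_eventually_pos(1)]) (use prob_rho_moment_diff[OF A] in auto)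
  from tendsto_add[OF this lim] show ?thesis by simp
qed

lemma rho_moment_converges_in_prob:
  assumes "0 < \<rho>" and "rv_frontier M X Y x \<rho>" and "\<And>n. 2 \<le> n \<Longrightarrow> 0 < k n \<and> k n < n"
    and "(\<lambda>n. real (k n) / real n) \<longlonglongrightarrow> 0" and "filterlim k at_top sequentially"
  shows "converges_in_prob M (\<lambda>n. rho_moment Xs Ys x (k n) n) \<rho>"
  unfolding converges_in_prob_def
proof (intro allI impI)
  fix \<epsilon> :: real assume \<epsilon>: "0 < \<epsilon>"
  interpret T: tail_sample M "\<lambda>d. S (\<phi> - d)" \<rho> Z \<phi> \<phi> by (rule tail_sample_of_rv) fact+
  have A: "{r. \<epsilon> < \<bar>r - \<rho>\<bar>} \<in> sets borel" by measurable
  have "(\<lambda>n. prob {\<omega> \<in> space M. \<epsilon> < \<bar>rho_os (\<lambda>l. Z l \<omega>) n (k n) - \<rho>\<bar>}) \<longlonglongrightarrow> 0"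
    by (rule T.rho_os_converges_in_prob) fact+
  then show "(\<lambda>n. prob {\<omega> \<in> space M. \<epsilon> < \<bar>rho_moment Xs Ys x (k n) n \<omega> - \<rho>\<bar>}) \<longlonglongrightarrow> 0"
    using rho_moment_limit[OF A, of k 0] by simp
qed

lemma rho_moment_converges_AE:
  assumes "0 < \<rho>" and "rv_frontier M X Y x \<rho>" and "\<And>n. 2 \<le> n \<Longrightarrow> 0 < k n \<and> k n < n"
    and "(\<lambda>n. real (k n) / real n) \<longlonglongrightarrow> 0"
    and "0 < \<delta>" and "filterlim (\<lambda>n. real (k n) / (ln (real n)) powr \<delta>) at_top sequentially"
  shows "AE \<omega> in M. (\<lambda>n. rho_moment Xs Ys x (k n) n \<omega>) \<longlonglongrightarrow> \<rho>"
proof -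
  interpret T: tail_sample M "\<lambda>d. S (\<phi> - d)" \<rho> Z \<phi> \<phi> by (rule tail_sample_of_rv) fact+
  have "AE \<omega> in M. (\<lambda>n. rho_os (\<lambda>l. Z l \<omega>) n (k n)) \<longlonglongrightarrow> \<rho>"
    by (rule T.rho_os_converges_AE) fact+
  then show ?thesis using N_eventually_pos(2)
  proof eventually_elim
    case (elim \<omega>)
    have "eventually (\<lambda>n. rho_os (\<lambda>l. Z l \<omega>) n (k n) = rho_moment Xs Ys x (k n) n \<omega>) sequentially"
      using elim(2) by eventually_elim (simp add: rho_moment_eq)
    with elim(1) show ?case by (rule Lim_transform_eventually)
  qed
qed

lemma tail_quantile_eq: "tail_quantile M X Y x t = Inf {y. 0 \<le> y \<and> S y \<le> 1 / t}"
proof -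
  have "1 - 1 / (t * FX) \<le> cond_df M X Y x y \<longleftrightarrow> S y / FX \<le> (1 / t) / FX" for y
    unfolding cond_df_eq[symmetric] by auto
  moreover have "S y / FX \<le> (1 / t) / FX \<longleftrightarrow> S y \<le> 1 / t" for y
    using FX_pos by (simp only: divide_le_cancel) auto
  ultimately show ?thesis unfolding tail_quantile_def quantile_of_def by simp
qed

text \<open>Otherwise U would vanish and the function would be a pure power t^(1/\<rho>) up to a
  constant. Its increments for z = 4 and z = 2 have the fixed quotient 2^(1/\<rho>) + 1 > 2, whereas
  the class demands ln 4 / ln 2 = 2.\<close>

lemma S_0_pos_of_Pi_class:
  assumes \<rho>: "0 < \<rho>" and Pi: "Pi_class B (\<lambda>t. s * (t powr (1 / \<rho>) * (\<phi> - tail_quantile M X Y x t)))"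
  shows "0 < S 0"
proof (rule ccontr)
  assume "\<not> 0 < S 0"
  then have Sy: "S y = 0" if "0 \<le> y" for y using S_antimono[OF that] S_nonneg[of y] by linarith
  have U: "tail_quantile M X Y x t = 0" if "0 < t" for t
  proof -
    have "{y. 0 \<le> y \<and> S y \<le> 1 / t} = {0..}" using that by (auto simp: Sy)
    then show ?thesis by (simp add: tail_quantile_eq)
  qed
  define q where "q t = s * \<phi> * t powr (1 / \<rho>) / B t" for t
  have L: "((\<lambda>t. q t * (z powr (1 / \<rho>) - 1)) \<longlongrightarrow> ln z) at_top" if z: "0 < z" for z
  proof -
    have "eventually (\<lambda>t. (s * ((t * z) powr (1 / \<rho>) * (\<phi> - tail_quantile M X Y x (t * z)))
        - s * (t powr (1 / \<rho>) * (\<phi> - tail_quantile M X Y x t))) / B t = q t * (z powr (1 / \<rho>) - 1)) at_top"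
      using eventually_gt_at_top[of 0]
    proof eventually_elim
      case (elim t)
      then have "(t * z) powr (1 / \<rho>) = t powr (1 / \<rho>) * z powr (1 / \<rho>)" using z by (simp add: powr_mult)
      then show ?case using elim z unfolding q_def by (simp add: U) (simp add: field_simps)
    qed
    moreover have "((\<lambda>t. (s * ((t * z) powr (1 / \<rho>) * (\<phi> - tail_quantile M X Y x (t * z)))
        - s * (t powr (1 / \<rho>) * (\<phi> - tail_quantile M X Y x t))) / B t) \<longlongrightarrow> ln z) at_top"
      using Pi z unfolding Pi_class_def by auto
    ultimately show ?thesis by (rule Lim_transform_eventually[rotated])
  qed
  define p where "p = (2 :: real) powr (1 / \<rho>)"
  have p1: "1 < p" using \<rho> by (simp add: p_def gr_one_powr)
  have p2: "(4 :: real) powr (1 / \<rho>) = p * p"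
    using powr_mult[of 2 2 "1 / \<rho>"] by (simp add: p_def)
  have "((\<lambda>t. q t * (p - 1) * (p + 1)) \<longlongrightarrow> ln 2 * (p + 1)) at_top"
    using L[of 2] by (intro tendsto_intros) (simp add: p_def)
  moreover have "(\<lambda>t. q t * (p - 1) * (p + 1)) = (\<lambda>t. q t * (p * p - 1))" by (auto simp: algebra_simps)
  ultimately have "((\<lambda>t. q t * (p * p - 1)) \<longlongrightarrow> ln 2 * (p + 1)) at_top" by (simp only:)
  moreover have "((\<lambda>t. q t * (p * p - 1)) \<longlongrightarrow> ln 4) at_top" using L[of 4] by (simp add: p2)
  ultimately have "ln 2 * (p + 1) = ln 4" by (rule tendsto_unique[rotated]) simp
  moreover have "ln (4 :: real) = 2 * ln 2" using ln_realpow[of 2 2] by simp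
  ultimately have "ln (2 :: real) * (p - 1) = 0" by (simp only: distrib_left right_diff_distrib)
  then show False using p1 by simp
qed

lemma rho_moment_asymptotic_normal:
  assumes \<rho>: "0 < \<rho>" and k: "\<And>n. 2 \<le> n \<Longrightarrow> 0 < k n \<and> k n < n"
    and B: "\<And>t. 0 < t \<Longrightarrow> 0 < B t" and s: "s = 1 \<or> s = -1"
    and Pi: "Pi_class B (\<lambda>t. s * (t powr (1 / \<rho>) * (\<phi> - tail_quantile M X Y x t)))"
    and k_top: "filterlim k at_top sequentially"
  shows "\<forall>\<^sub>F t0 in at_top. (\<lambda>n. real (k n)) \<in>
      o(\<lambda>n. real n / gen_inverse_from t0 (second_order_fun M X Y x \<rho> B) (real n))
    \<longrightarrow> weak_conv_m
          (\<lambda>n. distr M borel (\<lambda>\<omega>. sqrt (real (k n)) * (rho_moment Xs Ys x (k n) n \<omega> - \<rho>)))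
          (density lborel (normal_density 0 (sqrt (asymp_variance \<rho>))))"
proof -
  have S0: "0 < S 0" by (rule S_0_pos_of_Pi_class[OF \<rho> Pi])
  note fr = tail_at_frontier[OF S0]
  define U where "U = tail_quantile M X Y x"
  define V where "V t = \<phi> - U t" for t
  have ne: "\<exists>y\<ge>0. S y \<le> u" if "0 < u" for u using that fr by (intro exI[of _ \<phi>]) auto
  have bdd: "bdd_below {y. 0 \<le> y \<and> S y \<le> u}" for u by (rule bdd_belowI[of _ 0]) auto
  have U_nonneg: "0 \<le> U t" if "0 < t" for t
    unfolding U_def tail_quantile_eq by (rule cInf_greatest) (use ne[of "1 / t"] that in auto)
  have U_le: "U t \<le> \<phi>" if "0 < t" for t
    unfolding U_def tail_quantile_eq by (rule cInf_lower) (use fr that bdd in auto)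
  have U_mono: "U t \<le> U t'" if "0 < t" "t \<le> t'" for t t'
  proof -
    have "1 / t' \<le> 1 / t" using that by (intro divide_left_mono) auto
    then show ?thesis unfolding U_def tail_quantile_eq
      by (intro cInf_superset_mono bdd) (use ne[of "1 / t'"] that in auto)
  qed
  interpret PV: pi_varying V B "1 / \<rho>" s
  proof
    show "((\<lambda>t. (s * ((t * z) powr (1 / \<rho>) * V (t * z)) - s * (t powr (1 / \<rho>) * V t)) / B t) \<longlongrightarrow> ln z) at_top" if "0 < z" for z
      using Pi that unfolding Pi_class_def V_def U_def by blast
  qed (use \<rho> s U_mono U_le B in \<open>auto simp: V_def\<close>)
  define H where "H u = \<phi> - V (1 / u)" for u
  have H_eq: "H u = Inf {y. 0 \<le> y \<and> S y \<le> u}" for u by (simp add: H_def V_def U_def tail_quantile_eq)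
  have Hm [measurable]: "H \<in> borel_measurable borel"
    unfolding H_eq[abs_def]
  proof (rule borel_measurable_Inf_nonneg)
    fix y :: real
    have "{u \<in> space borel. S y \<le> u} = {S y..}" by auto
    then show "{u \<in> space borel. S y \<le> u} \<in> sets borel" by simp
  qed (meson S_antimono order_trans)
  \<comment> \<open>The quantile transform: \<open>H\<close> is the generalised inverse of the
    decreasing tail \<open>S\<close>, so H u \<le> y means S y \<le> u, which has probability 1 - S
    y.\<close>
  have law: "distr M borel (Z l) = distr unif borel H" for l
  proof (rule cdf_unique[OF Z_distribution])
    show "real_distribution (distr unif borel H)"
      by (rule unif.real_distribution_distr) (use Hm in simp)
    show "cdf (distr M borel (Z l)) = cdf (distr unif borel H)"
    proof
      fix y :: real
      have c: "cdf (distr unif borel H) y = measure unif {u. H u \<le> y}"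
        unfolding cdf_def by (subst measure_distr) (use Hm in \<open>auto intro!: arg_cong[where f="measure unif"]\<close>)
      show "cdf (distr M borel (Z l)) y = cdf (distr unif borel H) y"
      proof (cases "0 \<le> y")
        case True
        have "measure unif {u. H u \<le> y} = measure unif {S y..}"
        proof (rule measure_eq_AE)
          show "AE u in unif. u \<in> {u. H u \<le> y} \<longleftrightarrow> u \<in> {S y..}"
            using AE_unif by eventually_elim (use S_Inf_le_iff[OF ne True] in \<open>auto simp: H_eq\<close>)
          show "{u. H u \<le> y} \<in> sets unif" by simp
        qed auto
        also have "\<dots> = 1 - S y" by (rule measure_unif_atLeast[OF S_nonneg S_le_1])
        finally show ?thesis using S_cdf[OF True, of l] c by simp
      next
        case False
        have "measure unif {u. H u \<le> y} = measure unif {}"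
        proof (rule measure_eq_AE)
          show "AE u in unif. u \<in> {u. H u \<le> y} \<longleftrightarrow> u \<in> {}"
            using AE_unif
          proof eventually_elim
            case (elim u)
            have "0 \<le> H u" using U_nonneg[of "1 / u"] elim by (simp add: H_def V_def)
            then show ?case using False by simp
          qed
          show "{u. H u \<le> y} \<in> sets unif" by simp
        qed auto
        moreover have "cdf (distr M borel (Z l)) y = prob {}"
        proof -
          have "0 \<le> Z l \<omega>" for \<omega> by (simp add: Z_def)
          then have "\<not> Z l \<omega> \<le> y" for \<omega> using False order_trans by blast
          then have "Z l -` {..y} \<inter> space M = {}" by auto
          then show ?thesis unfolding cdf_def by (subst measure_distr) auto
        qed
        ultimately show ?thesis using c by simp
      qed
    qed
  qed
  \<comment> \<open>In terms of V = \<phi> - U and a = 1 / \<rho> this is the function treated in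
    \<open>level_condition\<close>.\<close>
  have G: "second_order_fun M X Y x \<rho> B = (\<lambda>t. t powr (1 + 2 * (1 / \<rho>)) * ((ln \<phi> - ln (\<phi> - V t)) / B t)\<^sup>2)"
    by (simp add: second_order_fun_def[abs_def] V_def U_def)
  have conv: "weak_conv_m
        (\<lambda>n. distr M borel (\<lambda>\<omega>. sqrt (real (k n)) * (rho_moment Xs Ys x (k n) n \<omega> - \<rho>)))
        (density lborel (normal_density 0 (sqrt (asymp_variance \<rho>))))"
    if small: "(\<lambda>n. sqrt (real (k n)) * PV.At (real n / real (k n))) \<longlonglongrightarrow> 0"
      and nk: "filterlim (\<lambda>n. real n / real (k n)) at_top sequentially"
    unfolding weak_conv_m_def weak_conv_def
  proof (intro allI impI)
    fix y :: real
    define A where "A n = {r. sqrt (real (k n)) * (r - \<rho>) \<le> y}" for n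
    have A: "A n \<in> sets borel" for n unfolding A_def by measurable
    let ?l = "cdf std_normal_distribution (y / sqrt (asymp_variance \<rho>))"
    have "(\<lambda>n. measure (PU {..<n}) {w \<in> space (PU {..<n}).
        sqrt (real (k n)) * (rho_os (\<lambda>l. H (w l)) n (k n) - \<rho>) \<le> y}) \<longlonglongrightarrow> ?l"
      unfolding H_def
      by (rule PV.clt_uniform[OF fr(1) refl \<rho> _ _ k k_top nk small])
         (use U_nonneg Hm[unfolded H_def[abs_def]] in \<open>auto simp: V_def[abs_def]\<close>)
    moreover have "eventually (\<lambda>n. measure (PU {..<n}) {w \<in> space (PU {..<n}).
        sqrt (real (k n)) * (rho_os (\<lambda>l. H (w l)) n (k n) - \<rho>) \<le> y}
        = prob {\<omega> \<in> space M. rho_os (\<lambda>l. Z l \<omega>) n (k n) \<in> A n}) sequentially"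
      using eventually_gt_at_top[of 0]
    proof eventually_elim
      case (elim n)
      show ?case using rho_os_law[OF Z_indep elim law Hm A[of n], of "k n"] by (simp add: A_def)
    qed
    ultimately have "(\<lambda>n. prob {\<omega> \<in> space M. rho_os (\<lambda>l. Z l \<omega>) n (k n) \<in> A n}) \<longlonglongrightarrow> ?l"
      by (rule Lim_transform_eventually)
    from rho_moment_limit[OF A this]
    have "(\<lambda>n. prob {\<omega> \<in> space M. rho_moment Xs Ys x (k n) n \<omega> \<in> A n}) \<longlonglongrightarrow> ?l" .
    moreover have "cdf (distr M borel (\<lambda>\<omega>. sqrt (real (k n)) * (rho_moment Xs Ys x (k n) n \<omega> - \<rho>))) y
      = prob {\<omega> \<in> space M. rho_moment Xs Ys x (k n) n \<omega> \<in> A n}" for n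
      unfolding cdf_def by (subst measure_distr) (auto simp: A_def intro!: arg_cong[where f=prob])
    moreover have "cdf (density lborel (normal_density 0 (sqrt (asymp_variance \<rho>)))) y = ?l"
      by (rule cdf_centered_normal) (simp add: asymp_variance_pos[OF \<rho>])
    ultimately show "(\<lambda>n. cdf (distr M borel (\<lambda>\<omega>. sqrt (real (k n)) * (rho_moment Xs Ys x (k n) n \<omega> - \<rho>))) y)
      \<longlonglongrightarrow> cdf (density lborel (normal_density 0 (sqrt (asymp_variance \<rho>)))) y" by simp
  qed
  obtain T where "\<forall>t0\<ge>T. (\<lambda>n. real (k n)) \<in> o(\<lambda>n. real n / gen_inverse_from t0 (second_order_fun M X Y x \<rho> B) (real n)) \<longrightarrow>
     (\<lambda>n. sqrt (real (k n)) * PV.At (real n / real (k n))) \<longlonglongrightarrow> 0 \<and>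
     filterlim (\<lambda>n. real n / real (k n)) at_top sequentially"
    using PV.level_condition[OF fr(1) k] unfolding G by blast
  then show ?thesis unfolding eventually_at_top_linorder using conv by blast
qed

end

theorem theorem2p4:
  fixes M :: "'a measure"
    and X :: "'a \<Rightarrow> real ^ 'p" and Y :: "'a \<Rightarrow> real"
    and Xs :: "nat \<Rightarrow> 'a \<Rightarrow> real ^ 'p" and Ys :: "nat \<Rightarrow> 'a \<Rightarrow> real"
    and x :: "real ^ 'p" and \<rho> :: real and k :: "nat \<Rightarrow> nat"
  assumes "prob_space M"
    and "X \<in> borel_measurable M" and "Y \<in> borel_measurable M"
    and "AE \<omega> in M. 0 \<le> X \<omega> \<and> 0 \<le> Y \<omega>"
    and indep: "prob_space.indep_vars M (\<lambda>_. borel) (\<lambda>i \<omega>. (Xs i \<omega>, Ys i \<omega>)) UNIV"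
    and copies: "\<And>i. distr M borel (\<lambda>\<omega>. (Xs i \<omega>, Ys i \<omega>)) = distr M borel (\<lambda>\<omega>. (X \<omega>, Y \<omega>))"
    and "0 \<le> x" and "0 < marginal_df M X x"
    and frontier_finite: "bdd_above {y. 0 \<le> y \<and> cond_df M X Y x y < 1}"
    and "0 < \<rho>"
    and "\<And>n. 2 \<le> n \<Longrightarrow> 0 < k n \<and> k n < n"
  shows
    "(rv_frontier M X Y x \<rho> \<and>
      (\<lambda>n. real (k n) / real n) \<longlonglongrightarrow> 0 \<and>
      filterlim k at_top sequentially
      \<longrightarrow> converges_in_prob M (\<lambda>n. rho_moment Xs Ys x (k n) n) \<rho>)
     \<and>
     (rv_frontier M X Y x \<rho> \<and>
      (\<lambda>n. real (k n) / real n) \<longlonglongrightarrow> 0 \<and>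
      (\<exists>\<delta>>0. filterlim (\<lambda>n. real (k n) / (ln (real n)) powr \<delta>) at_top sequentially)
      \<longrightarrow> (AE \<omega> in M. (\<lambda>n. rho_moment Xs Ys x (k n) n \<omega>) \<longlonglongrightarrow> \<rho>))
     \<and>
     (\<forall>(B :: real \<Rightarrow> real) (s :: real).
      (\<forall>t>0. 0 < B t) \<and> s \<in> {1, -1} \<and>
      Pi_class B (\<lambda>t. s * (t powr (1 / \<rho>) * (frontier_fun M X Y x - tail_quantile M X Y x t))) \<and>
      filterlim k at_top sequentially
      \<longrightarrow> (\<forall>\<^sub>F t0 in at_top.
            (\<lambda>n. real (k n)) \<in>
              o(\<lambda>n. real n / gen_inverse_from t0 (second_order_fun M X Y x \<rho> B) (real n))
            \<longrightarrow> weak_conv_m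
                  (\<lambda>n. distr M borel (\<lambda>\<omega>. sqrt (real (k n)) * (rho_moment Xs Ys x (k n) n \<omega> - \<rho>)))
                  (density lborel (normal_density 0 (sqrt (asymp_variance \<rho>))))))"
proof -
  interpret prob_space M by fact
  interpret frontier_sample M X Y Xs Ys x
    by unfold_locales (use assms in auto)
  note k = assms(11) and \<rho> = assms(10)
  show ?thesis
  proof (intro conjI impI allI; elim conjE)
    assume "rv_frontier M X Y x \<rho>" "(\<lambda>n. real (k n) / real n) \<longlonglongrightarrow> 0" "filterlim k at_top sequentially"
    then show "converges_in_prob M (\<lambda>n. rho_moment Xs Ys x (k n) n) \<rho>"
      by (intro rho_moment_converges_in_prob[OF \<rho> _ k])
  next
    assume "rv_frontier M X Y x \<rho>" "(\<lambda>n. real (k n) / real n) \<longlonglongrightarrow> 0"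
      "\<exists>\<delta>>0. filterlim (\<lambda>n. real (k n) / (ln (real n)) powr \<delta>) at_top sequentially"
    then show "AE \<omega> in M. (\<lambda>n. rho_moment Xs Ys x (k n) n \<omega>) \<longlonglongrightarrow> \<rho>"
      using rho_moment_converges_AE[OF \<rho> _ k] by blast
  next
    fix B :: "real \<Rightarrow> real" and s :: real
    assume "\<forall>t>0. 0 < B t" "s \<in> {1, -1}" "filterlim k at_top sequentially"
      "Pi_class B (\<lambda>t. s * (t powr (1 / \<rho>) * (frontier_fun M X Y x - tail_quantile M X Y x t)))"
    then show "\<forall>\<^sub>F t0 in at_top.
            (\<lambda>n. real (k n)) \<in>
              o(\<lambda>n. real n / gen_inverse_from t0 (second_order_fun M X Y x \<rho> B) (real n))
            \<longrightarrow> weak_conv_m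
                  (\<lambda>n. distr M borel (\<lambda>\<omega>. sqrt (real (k n)) * (rho_moment Xs Ys x (k n) n \<omega> - \<rho>)))
                  (density lborel (normal_density 0 (sqrt (asymp_variance \<rho>))))"
      by (intro rho_moment_asymptotic_normal[OF \<rho> k]) auto
  qed
qed

end
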